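(* Let $k,L,M,t\ge1$ be integers and $\psi$, $\varrho$ Dirichlet characters mod $L$ and $M$ with $\psi(-1)\varrho(-1)=(-1)^k$. Then $\mathcal{E}^{\psi,\varrho,t}_{2-k}\in H_{2-k}(tLM,\overline{\psi\varrho})$ and $\xi_{2-k}(\mathcal{E}^{\psi,\varrho,t}_{2-k})=E_k^{\psi,\varrho,t}$.
   Context: Notation: $\mathbb{H}$ upper half-plane, $z=x+iy$, $q=e^{2\pi iz}$, $\Gamma_0(N)=\{\pm\left(\begin{smallmatrix}a&b\\c&d\end{smallmatrix}\right)\in\mathrm{PSL}_2(\mathbb{Z}):N\mid c\}$. $H_{2-k}(N,\chi)$ is the space of real-analytic $F:\mathbb{H}\to\mathbb{C}$ with $F(\gamma z)=\chi(d)(cz+d)^{2-k}F(z)$ for all $\gamma\in\Gamma_0(N)$, $\Delta_{2-k}F=0$ where $\Delta_{2-k}=y^2(\partial_x^2+\partial_y^2)-i(2-k)y(\partial_x+i\partial_y)$, at most linear exponential growth at the cusps, and $\xi_{2-k}F$ holomorphic at every cusp, where $\xi_{2-k}:=2iy^{2-k}\overline{\partial_{\bar z}}$. Non-holomorphic Eisenstein series: for an integer $j$, characters $\alpha$, $\beta$, and $j+2\operatorname{Re}(s)>2$, $E_j(z,s,\alpha,\beta):=\frac12\sum_{(m,n)\ne(0,0)}\alpha(m)\beta(n)(mz+n)^{-j}|mz+n|^{-2s}$; for every integer $T\ge1$, $y^sE_j(Tz,s,\alpha,\beta)$ continues meromorphically to $s\in\mathbb{C}$. It is known that: for $k=2$,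 $(\psi,\varrho)\ne(\mathbf{1}_L,\mathbf{1}_M)$, $E_0(tMz,s,\overline\psi,\varrho)$ is analytic at $s=1$; for $k=2$, $(\psi,\varrho)=(\mathbf{1}_L,\mathbf{1}_M)$, $y^sE_0(tMz,s,\mathbf{1}_L,\mathbf{1}_M)$ has a simple pole at $s=1$ with residue $\frac{\pi}{2tM}\prod_{p\mid L}(1-p^{-1})\prod_{p\mid M}(1-p^{-1})$; for $k=1$, $E_1(tMz,s,\overline\psi,\varrho)$ is analytic at $s=0$. Define: if $k>2$, $\mathcal{E}^{\psi,\varrho,t}_{2-k}(z):=(k-1)^{-1}y^{k-1}E_{2-k}(tMz,k-1,\overline\psi,\varrho)$; if $k=2$, $(\psi,\varrho)\ne(\mathbf{1}_L,\mathbf{1}_M)$, $\mathcal{E}^{\psi,\varrho,t}_0(z):=yE_0(tMz,1,\overline\psi,\varrho)$; if $k=2$, $(\psi,\varrho)=(\mathbf{1}_L,\mathbf{1}_M)$, $\mathcal{E}^{\mathbf{1}_L,\mathbf{1}_M,t}_0(z):=\lim_{s\to1}\big(y^sE_0(Mz,s,\mathbf{1}_L,\mathbf{1}_M)-ty^sE_0(tMz,s,\mathbf{1}_L,\mathbf{1}_M)\big)$; if $k=1$, $\mathcal{E}^{\psi,\varrho,t}_1(z):=\frac{\partial}{\partial s}\big(y^sE_1(tMz,s,\overline\psi,\varrho)\big)\big|_{s=0}$. Holomorphic Eisenstein series: $\mathbf{1}_N$ trivial character mod $N$; for $\chi$ mod $N$, $\chi^0$ the primitive character inducing $\chi$, $m_\chi$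 its conductor, $\ell_\chi=N/m_\chi$, $W(\chi^0)=\sum_{n=1}^{m_\chi}\chi^0(n)e^{2\pi in/m_\chi}$, $L(s,\chi)$ the Dirichlet $L$-function; $\mu$ Möbius function. $\sigma^{\psi,\varrho}_{k-1}(n):=\sum_{0<c\mid n}\psi(n/c)c^{k-1}\sum_{0<d\mid\gcd(\ell_\varrho,c)}d\,\mu(\ell_\varrho/d)\overline{\varrho^0}(\ell_\varrho/d)\varrho^0(c/d)$. $C_k(\psi,\varrho):=L(k,\overline\varrho)$ if $\psi=\mathbf{1}_1$, else $0$; $D(\psi,\varrho):=-\pi iL(0,\psi)\prod_{p\mid M}(1-p^{-1})$ if $\varrho=\mathbf{1}_M$, else $0$. If $k>2$, or $k=2$ and $(\psi,\varrho)\ne(\mathbf{1}_L,\mathbf{1}_M)$: $E_k^{\psi,\varrho}(z):=C_k(\psi,\varrho)+\left(-\frac{2\pi i}{M}\right)^k\frac{W(\overline{\varrho^0})}{(k-1)!}\sum_{n\ge1}\sigma^{\psi,\varrho}_{k-1}(n)q^n$. If $k=2$, $(\psi,\varrho)=(\mathbf{1}_L,\mathbf{1}_M)$: $E_2^{\mathbf{1}_L,\mathbf{1}_M}(z):=C_2(\mathbf{1}_L,\mathbf{1}_M)-\frac{\pi}{2My}\prod_{p\mid M}(1-p^{-1})\prod_{p\mid L}(1-p^{-1})-\frac{4\pi^2}{M^2}\sum_{n\ge1}\sigma_1^{\mathbf{1}_L,\mathbf{1}_M}(n)q^n$. If $k=1$: $E_1^{\psi,\varrho}(z):=C_1(\psi,\varrho)+D(\psi,\varrho)-\frac{2\pi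 i}{M}W(\overline{\varrho^0})\sum_{n\ge1}\sigma_0^{\psi,\varrho}(n)q^n$. Finally $E_k^{\psi,\varrho,t}(z):=E_2^{\mathbf{1}_L,\mathbf{1}_M}(z)-tE_2^{\mathbf{1}_L,\mathbf{1}_M}(tz)$ if $k=2$ and $(\psi,\varrho)=(\mathbf{1}_L,\mathbf{1}_M)$, and $E_k^{\psi,\varrho,t}(z):=E_k^{\psi,\varrho}(tz)$ otherwise. *)

theory Defs
  imports
    "HOL-Complex_Analysis.Complex_Analysis"
    "HOL-Computational_Algebra.Computational_Algebra"
begin

section \<open>Dirichlet characters\<close>

definition dcharacter :: "nat \<Rightarrow> (int \<Rightarrow> complex) \<Rightarrow> bool" where
  "dcharacter N \<eta> \<longleftrightarrow> N > 0 \<and>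
     (\<forall>a b. \<eta> (a * b) = \<eta> a * \<eta> b) \<and>
     (\<forall>a. \<eta> (a + int N) = \<eta> a) \<and>
     (\<forall>a. \<eta> a = 0 \<longleftrightarrow> \<not> coprime a (int N))"

definition trivial_char :: "nat \<Rightarrow> int \<Rightarrow> complex" where
  "trivial_char N a = (if coprime a (int N) then 1 else 0)"

definition induces :: "nat \<Rightarrow> (int \<Rightarrow> complex) \<Rightarrow> nat \<Rightarrow> (int \<Rightarrow> complex) \<Rightarrow> bool" where
  "induces m \<eta>' N \<eta> \<longleftrightarrow> m dvd N \<and> dcharacter m \<eta>' \<and> dcharacter N \<eta> \<and>
     (\<forall>a. coprime a (int N) \<longrightarrow> \<eta> a = \<eta>' a)"

definition conductor :: "nat \<Rightarrow> (int \<Rightarrow> complex) \<Rightarrow> nat" where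
  "conductor N \<eta> = (LEAST m. \<exists>\<eta>'. induces m \<eta>' N \<eta>)"

text \<open>The primitive character inducing \<open>\<eta>\<close>; it is primitive because its modulus is the
  smallest one from which \<open>\<eta>\<close> is induced.\<close>

definition primitive_char :: "nat \<Rightarrow> (int \<Rightarrow> complex) \<Rightarrow> int \<Rightarrow> complex" where
  "primitive_char N \<eta> = (THE \<eta>'. induces (conductor N \<eta>) \<eta>' N \<eta>)"

definition gauss_sum :: "nat \<Rightarrow> (int \<Rightarrow> complex) \<Rightarrow> complex" where
  "gauss_sum m \<eta> = (\<Sum>n=1..m. \<eta> (int n) * exp (2 * of_real pi * \<i> * of_nat n / of_nat m))"

definition moebius_fun :: "nat \<Rightarrow> complex" where
  "moebius_fun n = (if squarefree n then (-1) ^ card (prime_factors n) else 0)"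

section \<open>Meromorphic continuation\<close>

text \<open>
  The value at \<open>s\<close> of the meromorphic continuation of a function given on \<open>Re w > \<sigma>\<close>.
  By the identity theorem any two functions \<open>g\<close> as below agree on the smaller of their
  half-planes, since \<open>nicely_meromorphic_on\<close> forces removable singularities to be filled in
  (and gives poles the value 0).  Hence the value does not depend on \<open>c\<close>, and it is the value
  of the continuation to the whole plane whenever that exists.
\<close>

definition continuation :: "real \<Rightarrow> (complex \<Rightarrow> complex) \<Rightarrow> complex \<Rightarrow> complex" where
  "continuation \<sigma> f s = (THE v. \<exists>c g. c < Re s \<and> g nicely_meromorphic_on {w. Re w > c} \<and>
     (\<forall>w. Re w > \<sigma> \<longrightarrow> g w = f w) \<and> v = g s)"

definition Dirichlet_L :: "complex \<Rightarrow> (int \<Rightarrow> complex) \<Rightarrow> complex" where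
  "Dirichlet_L s \<eta> =
     continuation 1 (\<lambda>w. \<Sum>n. \<eta> (int (Suc n)) * of_nat (Suc n) powr (- w)) s"

section \<open>Harmonic Maass forms\<close>

text \<open>Functions on the upper half-plane are represented by functions on \<open>complex\<close> of which
  only the values on \<open>upper_half_plane\<close> matter.\<close>

definition upper_half_plane :: "complex set" where
  "upper_half_plane = {z. Im z > 0}"

definition partial_x :: "(complex \<Rightarrow> complex) \<Rightarrow> complex \<Rightarrow> complex" where
  "partial_x F z = vector_derivative (\<lambda>u::real. F (z + of_real u)) (at 0)"

definition partial_y :: "(complex \<Rightarrow> complex) \<Rightarrow> complex \<Rightarrow> complex" where
  "partial_y F z = vector_derivative (\<lambda>u::real. F (z + \<i> * of_real u)) (at 0)"

definition wirtinger_bar :: "(complex \<Rightarrow> complex) \<Rightarrow> complex \<Rightarrow> complex" where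
  "wirtinger_bar F z = (partial_x F z + \<i> * partial_y F z) / 2"

definition xi_op :: "int \<Rightarrow> (complex \<Rightarrow> complex) \<Rightarrow> complex \<Rightarrow> complex" where
  "xi_op w F z = 2 * \<i> * of_real (Im z) powi w * cnj (wirtinger_bar F z)"

definition laplace_op :: "int \<Rightarrow> (complex \<Rightarrow> complex) \<Rightarrow> complex \<Rightarrow> complex" where
  "laplace_op w F z =
     of_real (Im z) ^ 2 * (partial_x (partial_x F) z + partial_y (partial_y F) z)
     - \<i> * of_int w * of_real (Im z) * (partial_x F z + \<i> * partial_y F z)"

text \<open>Real-analytic: near each point given by an (absolutely) convergent double power series
  in the two real coordinates.\<close>

definition real_analytic_on :: "(complex \<Rightarrow> complex) \<Rightarrow> complex set \<Rightarrow> bool" where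
  "real_analytic_on F S \<longleftrightarrow> (\<forall>z0\<in>S. \<exists>r>0. \<exists>a :: nat \<Rightarrow> nat \<Rightarrow> complex. \<forall>x y :: real.
     \<bar>x\<bar> < r \<and> \<bar>y\<bar> < r \<longrightarrow>
     ((\<lambda>(m, n). a m n * of_real x ^ m * of_real y ^ n) has_sum F (z0 + Complex x y)) UNIV)"

text \<open>The matrix with rows \<open>(a, b)\<close> and \<open>(c, d)\<close> is the tuple \<open>(a, b, c, d)\<close>; matrices are not
  taken modulo sign, i.e. both lifts of an element of \<open>PSL\<^sub>2(\<int>)\<close> are present.\<close>

definition SL2Z :: "(int \<times> int \<times> int \<times> int) set" where
  "SL2Z = {(a, b, c, d). a * d - b * c = 1}"

definition Gamma0 :: "nat \<Rightarrow> (int \<times> int \<times> int \<times> int) set" where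
  "Gamma0 N = {(a, b, c, d). (a, b, c, d) \<in> SL2Z \<and> int N dvd c}"

definition act :: "int \<times> int \<times> int \<times> int \<Rightarrow> complex \<Rightarrow> complex" where
  "act = (\<lambda>(a, b, c, d) z. (of_int a * z + of_int b) / (of_int c * z + of_int d))"

definition slash :: "int \<Rightarrow> (complex \<Rightarrow> complex) \<Rightarrow> int \<times> int \<times> int \<times> int \<Rightarrow> complex \<Rightarrow> complex" where
  "slash w F = (\<lambda>(a, b, c, d) z. (of_int c * z + of_int d) powi (- w) * F (act (a, b, c, d) z))"

text \<open>Conditions at a cusp \<open>\<gamma>\<infinity>\<close> are conditions at \<open>\<i>\<infinity>\<close> on the function slashed by \<open>\<gamma>\<close>, and
  \<open>\<gamma>\<close> running through all of \<open>SL\<^sub>2(\<int>)\<close> reaches every cusp.\<close>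

definition linear_exp_growth_at_cusps :: "int \<Rightarrow> (complex \<Rightarrow> complex) \<Rightarrow> bool" where
  "linear_exp_growth_at_cusps w F \<longleftrightarrow> (\<forall>\<gamma>\<in>SL2Z. \<exists>A C Y :: real.
     \<forall>z\<in>upper_half_plane. Im z > Y \<longrightarrow> norm (slash w F \<gamma> z) \<le> A * exp (C * Im z))"

definition holomorphic_at_cusps :: "int \<Rightarrow> (complex \<Rightarrow> complex) \<Rightarrow> bool" where
  "holomorphic_at_cusps w G \<longleftrightarrow> (\<forall>\<gamma>\<in>SL2Z. \<exists>h::nat. h > 0 \<and> (\<exists>a :: nat \<Rightarrow> complex.
     \<forall>z\<in>upper_half_plane.
       (\<lambda>n. a n * exp (2 * of_real pi * \<i> * of_nat n * z / of_nat h)) sums slash w G \<gamma> z))"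

definition harmonic_maass_space :: "int \<Rightarrow> nat \<Rightarrow> (int \<Rightarrow> complex) \<Rightarrow> (complex \<Rightarrow> complex) set" where
  "harmonic_maass_space w N \<eta> = {F.
     real_analytic_on F upper_half_plane \<and>
     (\<forall>(a, b, c, d)\<in>Gamma0 N. \<forall>z\<in>upper_half_plane.
        F (act (a, b, c, d) z) = \<eta> d * (of_int c * z + of_int d) powi w * F z) \<and>
     (\<forall>z\<in>upper_half_plane. laplace_op w F z = 0) \<and>
     linear_exp_growth_at_cusps w F \<and>
     holomorphic_at_cusps (2 - w) (xi_op w F)}"

section \<open>Non-holomorphic Eisenstein series\<close>

text \<open>The series converges absolutely for \<open>j + 2 Re s > 2\<close>; elsewhere \<open>eis_nonhol\<close> is its
  continuation.  As \<open>y\<^sup>s\<close> is entire and nowhere zero in \<open>s\<close>, continuing \<open>E\<^sub>j\<close> is the same as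
  continuing \<open>y\<^sup>s E\<^sub>j\<close>.\<close>

definition eis_nonhol_series ::
    "int \<Rightarrow> complex \<Rightarrow> complex \<Rightarrow> (int \<Rightarrow> complex) \<Rightarrow> (int \<Rightarrow> complex) \<Rightarrow> complex" where
  "eis_nonhol_series j z s \<alpha> \<beta> = 1 / 2 * (\<Sum>\<^sub>\<infinity>(m, n)\<in>UNIV - {(0, 0)}.
     \<alpha> m * \<beta> n * (of_int m * z + of_int n) powi (- j)
       * of_real (norm (of_int m * z + of_int n)) powr (- 2 * s))"

definition eis_nonhol ::
    "int \<Rightarrow> complex \<Rightarrow> complex \<Rightarrow> (int \<Rightarrow> complex) \<Rightarrow> (int \<Rightarrow> complex) \<Rightarrow> complex" where
  "eis_nonhol j z s \<alpha> \<beta> =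
     continuation (1 - of_int j / 2) (\<lambda>w. eis_nonhol_series j z w \<alpha> \<beta>) s"

text \<open>\<open>eis_harmonic k L M t \<psi> \<rho>\<close> has weight \<open>2 - k\<close>.\<close>

definition eis_harmonic ::
    "nat \<Rightarrow> nat \<Rightarrow> nat \<Rightarrow> nat \<Rightarrow> (int \<Rightarrow> complex) \<Rightarrow> (int \<Rightarrow> complex) \<Rightarrow> complex \<Rightarrow> complex" where
  "eis_harmonic k L M t \<psi> \<rho> z =
    (let y = complex_of_real (Im z); \<psi>' = (\<lambda>m. cnj (\<psi> m)) in
     if k > 2 then
       y ^ (k - 1) / of_nat (k - 1)
         * eis_nonhol (2 - int k) (of_nat (t * M) * z) (of_nat (k - 1)) \<psi>' \<rho>
     else if k = 2 then
       (if \<psi> = trivial_char L \<and> \<rho> = trivial_char M then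
          Lim (at 1) (\<lambda>s.
            y powr s * eis_nonhol 0 (of_nat M * z) s (trivial_char L) (trivial_char M)
            - of_nat t * y powr s
                * eis_nonhol 0 (of_nat (t * M) * z) s (trivial_char L) (trivial_char M))
        else y * eis_nonhol 0 (of_nat (t * M) * z) 1 \<psi>' \<rho>)
     else
       deriv (\<lambda>s. y powr s * eis_nonhol 1 (of_nat (t * M) * z) s \<psi>' \<rho>) 0)"

section \<open>Holomorphic Eisenstein series\<close>

definition sigma_char ::
    "nat \<Rightarrow> nat \<Rightarrow> (int \<Rightarrow> complex) \<Rightarrow> (int \<Rightarrow> complex) \<Rightarrow> nat \<Rightarrow> complex" where
  "sigma_char k M \<psi> \<rho> n =
    (let \<rho>0 = primitive_char M \<rho>; l = M div conductor M \<rho> in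
     \<Sum>c | c dvd n. \<psi> (int (n div c)) * of_nat c ^ (k - 1) *
       (\<Sum>d | d dvd gcd l c. of_nat d * moebius_fun (l div d)
          * cnj (\<rho>0 (int (l div d))) * \<rho>0 (int (c div d))))"

definition const_C :: "nat \<Rightarrow> (int \<Rightarrow> complex) \<Rightarrow> (int \<Rightarrow> complex) \<Rightarrow> complex" where
  "const_C k \<psi> \<rho> =
     (if \<psi> = trivial_char 1 then Dirichlet_L (of_nat k) (\<lambda>n. cnj (\<rho> n)) else 0)"

definition const_D :: "nat \<Rightarrow> (int \<Rightarrow> complex) \<Rightarrow> (int \<Rightarrow> complex) \<Rightarrow> complex" where
  "const_D M \<psi> \<rho> =
     (if \<rho> = trivial_char M
      then - of_real pi * \<i> * Dirichlet_L 0 \<psi> * (\<Prod>p\<in>prime_factors M. 1 - 1 / of_nat p)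
      else 0)"

definition eis_q_part ::
    "nat \<Rightarrow> nat \<Rightarrow> (int \<Rightarrow> complex) \<Rightarrow> (int \<Rightarrow> complex) \<Rightarrow> complex \<Rightarrow> complex" where
  "eis_q_part k M \<psi> \<rho> z =
     (- 2 * of_real pi * \<i> / of_nat M) ^ k
     * (gauss_sum (conductor M \<rho>) (\<lambda>n. cnj (primitive_char M \<rho> n)) / fact (k - 1))
     * (\<Sum>n. sigma_char k M \<psi> \<rho> (Suc n) * exp (2 * of_real pi * \<i> * z) ^ Suc n)"

definition eis_hol ::
    "nat \<Rightarrow> nat \<Rightarrow> nat \<Rightarrow> (int \<Rightarrow> complex) \<Rightarrow> (int \<Rightarrow> complex) \<Rightarrow> complex \<Rightarrow> complex" where
  "eis_hol k L M \<psi> \<rho> z =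
    (if k = 1 then
       const_C 1 \<psi> \<rho> + const_D M \<psi> \<rho> + eis_q_part 1 M \<psi> \<rho> z
     else if k = 2 \<and> \<psi> = trivial_char L \<and> \<rho> = trivial_char M then
       const_C 2 (trivial_char L) (trivial_char M)
       - of_real pi / (2 * of_nat M * of_real (Im z))
           * (\<Prod>p\<in>prime_factors M. 1 - 1 / of_nat p) * (\<Prod>p\<in>prime_factors L. 1 - 1 / of_nat p)
       - 4 * of_real pi ^ 2 / of_nat M ^ 2
           * (\<Sum>n. sigma_char 2 M (trivial_char L) (trivial_char M) (Suc n)
                * exp (2 * of_real pi * \<i> * z) ^ Suc n)
     else const_C k \<psi> \<rho> + eis_q_part k M \<psi> \<rho> z)"

definition eis_hol_t ::
    "nat \<Rightarrow> nat \<Rightarrow> nat \<Rightarrow> nat \<Rightarrow> (int \<Rightarrow> complex) \<Rightarrow> (int \<Rightarrow> complex) \<Rightarrow> complex \<Rightarrow> complex" where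
  "eis_hol_t k L M t \<psi> \<rho> z =
    (if k = 2 \<and> \<psi> = trivial_char L \<and> \<rho> = trivial_char M
     then eis_hol 2 L M (trivial_char L) (trivial_char M) z
          - of_nat t * eis_hol 2 L M (trivial_char L) (trivial_char M) (of_nat t * z)
     else eis_hol k L M \<psi> \<rho> (of_nat t * z))"

end

theory Submission
  imports Defs "HOL-Number_Theory.Number_Theory"
begin

text \<open>
  Both Eisenstein series are sums over \<open>\<int>\<^sup>2\<close> of \<open>\<phi>(m, n)\<close> times a homogeneous function of \<open>mz + n\<close> and
  its conjugate, with \<open>\<phi>(m, n) = \<alpha>(m / T) \<beta>(n)\<close> (zero unless \<open>T\<close> divides \<open>m\<close>) periodic modulo \<open>N = tLM\<close>.
  Summing over one period at a time, with coefficients \<open>\<kappa>\<close> adjusted so that the moments of order \<open>0\<close> and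
  \<open>1\<close> vanish, gains two powers of \<open>|mz + n|\<close>; this continues the sums in \<open>s\<close> without Poisson summation.
  Replacing \<open>cnj z\<close> by an independent variable \<open>\<zeta>\<close> yields a function holomorphic in \<open>(z, \<zeta>)\<close>, from
  which real analyticity, harmonicity and the image under \<open>\<xi>\<close>, a conjugated holomorphic lattice sum, are
  read off. The modular group acts by permuting the lattice. The Fourier expansion of the holomorphic
  sum comes from the partial fractions of the cotangent, row by row; for \<open>k = 1\<close> the corrections in \<open>\<kappa>\<close>
  contribute the constant containing \<open>L(0, \<psi>)\<close>. Finite Fourier transforms of imprimitive characters are
  evaluated by Moebius inversion and the separability of primitive Gauss sums.
\<close>

text \<open>The obstacle is k = 1 and k = 2: there the relevant point s lies beyond or on the border
  of absolute convergence. With u = s - (k - 1) the relevant point is u = 0 in every case, and a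
  summand has size |mz + n|^(-k - 2 Re u). Letting Re u sink to -1/4, so that u = 0 becomes an
  interior point, costs half a power; after a gain of two powers the exponent is still at least 5/2
  > 2, which is summable over the lattice of periods. For k \<ge> 3 the exponent k - 1/2 is large
  enough from the start. The corrected weights depend on the chosen box and are not respected by the
  modular group, so the transformation law is proved where the plain series converges and carried to
  u = 0 by the identity theorem. All bounds are explicit in one number C attached to z and at most
  exponential in it; that yields the growth at the cusps. A vanishing zeroth moment must come from
  \<phi> itself: it fails exactly when both characters are trivial, which parity excludes for k = 1
  and which the combination of the levels M and tM repairs for k = 2.\<close>

lemma has_field_derivative_infsum:
  fixes f :: "'a \<Rightarrow> complex \<Rightarrow> complex"
  assumes r: "r > 0"
    and der: "\<And>i w. i \<in> I \<Longrightarrow> w \<in> cball z r \<Longrightarrow> (f i has_field_derivative f' i w) (at w)"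
    and bd: "\<And>i w. i \<in> I \<Longrightarrow> w \<in> cball z r \<Longrightarrow> norm (f i w) \<le> M i"
    and M: "M summable_on I" and w: "w \<in> ball z r"
  shows "\<exists>D. ((\<lambda>w. \<Sum>\<^sub>\<infinity>i\<in>I. f i w) has_field_derivative D) (at w) \<and> ((\<lambda>i. f' i w) has_sum D) I"
proof -
  \<comment> \<open>A uniform limit of holomorphic functions may be differentiated termwise, along
    the net of finite index sets just as along a sequence. The convergence of the series of
    derivatives is part of what this yields.\<close>
  have ul: "uniform_limit (cball z r) (\<lambda>X w. \<Sum>i\<in>X. f i w) (\<lambda>w. \<Sum>\<^sub>\<infinity>i\<in>I. f i w)
      (finite_subsets_at_top I)"
    by (rule Weierstrass_m_test_general[OF _ M]) (use bd in auto)
  have ev: "eventually (\<lambda>X. continuous_on (cball z r) (\<lambda>w. \<Sum>i\<in>X. f i w) \<and>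
      (\<forall>w \<in> ball z r. ((\<lambda>w. \<Sum>i\<in>X. f i w) has_field_derivative (\<Sum>i\<in>X. f' i w)) (at w)))
      (finite_subsets_at_top I)"
  proof (rule eventually_finite_subsets_at_top_weakI)
    fix X assume X: "finite X" "X \<subseteq> I"
    have d: "((\<lambda>w. \<Sum>i\<in>X. f i w) has_field_derivative (\<Sum>i\<in>X. f' i w)) (at w)"
      if "w \<in> cball z r" for w
      using X that der by (auto intro!: DERIV_sum)
    hence "continuous_on (cball z r) (\<lambda>w. \<Sum>i\<in>X. f i w)"
      by (meson DERIV_isCont continuous_at_imp_continuous_on)
    with d show "continuous_on (cball z r) (\<lambda>w. \<Sum>i\<in>X. f i w) \<and>
      (\<forall>w \<in> ball z r. ((\<lambda>w. \<Sum>i\<in>X. f i w) has_field_derivative (\<Sum>i\<in>X. f' i w)) (at w))"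
      by (auto simp: less_imp_le)
  qed
  show ?thesis
    by (rule has_complex_derivative_uniform_limit[OF ev ul _ r])
       (use w in \<open>auto simp: has_sum_def\<close>)
qed

text \<open>The Cauchy estimates bound the coefficients by B/\<rho>^n and the two lowest vanish, so
  the value at 1 is dominated by a geometric series of ratio at most 1/2. This is where two powers
  of the lattice vector are gained: \<rho> will be proportional to its length.\<close>

lemma power_series_second_order:
  assumes hol: "P holomorphic_on cball 0 \<rho>" and rho: "\<rho> \<ge> (2::real)"
    and B: "\<And>t. norm t \<le> \<rho> \<Longrightarrow> norm (P t) \<le> B"
    and P0: "P 0 = 0" and P1: "deriv P 0 = 0"
  shows "norm (P 1) \<le> 2 * B / \<rho> ^ 2"
proof -
  define c where "c = (\<lambda>n. (deriv ^^ n) P 0 / fact n)"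
  have holb: "P holomorphic_on ball 0 \<rho>"
    using hol by (rule holomorphic_on_subset) auto
  have cn: "norm (c n) \<le> B / \<rho> ^ n" for n
  proof -
    have "norm ((deriv ^^ n) P 0) \<le> fact n * B / \<rho> ^ n"
      by (rule Cauchy_inequality[OF holb]) (use hol rho B in \<open>auto intro: holomorphic_on_imp_continuous_on\<close>)
    thus ?thesis by (simp add: c_def norm_divide field_simps)
  qed
  have B0: "B \<ge> 0" using B[of 0] rho by (simp add: P0)
  have s: "(\<lambda>n. c n * 1 ^ n) sums P 1"
    using holomorphic_power_series[OF holb, of 1] rho by (simp add: c_def)
  hence s2: "(\<lambda>n. c (n + 2)) sums P 1"
    using P0 P1 sums_split_initial_segment[OF s, of 2] by (simp add: c_def numeral_2_eq_2)
  have le: "norm (c (n + 2)) \<le> B / \<rho>^2 * (1/2) ^ n" for n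
  proof -
    have "norm (c (n + 2)) \<le> B / \<rho> ^ (n + 2)" by (rule cn)
    also have "\<dots> = B / \<rho>^2 * (1 / \<rho>) ^ n"
      by (simp add: power_add power2_eq_square power_divide)
    also have "\<dots> \<le> B / \<rho>^2 * (1/2) ^ n"
      using rho B0 by (intro mult_left_mono power_mono) (auto simp: field_simps)
    finally show ?thesis .
  qed
  have g: "(\<lambda>n. B / \<rho>^2 * (1/2::real) ^ n) sums (B / \<rho>^2 * 2)"
    using geometric_sums[of "1/2::real"] by (intro sums_mult) auto
  have "norm (P 1) \<le> B / \<rho>^2 * 2"
    using norm_suminf_le[OF le sums_summable[OF g]] s2 g by (simp add: sums_iff)
  thus ?thesis by (simp add: field_simps)
qed

section \<open>Functions holomorphic in two variables separately\<close>

text \<open>Boundedness on smaller bidiscs is made part of the notion: it renders the Cauchy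
  estimates in one variable uniform in the other and replaces an appeal to Hartogs' theorem.\<close>

definition biholo :: "complex \<Rightarrow> complex \<Rightarrow> real \<Rightarrow> (complex \<Rightarrow> complex \<Rightarrow> complex) \<Rightarrow> bool" where
  "biholo z0 \<zeta>0 r H \<longleftrightarrow> (\<forall>\<zeta>\<in>ball \<zeta>0 r. (\<lambda>z. H z \<zeta>) holomorphic_on ball z0 r) \<and>
     (\<forall>z\<in>ball z0 r. H z holomorphic_on ball \<zeta>0 r) \<and>
     (\<forall>s<r. \<exists>M. \<forall>z\<in>ball z0 s. \<forall>\<zeta>\<in>ball \<zeta>0 s. norm (H z \<zeta>) \<le> M)"

lemma cball_subset_ball_shift:
  fixes z z0 :: complex
  shows "z \<in> ball z0 s \<Longrightarrow> s + e < r \<Longrightarrow> cball z e \<subseteq> ball z0 r"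
proof
  fix w assume "z \<in> ball z0 s" "s + e < r" "w \<in> cball z e"
  thus "w \<in> ball z0 r" using dist_triangle[of z0 w z] by simp
qed

text \<open>The difference quotients in the first variable converge uniformly in the second one by
  the Cauchy estimates, so no integral representation is needed.\<close>

lemma biholo_deriv:
  assumes H: "biholo z0 \<zeta>0 r H"
  shows "biholo z0 \<zeta>0 r (\<lambda>z \<zeta>. deriv (\<lambda>z. H z \<zeta>) z)"
proof -
  have hz: "\<And>\<zeta>. \<zeta> \<in> ball \<zeta>0 r \<Longrightarrow> (\<lambda>z. H z \<zeta>) holomorphic_on ball z0 r"
    and h\<zeta>: "\<And>z. z \<in> ball z0 r \<Longrightarrow> H z holomorphic_on ball \<zeta>0 r"
    and bd: "\<And>s. s < r \<Longrightarrow> \<exists>M. \<forall>z\<in>ball z0 s. \<forall>\<zeta>\<in>ball \<zeta>0 s. norm (H z \<zeta>) \<le> M"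
    using H by (auto simp: biholo_def)
  \<comment> \<open>Orders up to 2 at once: order 1 is the boundedness that the derivative itself
    has to satisfy, order 2 controls the Taylor remainder of the difference quotients below.\<close>
  have key: "\<exists>M\<ge>0. \<forall>z\<in>ball z0 s. \<forall>\<zeta>\<in>ball \<zeta>0 s. \<forall>n\<le>2. norm ((deriv ^^ n) (\<lambda>z. H z \<zeta>) z) \<le> M"
    if s: "s < r" for s
  proof -
    define e where "e = (r - s) / 4"
    have e: "e > 0" "s + e < r" "s + 2 * e < r" using s by (simp_all add: e_def field_simps)
    obtain M where M: "\<forall>z\<in>ball z0 (s + 2 * e). \<forall>\<zeta>\<in>ball \<zeta>0 (s + 2 * e). norm (H z \<zeta>) \<le> M"
      using bd[OF e(3)] by blast
    define M' where "M' = \<bar>M\<bar> * (1 + 1 / e + 2 / e ^ 2)"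
    have bdn: "norm ((deriv ^^ n) (\<lambda>z. H z \<zeta>) z) \<le> M'"
      if z: "z \<in> ball z0 s" and zeta: "\<zeta> \<in> ball \<zeta>0 s" and n: "n \<le> 2" for z \<zeta> n
    proof -
      have sub: "cball z e \<subseteq> ball z0 r" "cball z e \<subseteq> ball z0 (s + 2 * e)"
        using cball_subset_ball_shift[OF z] e by auto
      have zr: "\<zeta> \<in> ball \<zeta>0 r" "\<zeta> \<in> ball \<zeta>0 (s + 2 * e)" using zeta s e by auto
      have hc: "(\<lambda>z. H z \<zeta>) holomorphic_on cball z e"
        using hz[OF zr(1)] sub holomorphic_on_subset by blast
      have "norm ((deriv ^^ n) (\<lambda>z. H z \<zeta>) z) \<le> fact n * \<bar>M\<bar> / e ^ n"
      proof (rule Cauchy_inequality)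
        show "(\<lambda>z. H z \<zeta>) holomorphic_on ball z e"
          using hc by (rule holomorphic_on_subset) auto
        show "continuous_on (cball z e) (\<lambda>z. H z \<zeta>)"
          using hc by (rule holomorphic_on_imp_continuous_on)
        show "e > 0" by fact
        fix x assume "norm (z - x) = e"
        hence "x \<in> cball z e" by (simp add: dist_norm)
        hence "x \<in> ball z0 (s + 2 * e)" using sub by blast
        hence "norm (H x \<zeta>) \<le> M" using M zr by blast
        thus "norm (H x \<zeta>) \<le> \<bar>M\<bar>" by simp
      qed
      also have "\<dots> \<le> M'"
      proof -
        have "n = 0 \<or> n = 1 \<or> n = 2" using n by auto
        hence "fact n / e ^ n \<le> 1 + 1 / e + 2 / e ^ 2" using e(1) by auto
        hence "\<bar>M\<bar> * (fact n / e ^ n) \<le> \<bar>M\<bar> * (1 + 1 / e + 2 / e ^ 2)"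
          by (intro mult_left_mono) auto
        thus ?thesis by (simp add: M'_def mult.commute)
      qed
      finally show ?thesis .
    qed
    have "M' \<ge> 0" using e by (simp add: M'_def)
    with bdn show ?thesis by blast
  qed
  show ?thesis
    unfolding biholo_def
  proof (intro conjI ballI allI impI)
    fix \<zeta> assume "\<zeta> \<in> ball \<zeta>0 r"
    thus "(\<lambda>z. deriv (\<lambda>z. H z \<zeta>) z) holomorphic_on ball z0 r"
      by (intro holomorphic_deriv hz) auto
  next
    fix s assume "s < r"
    from key[OF this] obtain M where
      "\<forall>z\<in>ball z0 s. \<forall>\<zeta>\<in>ball \<zeta>0 s. \<forall>n\<le>2. norm ((deriv ^^ n) (\<lambda>z. H z \<zeta>) z) \<le> M" by blast
    hence "\<forall>z\<in>ball z0 s. \<forall>\<zeta>\<in>ball \<zeta>0 s. norm ((deriv ^^ 1) (\<lambda>z. H z \<zeta>) z) \<le> M"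
      by (meson one_le_numeral)
    thus "\<exists>M. \<forall>z\<in>ball z0 s. \<forall>\<zeta>\<in>ball \<zeta>0 s. norm (deriv (\<lambda>z. H z \<zeta>) z) \<le> M" by auto
  next
    fix z assume z: "z \<in> ball z0 r"
    show "(\<lambda>\<zeta>. deriv (\<lambda>z. H z \<zeta>) z) holomorphic_on ball \<zeta>0 r"
    proof (rule holomorphic_uniform_sequence)
      show "open (ball \<zeta>0 r)" by simp
      define s0 where "s0 = (dist z0 z + r) / 2"
      have s0: "z \<in> ball z0 s0" "s0 < r" using z by (auto simp: s0_def)
      define d where "d = (r - s0) / 4"
      have d: "d > 0" "s0 + d < r" "s0 + 2 * d < r" using s0 by (simp_all add: d_def field_simps)
      have dz: "cball z d \<subseteq> ball z0 (s0 + 2 * d)" "cball z d \<subseteq> ball z0 r"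
        using cball_subset_ball_shift[OF s0(1)] d by auto
      \<comment> \<open>A null sequence of nonzero increments inside the disc of radius d; its rate
        d/(n + 1) becomes the rate of uniform convergence in \<open>est\<close>.\<close>
      define h where "h = (\<lambda>n::nat. complex_of_real (d / real (Suc n)))"
      have hn: "h n \<noteq> 0" "norm (h n) = d / real (Suc n)" "norm (h n) \<le> d" for n
        using d by (auto simp: h_def norm_divide divide_le_eq mult_le_cancel_left1
            simp del: of_nat_Suc)
      have zh: "z + h n \<in> cball z d" "z + h n \<in> ball z0 r" for n
      proof -
        show "z + h n \<in> cball z d" using hn(3)[of n] by (simp add: dist_norm)
        thus "z + h n \<in> ball z0 r" using dz by blast
      qed
      show "(\<lambda>\<zeta>. (H (z + h n) \<zeta> - H z \<zeta>) / h n) holomorphic_on ball \<zeta>0 r" for n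
        using hn by (intro holomorphic_intros h\<zeta> zh z)
      fix \<zeta> assume zeta: "\<zeta> \<in> ball \<zeta>0 r"
      define s1 where "s1 = max (s0 + 2 * d) ((dist \<zeta>0 \<zeta> + r) / 2)"
      define s2 where "s2 = (dist \<zeta>0 \<zeta> + r) / 2"
      have s1: "s1 < r" "s0 + 2 * d \<le> s1" "s2 \<le> s1" using zeta d by (auto simp: s1_def s2_def)
      define dd where "dd = (s2 - dist \<zeta>0 \<zeta>) / 2"
      have dd: "dd > 0" "dist \<zeta>0 \<zeta> + dd < s2" using zeta by (auto simp: dd_def s2_def field_simps)
      have sub: "cball \<zeta> dd \<subseteq> ball \<zeta>0 s2"
      proof
        fix w assume "w \<in> cball \<zeta> dd"
        thus "w \<in> ball \<zeta>0 s2" using dist_triangle[of \<zeta>0 w \<zeta>] dd by simp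
      qed
      have sub1: "ball \<zeta>0 s2 \<subseteq> ball \<zeta>0 s1" "ball \<zeta>0 s2 \<subseteq> ball \<zeta>0 r" "ball z0 (s0 + 2*d) \<subseteq> ball z0 s1"
        using s1 by (auto intro!: subset_ball)
      obtain M where M: "M \<ge> 0" "\<And>z \<zeta> n. z\<in>ball z0 s1 \<Longrightarrow> \<zeta>\<in>ball \<zeta>0 s1 \<Longrightarrow> n \<le> 2 \<Longrightarrow>
          norm ((deriv ^^ n) (\<lambda>z. H z \<zeta>) z) \<le> M"
        using key[OF s1(1)] by blast
      have est: "norm ((H (z + h n) x - H z x) / h n - deriv (\<lambda>z. H z x) z) \<le> M * (d / real (Suc n))"
        if x: "x \<in> cball \<zeta> dd" for x n
      proof -
        have xr: "x \<in> ball \<zeta>0 r" "x \<in> ball \<zeta>0 s1" using x sub sub1 by blast+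
        have "cmod ((deriv ^^ 0) (\<lambda>z. H z x) (z + h n) -
            (\<Sum>i\<le>1. (deriv ^^ i) (\<lambda>z. H z x) z * ((z + h n)-z) ^ i / (fact i)))
            \<le> M * cmod ((z + h n) - z)^(Suc 1) / fact 1"
        proof (rule complex_Taylor[of "cball z d"])
          fix i y assume y: "y \<in> cball z d" "i \<le> (1::nat)"
          have "(deriv ^^ i) (\<lambda>z. H z x) holomorphic_on ball z0 r"
            by (intro holomorphic_higher_deriv hz xr) auto
          moreover have "y \<in> ball z0 r" using y dz by blast
          ultimately have "((deriv ^^ i) (\<lambda>z. H z x) has_field_derivative
              deriv ((deriv ^^ i) (\<lambda>z. H z x)) y) (at y)"
            by (intro holomorphic_derivI) auto
          thus "((deriv ^^ i) (\<lambda>z. H z x) has_field_derivative (deriv ^^ Suc i) (\<lambda>z. H z x) y)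
              (at y within cball z d)"
            by (simp add: has_field_derivative_at_within)
        next
          fix y assume "y \<in> cball z d"
          hence "y \<in> ball z0 s1" using dz sub1 by blast
          thus "cmod ((deriv ^^ Suc 1) (\<lambda>z. H z x) y) \<le> M"
            using M(2)[of y x 2] xr by (simp add: numeral_2_eq_2)
        qed (use zh d in auto)
        hence "norm (H (z + h n) x - (H z x + deriv (\<lambda>z. H z x) z * h n)) \<le> M * norm (h n) ^ 2"
          by (simp add: numeral_2_eq_2)
        moreover have "(H (z + h n) x - H z x) / h n - deriv (\<lambda>z. H z x) z =
            (H (z + h n) x - (H z x + deriv (\<lambda>z. H z x) z * h n)) / h n"
          using hn(1)[of n] by (simp add: field_simps)
        ultimately have "norm ((H (z + h n) x - H z x) / h n - deriv (\<lambda>z. H z x) z)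
            \<le> M * norm (h n) ^ 2 / norm (h n)"
          by (simp add: norm_divide divide_right_mono)
        also have "\<dots> = M * (d / real (Suc n))"
          using hn by (simp add: power2_eq_square)
        finally show ?thesis .
      qed
      have "uniform_limit (cball \<zeta> dd) (\<lambda>n \<zeta>. (H (z + h n) \<zeta> - H z \<zeta>) / h n)
          (\<lambda>\<zeta>. deriv (\<lambda>z. H z \<zeta>) z) sequentially"
      proof (rule uniform_limitI)
        fix e :: real assume "e > 0"
        have "(\<lambda>n. M * (d / real (Suc n))) \<longlonglongrightarrow> M * 0"
          by (intro tendsto_mult tendsto_const LIMSEQ_Suc[OF lim_const_over_n])
        hence "eventually (\<lambda>n. M * (d / real (Suc n)) < e) sequentially"
          using order_tendstoD(2) \<open>e > 0\<close> by fastforce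
        thus "\<forall>\<^sub>F n in sequentially. \<forall>x\<in>cball \<zeta> dd.
            dist ((H (z + h n) x - H z x) / h n) (deriv (\<lambda>z. H z x) z) < e"
          unfolding dist_norm by eventually_elim (use est le_less_trans in blast)
      qed
      moreover have "cball \<zeta> dd \<subseteq> ball \<zeta>0 r" using sub sub1 by blast
      ultimately show "\<exists>d>0. cball \<zeta> d \<subseteq> ball \<zeta>0 r \<and> uniform_limit (cball \<zeta> d)
          (\<lambda>n \<zeta>. (H (z + h n) \<zeta> - H z \<zeta>) / h n) (\<lambda>\<zeta>. deriv (\<lambda>z. H z \<zeta>) z) sequentially"
        using dd(1) by blast
    qed
  qed
qed

lemma biholo_higher_deriv:
  assumes "biholo z0 \<zeta>0 r H"
  shows "biholo z0 \<zeta>0 r (\<lambda>z \<zeta>. (deriv ^^ n) (\<lambda>z. H z \<zeta>) z)"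
proof (induction n)
  case 0 thus ?case using assms by simp
next
  case (Suc n)
  have "(\<lambda>z \<zeta>. (deriv ^^ Suc n) (\<lambda>z. H z \<zeta>) z) = (\<lambda>z \<zeta>. deriv (\<lambda>z. (deriv ^^ n) (\<lambda>z. H z \<zeta>) z) z)"
    by (simp add: fun_eq_iff)
  thus ?case using biholo_deriv[OF Suc] by simp
qed

lemma has_sum_geometric_product:
  fixes x y :: real
  assumes "0 \<le> x" "x < 1" "0 \<le> y" "y < 1"
  shows "((\<lambda>(p, q). x ^ p * y ^ q) has_sum (1 / (1 - x) * (1 / (1 - y)))) (UNIV :: (nat \<times> nat) set)"
proof -
  have g: "((\<lambda>p. x ^ p) has_sum (1 / (1 - x))) UNIV" if "0 \<le> x" "x < 1" for x :: real
    by (rule norm_summable_imp_has_sum) (use that geometric_sums[of x] in auto)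
  have i: "((\<lambda>q. (\<lambda>(p, q). x ^ p * y ^ q) (p, q)) has_sum (x ^ p * (1 / (1 - y)))) UNIV" for p
    using has_sum_cmult_right[OF g[OF assms(3,4)]] by simp
  have o: "((\<lambda>p. x ^ p * (1 / (1 - y))) has_sum (1 / (1 - x) * (1 / (1 - y)))) UNIV"
    by (rule has_sum_cmult_left[OF g[OF assms(1,2)]])
  have "(\<lambda>(p, q). x ^ p * y ^ q) summable_on Sigma UNIV (\<lambda>_::nat. UNIV :: nat set)"
    by (rule summable_on_SigmaI[OF i]) (use o assms in \<open>auto simp: summable_on_def\<close>)
  from has_sum_SigmaI[OF i o this] show ?thesis by simp
qed

lemma double_series_abs_summable:
  fixes a :: "nat \<Rightarrow> nat \<Rightarrow> complex"
  assumes R: "R > 0" and a: "\<And>p q. norm (a p q) \<le> M / R ^ (p + q)"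
    and u: "norm u < R" and v: "norm v < R"
  shows "(\<lambda>x. norm (case x of (p, q) \<Rightarrow> a p q * u ^ p * v ^ q)) summable_on UNIV"
proof -
  have "(\<lambda>(p, q). M * ((norm u / R) ^ p * (norm v / R) ^ q)) summable_on (UNIV :: (nat \<times> nat) set)"
    using summable_on_cmult_right[OF has_sum_imp_summable[OF has_sum_geometric_product[of "norm u / R" "norm v / R"]], of M]
      R u v by (simp add: case_prod_unfold)
  thus ?thesis
  proof (rule Infinite_Sum.abs_summable_on_comparison_test')
    fix x :: "nat \<times> nat"
    obtain p q where x: "x = (p, q)" by force
    have "norm (a p q * u ^ p * v ^ q) \<le> M / R ^ (p + q) * norm u ^ p * norm v ^ q"
      unfolding norm_mult norm_power by (intro mult_right_mono a) auto
    also have "\<dots> = M * ((norm u / R) ^ p * (norm v / R) ^ q)"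
      by (simp add: power_add power_divide)
    finally show "norm (case x of (p, q) \<Rightarrow> a p q * u ^ p * v ^ q)
        \<le> (case x of (p, q) \<Rightarrow> M * ((norm u / R) ^ p * (norm v / R) ^ q))"
      by (simp add: x)
  qed
qed

text \<open>The expansion in z about \<open>z0\<close> has the coefficients \<open>h p\<close>,
  which are holomorphic in the second variable by \<open>biholo_higher_deriv\<close> and are
  expanded in turn. Two Cauchy estimates give the bound M/R^(p+q); it makes the double series
  absolutely summable, so the iterated sum is the unordered one.\<close>

lemma biholo_expansion:
  assumes H: "biholo z0 \<zeta>0 r H" and r: "r > 0"
  obtains R M where "R > 0" "R < r"
    "\<And>p q. norm ((deriv ^^ q) (\<lambda>\<zeta>. (deriv ^^ p) (\<lambda>z. H z \<zeta>) z0) \<zeta>0 / (fact p * fact q)) \<le> M / R ^ (p + q)"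
    "\<And>u v. norm u < R \<Longrightarrow> norm v < R \<Longrightarrow>
      ((\<lambda>(p, q). (deriv ^^ q) (\<lambda>\<zeta>. (deriv ^^ p) (\<lambda>z. H z \<zeta>) z0) \<zeta>0 / (fact p * fact q) * u ^ p * v ^ q)
        has_sum H (z0 + u) (\<zeta>0 + v)) UNIV"
proof -
  define a where "a = (\<lambda>p q. (deriv ^^ q) (\<lambda>\<zeta>. (deriv ^^ p) (\<lambda>z. H z \<zeta>) z0) \<zeta>0 / (fact p * fact q))"
  define h where "h = (\<lambda>p \<zeta>. (deriv ^^ p) (\<lambda>z. H z \<zeta>) z0)"
  have hz: "\<And>\<zeta>. \<zeta> \<in> ball \<zeta>0 r \<Longrightarrow> (\<lambda>z. H z \<zeta>) holomorphic_on ball z0 r"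
    using H by (auto simp: biholo_def)
  have hh: "h p holomorphic_on ball \<zeta>0 r" for p
    using biholo_higher_deriv[OF H, of p] r by (auto simp: biholo_def h_def)
  define R where "R = r / 2"
  have R: "R > 0" "R < r" using r by (auto simp: R_def)
  \<comment> \<open>The closed discs of radius R = r/2 must lie inside open discs on which H is
    bounded; the radius 3r/4 leaves that margin.\<close>
  have "3/4 * r < r" using r by simp
  then obtain M where M: "\<forall>z\<in>ball z0 (3/4*r). \<forall>\<zeta>\<in>ball \<zeta>0 (3/4*r). norm (H z \<zeta>) \<le> M"
    using H unfolding biholo_def by blast
  have sub: "cball z0 R \<subseteq> ball z0 (3/4*r)" "cball \<zeta>0 R \<subseteq> ball \<zeta>0 (3/4*r)" 
      "cball z0 R \<subseteq> ball z0 r" "cball \<zeta>0 R \<subseteq> ball \<zeta>0 r" using r by (auto simp: R_def)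
  have hb: "norm (h p \<zeta>) \<le> fact p * M / R ^ p" if "\<zeta> \<in> cball \<zeta>0 R" for p \<zeta>
    unfolding h_def
  proof (rule Cauchy_inequality)
    have "\<zeta> \<in> ball \<zeta>0 r" using that sub by blast
    hence hc: "(\<lambda>z. H z \<zeta>) holomorphic_on cball z0 R"
      using hz sub holomorphic_on_subset by blast
    thus "(\<lambda>z. H z \<zeta>) holomorphic_on ball z0 R"
      by (rule holomorphic_on_subset) auto
    show "continuous_on (cball z0 R) (\<lambda>z. H z \<zeta>)"
      using hc by (rule holomorphic_on_imp_continuous_on)
    fix x assume "norm (z0 - x) = R"
    hence "x \<in> cball z0 R" by (simp add: dist_norm)
    thus "norm (H x \<zeta>) \<le> M" using M sub that by blast
  qed fact
  have ab: "norm (a p q) \<le> M / R ^ (p + q)" for p q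
  proof -
    have hc: "h p holomorphic_on cball \<zeta>0 R"
      using hh sub holomorphic_on_subset by blast
    have "norm ((deriv ^^ q) (h p) \<zeta>0) \<le> fact q * (fact p * M / R ^ p) / R ^ q"
    proof (rule Cauchy_inequality)
      show "h p holomorphic_on ball \<zeta>0 R"
        using hc by (rule holomorphic_on_subset) auto
      show "continuous_on (cball \<zeta>0 R) (h p)"
        using hc by (rule holomorphic_on_imp_continuous_on)
      fix x assume "norm (\<zeta>0 - x) = R"
      thus "norm (h p x) \<le> fact p * M / R ^ p" by (intro hb) (simp add: dist_norm)
    qed fact
    hence "norm ((deriv ^^ q) (h p) \<zeta>0) / (fact p * fact q) \<le> M / R ^ (p + q)"
      by (simp add: power_add field_simps)
    thus ?thesis by (simp add: a_def h_def norm_divide norm_mult)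
  qed
  have hs: "((\<lambda>(p, q). a p q * u ^ p * v ^ q) has_sum H (z0 + u) (\<zeta>0 + v)) UNIV"
    if u: "norm u < R" and v: "norm v < R" for u v
  proof -
    have abs: "(\<lambda>x. norm (case x of (p, q) \<Rightarrow> a p q * u ^ p * v ^ q)) summable_on UNIV"
      by (rule double_series_abs_summable[OF R(1) ab u v])
    have vb: "\<zeta>0 + v \<in> ball \<zeta>0 r" using v R by (simp add: dist_norm)
    have i: "((\<lambda>q. (\<lambda>(p, q). a p q * u ^ p * v ^ q) (p, q)) has_sum (h p (\<zeta>0 + v) / fact p * u ^ p)) UNIV" for p
    proof (rule norm_summable_imp_has_sum)
      have "(\<lambda>q. norm (case (p, q) of (p, q) \<Rightarrow> a p q * u ^ p * v ^ q)) summable_on UNIV"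
        using abs Infinite_Sum.abs_summable_on_Sigma_iff[of "\<lambda>(p, q). a p q * u ^ p * v ^ q" UNIV "\<lambda>_. UNIV"] by simp
      thus "summable (\<lambda>n. norm (case (p, n) of (p, q) \<Rightarrow> a p q * u ^ p * v ^ q))"
        by (rule summable_on_imp_summable)
      have "(\<lambda>q. (deriv ^^ q) (h p) \<zeta>0 / fact q * ((\<zeta>0 + v) - \<zeta>0) ^ q) sums h p (\<zeta>0 + v)"
        by (rule holomorphic_power_series[OF hh vb])
      from sums_mult[OF this, of "u ^ p / fact p"]
      show "(\<lambda>n. case (p, n) of (p, q) \<Rightarrow> a p q * u ^ p * v ^ q) sums (h p (\<zeta>0 + v) / fact p * u ^ p)"
        by (simp add: a_def h_def mult_ac)
    qed
    have S: "(\<lambda>(p, q). a p q * u ^ p * v ^ q) summable_on (UNIV \<times> UNIV)"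
      using Infinite_Sum.abs_summable_summable[OF abs] by simp
    then obtain T where T: "((\<lambda>(p, q). a p q * u ^ p * v ^ q) has_sum T) (UNIV \<times> UNIV)"
      by (auto simp: summable_on_def)
    from has_sum_SigmaD[OF T i] have "((\<lambda>p. h p (\<zeta>0 + v) / fact p * u ^ p) has_sum T) UNIV" .
    hence "(\<lambda>p. h p (\<zeta>0 + v) / fact p * u ^ p) sums T" by (rule has_sum_imp_sums)
    moreover have "(\<lambda>p. h p (\<zeta>0 + v) / fact p * ((z0 + u) - z0) ^ p) sums H (z0 + u) (\<zeta>0 + v)"
      unfolding h_def using u R by (intro holomorphic_power_series[OF hz[OF vb]]) (simp add: dist_norm)
    ultimately have "T = H (z0 + u) (\<zeta>0 + v)" using sums_unique2 by simp
    with T show ?thesis by simp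
  qed
  show thesis
    using R ab hs that unfolding a_def by blast
qed

text \<open>With u = x + iy the binomial theorem turns u^p (cnj u)^q into a sum over (i, j), the
  numbers of factors y taken from the two powers. Collecting by the exponents of x and y is a
  rearrangement of a sum over ((p, q), (i, j)), legitimate because that sum converges
  absolutely.\<close>

lemma expansion_real_analytic:
  fixes a :: "nat \<Rightarrow> nat \<Rightarrow> complex"
  assumes R: "R > 0" and a: "\<And>p q. norm (a p q) \<le> M / R ^ (p + q)"
    and F: "\<And>u. norm u < R \<Longrightarrow> ((\<lambda>(p, q). a p q * u ^ p * cnj u ^ q) has_sum F (z0 + u)) UNIV"
  shows "\<exists>r>0. \<exists>b :: nat \<Rightarrow> nat \<Rightarrow> complex. \<forall>x y :: real. \<bar>x\<bar> < r \<and> \<bar>y\<bar> < r \<longrightarrow>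
     ((\<lambda>(m, n). b m n * of_real x ^ m * of_real y ^ n) has_sum F (z0 + Complex x y)) UNIV"
proof -
  define S where "S = Sigma (UNIV :: (nat \<times> nat) set) (\<lambda>(p, q). {..p} \<times> {..q})"
  define g where "g = (\<lambda>((p, q), (i, j)). (p - i + (q - j), i + j :: nat))"
  define co where "co = (\<lambda>((p, q), (i, j)). a p q * of_nat (p choose i) * of_nat (q choose j) * \<i> ^ i * (-\<i>) ^ j)"
  define fib where "fib = (\<lambda>mn. {e \<in> S. g e = mn})"
  define b where "b = (\<lambda>m n. \<Sum>e\<in>fib (m, n). co e)"
  \<comment> \<open>The two exponents add up to p + q, so only finitely many quadruples feed a given
    monomial.\<close>
  have finfib: "finite (fib mn)" for mn
  proof (rule finite_subset)
    show "fib mn \<subseteq> ({..fst mn + snd mn} \<times> {..fst mn + snd mn}) \<times> ({..snd mn} \<times> {..snd mn})"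
      by (auto simp: fib_def S_def g_def)
  qed auto
  show ?thesis
  proof (intro exI[of _ "R / 4"] conjI exI[of _ b] allI impI)
    show "R / 4 > 0" using R by simp
    fix x y :: real assume xy: "\<bar>x\<bar> < R / 4 \<and> \<bar>y\<bar> < R / 4"
    define u where "u = Complex x y"
    have ueq: "u = of_real x + \<i> * of_real y" "cnj u = of_real x + (-\<i>) * of_real y"
      by (simp_all add: u_def complex_eq_iff)
    have un: "norm u < R"
      using cmod_le[of u] xy R by (simp add: u_def)
    define \<tau> where "\<tau> = (\<lambda>e. co e * of_real x ^ fst (g e) * of_real y ^ snd (g e))"
    \<comment> \<open>Once absolute values are taken inside the binomial sums, |u| is replaced by
      |x| + |y|. Shrinking the radius to R/4 keeps this below R.\<close>
    define s where "s = \<bar>x\<bar> + \<bar>y\<bar>"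
    have s: "0 \<le> s" "s < R" using xy R by (auto simp: s_def)
    have M0: "M \<ge> 0" using order_trans[OF norm_ge_zero a[of 0 0]] by simp
    have inner: "((\<lambda>ij. \<tau> (pq, ij)) has_sum (case pq of (p, q) \<Rightarrow> a p q * u ^ p * cnj u ^ q)) (case pq of (p, q) \<Rightarrow> {..p} \<times> {..q})" for pq
    proof (cases pq)
      case (Pair p q)
      have "u ^ p = (\<Sum>i\<le>p. of_nat (p choose i) * (\<i> * of_real y) ^ i * of_real x ^ (p - i))"
        "cnj u ^ q = (\<Sum>j\<le>q. of_nat (q choose j) * (-\<i> * of_real y) ^ j * of_real x ^ (q - j))"
        using binomial_ring[of "\<i> * of_real y" "of_real x :: complex" p]
          binomial_ring[of "-\<i> * of_real y" "of_real x :: complex" q]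
        unfolding ueq(2) unfolding ueq(1) by (simp_all only: add.commute)
      hence "u ^ p * cnj u ^ q = (\<Sum>i\<le>p. of_nat (p choose i) * (\<i> * of_real y) ^ i * of_real x ^ (p - i)) *
          (\<Sum>j\<le>q. of_nat (q choose j) * (-\<i> * of_real y) ^ j * of_real x ^ (q - j))"
        by simp
      also have "\<dots> = (\<Sum>i\<le>p. \<Sum>j\<le>q. (of_nat (p choose i) * (\<i> * of_real y) ^ i * of_real x ^ (p - i)) *
          (of_nat (q choose j) * (-\<i> * of_real y) ^ j * of_real x ^ (q - j)))"
        by (rule sum_product)
      finally have "a p q * u ^ p * cnj u ^ q = (\<Sum>i\<le>p. \<Sum>j\<le>q. a p q * ((of_nat (p choose i) * (\<i> * of_real y) ^ i * of_real x ^ (p - i)) *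
          (of_nat (q choose j) * (-\<i> * of_real y) ^ j * of_real x ^ (q - j))))"
        by (simp add: sum_distrib_left mult.assoc)
      also have "\<dots> = (\<Sum>i\<le>p. \<Sum>j\<le>q. \<tau> ((p, q), (i, j)))"
        unfolding power_mult_distrib
        by (intro sum.cong refl) (simp only: \<tau>_def co_def g_def prod.case fst_conv snd_conv power_add mult_ac)
      also have "\<dots> = (\<Sum>ij\<in>{..p} \<times> {..q}. \<tau> ((p, q), ij))"
        by (simp add: sum.cartesian_product)
      finally show ?thesis
        unfolding Pair by (auto intro!: has_sum_finiteI)
    qed
    have ninner: "((\<lambda>ij. norm (\<tau> (pq, ij))) has_sum (case pq of (p, q) \<Rightarrow> norm (a p q) * s ^ p * s ^ q)) (case pq of (p, q) \<Rightarrow> {..p} \<times> {..q})" for pq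
    proof (cases pq)
      case (Pair p q)
      have sp: "s ^ p = (\<Sum>i\<le>p. of_nat (p choose i) * \<bar>y\<bar> ^ i * \<bar>x\<bar> ^ (p - i))" for p
        using binomial_ring[of "\<bar>y\<bar>" "\<bar>x\<bar>" p] unfolding s_def by (simp only: add.commute)
      have "s ^ p * s ^ q = (\<Sum>i\<le>p. of_nat (p choose i) * \<bar>y\<bar> ^ i * \<bar>x\<bar> ^ (p - i)) *
          (\<Sum>j\<le>q. of_nat (q choose j) * \<bar>y\<bar> ^ j * \<bar>x\<bar> ^ (q - j))"
        by (simp only: sp)
      also have "\<dots> = (\<Sum>i\<le>p. \<Sum>j\<le>q. (of_nat (p choose i) * \<bar>y\<bar> ^ i * \<bar>x\<bar> ^ (p - i)) *
          (of_nat (q choose j) * \<bar>y\<bar> ^ j * \<bar>x\<bar> ^ (q - j)))"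
        by (rule sum_product)
      finally have "norm (a p q) * s ^ p * s ^ q = (\<Sum>i\<le>p. \<Sum>j\<le>q. norm (a p q) * ((of_nat (p choose i) * \<bar>y\<bar> ^ i * \<bar>x\<bar> ^ (p - i)) *
          (of_nat (q choose j) * \<bar>y\<bar> ^ j * \<bar>x\<bar> ^ (q - j))))"
        by (simp add: sum_distrib_left mult.assoc)
      also have "\<dots> = (\<Sum>i\<le>p. \<Sum>j\<le>q. norm (\<tau> ((p, q), (i, j))))"
        by (intro sum.cong refl) (simp only: \<tau>_def co_def g_def prod.case fst_conv snd_conv power_add
            norm_mult norm_power norm_of_nat norm_of_real norm_ii norm_minus_cancel power_one mult_1_left mult_1_right mult_ac)
      also have "\<dots> = (\<Sum>ij\<in>{..p} \<times> {..q}. norm (\<tau> ((p, q), ij)))"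
        by (simp add: sum.cartesian_product)
      finally show ?thesis
        unfolding Pair by (auto intro!: has_sum_finiteI)
    qed
    have "(\<lambda>e. norm (\<tau> e)) summable_on S"
      unfolding S_def
    proof (rule summable_on_SigmaI[OF ninner])
      have eq: "(\<lambda>x. norm (case x of (p, q) \<Rightarrow> a p q * of_real s ^ p * of_real s ^ q)) =
          (\<lambda>(p, q). norm (a p q) * s ^ p * s ^ q)"
        using s by (auto simp: fun_eq_iff norm_mult norm_power)
      show "(\<lambda>pq. case pq of (p, q) \<Rightarrow> norm (a p q) * s ^ p * s ^ q) summable_on UNIV"
        using double_series_abs_summable[OF R a, of "of_real s" "of_real s"] s
        unfolding eq by simp
    qed auto
    hence "\<tau> summable_on S" by (rule Infinite_Sum.abs_summable_summable)
    hence tS: "(\<tau> has_sum F (z0 + u)) S"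
      unfolding S_def by (intro has_sum_SigmaI[OF inner F[OF un]]) (auto simp: S_def)
    have "((\<lambda>x. \<tau> (snd x)) has_sum F (z0 + u)) (Sigma UNIV fib)"
      using tS by (subst has_sum_reindex_bij_witness[of "Sigma UNIV fib" "\<lambda>e. (g e, e)" snd S \<tau> _ "F (z0 + u)" "F (z0 + u)"])
        (auto simp: fib_def)
    hence "((\<lambda>mn. \<Sum>e\<in>fib mn. \<tau> e) has_sum F (z0 + u)) UNIV"
      by (rule has_sum_SigmaD) (auto intro: has_sum_finiteI finfib)
    moreover have "(\<Sum>e\<in>fib mn. \<tau> e) = (case mn of (m, n) \<Rightarrow> b m n * of_real x ^ m * of_real y ^ n)" for mn
    proof (cases mn)
      case (Pair m n)
      have "(\<Sum>e\<in>fib mn. \<tau> e) = (\<Sum>e\<in>fib (m, n). co e * of_real x ^ m * of_real y ^ n)"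
        unfolding Pair by (rule sum.cong) (auto simp: fib_def \<tau>_def)
      thus ?thesis by (simp add: Pair b_def sum_distrib_right)
    qed
    ultimately show "((\<lambda>(m, n). b m n * of_real x ^ m * of_real y ^ n) has_sum F (z0 + Complex x y)) UNIV"
      unfolding u_def by (simp only:)
  qed
qed

text \<open>Along the line \<open>t \<mapsto> z0 + t \<alpha>\<close> the double series is a power series in \<open>t\<close>, from which the
  first two derivatives at \<open>0\<close> can be read off.\<close>

lemma expansion_directional:
  fixes a :: "nat \<Rightarrow> nat \<Rightarrow> complex"
  assumes R: "R > 0" and a: "\<And>p q. norm (a p q) \<le> M / R ^ (p + q)"
    and F: "\<And>u. norm u < R \<Longrightarrow> ((\<lambda>(p, q). a p q * u ^ p * cnj u ^ q) has_sum F (z0 + u)) UNIV"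
    and \<alpha>: "norm \<alpha> = 1"
  defines "d \<equiv> \<lambda>z. vector_derivative (\<lambda>u::real. F (z + of_real u * \<alpha>)) (at 0)"
  shows "d z0 = a 1 0 * \<alpha> + a 0 1 * cnj \<alpha>"
    and "vector_derivative (\<lambda>u::real. d (z0 + of_real u * \<alpha>)) (at 0) =
      2 * (a 2 0 * \<alpha>^2 + a 1 1 * \<alpha> * cnj \<alpha> + a 0 2 * cnj \<alpha>^2)"
proof -
  \<comment> \<open>The homogeneous part of degree n of the double series evaluated at \<alpha>,
    that is, the coefficient of t^n along the line.\<close>
  define A where "A = (\<lambda>n. \<Sum>p\<le>n. a p (n - p) * \<alpha> ^ p * cnj \<alpha> ^ (n - p))"
  have sums: "(\<lambda>n. A n * of_real t ^ n) sums F (z0 + of_real t * \<alpha>)" if t: "\<bar>t\<bar> < R" for t :: real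
  proof -
    define u where "u = of_real t * \<alpha>"
    have u: "norm u < R" using t \<alpha> by (simp add: u_def norm_mult)
    have "((\<lambda>(n, p). a p (n - p) * u ^ p * cnj u ^ (n - p)) has_sum F (z0 + u)) (Sigma UNIV (\<lambda>n. {..n}))"
    proof (rule iffD2[OF has_sum_reindex_bij_witness])
      show "((\<lambda>(p, q). a p q * u ^ p * cnj u ^ q) has_sum F (z0 + u)) UNIV" by (rule F[OF u])
      show "(\<lambda>(n, p). (p, n - p)) x \<in> UNIV" for x :: "nat \<times> nat" by simp
      show "(\<lambda>(p, q). (p + q, p)) ((\<lambda>(n, p). (p, n - p)) x) = x"
        if "x \<in> Sigma UNIV (\<lambda>n. {..n})" for x :: "nat \<times> nat" using that by auto
    qed auto
    hence "((\<lambda>n. \<Sum>p\<le>n. a p (n - p) * u ^ p * cnj u ^ (n - p)) has_sum F (z0 + u)) UNIV"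
      by (rule has_sum_SigmaD) (auto intro: has_sum_finiteI)
    moreover have "(\<Sum>p\<le>n. a p (n - p) * u ^ p * cnj u ^ (n - p)) = A n * of_real t ^ n" for n
      unfolding A_def sum_distrib_right
    proof (rule sum.cong)
      fix p assume "p \<in> {..n}"
      hence "of_real t ^ n = of_real t ^ p * (of_real t ^ (n - p) :: complex)"
        by (simp flip: power_add)
      thus "a p (n - p) * u ^ p * cnj u ^ (n - p) = a p (n - p) * \<alpha> ^ p * cnj \<alpha> ^ (n - p) * of_real t ^ n"
        by (simp add: u_def power_mult_distrib)
    qed simp
    ultimately have "((\<lambda>n. A n * of_real t ^ n) has_sum F (z0 + u)) UNIV"
      by (simp only:)
    thus ?thesis unfolding u_def by (rule has_sum_imp_sums)
  qed
  have summ: "summable (\<lambda>n. A n * s ^ n)" if "norm s < R" for s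
  proof -
    have "\<exists>t. norm s < t \<and> t < R" using that by (intro dense)
    then obtain t where t: "norm s < t" "t < R" by blast
    have "summable (\<lambda>n. A n * of_real t ^ n)"
      using sums[of t] t norm_ge_zero[of s] by (auto simp: sums_iff)
    thus ?thesis by (rule powser_inside) (use t in auto)
  qed
  define G where "G = (\<lambda>s. \<Sum>n. A n * s ^ n)"
  define G1 where "G1 = (\<lambda>s. \<Sum>n. diffs A n * s ^ n)"
  define G2 where "G2 = (\<lambda>s. \<Sum>n. diffs (diffs A) n * s ^ n)"
  have G: "(G has_field_derivative G1 s) (at s)" if "norm s < R" for s
    unfolding G_def G1_def by (rule termdiffs_strong'[of R]) (use summ that in auto)
  have summ1: "summable (\<lambda>n. diffs A n * s ^ n)" if "norm s < R" for s
    by (rule termdiff_converges[of _ R]) (use summ that in auto)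
  have G1: "(G1 has_field_derivative G2 s) (at s)" if "norm s < R" for s
    unfolding G2_def G1_def by (rule termdiffs_strong'[of R]) (use summ1 that in auto)
  have FG: "F (z0 + of_real t * \<alpha>) = G (of_real t)" if "\<bar>t\<bar> < R" for t
    using sums[OF that] by (simp add: G_def sums_iff)
  have vd: "vector_derivative (\<lambda>u::real. K (of_real (t + u))) (at 0) = K'"
    if "(K has_field_derivative K') (at (of_real t))" for K :: "complex \<Rightarrow> complex" and K' t
  proof (rule vector_derivative_at)
    have "((\<lambda>u. complex_of_real (t + u)) has_vector_derivative of_real 1) (at 0)"
      by (intro derivative_eq_intros has_vector_derivative_of_real refl) auto
    hence "((\<lambda>u. complex_of_real (t + u)) has_vector_derivative 1) (at 0)" by simp
    from field_vector_diff_chain_at[OF this, of K K'] that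
    show "((\<lambda>u. K (of_real (t + u))) has_vector_derivative K') (at 0)"
      by (simp add: o_def)
  qed
  have vdcong: "vector_derivative f (at 0) = vector_derivative g (at (0::real))"
    if "\<And>u. \<bar>u\<bar> < e \<Longrightarrow> f u = g u" "e > 0" for f g :: "real \<Rightarrow> complex" and e
  proof (rule vector_derivative_cong_eq)
    have "eventually (\<lambda>u. u \<in> ball 0 e) (nhds (0::real))"
      by (rule eventually_nhds_in_open) (use that in auto)
    thus "eventually (\<lambda>u. u \<in> UNIV \<longrightarrow> f u = g u) (nhds 0)"
      by eventually_elim (use that in auto)
  qed auto
  have dG: "d (z0 + of_real t * \<alpha>) = G1 (of_real t)" if t: "\<bar>t\<bar> < R" for t
  proof -
    have "d (z0 + of_real t * \<alpha>) = vector_derivative (\<lambda>u::real. G (of_real (t + u))) (at 0)"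
      unfolding d_def
    proof (rule vdcong[of "R - \<bar>t\<bar>"])
      fix u :: real assume "\<bar>u\<bar> < R - \<bar>t\<bar>"
      hence "\<bar>t + u\<bar> < R" by linarith
      from FG[OF this] show "F (z0 + of_real t * \<alpha> + of_real u * \<alpha>) = G (of_real (t + u))"
        by (simp add: algebra_simps)
    qed (use t in auto)
    also have "\<dots> = G1 (of_real t)" by (rule vd) (use G t in auto)
    finally show ?thesis .
  qed
  have s0: "(\<Sum>n. f n * 0 ^ n) = f 0" for f :: "nat \<Rightarrow> complex"
    by (simp add: powser_zero)
  have "d z0 = G1 0" using dG[of 0] R by simp
  also have "\<dots> = A 1" by (simp add: G1_def s0 diffs_def)
  also have "\<dots> = a 1 0 * \<alpha> + a 0 1 * cnj \<alpha>"
    by (simp add: A_def)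
  finally show "d z0 = a 1 0 * \<alpha> + a 0 1 * cnj \<alpha>" .
  have "vector_derivative (\<lambda>u::real. d (z0 + of_real u * \<alpha>)) (at 0) =
      vector_derivative (\<lambda>u::real. G1 (of_real (0 + u))) (at 0)"
    by (rule vdcong[OF _ R]) (simp add: dG)
  also have "\<dots> = G2 (of_real 0)"
    by (rule vd) (use G1[of 0] R in simp)
  also have "\<dots> = 2 * A 2" by (simp add: G2_def s0 diffs_def numeral_2_eq_2)
  also have "A 2 = a 2 0 * \<alpha>^2 + a 1 1 * \<alpha> * cnj \<alpha> + a 0 2 * cnj \<alpha>^2"
    by (simp add: A_def numeral_2_eq_2)
  finally show "vector_derivative (\<lambda>u::real. d (z0 + of_real u * \<alpha>)) (at 0) =
      2 * (a 2 0 * \<alpha>^2 + a 1 1 * \<alpha> * cnj \<alpha> + a 0 2 * cnj \<alpha>^2)" .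
qed

text \<open>With \<open>\<zeta>\<close> in the role of \<open>cnj z\<close>, the Wirtinger derivatives of \<open>F\<close> are the partial
  derivatives of \<open>H\<close>.\<close>

lemma biholo_diagonal:
  assumes H: "biholo z0 (cnj z0) r H" and r: "r > 0"
    and F: "\<And>z. z \<in> ball z0 r \<Longrightarrow> F z = H z (cnj z)"
  shows "\<exists>r>0. \<exists>b :: nat \<Rightarrow> nat \<Rightarrow> complex. \<forall>x y :: real. \<bar>x\<bar> < r \<and> \<bar>y\<bar> < r \<longrightarrow>
     ((\<lambda>(m, n). b m n * of_real x ^ m * of_real y ^ n) has_sum F (z0 + Complex x y)) UNIV"
    and "wirtinger_bar F z0 = deriv (H z0) (cnj z0)"
    and "partial_x F z0 + \<i> * partial_y F z0 = 2 * deriv (H z0) (cnj z0)"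
    and "partial_x (partial_x F) z0 + partial_y (partial_y F) z0 =
      4 * deriv (\<lambda>\<zeta>. deriv (\<lambda>z. H z \<zeta>) z0) (cnj z0)"
proof -
  define a where "a = (\<lambda>p q. (deriv ^^ q) (\<lambda>\<zeta>. (deriv ^^ p) (\<lambda>z. H z \<zeta>) z0) (cnj z0) / (fact p * fact q))"
  obtain R M where R: "R > 0" "R < r" and ab: "\<And>p q. norm (a p q) \<le> M / R ^ (p + q)"
    and hs: "\<And>u v. norm u < R \<Longrightarrow> norm v < R \<Longrightarrow>
      ((\<lambda>(p, q). a p q * u ^ p * v ^ q) has_sum H (z0 + u) (cnj z0 + v)) UNIV"
  proof (unfold a_def, rule biholo_expansion[OF H r], goal_cases)
    case (1 R M)
    show ?case by (rule 1(1)[OF 1(2) 1(3) 1(4) 1(5)])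
  qed
  have Fs: "((\<lambda>(p, q). a p q * u ^ p * cnj u ^ q) has_sum F (z0 + u)) UNIV" if "norm u < R" for u
    using hs[of u "cnj u"] F[of "z0 + u"] that R by (simp add: dist_norm)
  show "\<exists>r>0. \<exists>b :: nat \<Rightarrow> nat \<Rightarrow> complex. \<forall>x y :: real. \<bar>x\<bar> < r \<and> \<bar>y\<bar> < r \<longrightarrow>
     ((\<lambda>(m, n). b m n * of_real x ^ m * of_real y ^ n) has_sum F (z0 + Complex x y)) UNIV"
    by (rule expansion_real_analytic[OF R(1) ab Fs])
  note dx = expansion_directional[OF R(1) ab Fs, of 1, simplified]
  note dy = expansion_directional[OF R(1) ab Fs, of \<i>, simplified]
  have px: "partial_x F = (\<lambda>z. vector_derivative (\<lambda>u::real. F (z + of_real u)) (at 0))"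
    by (simp add: partial_x_def fun_eq_iff)
  have py: "partial_y F = (\<lambda>z. vector_derivative (\<lambda>u::real. F (z + of_real u * \<i>)) (at 0))"
    by (simp add: partial_y_def fun_eq_iff mult.commute)
  have 1: "partial_x F z0 = a 1 0 + a 0 1" using dx(1) by (simp add: px)
  have 2: "partial_y F z0 = a 1 0 * \<i> - a 0 1 * \<i>" using dy(1) by (simp add: py)
  have a01: "a 0 1 = deriv (H z0) (cnj z0)" by (simp add: a_def)
  show s: "partial_x F z0 + \<i> * partial_y F z0 = 2 * deriv (H z0) (cnj z0)"
    unfolding 1 2 a01[symmetric] by (simp add: algebra_simps)
  thus "wirtinger_bar F z0 = deriv (H z0) (cnj z0)" by (simp add: wirtinger_bar_def)
  have 3: "partial_x (partial_x F) z0 = 2 * (a 2 0 + a 1 1 + a 0 2)"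
    using dx(2) by (simp add: px partial_x_def)
  have 4: "partial_y (partial_y F) z0 = 2 * (- a 2 0 + a 1 1 - a 0 2)"
    using dy(2) by (simp add: py partial_y_def mult.commute)
  have a11: "a 1 1 = deriv (\<lambda>\<zeta>. deriv (\<lambda>z. H z \<zeta>) z0) (cnj z0)" by (simp add: a_def)
  show "partial_x (partial_x F) z0 + partial_y (partial_y F) z0 =
      4 * deriv (\<lambda>\<zeta>. deriv (\<lambda>z. H z \<zeta>) z0) (cnj z0)"
    unfolding 3 4 a11[symmetric] by (simp add: algebra_simps)
qed

lemma power_series_deriv:
  fixes f :: "complex \<Rightarrow> complex"
  assumes R: "R > 0" and s: "\<And>v. norm v < R \<Longrightarrow> (\<lambda>n. c n * v ^ n) sums f (x0 + v)"
  shows "deriv f x0 = c 1"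
proof (rule DERIV_imp_deriv)
  define G where "G = (\<lambda>v. \<Sum>n. c n * v ^ n)"
  have "(G has_field_derivative (\<Sum>n. diffs c n * 0 ^ n)) (at 0)"
    unfolding G_def by (rule termdiffs_strong'[of R]) (use s R in \<open>auto simp: sums_iff\<close>)
  hence "(G has_field_derivative c 1) (at (x0 - x0))"
    by (simp add: powser_zero diffs_def)
  hence "((\<lambda>x. G (x - x0)) has_field_derivative c 1) (at x0)"
    using DERIV_shift[of G "c 1" x0 "- x0"] by simp
  thus "(f has_field_derivative c 1) (at x0)"
  proof (rule has_field_derivative_transform_within_open[of _ _ _ "ball x0 R"])
    fix x assume "x \<in> ball x0 R"
    hence "norm (x - x0) < R" by (simp add: dist_norm norm_minus_commute)
    from s[OF this] show "G (x - x0) = f x" by (simp add: G_def sums_iff)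
  qed (use R in auto)
qed

text \<open>Both mixed derivatives are the coefficient \<open>a 1 1\<close>, because absolute
  summability allows summing over p first or over q first. The exchange is wanted because only the
  \<zeta>-derivative of the lattice sum will have a closed form.\<close>

lemma biholo_mixed:
  assumes H: "biholo z0 \<zeta>0 r H" and r: "r > 0"
  shows "deriv (\<lambda>\<zeta>. deriv (\<lambda>z. H z \<zeta>) z0) \<zeta>0 = deriv (\<lambda>z. deriv (H z) \<zeta>0) z0"
proof -
  define a where "a = (\<lambda>p q. (deriv ^^ q) (\<lambda>\<zeta>. (deriv ^^ p) (\<lambda>z. H z \<zeta>) z0) \<zeta>0 / (fact p * fact q))"
  obtain R M where R: "R > 0" "R < r" and ab: "\<And>p q. norm (a p q) \<le> M / R ^ (p + q)"
    and hs: "\<And>u v. norm u < R \<Longrightarrow> norm v < R \<Longrightarrow>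
      ((\<lambda>(p, q). a p q * u ^ p * v ^ q) has_sum H (z0 + u) (\<zeta>0 + v)) UNIV"
  proof (unfold a_def, rule biholo_expansion[OF H r], goal_cases)
    case (1 R M)
    show ?case by (rule 1(1)[OF 1(2) 1(3) 1(4) 1(5)])
  qed
  define c where "c = (\<lambda>q u. \<Sum>\<^sub>\<infinity>p. a p q * u ^ p)"
  have swp: "((\<lambda>(q, p). a p q * u ^ p * v ^ q) has_sum H (z0 + u) (\<zeta>0 + v)) (UNIV \<times> UNIV)"
    if "norm u < R" "norm v < R" for u v
    using hs[OF that] has_sum_swap[of "\<lambda>(p, q). a p q * u ^ p * v ^ q" UNIV UNIV "H (z0 + u) (\<zeta>0 + v)"] by simp
  have c: "((\<lambda>p. a p q * u ^ p) has_sum c q u) UNIV" if u: "norm u < R" for u q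
  proof -
    \<comment> \<open>A fixed nonzero v in the disc: dividing the summable row at v by v^q gives the
      summability of the q-th row.\<close>
    define v where "v = complex_of_real (R / 2)"
    have v: "norm v < R" "v \<noteq> 0" using R by (auto simp: v_def)
    have "(\<lambda>p. a p q * u ^ p * v ^ q) summable_on UNIV"
      by (rule summable_on_SigmaD1[of "\<lambda>q p. a p q * u ^ p * v ^ q" UNIV "\<lambda>_. UNIV"])
        (use swp[OF u v(1)] in \<open>auto simp: summable_on_def\<close>)
    from summable_on_cmult_left[OF this, of "inverse (v ^ q)"]
    have "(\<lambda>p. a p q * u ^ p) summable_on UNIV" using v by (simp add: field_simps)
    thus ?thesis unfolding c_def by (rule has_sum_infsum)
  qed
  have d: "deriv (H (z0 + u)) \<zeta>0 = c 1 u" if u: "norm u < R" for u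
  proof (rule power_series_deriv[OF R(1)])
    fix v :: complex assume v: "norm v < R"
    have "((\<lambda>q. c q u * v ^ q) has_sum H (z0 + u) (\<zeta>0 + v)) UNIV"
    proof (rule has_sum_SigmaD[OF swp[OF u v]])
      fix q
      from has_sum_cmult_left[OF c[OF u, of q], of "v ^ q"]
      show "((\<lambda>p. case (q, p) of (q, p) \<Rightarrow> a p q * u ^ p * v ^ q) has_sum c q u * v ^ q) UNIV" by simp
    qed
    thus "(\<lambda>q. c q u * v ^ q) sums H (z0 + u) (\<zeta>0 + v)" by (rule has_sum_imp_sums)
  qed
  have "deriv (\<lambda>z. deriv (H z) \<zeta>0) z0 = a 1 1"
  proof (rule power_series_deriv[where c = "\<lambda>p. a p 1", OF R(1)])
    fix u :: complex assume u: "norm u < R"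
    show "(\<lambda>p. a p 1 * u ^ p) sums deriv (H (z0 + u)) \<zeta>0"
      unfolding d[OF u] by (rule has_sum_imp_sums[OF c[OF u]])
  qed
  thus ?thesis by (simp add: a_def)
qed

section \<open>Lattice sums with vanishing moments\<close>

definition lat :: "complex \<Rightarrow> int \<times> int \<Rightarrow> complex" where
  "lat z mn = of_int (fst mn) * z + of_int (snd mn)"

text \<open>For w' = cnj w this is w^(-a) (cnj w)^(-b) |w|^(-2u). The choice a = 1, b = k - 1, u = s
  - (k - 1) gives the summand of the Eisenstein series of weight 2 - k; the choice a = 0, b = k, u =
  0 gives the conjugate of the holomorphic summand of weight k.\<close>

definition fab :: "nat \<Rightarrow> nat \<Rightarrow> complex \<Rightarrow> complex \<Rightarrow> complex \<Rightarrow> complex" where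
  "fab a b u w w' = inverse w ^ a * inverse w' ^ b * exp (- u * Ln (w * w'))"

definition blk :: "nat \<Rightarrow> (int \<times> int) set \<Rightarrow> (int \<times> int \<Rightarrow> complex) \<Rightarrow>
    (int \<times> int \<Rightarrow> complex) \<Rightarrow> int \<times> int \<Rightarrow> complex" where
  "blk N B \<kappa> g Q = (\<Sum>b\<in>B. \<kappa> b * g (int N * fst Q + fst b, int N * snd Q + snd b))"

definition hgt :: "int \<times> int \<Rightarrow> real" where
  "hgt Q = 1 + \<bar>of_int (fst Q)\<bar> + \<bar>of_int (snd Q)\<bar>"

text \<open>C records all that the estimates use about the point: its size, its height above the
  real axis, and a lower bound for |mz + n| in terms of |m| + |n|. Bounds that depend on C alone are
  locally uniform in z, and their growth towards a cusp can be read off.\<close>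

definition good :: "real \<Rightarrow> complex \<Rightarrow> bool" where
  "good C z \<longleftrightarrow> C \<ge> 1 \<and> norm z \<le> C \<and> 1 \<le> C * Im z \<and>
     (\<forall>mn. \<bar>of_int (fst mn)\<bar> + \<bar>of_int (snd mn)\<bar> \<le> C * norm (lat z mn))"

lemma hgt_ge_1: "hgt Q \<ge> 1"
  by (simp add: hgt_def)

text \<open>The imaginary part of mz + n controls m, and then the real part controls n. The value of
  C is spelled out because \<open>Fz_growth\<close> uses that it grows only linearly with Im z on
  vertical strips.\<close>

lemma good_exists:
  assumes "Im z > 0"
  shows "good (1 + norm z + (1 + \<bar>Re z\<bar>) / Im z) z"
proof -
  define C where "C = 1 + norm z + (1 + \<bar>Re z\<bar>) / Im z"
  have C1: "C \<ge> 1" "norm z \<le> C" using assms by (auto simp: C_def)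
  have "C * Im z \<ge> (1 + \<bar>Re z\<bar>) / Im z * Im z"
    using assms by (intro mult_right_mono) (auto simp: C_def)
  hence C2: "1 \<le> C * Im z" using assms by simp
  have "\<bar>of_int (fst mn)\<bar> + \<bar>of_int (snd mn)\<bar> \<le> C * norm (lat z mn)" for mn
  proof -
    define m n :: real where "m = of_int (fst mn)" and "n = of_int (snd mn)"
    define W where "W = norm (lat z mn)"
    have "\<bar>Im (lat z mn)\<bar> \<le> W" "\<bar>Re (lat z mn)\<bar> \<le> W"
      unfolding W_def by (rule abs_Im_le_cmod, rule abs_Re_le_cmod)
    hence im: "\<bar>m\<bar> * Im z \<le> W" and re: "\<bar>m * Re z + n\<bar> \<le> W"
      using assms by (auto simp: lat_def m_def n_def abs_mult)
    have m: "\<bar>m\<bar> \<le> W / Im z" using im assms by (simp add: field_simps)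
    have "\<bar>n\<bar> \<le> \<bar>m * Re z + n\<bar> + \<bar>m * Re z\<bar>" by linarith
    also have "\<dots> \<le> W + W / Im z * \<bar>Re z\<bar>"
      unfolding abs_mult by (intro add_mono re mult_right_mono m) auto
    finally have "\<bar>m\<bar> + \<bar>n\<bar> \<le> W * (1 + (1 + \<bar>Re z\<bar>) / Im z)"
      using m by (simp add: distrib_left add_divide_distrib)
    also have "\<dots> \<le> W * C"
      by (intro mult_left_mono) (auto simp: C_def W_def)
    finally show ?thesis by (simp add: m_def n_def W_def mult.commute)
  qed
  with C1 C2 show ?thesis by (simp add: good_def C_def)
qed

lemma good_lat:
  assumes "good C z" "mn \<noteq> (0, 0)"
  shows "C * norm (lat z mn) \<ge> 1" "lat z mn \<noteq> 0"
proof -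
  have "\<bar>fst mn\<bar> + \<bar>snd mn\<bar> \<ge> 1" using assms(2) by (cases mn) auto
  hence "1 \<le> real_of_int (\<bar>fst mn\<bar> + \<bar>snd mn\<bar>)" by linarith
  also have "\<dots> \<le> C * norm (lat z mn)" using assms(1) unfolding good_def of_int_add of_int_abs by blast
  finally show "C * norm (lat z mn) \<ge> 1" .
  thus "lat z mn \<noteq> 0" by auto
qed

text \<open>As |m| is at most C |m z0 + n|, moving the point by 1/(16C) changes every mz + n by at
  most a sixteenth of its length, uniformly in (m, n). This fixes the size of the neighbourhoods in
  all later estimates.\<close>

lemma lat_diff_bound:
  assumes g: "good C z0" and d: "norm (z - z0) \<le> 1 / (16 * C)"
  shows "norm (lat z mn - lat z0 mn) \<le> norm (lat z0 mn) / 16"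
proof -
  have C: "C \<ge> 1" using g by (simp add: good_def)
  have "lat z mn - lat z0 mn = of_int (fst mn) * (z - z0)"
    by (simp add: lat_def algebra_simps)
  hence "norm (lat z mn - lat z0 mn) = \<bar>of_int (fst mn)\<bar> * norm (z - z0)"
    by (simp add: norm_mult)
  also have "\<dots> \<le> (C * norm (lat z0 mn)) * (1 / (16 * C))"
  proof (intro mult_mono d)
    have "\<bar>of_int (fst mn)\<bar> + \<bar>of_int (snd mn)\<bar> \<le> C * norm (lat z0 mn)"
      using g unfolding good_def by blast
    thus "\<bar>real_of_int (fst mn)\<bar> \<le> C * norm (lat z0 mn)" by linarith
  qed (use C in auto)
  also have "\<dots> = norm (lat z0 mn) / 16" using C by simp
  finally show ?thesis .
qed

lemma cnj_lat: "cnj (lat z mn) = lat (cnj z) mn"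
  by (simp add: lat_def)

lemma lat_add:
  "lat z (p + i, q + j) = lat z (p, q) + lat z (i, j)"
  by (simp add: lat_def algebra_simps)

text \<open>The product w w' differs from |v|^2 by at most (5/16 + 1/4) |v|^2, so it stays in the
  right half-plane, where the principal logarithm in \<open>fab\<close> is holomorphic.\<close>

lemma near_pair:
  assumes w: "norm (w - v) \<le> norm v / 4" and w': "norm (w' - cnj v) \<le> norm v / 4" and v: "v \<noteq> 0"
  shows "Re (w * w') > 0" "norm w \<ge> 3 / 4 * norm v" "norm w' \<ge> 3 / 4 * norm v"
    "norm (w * w') \<ge> 7 / 16 * norm v ^ 2" "norm (w * w') \<le> 25 / 16 * norm v ^ 2" "w \<noteq> 0" "w' \<noteq> 0"
proof -
  have vp: "norm v > 0" using v by simp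
  have nw: "norm w \<le> 5 / 4 * norm v" using norm_triangle_sub[of w v] w by simp
  have nw': "norm w' \<le> 5 / 4 * norm v" using norm_triangle_sub[of w' "cnj v"] w' by simp
  show n1: "norm w \<ge> 3 / 4 * norm v" using norm_triangle_sub[of v w] w by (simp add: norm_minus_commute)
  show n2: "norm w' \<ge> 3 / 4 * norm v"
    using norm_triangle_sub[of "cnj v" w'] w' by (simp add: norm_minus_commute)
  show "w \<noteq> 0" "w' \<noteq> 0" using n1 n2 vp by auto
  have "w * w' - v * cnj v = (w - v) * w' + v * (w' - cnj v)" by (simp add: algebra_simps)
  hence "norm (w * w' - v * cnj v) \<le> norm (w - v) * norm w' + norm v * norm (w' - cnj v)"
    by (metis norm_mult norm_triangle_ineq)
  also have "\<dots> \<le> (norm v / 4) * (5 / 4 * norm v) + norm v * (norm v / 4)"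
    by (intro add_mono mult_mono w nw' w') auto
  also have "\<dots> = 9 / 16 * norm v ^ 2" by (simp add: power2_eq_square)
  finally have d: "norm (w * w' - v * cnj v) \<le> 9 / 16 * norm v ^ 2" .
  have vv: "v * cnj v = of_real (norm v ^ 2)" by (rule complex_norm_square[symmetric])
  have "norm v ^ 2 - Re (w * w') \<le> norm (w * w' - v * cnj v)"
    using abs_Re_le_cmod[of "w * w' - v * cnj v"] unfolding vv by simp
  hence re: "Re (w * w') \<ge> 7 / 16 * norm v ^ 2" using d by simp
  have "7 / 16 * norm v ^ 2 > 0" using vp by simp
  with re show "Re (w * w') > 0" by linarith
  show "norm (w * w') \<ge> 7 / 16 * norm v ^ 2" using re complex_Re_le_cmod[of "w * w'"] by linarith
  have "norm (v * cnj v) = norm v ^ 2" by (simp add: norm_mult power2_eq_square)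
  thus "norm (w * w') \<le> 25 / 16 * norm v ^ 2"
    using norm_triangle_sub[of "w * w'" "v * cnj v"] d by simp
qed

text \<open>The factors come from exp (1/4) \<le> 2, from the reciprocals of |w| and |w'| (both at
  least 3/4 |v|), from the argument of w w', and from the lower bound 7/(16 C^2) of |w w'|.\<close>

definition fab_const :: "nat \<Rightarrow> real \<Rightarrow> real \<Rightarrow> real" where
  "fab_const k U C = 2 * (4 / 3) ^ k * exp (pi * U) * exp ((U + 1) * (2 + 2 * C))"

lemma fab_const_pos: "fab_const k U C > 0"
  by (simp add: fab_const_def)

text \<open>The summand 1/2 in the exponent is the price of admitting Re u down to -1/4, where |w
  w'|^(-Re u) is of order |v|^(1/2).\<close>

lemma fab_bound:
  assumes w: "norm (w - v) \<le> norm v / 4" and w': "norm (w' - cnj v) \<le> norm v / 4"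
    and C: "C \<ge> 1" "C * norm v \<ge> 1" and u: "Re u \<ge> - 1 / 4" "norm u \<le> U"
  shows "norm (fab a b u w w') \<le> fab_const (a + b) U C * norm v powr (1 / 2 - real (a + b))"
proof -
  have v: "v \<noteq> 0" using C by auto
  hence vp: "norm v > 0" by simp
  note np = near_pair[OF w w' v]
  define P where "P = norm (w * w')"
  have P: "P > 0" "P \<ge> 7 / 16 * norm v ^ 2" "P \<le> 25 / 16 * norm v ^ 2"
    using np unfolding P_def by (auto simp: norm_mult)
  have "- ln P = ln (1 / P)" using P by (simp add: ln_div)
  also have "1 / P \<le> 16 / 7 * C ^ 2"
  proof -
    have "1 \<le> (C * norm v) ^ 2" using C(2) by (rule one_le_power)
    also have "\<dots> = C ^ 2 * norm v ^ 2" by (rule power_mult_distrib)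
    also have "\<dots> \<le> C ^ 2 * (16 / 7 * P)"
      using P(2) by (intro mult_left_mono) auto
    finally have "1 \<le> C ^ 2 * (16 / 7 * P)" .
    thus ?thesis using P by (simp add: field_simps)
  qed
  hence "ln (1 / P) \<le> ln (16 / 7 * C ^ 2)"
    using P C by (subst ln_le_cancel_iff) auto
  also have "\<dots> = ln (16 / 7) + ln (C ^ 2)" using C by (intro ln_mult_pos) auto
  also have "\<dots> = ln (16 / 7) + 2 * ln C" using C by (simp add: ln_realpow)
  also have "\<dots> \<le> 2 + 2 * C"
    using ln_le_minus_one[of "16/7::real"] ln_le_minus_one[of C] C by simp
  finally have L1: "- ln P \<le> 2 + 2 * C" .
  have "ln P \<le> ln (25 / 16 * norm v ^ 2)" using P vp by (subst ln_le_cancel_iff) auto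
  also have "\<dots> = ln (25 / 16) + ln (norm v ^ 2)" using vp by (intro ln_mult_pos) auto
  also have "\<dots> = ln (25 / 16) + 2 * ln (norm v)" using vp by (simp add: ln_realpow)
  also have "ln (25 / 16 :: real) \<le> 1" using ln_le_minus_one[of "25/16::real"] by simp
  finally have L2: "ln P \<le> 1 + 2 * ln (norm v)" by simp
  have U: "\<bar>Re u\<bar> \<le> U" "\<bar>Im u\<bar> \<le> U" using abs_Re_le_cmod[of u] abs_Im_le_cmod[of u] u by linarith+
  have "Re (- u * Ln (w * w')) = - Re u * ln P + Im u * Im (Ln (w * w'))"
    using np by (simp add: P_def norm_mult)
  \<comment> \<open>After splitting off -1/4 the factor Re u + 1/4 is nonnegative, so
    \<open>L1\<close> bounds the first summand; the rest, ln P / 4, is bounded by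
    \<open>L2\<close>.\<close>
  also have "- Re u * ln P = (Re u + 1 / 4) * (- ln P) + ln P / 4" by (simp add: algebra_simps)
  also have "(Re u + 1 / 4) * (- ln P) \<le> (U + 1) * (2 + 2 * C)"
    using u U C by (intro mult_mono' order_trans[OF mult_left_mono[OF L1]] ) (auto intro!: mult_right_mono)
  also have "ln P / 4 \<le> 1 / 4 + ln (norm v) / 2" using L2 by simp
  also have "Im u * Im (Ln (w * w')) \<le> U * pi"
  proof -
    have "\<bar>Im (Ln (w * w'))\<bar> \<le> pi"
      using mpi_less_Im_Ln[of "w * w'"] Im_Ln_le_pi[of "w * w'"] np by auto
    hence "\<bar>Im u * Im (Ln (w * w'))\<bar> \<le> U * pi" unfolding abs_mult using U by (intro mult_mono) auto
    thus ?thesis by linarith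
  qed
  finally have re: "Re (- u * Ln (w * w')) \<le> (U + 1) * (2 + 2 * C) + (1 / 4 + ln (norm v) / 2) + U * pi"
    by simp
  have "norm (exp (- u * Ln (w * w'))) = exp (Re (- u * Ln (w * w')))" by (rule norm_exp_eq_Re)
  also have "\<dots> \<le> exp ((U + 1) * (2 + 2 * C) + (1 / 4 + ln (norm v) / 2) + U * pi)" using re by simp
  also have "\<dots> = exp ((U + 1) * (2 + 2 * C)) * (exp (1/4) * norm v powr (1 / 2)) * exp (pi * U)"
    using vp by (simp add: exp_add powr_def mult_ac)
  also have "\<dots> \<le> exp ((U + 1) * (2 + 2 * C)) * (2 * norm v powr (1 / 2)) * exp (pi * U)"
  proof -
    have "exp (1/4 :: real) \<le> 2" using exp_bound_half[of "1/4::real"] by simp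
    thus ?thesis by (intro mult_mono) auto
  qed
  finally have e: "norm (exp (- u * Ln (w * w'))) \<le> exp ((U + 1) * (2 + 2 * C)) * (2 * norm v powr (1 / 2)) * exp (pi * U)" .
  have i: "norm (inverse x) \<le> 4 / 3 / norm v" if "norm x \<ge> 3 / 4 * norm v" for x :: complex
  proof -
    have "inverse (norm x) \<le> inverse (3 / 4 * norm v)" using that vp by (intro le_imp_inverse_le) auto
    also have "\<dots> = 4 / 3 / norm v" using vp by (simp add: field_simps)
    finally show ?thesis unfolding norm_inverse .
  qed
  have "norm (fab a b u w w') \<le> (4 / 3 / norm v) ^ a * (4 / 3 / norm v) ^ b *
      (exp ((U + 1) * (2 + 2 * C)) * (2 * norm v powr (1 / 2)) * exp (pi * U))"
    unfolding fab_def norm_mult norm_power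
    by (intro mult_mono power_mono i np e) (auto intro!: mult_nonneg_nonneg)
  also have "\<dots> = fab_const (a + b) U C * (norm v powr (1 / 2) * (1 / norm v) ^ (a + b))"
    by (simp add: fab_const_def power_add power_divide mult_ac)
  also have "norm v powr (1 / 2) * (1 / norm v) ^ (a + b) = norm v powr (1 / 2 - real (a + b))"
  proof -
    have "norm v powr (1 / 2 - real (a + b)) = norm v powr (1 / 2) / norm v powr real (a + b)"
      by (rule powr_diff)
    also have "norm v powr real (a + b) = norm v ^ (a + b)" using vp by (rule powr_realpow)
    finally show ?thesis by (simp add: power_one_over)
  qed
  finally show ?thesis .
qed

lemma fab_lat_bound:
  assumes g: "good C z0" and z: "norm (z - z0) \<le> 1 / (16 * C)"
    and zeta: "norm (\<zeta> - cnj z0) \<le> 1 / (16 * C)"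
    and u: "Re u \<ge> - 1 / 4" "norm u \<le> U" and mn: "mn \<noteq> (0, 0)"
  shows "norm (fab a b u (lat z mn) (lat \<zeta> mn)) \<le>
    fab_const (a + b) U C * norm (lat z0 mn) powr (1 / 2 - real (a + b))"
proof (rule fab_bound)
  have "norm (cnj \<zeta> - z0) \<le> 1 / (16 * C)"
    using zeta by (metis complex_cnj_cnj complex_cnj_diff complex_mod_cnj)
  from lat_diff_bound[OF g this, of mn]
  have "norm (lat \<zeta> mn - cnj (lat z0 mn)) \<le> norm (lat z0 mn) / 16"
    by (metis cnj_lat complex_cnj_cnj complex_cnj_diff complex_mod_cnj)
  thus "norm (lat \<zeta> mn - cnj (lat z0 mn)) \<le> norm (lat z0 mn) / 4"
    using norm_ge_zero[of "lat z0 mn"] by linarith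
  show "norm (lat z mn - lat z0 mn) \<le> norm (lat z0 mn) / 4"
    using lat_diff_bound[OF g z, of mn] norm_ge_zero[of "lat z0 mn"] by linarith
  show "C \<ge> 1" using g by (simp add: good_def)
  show "C * norm (lat z0 mn) \<ge> 1" by (rule good_lat(1)[OF g mn])
qed (use u in auto)

lemma fab_zero: "a + b \<ge> 1 \<Longrightarrow> fab a b u 0 0 = 0"
  by (cases a) (auto simp: fab_def)

lemma lat_zero [simp]: "lat z (0, 0) = 0"
  by (simp add: lat_def)

lemma inverse_power_deriv:
  fixes w :: complex
  assumes "w \<noteq> 0"
  shows "((\<lambda>w. inverse w ^ a) has_field_derivative (- of_nat a * inverse w ^ a * inverse w)) (at w)"
proof (cases a)
  case (Suc n)
  have "((\<lambda>w. inverse w ^ Suc n) has_field_derivative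
      (1 + of_nat n) * (- (inverse w ^ Suc (Suc 0)) * inverse w ^ n)) (at w)"
    by (rule DERIV_power_Suc[OF DERIV_inverse[OF assms]])
  thus ?thesis by (simp add: Suc algebra_simps)
qed auto

text \<open>The derivative is displayed as a linear form in the velocities \<alpha> and \<beta>. At
  a common base point, the derivative of a weighted sum of such terms then depends on the weights
  only through their first moments.\<close>

lemma fab_deriv:
  assumes w: "(w has_field_derivative \<alpha>) (at t)" "(w' has_field_derivative \<beta>) (at t)"
    and nz: "w t \<noteq> 0" "w' t \<noteq> 0" "Re (w t * w' t) > 0"
  shows "((\<lambda>t. fab a b u (w t) (w' t)) has_field_derivative
     (\<alpha> * (fab a b u (w t) (w' t) * (- (of_nat a + u) / w t)) +
      \<beta> * (fab a b u (w t) (w' t) * (- (of_nat b + u) / w' t)))) (at t)"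
proof -
  have nr: "w t * w' t \<notin> \<real>\<^sub>\<le>\<^sub>0" using nz by (auto simp: complex_nonpos_Reals_iff)
  have 1: "((\<lambda>t. inverse (w t) ^ a) has_field_derivative
      (- of_nat a * inverse (w t) ^ a * inverse (w t)) * \<alpha>) (at t)"
    by (rule DERIV_chain2[OF inverse_power_deriv[OF nz(1)] w(1)])
  have 2: "((\<lambda>t. inverse (w' t) ^ b) has_field_derivative
      (- of_nat b * inverse (w' t) ^ b * inverse (w' t)) * \<beta>) (at t)"
    by (rule DERIV_chain2[OF inverse_power_deriv[OF nz(2)] w(2)])
  have 3: "((\<lambda>t. Ln (w t * w' t)) has_field_derivative
      (\<alpha> * w' t + \<beta> * w t) / (w t * w' t)) (at t)"
    using nr nz by (auto intro!: derivative_eq_intros w simp: field_simps)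
  have 4: "((\<lambda>t. exp (- u * Ln (w t * w' t))) has_field_derivative
      exp (- u * Ln (w t * w' t)) * (- u * ((\<alpha> * w' t + \<beta> * w t) / (w t * w' t)))) (at t)"
    by (rule DERIV_chain2[OF DERIV_exp DERIV_cmult[OF 3]])
  have "((\<lambda>t. inverse (w t) ^ a * inverse (w' t) ^ b * exp (- u * Ln (w t * w' t))) has_field_derivative
     ((- of_nat a * inverse (w t) ^ a * inverse (w t)) * \<alpha> * inverse (w' t) ^ b +
      (- of_nat b * inverse (w' t) ^ b * inverse (w' t)) * \<beta> * inverse (w t) ^ a) * exp (- u * Ln (w t * w' t)) +
      exp (- u * Ln (w t * w' t)) * (- u * ((\<alpha> * w' t + \<beta> * w t) / (w t * w' t))) * (inverse (w t) ^ a * inverse (w' t) ^ b)) (at t)"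
    by (intro DERIV_mult' DERIV_mult 1 2 4)
  thus ?thesis
    unfolding fab_def
  proof (rule DERIV_cong)
    have e: "(\<alpha> * w' t + \<beta> * w t) / (w t * w' t) = \<alpha> * inverse (w t) + \<beta> * inverse (w' t)"
      using nz by (simp add: field_simps)
    show "(- of_nat a * inverse (w t) ^ a * inverse (w t) * \<alpha> * inverse (w' t) ^ b +
        - of_nat b * inverse (w' t) ^ b * inverse (w' t) * \<beta> * inverse (w t) ^ a) * exp (- u * Ln (w t * w' t)) +
        exp (- u * Ln (w t * w' t)) * (- u * ((\<alpha> * w' t + \<beta> * w t) / (w t * w' t))) *
        (inverse (w t) ^ a * inverse (w' t) ^ b) =
      \<alpha> * (inverse (w t) ^ a * inverse (w' t) ^ b * exp (- u * Ln (w t * w' t)) * (- (of_nat a + u) / w t)) +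
      \<beta> * (inverse (w t) ^ a * inverse (w' t) ^ b * exp (- u * Ln (w t * w' t)) * (- (of_nat b + u) / w' t))"
      unfolding e unfolding divide_inverse by (simp add: algebra_simps)
  qed
qed

text \<open>The block is P(1), where P(t) is the sum of \<kappa>(b) times \<open>fab\<close> at W +
  t \<open>lat z b\<close> and W' + t \<open>lat \<zeta> b\<close>. P(0) is the zeroth moment times
  a constant and P'(0) is linear in the entries of b, so both vanish and
  \<open>power_series_second_order\<close> applies.\<close>

lemma blk_bound_far:
  fixes N :: nat
  assumes B: "finite B" "B \<subseteq> {0..int N} \<times> {0..int N}" "N \<ge> 1"
    and mom: "(\<Sum>b\<in>B. \<kappa> b) = 0" "(\<Sum>b\<in>B. \<kappa> b * of_int (fst b)) = 0" "(\<Sum>b\<in>B. \<kappa> b * of_int (snd b)) = 0"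
    and g: "good C z0" and z: "norm (z - z0) \<le> 1 / (16 * C)"
    and zeta: "norm (\<zeta> - cnj z0) \<le> 1 / (16 * C)"
    and u: "Re u \<ge> - 1 / 4" "norm u \<le> U"
    and far: "16 * real N * (C + 2) \<le> norm (lat z0 (int N * p, int N * q))"
  shows "norm (blk N B \<kappa> (\<lambda>mn. fab a b u (lat z mn) (lat \<zeta> mn)) (p, q)) \<le>
    (\<Sum>b\<in>B. norm (\<kappa> b)) * fab_const (a + b) U C * (512 * real N ^ 2 * (C + 2) ^ 2) *
      norm (lat z0 (int N * p, int N * q)) powr (- 3 / 2 - real (a + b))"
proof -
  define v where "v = lat z0 (int N * p, int N * q)"
  define W W' where "W = lat z (int N * p, int N * q)" and "W' = lat \<zeta> (int N * p, int N * q)"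
  have C: "C \<ge> 1" "norm z0 \<le> C" using g by (auto simp: good_def)
  \<comment> \<open>\<open>A\<close> bounds |lat z b| over the box. With \<rho> = |v|/(8A), the
    displacement by t costs at most |v|/8 and the change of z at most |v|/16, together within the
    |v|/4 of \<open>near_pair\<close>. The assumption \<open>far\<close> says |v| \<ge> 16A, that
    is, \<rho> \<ge> 2.\<close>
  define A where "A = real N * (C + 2)"
  have A: "A \<ge> 1" using B C by (auto simp: A_def intro!: mult_ge1_I)
  define \<rho> where "\<rho> = norm v / (8 * A)"
  have vA: "norm v \<ge> 16 * A" using far by (simp add: v_def A_def mult.assoc)
  have rho: "\<rho> \<ge> 2" using vA A by (simp add: \<rho>_def field_simps)
  have vp: "norm v > 0" using vA A by linarith
  have "C * norm v \<ge> 1 * 1" using C vA A by (intro mult_mono) linarith+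
  hence Cv: "C * norm v \<ge> 1" by simp
  have zc: "norm (cnj \<zeta> - z0) \<le> 1 / (16 * C)"
    using zeta by (metis complex_cnj_cnj complex_cnj_diff complex_mod_cnj)
  have small: "norm (lat x b) \<le> A" if b: "b \<in> B" and x: "norm (x - z0) \<le> 1 / (16 * C)" for x b
  proof -
    have bb: "\<bar>real_of_int (fst b)\<bar> \<le> real N" "\<bar>real_of_int (snd b)\<bar> \<le> real N"
      using B(2) b by (cases b; auto)+
    have "1 / (16 * C) \<le> 1" using C by (simp add: field_simps)
    hence nx: "norm x \<le> C + 1" using norm_triangle_sub[of x z0] x C by linarith
    have "norm (lat x b) \<le> \<bar>real_of_int (fst b)\<bar> * norm x + \<bar>real_of_int (snd b)\<bar>"
      unfolding lat_def by (rule order_trans[OF norm_triangle_ineq]) (simp add: norm_mult)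
    also have "\<dots> \<le> real N * (C + 1) + real N"
      by (intro add_mono mult_mono bb nx) auto
    also have "\<dots> = A" by (simp add: A_def algebra_simps)
    finally show ?thesis .
  qed
  have small': "norm (lat \<zeta> b) \<le> A" if "b \<in> B" for b
    using small[OF that zc] by (metis cnj_lat complex_mod_cnj)
  have Wv: "norm (W - v) \<le> norm v / 16" unfolding W_def v_def by (rule lat_diff_bound[OF g z])
  have "norm (cnj W' - v) \<le> norm v / 16"
    unfolding W'_def v_def cnj_lat by (rule lat_diff_bound[OF g zc])
  hence Wv': "norm (W' - cnj v) \<le> norm v / 16"
    by (metis complex_cnj_cnj complex_cnj_diff complex_mod_cnj)
  have near: "norm (W + t * lat z b - v) \<le> norm v / 4" "norm (W' + t * lat \<zeta> b - cnj v) \<le> norm v / 4"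
    if t: "norm t \<le> \<rho>" and b: "b \<in> B" for t b
  proof -
    have "norm t * A \<le> \<rho> * A" using t A by (intro mult_right_mono) auto
    also have "\<dots> = norm v / 8" using A by (simp add: \<rho>_def)
    finally have tA: "norm t * A \<le> norm v / 8" .
    have "norm (t * lat z b) \<le> norm t * A" unfolding norm_mult by (intro mult_left_mono small b z) auto
    moreover have "norm (W + t * lat z b - v) \<le> norm (W - v) + norm (t * lat z b)"
      using norm_triangle_ineq[of "W - v" "t * lat z b"] by (simp add: algebra_simps)
    ultimately show "norm (W + t * lat z b - v) \<le> norm v / 4" using Wv tA vp by linarith
    have "norm (t * lat \<zeta> b) \<le> norm t * A" unfolding norm_mult by (intro mult_left_mono small' b) auto
    moreover have "norm (W' + t * lat \<zeta> b - cnj v) \<le> norm (W' - cnj v) + norm (t * lat \<zeta> b)"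
      using norm_triangle_ineq[of "W' - cnj v" "t * lat \<zeta> b"] by (simp add: algebra_simps)
    ultimately show "norm (W' + t * lat \<zeta> b - cnj v) \<le> norm v / 4" using Wv' tA vp by linarith
  qed
  define P where "P = (\<lambda>t. \<Sum>c\<in>B. \<kappa> c * fab a b u (W + t * lat z c) (W' + t * lat \<zeta> c))"
  define X Y where "X = (\<lambda>t c. fab a b u (W + t * lat z c) (W' + t * lat \<zeta> c) * (- (of_nat a + u) / (W + t * lat z c)))"
    and "Y = (\<lambda>t c. fab a b u (W + t * lat z c) (W' + t * lat \<zeta> c) * (- (of_nat b + u) / (W' + t * lat \<zeta> c)))"
  have v0: "v \<noteq> 0" using vp by auto
  have dP: "(P has_field_derivative (\<Sum>c\<in>B. \<kappa> c * (lat z c * X t c + lat \<zeta> c * Y t c))) (at t)"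
    if t: "norm t \<le> \<rho>" for t
    unfolding P_def
  proof (intro DERIV_sum DERIV_cmult)
    fix c assume c: "c \<in> B"
    note np = near_pair[OF near[OF t c] v0]
    show "((\<lambda>t. fab a b u (W + t * lat z c) (W' + t * lat \<zeta> c)) has_field_derivative
        (lat z c * X t c + lat \<zeta> c * Y t c)) (at t)"
      unfolding X_def Y_def
      by (rule fab_deriv) (use np in \<open>auto intro!: derivative_eq_intros\<close>)
  qed
  have "norm (P 1) \<le> 2 * ((\<Sum>c\<in>B. norm (\<kappa> c)) * (fab_const (a + b) U C * norm v powr (1 / 2 - real (a + b)))) / \<rho> ^ 2"
  proof (rule power_series_second_order[OF _ rho])
    show "P holomorphic_on cball 0 \<rho>"
      unfolding holomorphic_on_def field_differentiable_def
    proof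
      fix x :: complex assume "x \<in> cball 0 \<rho>"
      hence "norm x \<le> \<rho>" by simp
      from has_field_derivative_at_within[OF dP[OF this]]
      show "\<exists>f'. (P has_field_derivative f') (at x within cball 0 \<rho>)" by blast
    qed
    show "norm (P t) \<le> (\<Sum>c\<in>B. norm (\<kappa> c)) * (fab_const (a + b) U C * norm v powr (1 / 2 - real (a + b)))"
      if t: "norm t \<le> \<rho>" for t
      unfolding P_def sum_distrib_right
    proof (rule sum_norm_le)
      fix c assume c: "c \<in> B"
      show "norm (\<kappa> c * fab a b u (W + t * lat z c) (W' + t * lat \<zeta> c)) \<le>
        norm (\<kappa> c) * (fab_const (a + b) U C * norm v powr (1 / 2 - real (a + b)))"
        unfolding norm_mult
        by (intro mult_left_mono fab_bound near t c C Cv u) auto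
    qed
    show "P 0 = 0" using mom(1) by (simp add: P_def flip: sum_distrib_right)
    have "deriv P 0 = (\<Sum>c\<in>B. \<kappa> c * (lat z c * X 0 c + lat \<zeta> c * Y 0 c))"
      by (rule DERIV_imp_deriv[OF dP]) (use rho in auto)
    also have "\<dots> = (\<Sum>c\<in>B. (\<kappa> c * of_int (fst c)) * (z * X 0 (0, 0) + \<zeta> * Y 0 (0, 0)) +
        (\<kappa> c * of_int (snd c)) * (X 0 (0, 0) + Y 0 (0, 0)))"
    proof (intro sum.cong refl)
      fix c
      have "X 0 c = X 0 (0, 0)" "Y 0 c = Y 0 (0, 0)" by (simp_all add: X_def Y_def)
      moreover have "\<kappa> c * (lat z c * x + lat \<zeta> c * y) = \<kappa> c * of_int (fst c) * (z * x + \<zeta> * y) +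
          \<kappa> c * of_int (snd c) * (x + y)" for x y
        by (simp add: lat_def algebra_simps)
      ultimately show "\<kappa> c * (lat z c * X 0 c + lat \<zeta> c * Y 0 c) =
          \<kappa> c * of_int (fst c) * (z * X 0 (0, 0) + \<zeta> * Y 0 (0, 0)) +
          \<kappa> c * of_int (snd c) * (X 0 (0, 0) + Y 0 (0, 0))" by simp
    qed
    also have "\<dots> = 0"
      unfolding sum.distrib by (simp only: sum_distrib_right[symmetric] mom mult_zero_left add_0)
    finally show "deriv P 0 = 0" .
  qed
  also have "2 * ((\<Sum>c\<in>B. norm (\<kappa> c)) * (fab_const (a + b) U C * norm v powr (1 / 2 - real (a + b)))) / \<rho> ^ 2 =
      (\<Sum>c\<in>B. norm (\<kappa> c)) * fab_const (a + b) U C * (128 * A ^ 2) * (norm v powr (1 / 2 - real (a + b)) / norm v ^ 2)"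
    using A vp by (simp add: \<rho>_def field_simps power2_eq_square)
  also have "norm v powr (1 / 2 - real (a + b)) / norm v ^ 2 = norm v powr (- 3 / 2 - real (a + b))"
  proof -
    have "norm v ^ 2 = norm v powr 2" using vp by simp
    hence "norm v powr (1 / 2 - real (a + b)) / norm v ^ 2 = norm v powr (1 / 2 - real (a + b) - 2)"
      by (simp only: powr_diff[symmetric])
    also have "1 / 2 - real (a + b) - 2 = - 3 / 2 - real (a + b)" by simp
    finally show ?thesis .
  qed
  also have "(\<Sum>c\<in>B. norm (\<kappa> c)) * fab_const (a + b) U C * (128 * A ^ 2) * norm v powr (- 3 / 2 - real (a + b)) \<le>
      (\<Sum>c\<in>B. norm (\<kappa> c)) * fab_const (a + b) U C * (512 * real N ^ 2 * (C + 2) ^ 2) * norm v powr (- 3 / 2 - real (a + b))"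
    by (intro mult_right_mono mult_left_mono)
       (auto simp: A_def power_mult_distrib intro!: sum_nonneg mult_nonneg_nonneg less_imp_le[OF fab_const_pos])
  finally have main: "norm (P 1) \<le> (\<Sum>c\<in>B. norm (\<kappa> c)) * fab_const (a + b) U C * (512 * real N ^ 2 * (C + 2) ^ 2) * norm v powr (- 3 / 2 - real (a + b))" .
  have "P 1 = blk N B \<kappa> (\<lambda>mn. fab a b u (lat z mn) (lat \<zeta> mn)) (p, q)"
    unfolding P_def blk_def by (intro sum.cong refl) (simp add: W_def W'_def lat_add)
  with main show ?thesis unfolding v_def by (simp only:)
qed

lemma power_le_exp:
  fixes x :: real
  assumes "x \<ge> 0"
  shows "x ^ n \<le> exp (real n * x)"
proof -
  have "x \<le> exp x" using exp_ge_add_one_self[of x] by linarith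
  hence "x ^ n \<le> exp x ^ n" by (intro power_mono assms)
  thus ?thesis by (simp add: exp_of_nat_mult)
qed

text \<open>Rounding s^(5/2) up to s^3 keeps the constants polynomial in C, ready to be absorbed
  into an exponential.\<close>

lemma powr_neg_scale:
  fixes x y s :: real
  assumes "0 < x" "1 \<le> s" "x \<le> s * y"
  shows "y powr (- 5 / 2) \<le> s ^ 3 * x powr (- 5 / 2)"
proof -
  have y: "x / s \<le> y" "0 < x / s" using assms by (auto simp: field_simps)
  have "y powr (- 5 / 2) \<le> (x / s) powr (- 5 / 2)" using y by (intro powr_mono2') auto
  also have "\<dots> = s powr (5 / 2) * x powr (- 5 / 2)"
    using assms by (simp add: powr_divide powr_minus_divide)
  also have "s powr (5 / 2) \<le> s powr 3" using assms by (intro powr_mono) auto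
  also have "s powr 3 = s ^ 3" using assms powr_realpow[of s 3] by simp
  finally show ?thesis using assms by (simp add: mult_right_mono)
qed

lemma powr_lower_bound:
  fixes x C :: real
  assumes "C \<ge> 1" "C * x \<ge> 1" "e \<le> real k" "e \<ge> 0"
  shows "x powr (- e) \<le> C ^ k"
proof -
  have x: "1 / C \<le> x" "0 < 1 / C" using assms by (auto simp: field_simps)
  have "x powr (- e) \<le> (1 / C) powr (- e)" using x assms by (intro powr_mono2') auto
  also have "\<dots> = C powr e" using assms by (simp add: powr_divide powr_minus_divide)
  also have "\<dots> \<le> C powr real k" using assms by (intro powr_mono) auto
  also have "\<dots> = C ^ k" using assms by (simp add: powr_realpow)
  finally show ?thesis .
qed

text \<open>The box is closed because the corrected weights also sit at (N, 0) and (0, N). For k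
  \<ge> 3 no moment condition is imposed: single terms already decay with exponent k - 1/2 \<ge>
  5/2.\<close>

locale latsum =
  fixes N :: nat and B :: "(int \<times> int) set" and \<kappa> :: "int \<times> int \<Rightarrow> complex" and k :: nat
  assumes finB: "finite B" and B: "B \<subseteq> {0..int N} \<times> {0..int N}" and N: "N \<ge> 1" and k: "k \<ge> 1"
    and mom: "k \<ge> 3 \<or> (\<Sum>b\<in>B. \<kappa> b) = 0 \<and> (\<Sum>b\<in>B. \<kappa> b * of_int (fst b)) = 0 \<and> (\<Sum>b\<in>B. \<kappa> b * of_int (snd b)) = 0"
begin

definition "Sk = (\<Sum>b\<in>B. norm (\<kappa> b))"

lemma Sk_nonneg: "Sk \<ge> 0"
  by (simp add: Sk_def sum_nonneg)

lemma blk_termwise: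
  assumes "\<And>b. b \<in> B \<Longrightarrow> norm (g (int N * p + fst b, int N * q + snd b)) \<le> c"
  shows "norm (blk N B \<kappa> g (p, q)) \<le> Sk * c"
  unfolding blk_def Sk_def sum_distrib_right
  by (rule sum_norm_le) (auto simp: norm_mult intro!: mult_left_mono assms)

text \<open>The last exponential absorbs C^k (C + 2)^6, the highest power of C met in the three
  cases of \<open>blk_bound\<close>; the numerical factor is a generous common one.\<close>

definition Kb :: "real \<Rightarrow> real \<Rightarrow> real" where
  "Kb U C = Sk * fab_const k U C * (4096 * 4096 * real N ^ 2 * exp ((real k + 6) * (C + 2)))"

lemma Kb_nonneg: "Kb U C \<ge> 0"
  unfolding Kb_def using Sk_nonneg less_imp_le[OF fab_const_pos[of k U C]]
  by (intro mult_nonneg_nonneg) auto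

text \<open>The exponent 5/2 exceeds 2, so the blocks are summable over all Q, uniformly near
  \<open>z0\<close>. For k \<ge> 3 the terms are bounded one by one; for k \<le> 2 the far blocks
  gain two powers from the moments, while the near blocks are finitely many for given C and need
  only a constant bound.\<close>

lemma blk_bound:
  assumes g: "good C z0" and z: "norm (z - z0) \<le> 1 / (16 * C)"
    and zeta: "norm (\<zeta> - cnj z0) \<le> 1 / (16 * C)"
    and u: "Re u \<ge> - 1 / 4" "norm u \<le> U" and ab: "a + b = k"
  shows "norm (blk N B \<kappa> (\<lambda>mn. fab a b u (lat z mn) (lat \<zeta> mn)) Q) \<le> Kb U C * hgt Q powr (- 5 / 2)"
proof -
  obtain p q where Q: "Q = (p, q)" by force
  have C: "C \<ge> 1" using g by (simp add: good_def)
  define h where "h = hgt Q"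
  have h: "h \<ge> 1" by (simp add: h_def hgt_ge_1)
  define v where "v = lat z0 (int N * p, int N * q)"
  define A where "A = fab_const k U C"
  have A: "A > 0" by (simp add: A_def fab_const_pos)
  have N1: "1 \<le> real N" "1 \<le> real N ^ 2" using N by auto
  hence N64: "64 \<le> 4096 * 4096 * real N ^ 2" "4913 \<le> 4096 * 4096 * real N ^ 2" by linarith+
  define E where "E = exp ((real k + 6) * (C + 2))"
  have E1: "C ^ k * (C + 2) ^ 6 \<le> E"
  proof -
    have "C ^ k \<le> exp (real k * (C + 2))"
      by (rule order_trans[OF power_le_exp]) (use C in \<open>auto intro!: mult_left_mono\<close>)
    moreover have "(C + 2) ^ 6 \<le> exp (6 * (C + 2))" using power_le_exp[of "C + 2" 6] C by simp
    ultimately have "C ^ k * (C + 2) ^ 6 \<le> exp (real k * (C + 2)) * exp (6 * (C + 2))"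
      using C by (intro mult_mono) auto
    thus ?thesis by (simp add: E_def exp_add[symmetric] algebra_simps)
  qed
  have Ck: "1 \<le> C ^ k" using C by (rule one_le_power)
  have C2: "(C + 2) ^ i \<le> (C + 2) ^ 6" if "i \<le> 6" for i
    using that C by (intro power_increasing) auto
  have E0: "0 < E" by (simp add: E_def)
  \<comment> \<open>Each case ends with a constant c that is polynomial in C; here all of them are
    absorbed into the single constant \<open>Kb\<close>.\<close>
  have reduce: "norm (blk N B \<kappa> (\<lambda>mn. fab a b u (lat z mn) (lat \<zeta> mn)) Q) \<le> Kb U C * h powr (- 5 / 2)"
    if "norm (blk N B \<kappa> (\<lambda>mn. fab a b u (lat z mn) (lat \<zeta> mn)) Q) \<le> Sk * A * (c * h powr (- 5 / 2))"
      "c \<le> 4096 * 4096 * real N ^ 2 * (C ^ k * (C + 2) ^ 6)" for c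
  proof -
    have "4096 * 4096 * real N ^ 2 * (C ^ k * (C + 2) ^ 6) \<le> 4096 * 4096 * real N ^ 2 * E"
      by (intro mult_left_mono E1) auto
    with that(2) have "c \<le> 4096 * 4096 * real N ^ 2 * E" by (rule order_trans)
    hence "Sk * A * (c * h powr (- 5 / 2)) \<le> Sk * A * ((4096 * 4096 * real N ^ 2 * E) * h powr (- 5 / 2))"
      using Sk_nonneg A by (intro mult_left_mono mult_right_mono mult_nonneg_nonneg) auto
    with that(1) show ?thesis by (simp add: Kb_def A_def E_def mult.assoc)
  qed
  have tbound: "norm (fab a b u (lat z mn) (lat \<zeta> mn)) \<le> A * norm (lat z0 mn) powr (- (real k - 1 / 2))"
    if "mn \<noteq> (0, 0)" for mn
    using fab_lat_bound[OF g z zeta u that, of a b] ab by (simp add: A_def)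
  have hv: "real N * (\<bar>real_of_int p\<bar> + \<bar>real_of_int q\<bar>) \<le> C * norm v"
  proof -
    have "\<bar>real_of_int (int N * p)\<bar> + \<bar>real_of_int (int N * q)\<bar> \<le> C * norm v"
    proof -
      have "\<forall>mn. \<bar>of_int (fst mn)\<bar> + \<bar>of_int (snd mn)\<bar> \<le> C * norm (lat z0 mn)"
        using g by (auto simp: good_def)
      from spec[OF this, of "(int N * p, int N * q)"] show ?thesis by (simp add: v_def)
    qed
    thus ?thesis by (simp add: abs_mult algebra_simps)
  qed
  consider (big) "k \<ge> 3" | (far) "k < 3" "16 * real N * (C + 2) \<le> norm v"
    | (near) "k < 3" "16 * real N * (C + 2) > norm v" by linarith
  thus ?thesis
  proof cases
    case big
    have "norm (blk N B \<kappa> (\<lambda>mn. fab a b u (lat z mn) (lat \<zeta> mn)) (p, q)) \<le>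
        Sk * (A * (((4 * C) ^ 3 * h powr (- 5 / 2)) * C ^ k))"
    proof (rule blk_termwise)
      fix c assume c: "c \<in> B"
      define mn where "mn = (int N * p + fst c, int N * q + snd c)"
      show "norm (fab a b u (lat z (int N * p + fst c, int N * q + snd c))
          (lat \<zeta> (int N * p + fst c, int N * q + snd c))) \<le> A * (((4 * C) ^ 3 * h powr (- 5 / 2)) * C ^ k)"
      proof (cases "mn = (0, 0)")
        case True
        thus ?thesis unfolding mn_def[symmetric] using A C ab k by (simp add: fab_zero)
      next
        case False
        define x where "x = norm (lat z0 mn)"
        have Cx: "C * x \<ge> 1" "lat z0 mn \<noteq> 0" using good_lat[OF g False] by (auto simp: x_def)
        have xp: "x > 0" using Cx(2) by (simp add: x_def)
        have mnx: "\<bar>real_of_int (fst mn)\<bar> + \<bar>real_of_int (snd mn)\<bar> \<le> C * x"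
          using g unfolding good_def x_def by blast
        have cc: "0 \<le> fst c" "fst c \<le> int N" "0 \<le> snd c" "snd c \<le> int N"
          using B c by (cases c; auto)+
        \<comment> \<open>Compares the index of a block with the lattice vectors in it: passing from
          N P + i back to P loses at most 1.\<close>
        have l: "\<bar>P\<bar> \<le> \<bar>int N * P + i\<bar> + 1" if "0 \<le> i" "i \<le> int N" for P i
        proof -
          have "int N * \<bar>P\<bar> = \<bar>int N * P\<bar>" by (simp add: abs_mult)
          also have "\<dots> \<le> \<bar>int N * P + i\<bar> + int N" using that by linarith
          also have "\<dots> \<le> int N * \<bar>int N * P + i\<bar> + int N * 1"
            using N by (simp add: mult_le_cancel_right1)
          finally have "int N * \<bar>P\<bar> \<le> int N * (\<bar>int N * P + i\<bar> + 1)" by (simp add: algebra_simps)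
          thus ?thesis using N by simp
        qed
        have "\<bar>p\<bar> + \<bar>q\<bar> \<le> 2 + \<bar>fst mn\<bar> + \<bar>snd mn\<bar>"
          using l[OF cc(1,2), of p] l[OF cc(3,4), of q] by (simp add: mn_def)
        hence "real_of_int (\<bar>p\<bar> + \<bar>q\<bar>) \<le> real_of_int (2 + \<bar>fst mn\<bar> + \<bar>snd mn\<bar>)"
          by (simp only: of_int_le_iff)
        hence "h \<le> 3 + (\<bar>real_of_int (fst mn)\<bar> + \<bar>real_of_int (snd mn)\<bar>)"
          by (simp add: h_def hgt_def Q)
        also have "\<dots> \<le> 4 * C * x" using mnx Cx(1) by linarith
        finally have hx: "h \<le> (4 * C) * x" .
        have "norm (fab a b u (lat z mn) (lat \<zeta> mn)) \<le> A * x powr (- (real k - 1 / 2))"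
          unfolding x_def by (rule tbound[OF False])
        also have "x powr (- (real k - 1 / 2)) = x powr (- 5 / 2) * x powr (- (real k - 3))"
          by (simp flip: powr_add)
        also have "\<dots> \<le> ((4 * C) ^ 3 * h powr (- 5 / 2)) * C ^ k"
        proof (intro mult_mono)
          show "x powr (- 5 / 2) \<le> (4 * C) ^ 3 * h powr (- 5 / 2)"
            by (rule powr_neg_scale) (use h C hx in auto)
          show "x powr (- (real k - 3)) \<le> C ^ k"
            by (rule powr_lower_bound) (use big C Cx in auto)
        qed (use C in auto)
        finally show ?thesis using A by (simp add: mn_def mult_left_mono)
      qed
    qed
    hence "norm (blk N B \<kappa> (\<lambda>mn. fab a b u (lat z mn) (lat \<zeta> mn)) Q) \<le>
        Sk * A * ((64 * C ^ 3 * C ^ k) * h powr (- 5 / 2))"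
      by (simp add: Q power_mult_distrib mult_ac)
    moreover have "64 * C ^ 3 * C ^ k \<le> 4096 * 4096 * real N ^ 2 * (C ^ k * (C + 2) ^ 6)"
    proof -
      have "C ^ 3 \<le> (C + 2) ^ 3" using C by (intro power_mono) auto
      also have "\<dots> \<le> (C + 2) ^ 6" by (rule C2) simp
      finally have "C ^ 3 * C ^ k \<le> (C + 2) ^ 6 * C ^ k" using Ck by (intro mult_right_mono) auto
      note le = this
      have "64 * (C ^ 3 * C ^ k) \<le> (4096 * 4096 * real N ^ 2) * ((C + 2) ^ 6 * C ^ k)"
        by (rule mult_mono[OF N64(1) le]) (use C in auto)
      thus ?thesis by (simp add: mult_ac)
    qed
    ultimately show ?thesis using reduce unfolding h_def by blast
  next
    case far
    hence m: "(\<Sum>b\<in>B. \<kappa> b) = 0" "(\<Sum>b\<in>B. \<kappa> b * of_int (fst b)) = 0" "(\<Sum>b\<in>B. \<kappa> b * of_int (snd b)) = 0"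
      using mom by auto
    have v1: "norm v \<ge> 1" 
    proof -
      have "1 * 1 \<le> real N * (C + 2)" using N1 C by (intro mult_mono) auto
      thus ?thesis using far(2) by linarith
    qed
    have hx: "h \<le> (2 * C) * norm v"
    proof -
      have "1 * (\<bar>real_of_int p\<bar> + \<bar>real_of_int q\<bar>) \<le> real N * (\<bar>real_of_int p\<bar> + \<bar>real_of_int q\<bar>)"
        using N1 by (intro mult_right_mono) auto
      hence "h \<le> 1 + C * norm v" using hv by (simp add: h_def hgt_def Q)
      also have "1 \<le> C * norm v" using C v1 mult_mono[of 1 C 1 "norm v"] by simp
      finally show ?thesis by simp
    qed
    have "norm (blk N B \<kappa> (\<lambda>mn. fab a b u (lat z mn) (lat \<zeta> mn)) (p, q)) \<le>
      (\<Sum>b\<in>B. norm (\<kappa> b)) * fab_const (a + b) U C * (512 * real N ^ 2 * (C + 2) ^ 2) *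
      norm (lat z0 (int N * p, int N * q)) powr (- 3 / 2 - real (a + b))"
      by (rule blk_bound_far[OF finB B N m g z zeta u]) (use far in \<open>simp add: v_def\<close>)
    also have "\<dots> = Sk * A * (512 * real N ^ 2 * (C + 2) ^ 2) * norm v powr (- 3 / 2 - real k)"
      by (simp only: Sk_def A_def ab v_def)
    also have "\<dots> \<le> Sk * A * (512 * real N ^ 2 * (C + 2) ^ 2) * ((2 * C) ^ 3 * h powr (- 5 / 2))"
    proof (intro mult_left_mono)
      have "norm v powr (- 3 / 2 - real k) \<le> norm v powr (- 5 / 2)"
        using v1 k by (intro powr_mono) auto
      also have "\<dots> \<le> (2 * C) ^ 3 * h powr (- 5 / 2)"
        by (rule powr_neg_scale) (use h C hx in auto)
      finally show "norm v powr (- 3 / 2 - real k) \<le> (2 * C) ^ 3 * h powr (- 5 / 2)" .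
    qed (use Sk_nonneg A in auto)
    finally have "norm (blk N B \<kappa> (\<lambda>mn. fab a b u (lat z mn) (lat \<zeta> mn)) Q) \<le>
        Sk * A * ((512 * real N ^ 2 * (C + 2) ^ 2 * (8 * C ^ 3)) * h powr (- 5 / 2))"
      by (simp add: Q power_mult_distrib mult_ac)
    moreover have "512 * real N ^ 2 * (C + 2) ^ 2 * (8 * C ^ 3) \<le> 4096 * 4096 * real N ^ 2 * (C ^ k * (C + 2) ^ 6)"
    proof -
      have "C ^ 3 \<le> (C + 2) ^ 3" using C by (intro power_mono) auto
      hence "(C + 2) ^ 2 * C ^ 3 \<le> (C + 2) ^ 2 * (C + 2) ^ 3" by (intro mult_left_mono) auto
      also have "\<dots> = (C + 2) ^ 5" by (simp flip: power_add)
      also have "\<dots> \<le> (C + 2) ^ 6" by (rule C2) simp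
      also have "\<dots> \<le> C ^ k * (C + 2) ^ 6"
        using mult_right_mono[OF Ck, of "(C + 2) ^ 6"] C by simp
      finally have le: "(C + 2) ^ 2 * C ^ 3 \<le> C ^ k * (C + 2) ^ 6" .
      have "(4096 * real N ^ 2) * ((C + 2) ^ 2 * C ^ 3) \<le> (4096 * 4096 * real N ^ 2) * (C ^ k * (C + 2) ^ 6)"
        by (rule mult_mono[OF _ le]) (use C in auto)
      thus ?thesis by (simp add: mult_ac)
    qed
    ultimately show ?thesis using reduce unfolding h_def by blast
  next
    case near
    \<comment> \<open>Near blocks have bounded height h. As h^3 h^(-5/2) \<ge> 1, a constant bound
      turns into the required power at the price of the factor (17 (C + 2)^2)^3.\<close>
    have hs: "h \<le> 17 * (C + 2) ^ 2"
    proof -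
      have "real N * (\<bar>real_of_int p\<bar> + \<bar>real_of_int q\<bar>) \<le> C * (16 * real N * (C + 2))"
        by (rule order_trans[OF hv mult_left_mono]) (use near(2) C in auto)
      hence "real N * (\<bar>real_of_int p\<bar> + \<bar>real_of_int q\<bar>) \<le> real N * (16 * C * (C + 2))"
        by (simp add: mult_ac)
      hence "\<bar>real_of_int p\<bar> + \<bar>real_of_int q\<bar> \<le> 16 * C * (C + 2)" using N1 by simp
      hence "h \<le> 1 + 16 * C * (C + 2)" by (simp add: h_def hgt_def Q)
      also have "\<dots> \<le> 17 * (C + 2) ^ 2" using C by (simp add: power2_eq_square algebra_simps)
      finally show ?thesis .
    qed
    have h3: "1 \<le> h ^ 3 * h powr (- 5 / 2)"
    proof -
      have "h ^ 3 * h powr (- 5 / 2) = h powr 3 * h powr (- 5 / 2)" using h powr_realpow[of h 3] by simp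
      also have "\<dots> = h powr (1 / 2)" by (simp flip: powr_add)
      also have "\<dots> \<ge> 1" using h by (intro ge_one_powr_ge_zero) auto
      finally show ?thesis .
    qed
    have "norm (blk N B \<kappa> (\<lambda>mn. fab a b u (lat z mn) (lat \<zeta> mn)) (p, q)) \<le> Sk * (A * C ^ k)"
    proof (rule blk_termwise)
      fix c assume c: "c \<in> B"
      define mn where "mn = (int N * p + fst c, int N * q + snd c)"
      show "norm (fab a b u (lat z (int N * p + fst c, int N * q + snd c))
          (lat \<zeta> (int N * p + fst c, int N * q + snd c))) \<le> A * C ^ k"
      proof (cases "mn = (0, 0)")
        case True
        thus ?thesis unfolding mn_def[symmetric] using A C ab k by (simp add: fab_zero)
      next
        case False
        have "norm (fab a b u (lat z mn) (lat \<zeta> mn)) \<le> A * norm (lat z0 mn) powr (- (real k - 1 / 2))"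
          by (rule tbound[OF False])
        also have "norm (lat z0 mn) powr (- (real k - 1 / 2)) \<le> C ^ k"
          by (rule powr_lower_bound) (use k C good_lat[OF g False] in auto)
        finally show ?thesis using A by (simp add: mn_def mult_left_mono)
      qed
    qed
    also have "\<dots> \<le> Sk * (A * C ^ k) * ((17 * (C + 2) ^ 2) ^ 3 * h powr (- 5 / 2))"
    proof -
      have "h ^ 3 \<le> (17 * (C + 2) ^ 2) ^ 3" using hs h by (intro power_mono) auto
      hence "h ^ 3 * h powr (- 5 / 2) \<le> (17 * (C + 2) ^ 2) ^ 3 * h powr (- 5 / 2)"
        by (intro mult_right_mono) auto
      hence "1 \<le> (17 * (C + 2) ^ 2) ^ 3 * h powr (- 5 / 2)" using h3 by linarith
      hence "Sk * (A * C ^ k) * 1 \<le> Sk * (A * C ^ k) * ((17 * (C + 2) ^ 2) ^ 3 * h powr (- 5 / 2))"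
        using Sk_nonneg A Ck by (intro mult_left_mono) auto
      thus ?thesis by simp
    qed
    finally have "norm (blk N B \<kappa> (\<lambda>mn. fab a b u (lat z mn) (lat \<zeta> mn)) Q) \<le>
        Sk * A * ((4913 * (C ^ k * (C + 2) ^ 6)) * h powr (- 5 / 2))"
      by (simp add: Q power_mult_distrib mult_ac flip: power_mult)
    moreover have "4913 * (C ^ k * (C + 2) ^ 6) \<le> 4096 * 4096 * real N ^ 2 * (C ^ k * (C + 2) ^ 6)"
      by (rule mult_right_mono[OF N64(2)]) (use C in auto)
    ultimately show ?thesis using reduce unfolding h_def by blast
  qed
qed

end

section \<open>Summability over the lattice, and the summands of the harmonic form\<close>

lemma summable_on_product:
  fixes f :: "'a \<Rightarrow> real" and g :: "'b \<Rightarrow> real"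
  assumes f: "f summable_on A" and g: "g summable_on B" and nn: "\<And>x. f x \<ge> 0" "\<And>y. g y \<ge> 0"
  shows "(\<lambda>(x, y). f x * g y) summable_on (A \<times> B)"
proof (rule summable_on_SigmaI)
  show "((\<lambda>y. case (x, y) of (x, y) \<Rightarrow> f x * g y) has_sum f x * infsum g B) B" for x
    using has_sum_cmult_right[OF has_sum_infsum[OF g]] by simp
  show "(\<lambda>x. f x * infsum g B) summable_on A" by (rule summable_on_cmult_left[OF f])
qed (use nn in auto)

lemma summable_on_int_powr:
  assumes "s > 1"
  shows "(\<lambda>p::int. (1 + \<bar>real_of_int p\<bar>) powr (- s)) summable_on UNIV"
proof -
  have "summable (\<lambda>n. real (Suc n) powr (- s))"
    using summable_real_powr_iff[of "- s"] assms summable_Suc_iff[of "\<lambda>n. real n powr (- s)"] by simp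
  hence 1: "(\<lambda>n. (1 + real n) powr (- s)) summable_on UNIV"
    by (subst summable_on_UNIV_nonneg_real_iff) (auto simp: add.commute)
  have "(\<lambda>p::int. (1 + \<bar>real_of_int p\<bar>) powr (- s)) summable_on range int"
    by (subst summable_on_reindex) (use 1 in \<open>auto simp: o_def\<close>)
  moreover have "(\<lambda>p::int. (1 + \<bar>real_of_int p\<bar>) powr (- s)) summable_on range (\<lambda>n. - int n)"
    by (subst summable_on_reindex) (use 1 in \<open>auto simp: o_def inj_def\<close>)
  ultimately have "(\<lambda>p::int. (1 + \<bar>real_of_int p\<bar>) powr (- s)) summable_on (range int \<union> range (\<lambda>n. - int n))"
    by (rule summable_on_union)
  also have "range int \<union> range (\<lambda>n. - int n) = UNIV"
  proof -
    have "x \<in> range int \<union> range (\<lambda>n. - int n)" for x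
      by (cases x rule: int_cases2) auto
    thus ?thesis by auto
  qed
  finally show ?thesis .
qed

text \<open>The height is at least 1 + |p| and at least 1 + |q|, so its power -s is dominated by a
  product of two one-dimensional powers with exponent s/2 > 1.\<close>

lemma summable_hgt:
  assumes "s > 2"
  shows "(\<lambda>Q. hgt Q powr (- s)) summable_on UNIV"
proof -
  have "(\<lambda>(p, q). (1 + \<bar>real_of_int p\<bar>) powr (- (s / 2)) * (1 + \<bar>real_of_int q\<bar>) powr (- (s / 2)))
      summable_on (UNIV \<times> UNIV)"
    by (rule summable_on_product) (use assms in \<open>auto intro: summable_on_int_powr\<close>)
  hence S: "(\<lambda>Q. (1 + \<bar>real_of_int (fst Q)\<bar>) powr (- (s / 2)) * (1 + \<bar>real_of_int (snd Q)\<bar>) powr (- (s / 2)))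
      summable_on UNIV" by (simp add: case_prod_unfold)
  show ?thesis
  proof (rule summable_on_comparison_test[OF S])
    fix Q :: "int \<times> int"
    have le: "(hgt Q) powr (- (s / 2)) \<le> (1 + \<bar>real_of_int (fst Q)\<bar>) powr (- (s / 2))"
       "(hgt Q) powr (- (s / 2)) \<le> (1 + \<bar>real_of_int (snd Q)\<bar>) powr (- (s / 2))"
      using assms by (auto simp: hgt_def intro!: powr_mono2')
    have "hgt Q powr (- s) = (hgt Q) powr (- (s / 2)) * (hgt Q) powr (- (s / 2))"
      by (simp flip: powr_add)
    also have "\<dots> \<le> (1 + \<bar>real_of_int (fst Q)\<bar>) powr (- (s / 2)) * (1 + \<bar>real_of_int (snd Q)\<bar>) powr (- (s / 2))"
      by (intro mult_mono le) auto
    finally show "hgt Q powr (- s) \<le> (1 + \<bar>real_of_int (fst Q)\<bar>) powr (- (s / 2)) * (1 + \<bar>real_of_int (snd Q)\<bar>) powr (- (s / 2))" .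
  qed auto
qed

lemma powi_deriv:
  fixes Y :: complex
  assumes "Y \<noteq> 0"
  shows "((\<lambda>Y. Y powi n) has_field_derivative (of_int n * Y powi (n - 1))) (at Y)"
  using assms by (auto intro!: derivative_eq_intros)

text \<open>The summand of the harmonic form with \<zeta> in place of cnj z; the quotient (z -
  \<zeta>)/(2i) stands for y. For k = 1 it is the derivative at u = 0 of y^u w^(-1) (w w')^(-u),
  whence the two logarithms.\<close>

definition gk :: "nat \<Rightarrow> complex \<Rightarrow> complex \<Rightarrow> int \<times> int \<Rightarrow> complex" where
  "gk k z \<zeta> mn = (if k = 1 then inverse (lat z mn) * (Ln ((z - \<zeta>) / (2 * \<i>)) - Ln (lat z mn * lat \<zeta> mn))
     else ((z - \<zeta>) / (2 * \<i>)) ^ (k - 1) / of_nat (k - 1) * inverse (lat z mn) * inverse (lat \<zeta> mn) ^ (k - 1))"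

lemma diff_cnj_div: "(z - cnj z) / (2 * \<i>) = of_real (Im z)"
  by (simp add: complex_diff_cnj complex_eq_iff)

lemma lat_deriv: "((\<lambda>z. lat z mn) has_field_derivative of_int (fst mn)) (at z)"
  unfolding lat_def by (auto intro!: derivative_eq_intros)

text \<open>The identity mz + n = (m\<zeta> + n) + 2imy, with y = (z - \<zeta>)/(2i), cancels the
  factor 1/(mz + n). What remains is y^(k-2) times a function of \<zeta> alone; both the image under
  \<xi> and harmonicity rest on this shape.\<close>

lemma gk_deriv_zeta:
  assumes k: "k \<ge> 1" and nz: "lat z mn \<noteq> 0" "lat \<zeta> mn \<noteq> 0" "Re (lat z mn * lat \<zeta> mn) > 0"
    and Y: "Re ((z - \<zeta>) / (2 * \<i>)) > 0"
  shows "((\<lambda>\<zeta>. gk k z \<zeta> mn) has_field_derivative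
    (\<i> / 2 * ((z - \<zeta>) / (2 * \<i>)) powi (int k - 2) * inverse (lat \<zeta> mn) ^ k)) (at \<zeta>)"
proof -
  define m where "m = (of_int (fst mn) :: complex)"
  define y where "y = (z - \<zeta>) / (2 * \<i>)"
  define w w' where "w = lat z mn" and "w' = lat \<zeta> mn"
  have y0: "y \<noteq> 0" "y \<notin> \<real>\<^sub>\<le>\<^sub>0" using Y by (auto simp: y_def complex_nonpos_Reals_iff)
  have w0: "w \<noteq> 0" "w' \<noteq> 0" "w * w' \<notin> \<real>\<^sub>\<le>\<^sub>0"
    using nz by (auto simp: w_def w'_def complex_nonpos_Reals_iff)
  have rel: "w = w' + 2 * \<i> * m * y"
    by (simp add: w_def w'_def y_def m_def lat_def field_simps)
  have dY: "((\<lambda>\<zeta>. (z - \<zeta>) / (2 * \<i>)) has_field_derivative (\<i> / 2)) (at \<zeta>)"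
    by (auto intro!: derivative_eq_intros simp: field_simps)
  have dl: "((\<lambda>\<zeta>. lat \<zeta> mn) has_field_derivative m) (at \<zeta>)" unfolding m_def by (rule lat_deriv)
  show ?thesis
  proof (cases "k = 1")
    case True
    have 1: "((\<lambda>\<zeta>. Ln ((z - \<zeta>) / (2 * \<i>))) has_field_derivative inverse y * (\<i> / 2)) (at \<zeta>)"
      by (rule DERIV_chain2[OF _ dY]) (use y0 in \<open>auto simp: y_def intro!: derivative_eq_intros\<close>)
    have 2: "((\<lambda>\<zeta>. Ln (w * lat \<zeta> mn)) has_field_derivative inverse (w * w') * (w * m)) (at \<zeta>)"
      by (rule DERIV_chain2[OF _ DERIV_cmult[OF dl]])
         (use w0 in \<open>auto simp: w'_def intro!: derivative_eq_intros\<close>)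
    have "((\<lambda>\<zeta>. inverse w * (Ln ((z - \<zeta>) / (2 * \<i>)) - Ln (w * lat \<zeta> mn))) has_field_derivative
        inverse w * (inverse y * (\<i> / 2) - inverse (w * w') * (w * m))) (at \<zeta>)"
      by (intro DERIV_cmult DERIV_diff 1 2)
    moreover have "inverse w * (inverse y * (\<i> / 2) - inverse (w * w') * (w * m)) =
        \<i> / 2 * inverse y * inverse w'"
    proof -
      have "inverse y * (\<i> / 2) - inverse (w * w') * (w * m) = (\<i> / 2 * w' - m * y) / (y * w')"
        using y0 w0 by (simp add: field_simps)
      also have "\<i> / 2 * w' - m * y = \<i> / 2 * w" unfolding rel by (simp add: algebra_simps)
      finally show ?thesis using w0 y0 by (simp add: field_simps)
    qed
    ultimately show ?thesis
      using True by (simp add: gk_def y_def w_def w'_def power_int_minus)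
  next
    case False
    define n where "n = k - 2"
    have kn: "k = Suc (Suc n)" using k False by (simp add: n_def)
    have 1: "((\<lambda>\<zeta>. ((z - \<zeta>) / (2 * \<i>)) ^ Suc n) has_field_derivative (1 + of_nat n) * (\<i> / 2 * y ^ n)) (at \<zeta>)"
      unfolding y_def by (rule DERIV_power_Suc[OF dY])
    have 2: "((\<lambda>\<zeta>. inverse (lat \<zeta> mn) ^ Suc n) has_field_derivative
        (- of_nat (Suc n) * inverse w' ^ Suc n * inverse w') * m) (at \<zeta>)"
      using DERIV_chain2[OF inverse_power_deriv dl] w0 unfolding w'_def by blast
    have a: "((\<lambda>\<zeta>. (((z - \<zeta>) / (2 * \<i>)) ^ Suc n * inverse (lat \<zeta> mn) ^ Suc n) * (inverse w / of_nat (Suc n)))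
        has_field_derivative (((1 + of_nat n) * (\<i> / 2 * y ^ n)) * inverse w' ^ Suc n +
          ((- of_nat (Suc n) * inverse w' ^ Suc n * inverse w') * m) * y ^ Suc n) * (inverse w / of_nat (Suc n))) (at \<zeta>)"
      using DERIV_cmult_right[OF DERIV_mult[OF 1 2], of "inverse w / of_nat (Suc n)"]
      unfolding y_def w'_def by (simp only:)
    have b: "(((1 + of_nat n) * (\<i> / 2 * y ^ n)) * inverse w' ^ Suc n +
          ((- of_nat (Suc n) * inverse w' ^ Suc n * inverse w') * m) * y ^ Suc n) * (inverse w / of_nat (Suc n)) =
        \<i> / 2 * y ^ n * inverse w' ^ k"
    proof -
      have "((1 + of_nat n) * (\<i> / 2 * y ^ n)) * inverse w' ^ Suc n +
          ((- of_nat (Suc n) * inverse w' ^ Suc n * inverse w') * m) * y ^ Suc n =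
        of_nat (Suc n) * y ^ n * inverse w' ^ Suc n * inverse w' * (\<i> / 2 * w' - m * y)"
        using w0 by (simp add: field_simps)
      also have "\<i> / 2 * w' - m * y = \<i> / 2 * w" unfolding rel by (simp add: algebra_simps)
      finally have e: "(1 + of_nat n) * (\<i> / 2 * y ^ n) * inverse w' ^ Suc n +
          (- of_nat (Suc n) * inverse w' ^ Suc n * inverse w') * m * y ^ Suc n =
          of_nat (Suc n) * y ^ n * inverse w' ^ Suc n * inverse w' * (\<i> / 2 * w)" .
      define s where "s = (of_nat (Suc n) :: complex)"
      have s0: "s \<noteq> 0" by (simp add: s_def del: of_nat_Suc)
      have "s * y ^ n * inverse w' ^ Suc n * inverse w' * (\<i> / 2 * w) * (inverse w / s) =
          (s * inverse s) * (w * inverse w) * (\<i> / 2 * y ^ n * (inverse w' ^ Suc n * inverse w'))"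
        by (simp only: divide_inverse mult_ac)
      also have "\<dots> = \<i> / 2 * y ^ n * (inverse w' ^ Suc n * inverse w')" using s0 w0 by simp
      also have "inverse w' ^ Suc n * inverse w' = inverse w' ^ k" by (simp add: kn mult_ac)
      finally show ?thesis unfolding e s_def .
    qed
    have c: "gk k z \<zeta> mn = (((z - \<zeta>) / (2 * \<i>)) ^ Suc n * inverse (lat \<zeta> mn) ^ Suc n) * (inverse w / of_nat (Suc n))" for \<zeta>
      using False by (simp add: gk_def kn w_def)
    have d: "y powi (int k - 2) = y ^ n" by (simp add: kn)
    show ?thesis
      unfolding y_def[symmetric] w'_def[symmetric] d c using a unfolding b .
  qed
qed

lemma gk_differentiable_z:
  assumes k: "k \<ge> 1" and nz: "lat z mn \<noteq> 0" "lat \<zeta> mn \<noteq> 0" "Re (lat z mn * lat \<zeta> mn) > 0"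
    and Y: "Re ((z - \<zeta>) / (2 * \<i>)) > 0"
  shows "(\<lambda>z. gk k z \<zeta> mn) field_differentiable (at z)"
proof -
  have y0: "(z - \<zeta>) / (2 * \<i>) \<noteq> 0" "(z - \<zeta>) / (2 * \<i>) \<notin> \<real>\<^sub>\<le>\<^sub>0"
    using Y by (auto simp: complex_nonpos_Reals_iff)
  have w0: "lat z mn * lat \<zeta> mn \<notin> \<real>\<^sub>\<le>\<^sub>0" using nz by (auto simp: complex_nonpos_Reals_iff)
  have l: "(\<lambda>z. lat z mn) field_differentiable (at z)"
    using lat_deriv field_differentiable_def by blast
  have Ld: "(\<lambda>z. Ln (f z)) field_differentiable (at z)" if "f field_differentiable (at z)" "f z \<notin> \<real>\<^sub>\<le>\<^sub>0" for f :: "complex \<Rightarrow> complex"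
    using field_differentiable_compose[of f z Ln] that field_differentiable_at_Ln by (simp add: o_def)
  have dY: "(\<lambda>z. (z - \<zeta>) / (2 * \<i>)) field_differentiable (at z)"
    by (intro derivative_intros) auto
  have 1: "(\<lambda>z. inverse (lat z mn) * (Ln ((z - \<zeta>) / (2 * \<i>)) - Ln (lat z mn * lat \<zeta> mn))) field_differentiable (at z)"
    by (intro field_differentiable_mult field_differentiable_diff field_differentiable_inverse Ld l dY
         field_differentiable_const nz y0 w0)
  have 2: "(\<lambda>z. ((z - \<zeta>) / (2 * \<i>)) ^ (k - 1) / of_nat (k - 1) * inverse (lat z mn) * inverse (lat \<zeta> mn) ^ (k - 1))
      field_differentiable (at z)" if "k \<noteq> 1"
    by (intro field_differentiable_mult field_differentiable_divide field_differentiable_inverse l dY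
         field_differentiable_const nz field_differentiable_power) (use that k in auto)
  show ?thesis
    using 1 2 by (cases "k = 1") (simp_all add: gk_def)
qed

lemma gk_zero: "k \<ge> 1 \<Longrightarrow> gk k z \<zeta> (0, 0) = 0"
  by (simp add: gk_def)

lemma good_near:
  assumes g: "good C z0" and z: "norm (z - z0) \<le> 1 / (16 * C)" and zeta: "norm (\<zeta> - cnj z0) \<le> 1 / (16 * C)"
  shows "Re ((z - \<zeta>) / (2 * \<i>)) > 0" "norm ((z - \<zeta>) / (2 * \<i>)) \<le> C + 1" "1 \<le> 2 * C * norm ((z - \<zeta>) / (2 * \<i>))"
    "mn \<noteq> (0, 0) \<Longrightarrow> lat z mn \<noteq> 0 \<and> lat \<zeta> mn \<noteq> 0 \<and> Re (lat z mn * lat \<zeta> mn) > 0"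
proof -
  have C: "C \<ge> 1" "norm z0 \<le> C" "1 \<le> C * Im z0" using g by (auto simp: good_def)
  define Y where "Y = (z - \<zeta>) / (2 * \<i>)"
  have "(z - \<zeta>) / x - (z0 - cnj z0) / x = ((z - z0) - (\<zeta> - cnj z0)) / x" for x
    by (simp add: diff_divide_distrib)
  hence "Y - of_real (Im z0) = ((z - z0) - (\<zeta> - cnj z0)) / (2 * \<i>)"
    unfolding Y_def diff_cnj_div[symmetric] .
  hence "norm (Y - of_real (Im z0)) = norm ((z - z0) - (\<zeta> - cnj z0)) / 2"
    by (simp add: norm_divide norm_mult)
  also have "\<dots> \<le> (norm (z - z0) + norm (\<zeta> - cnj z0)) / 2" by (simp add: norm_triangle_ineq4)
  also have "\<dots> \<le> 1 / (16 * C)" using z zeta by simp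
  finally have d: "norm (Y - of_real (Im z0)) \<le> 1 / (16 * C)" .
  define c where "c = 1 / C"
  have y: "Im z0 \<ge> c" using C by (simp add: c_def field_simps)
  have c1: "c > 0" "1 / (16 * C) = c / 16" "c \<le> 1" using C by (auto simp: c_def)
  note d = d[unfolded c1(2)]
  have re: "Re Y \<ge> Im z0 - c / 16"
    using d abs_Re_le_cmod[of "Y - of_real (Im z0)"] by simp
  hence re2: "Re Y \<ge> c / 2" using y c1 by linarith
  thus "Re ((z - \<zeta>) / (2 * \<i>)) > 0" using c1 unfolding Y_def[symmetric] by linarith
  have "norm Y \<ge> c / 2" using re2 complex_Re_le_cmod[of Y] by linarith
  thus "1 \<le> 2 * C * norm ((z - \<zeta>) / (2 * \<i>))" using C unfolding Y_def[symmetric] by (simp add: c_def field_simps)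
  have "norm Y \<le> \<bar>Im z0\<bar> + norm (Y - of_real (Im z0))"
    using norm_triangle_sub[of Y "of_real (Im z0)"] by simp
  thus "norm ((z - \<zeta>) / (2 * \<i>)) \<le> C + 1"
    using d c1 abs_Im_le_cmod[of z0] C unfolding Y_def[symmetric] by linarith
  assume mn: "mn \<noteq> (0, 0)"
  define v where "v = lat z0 mn"
  have v: "v \<noteq> 0" using good_lat[OF g mn] by (simp add: v_def)
  have "norm (cnj \<zeta> - z0) \<le> 1 / (16 * C)"
    using zeta by (metis complex_cnj_cnj complex_cnj_diff complex_mod_cnj)
  from lat_diff_bound[OF g this, of mn]
  have "norm (lat \<zeta> mn - cnj v) \<le> norm v / 16" unfolding v_def
    by (metis cnj_lat complex_cnj_cnj complex_cnj_diff complex_mod_cnj)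
  hence 1: "norm (lat \<zeta> mn - cnj v) \<le> norm v / 4" using norm_ge_zero[of v] by linarith
  have 2: "norm (lat z mn - v) \<le> norm v / 4"
    using lat_diff_bound[OF g z, of mn] norm_ge_zero[of v] unfolding v_def by linarith
  from near_pair[OF 2 1 v] show "lat z mn \<noteq> 0 \<and> lat \<zeta> mn \<noteq> 0 \<and> Re (lat z mn * lat \<zeta> mn) > 0" by blast
qed

section \<open>Block sums as holomorphic functions of u and of (z, \<zeta>)\<close>

context latsum
begin

lemma blk_deriv:
  assumes "\<And>mn. (g mn has_field_derivative g' mn) (at x)"
  shows "((\<lambda>x. blk N B \<kappa> (\<lambda>mn. g mn x) Q) has_field_derivative blk N B \<kappa> g' Q) (at x)"
  unfolding blk_def by (intro DERIV_sum DERIV_cmult assms)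

lemma fab_u_deriv:
  assumes "a + b \<ge> 1"
  shows "((\<lambda>u. fab a b u w w') has_field_derivative fab a b u w w' * (- Ln (w * w'))) (at u)"
  unfolding fab_def by (auto intro!: derivative_eq_intros)

text \<open>Grouping into blocks gives convergence for all Re u > -1/4, and thereby the continuation
  of the sum over single lattice points, with which it agrees where the latter converges
  absolutely.\<close>

definition Su :: "nat \<Rightarrow> nat \<Rightarrow> complex \<Rightarrow> complex \<Rightarrow> complex" where
  "Su a b z u = (\<Sum>\<^sub>\<infinity>Q. blk N B \<kappa> (\<lambda>mn. fab a b u (lat z mn) (lat (cnj z) mn)) Q)"

lemma summable_hgt': "(\<lambda>Q. K * hgt Q powr (- 5 / 2)) summable_on UNIV"
  using summable_on_cmult_right[OF summable_hgt[of "5/2"]] by simp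

lemma Su_deriv:
  assumes ab: "a + b = k" and z: "Im z > 0" and u: "Re u > - 1 / 4"
  shows "\<exists>D. (Su a b z has_field_derivative D) (at u) \<and>
    ((\<lambda>Q. blk N B \<kappa> (\<lambda>mn. fab a b u (lat z mn) (lat (cnj z) mn) * (- Ln (lat z mn * lat (cnj z) mn))) Q) has_sum D) UNIV"
proof -
  obtain C where g: "good C z" using good_exists[OF z] by blast
  have C: "C \<ge> 1" using g by (simp add: good_def)
  \<comment> \<open>Half the distance to the line Re u = -1/4, so that the disc stays in the range
    of \<open>blk_bound\<close>.\<close>
  define r where "r = (Re u + 1 / 4) / 2"
  have r: "r > 0" using u by (simp add: r_def)
  have "\<exists>D. ((\<lambda>u. \<Sum>\<^sub>\<infinity>Q\<in>UNIV. blk N B \<kappa> (\<lambda>mn. fab a b u (lat z mn) (lat (cnj z) mn)) Q) has_field_derivative D) (at u) \<and>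
    ((\<lambda>Q. blk N B \<kappa> (\<lambda>mn. fab a b u (lat z mn) (lat (cnj z) mn) * (- Ln (lat z mn * lat (cnj z) mn))) Q) has_sum D) UNIV"
  proof (rule has_field_derivative_infsum[OF r])
    fix Q v assume v: "v \<in> cball u r"
    show "((\<lambda>u. blk N B \<kappa> (\<lambda>mn. fab a b u (lat z mn) (lat (cnj z) mn)) Q) has_field_derivative
       blk N B \<kappa> (\<lambda>mn. fab a b v (lat z mn) (lat (cnj z) mn) * (- Ln (lat z mn * lat (cnj z) mn))) Q) (at v)"
      by (intro blk_deriv fab_u_deriv) (use ab k in auto)
    have "norm (v - u) \<le> r" using v by (simp add: dist_norm norm_minus_commute)
    hence "\<bar>Re v - Re u\<bar> \<le> r" "norm v \<le> norm u + r"
      using abs_Re_le_cmod[of "v - u"] norm_triangle_sub[of v u] by simp_all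
    moreover have "Re u - r \<ge> - 1 / 4" using r unfolding r_def by (simp add: field_simps)
    ultimately have "Re v \<ge> - 1 / 4" "norm v \<le> norm u + r" by linarith+
    thus "norm (blk N B \<kappa> (\<lambda>mn. fab a b v (lat z mn) (lat (cnj z) mn)) Q) \<le> Kb (norm u + r) C * hgt Q powr (- 5 / 2)"
      by (intro blk_bound[OF g _ _ _ _ ab]) (use C in auto)
  qed (use r summable_hgt' in auto)
  thus ?thesis by (simp add: Su_def[abs_def])
qed

definition Gz :: "complex \<Rightarrow> complex \<Rightarrow> complex" where
  "Gz z \<zeta> = (\<Sum>\<^sub>\<infinity>Q. blk N B \<kappa> (gk k z \<zeta>) Q)"

definition Ez :: "complex \<Rightarrow> complex" where
  "Ez \<zeta> = (\<Sum>\<^sub>\<infinity>Q. blk N B \<kappa> (\<lambda>mn. inverse (lat \<zeta> mn) ^ k) Q)"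

lemma blk_cmult: "blk N B \<kappa> (\<lambda>mn. c * g mn) Q = c * blk N B \<kappa> g Q"
  by (simp add: blk_def sum_distrib_left mult_ac)

lemma blk_add: "blk N B \<kappa> (\<lambda>mn. f mn + g mn) Q = blk N B \<kappa> f Q + blk N B \<kappa> g Q"
  by (simp add: blk_def sum.distrib distrib_left)

text \<open>The 8 is the Cauchy factor of the u-derivative for k = 1; the exponential covers the
  power of y, or its logarithm for k = 1.\<close>

definition Gb :: "real \<Rightarrow> real" where
  "Gb C = Kb 1 C * (8 + exp (real (k + 2) * (C + 1)))"

lemma gk_bound:
  assumes g: "good C z0" and z: "norm (z - z0) \<le> 1 / (16 * C)"
    and zeta: "norm (\<zeta> - cnj z0) \<le> 1 / (16 * C)"
  shows "norm (blk N B \<kappa> (gk k z \<zeta>) Q) \<le> Gb C * hgt Q powr (- 5 / 2)"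
proof -
  have C: "C \<ge> 1" using g by (simp add: good_def)
  define Y where "Y = (z - \<zeta>) / (2 * \<i>)"
  note gn = good_near[OF g z zeta]
  have Y: "norm Y \<le> C + 1" "1 \<le> 2 * C * norm Y" "Re Y > 0" using gn by (auto simp: Y_def)
  have Yp: "norm Y > 0" using Y(3) by auto
  have b0: "norm (blk N B \<kappa> (\<lambda>mn. fab 1 (k - 1) u (lat z mn) (lat \<zeta> mn)) Q) \<le> Kb 1 C * hgt Q powr (- 5 / 2)"
    if "Re u \<ge> - 1 / 4" "norm u \<le> 1" for u
    by (rule blk_bound[OF g z zeta that]) (use k in auto)
  define K where "K = Kb 1 C * hgt Q powr (- 5 / 2)"
  have K: "K \<ge> 0" by (simp add: K_def Kb_nonneg)
  define D where "D = blk N B \<kappa> (\<lambda>mn. fab 1 (k - 1) 0 (lat z mn) (lat \<zeta> mn)) Q"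
  have D: "norm D \<le> K" unfolding D_def K_def by (rule b0) auto
  have "norm (blk N B \<kappa> (gk k z \<zeta>) Q) \<le> K * (8 + exp (real (k + 2) * (C + 1)))"
  proof (cases "k = 1")
    case False
    hence k2: "k \<ge> 2" using k by auto
    have "blk N B \<kappa> (gk k z \<zeta>) Q = (Y ^ (k - 1) / of_nat (k - 1)) * D"
      unfolding D_def blk_cmult[symmetric] using False by (simp add: gk_def[abs_def] fab_def Y_def mult_ac)
    hence "norm (blk N B \<kappa> (gk k z \<zeta>) Q) = norm Y ^ (k - 1) / real (k - 1) * norm D"
      by (simp add: norm_mult norm_divide norm_power)
    also have "\<dots> \<le> exp (real (k + 2) * (C + 1)) * K"
    proof (intro mult_mono D)
      have "norm Y ^ (k - 1) / real (k - 1) \<le> norm Y ^ (k - 1) / 1"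
        using k2 by (intro divide_left_mono) auto
      also have "\<dots> \<le> (C + 1) ^ (k - 1)" using Y by (simp add: power_mono)
      also have "\<dots> \<le> exp (real (k - 1) * (C + 1))" by (rule power_le_exp) (use C in auto)
      also have "\<dots> \<le> exp (real (k + 2) * (C + 1))" using C by (auto intro!: mult_right_mono)
      finally show "norm Y ^ (k - 1) / real (k - 1) \<le> exp (real (k + 2) * (C + 1))" .
    qed auto
    also have "\<dots> \<le> K * (8 + exp (real (k + 2) * (C + 1)))" using K by (simp add: algebra_simps)
    finally show ?thesis .
  next
    case True
    define h where "h = (\<lambda>u. blk N B \<kappa> (\<lambda>mn. fab 1 0 u (lat z mn) (lat \<zeta> mn)) Q)"
    define h' where "h' = (\<lambda>u. blk N B \<kappa> (\<lambda>mn. fab 1 0 u (lat z mn) (lat \<zeta> mn) * (- Ln (lat z mn * lat \<zeta> mn))) Q)"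
    have hd: "(h has_field_derivative h' u) (at u)" for u
      unfolding h_def h'_def by (intro blk_deriv fab_u_deriv) auto
    \<comment> \<open>The terms containing Ln (w w') are the u-derivative of the block at 0. The
      Cauchy estimate on |u| = 1/8, which lies in Re u \<ge> -1/4, passes the decay of the blocks on
      to them.\<close>
    have "norm ((deriv ^^ 1) h 0) \<le> fact 1 * K / (1 / 8) ^ 1"
    proof (rule Cauchy_inequality)
      have hol: "h holomorphic_on UNIV" using hd by (auto simp: holomorphic_on_open)
      thus "h holomorphic_on ball 0 (1 / 8)" by (rule holomorphic_on_subset) auto
      show "continuous_on (cball 0 (1 / 8)) h"
        using hol holomorphic_on_imp_continuous_on continuous_on_subset by blast
      fix u :: complex assume "norm (0 - u) = 1 / 8"
      hence nu: "norm u = 1 / 8" by simp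
      thus "norm (h u) \<le> K"
        using b0[of u] abs_Re_le_cmod[of u] True by (simp add: h_def K_def)
    qed simp
    hence h'0: "norm (h' 0) \<le> 8 * K" using DERIV_imp_deriv[OF hd[of 0]] by simp
    have "blk N B \<kappa> (gk k z \<zeta>) Q = Ln Y * D + h' 0"
      unfolding D_def h'_def blk_cmult[symmetric] blk_add[symmetric]
      using True by (simp add: gk_def[abs_def] fab_def Y_def algebra_simps)
    hence "norm (blk N B \<kappa> (gk k z \<zeta>) Q) \<le> norm (Ln Y) * norm D + norm (h' 0)"
      by (metis norm_mult norm_triangle_ineq)
    also have "\<dots> \<le> exp (real (k + 2) * (C + 1)) * K + 8 * K"
    proof (intro add_mono mult_mono D h'0)
      have "ln (norm Y) \<le> norm Y - 1" by (rule ln_le_minus_one[OF Yp])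
      hence l1: "ln (norm Y) \<le> C" using Y by linarith
      have "- ln (norm Y) = ln (1 / norm Y)" using Yp by (simp add: ln_div)
      also have "\<dots> \<le> 1 / norm Y - 1" by (rule ln_le_minus_one) (use Yp in auto)
      also have "1 / norm Y \<le> 2 * C" using Y Yp by (simp add: field_simps)
      finally have l2: "- ln (norm Y) \<le> 2 * C" by simp
      have Y0: "Y \<noteq> 0" using Yp by auto
      have "\<bar>Im (Ln Y)\<bar> \<le> pi" using mpi_less_Im_Ln[OF Y0] Im_Ln_le_pi[OF Y0] by auto
      hence "norm (Ln Y) \<le> 2 * C + 4"
        using cmod_le[of "Ln Y"] l1 l2 C Y0 pi_less_4 by auto
      also have "\<dots> \<le> real (k + 2) * (C + 1) + 1" using True C by simp
      also have "\<dots> \<le> exp (real (k + 2) * (C + 1))" using exp_ge_add_one_self[of "real (k + 2) * (C + 1)"] by linarith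
      finally show "norm (Ln Y) \<le> exp (real (k + 2) * (C + 1))" .
    qed auto
    finally show ?thesis by (simp add: algebra_simps)
  qed
  thus ?thesis by (simp add: K_def Gb_def mult_ac)
qed

lemma Su_has_sum:
  assumes ab: "a + b = k" and z: "Im z > 0" and u: "Re u > - 1 / 4"
  shows "((\<lambda>Q. blk N B \<kappa> (\<lambda>mn. fab a b u (lat z mn) (lat (cnj z) mn)) Q) has_sum Su a b z u) UNIV"
proof -
  obtain C where g: "good C z" using good_exists[OF z] by blast
  have C: "C \<ge> 1" using g by (simp add: good_def)
  have "(\<lambda>Q. norm (blk N B \<kappa> (\<lambda>mn. fab a b u (lat z mn) (lat (cnj z) mn)) Q)) summable_on UNIV"
  proof (rule Infinite_Sum.abs_summable_on_comparison_test'
      [where f = "\<lambda>Q. blk N B \<kappa> (\<lambda>mn. fab a b u (lat z mn) (lat (cnj z) mn)) Q" and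
        g = "\<lambda>Q. Kb (norm u) C * hgt Q powr (- 5 / 2)"])
    show "(\<lambda>Q. Kb (norm u) C * hgt Q powr (- 5 / 2)) summable_on UNIV" by (rule summable_hgt')
    show "norm (blk N B \<kappa> (\<lambda>mn. fab a b u (lat z mn) (lat (cnj z) mn)) Q) \<le> Kb (norm u) C * hgt Q powr (- 5 / 2)" for Q
      by (rule blk_bound[OF g _ _ _ _ ab]) (use u C in auto)
  qed
  hence "(\<lambda>Q. blk N B \<kappa> (\<lambda>mn. fab a b u (lat z mn) (lat (cnj z) mn)) Q) summable_on UNIV"
    by (rule Infinite_Sum.abs_summable_summable)
  thus ?thesis unfolding Su_def by (rule has_sum_infsum)
qed

lemma gk_has_sum:
  assumes g: "good C z0" and z: "norm (z - z0) \<le> 1 / (16 * C)" and zeta: "norm (\<zeta> - cnj z0) \<le> 1 / (16 * C)"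
  shows "((\<lambda>Q. blk N B \<kappa> (gk k z \<zeta>) Q) has_sum Gz z \<zeta>) UNIV"
    and "norm (Gz z \<zeta>) \<le> Gb C * (\<Sum>\<^sub>\<infinity>Q. hgt Q powr (- 5 / 2))"
proof -
  have "(\<lambda>Q. norm (blk N B \<kappa> (gk k z \<zeta>) Q)) summable_on UNIV"
    by (rule Infinite_Sum.abs_summable_on_comparison_test'
          [where f = "\<lambda>Q. blk N B \<kappa> (gk k z \<zeta>) Q" and g = "\<lambda>Q. Gb C * hgt Q powr (- 5 / 2)"])
       (rule summable_hgt', rule gk_bound[OF g z zeta])
  hence "(\<lambda>Q. blk N B \<kappa> (gk k z \<zeta>) Q) summable_on UNIV"
    by (rule Infinite_Sum.abs_summable_summable)
  thus hs: "((\<lambda>Q. blk N B \<kappa> (gk k z \<zeta>) Q) has_sum Gz z \<zeta>) UNIV"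
    unfolding Gz_def by (rule has_sum_infsum)
  have "((\<lambda>Q. Gb C * hgt Q powr (- 5 / 2)) has_sum (Gb C * (\<Sum>\<^sub>\<infinity>Q. hgt Q powr (- 5 / 2)))) UNIV"
    by (rule has_sum_cmult_right[OF has_sum_infsum]) (use summable_hgt'[of 1] in simp)
  thus "norm (Gz z \<zeta>) \<le> Gb C * (\<Sum>\<^sub>\<infinity>Q. hgt Q powr (- 5 / 2))"
    by (rule norm_infsum_le[OF hs]) (rule gk_bound[OF g z zeta])
qed

text \<open>By \<open>gk_deriv_zeta\<close> the factor y^(k-2) is common to all terms and leaves the
  sum. What remains, \<open>Ez\<close>, is the holomorphic lattice sum of weight k in the variable
  \<zeta>.\<close>

lemma Gz_deriv_zeta:
  assumes g: "good C z0" and z: "norm (z - z0) \<le> 1 / (16 * C)" and zeta: "norm (\<zeta> - cnj z0) < 1 / (16 * C)"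
  shows "(Gz z has_field_derivative (\<i> / 2 * ((z - \<zeta>) / (2 * \<i>)) powi (int k - 2) * Ez \<zeta>)) (at \<zeta>)"
proof -
  have r: "1 / (16 * C) > 0" using g by (simp add: good_def)
  define Y where "Y = ((z - \<zeta>) / (2 * \<i>)) powi (int k - 2)"
  have "\<exists>D. ((\<lambda>\<zeta>. \<Sum>\<^sub>\<infinity>Q\<in>UNIV. blk N B \<kappa> (gk k z \<zeta>) Q) has_field_derivative D) (at \<zeta>) \<and>
      ((\<lambda>Q. blk N B \<kappa> (\<lambda>mn. \<i> / 2 * ((z - \<zeta>) / (2 * \<i>)) powi (int k - 2) * inverse (lat \<zeta> mn) ^ k) Q) has_sum D) UNIV"
  proof (rule has_field_derivative_infsum[OF r])
    fix Q x assume "x \<in> cball (cnj z0) (1 / (16 * C))"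
    hence x: "norm (x - cnj z0) \<le> 1 / (16 * C)" by (simp add: dist_norm norm_minus_commute)
    note gn = good_near[OF g z x]
    show "((\<lambda>\<zeta>. blk N B \<kappa> (gk k z \<zeta>) Q) has_field_derivative
       blk N B \<kappa> (\<lambda>mn. \<i> / 2 * ((z - x) / (2 * \<i>)) powi (int k - 2) * inverse (lat x mn) ^ k) Q) (at x)"
    proof (rule blk_deriv)
      fix mn
      show "((\<lambda>\<zeta>. gk k z \<zeta> mn) has_field_derivative
          \<i> / 2 * ((z - x) / (2 * \<i>)) powi (int k - 2) * inverse (lat x mn) ^ k) (at x)"
      proof (cases "mn = (0, 0)")
        case True
        have "k \<noteq> 0" using k by simp
        with True show ?thesis using k by (simp add: gk_zero power_0_left)
      next
        case False
        thus ?thesis using gn by (intro gk_deriv_zeta k) auto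
      qed
    qed
    show "norm (blk N B \<kappa> (gk k z x) Q) \<le> Gb C * hgt Q powr (- 5 / 2)"
      by (rule gk_bound[OF g z x])
  next
    show "\<zeta> \<in> ball (cnj z0) (1 / (16 * C))" using zeta by (simp add: dist_norm norm_minus_commute)
  qed (rule summable_hgt')
  then obtain D where D: "(Gz z has_field_derivative D) (at \<zeta>)"
    "((\<lambda>Q. blk N B \<kappa> (\<lambda>mn. \<i> / 2 * Y * inverse (lat \<zeta> mn) ^ k) Q) has_sum D) UNIV"
    unfolding Gz_def[abs_def] Y_def by blast
  from D(2) have "D = (\<Sum>\<^sub>\<infinity>Q. \<i> / 2 * Y * blk N B \<kappa> (\<lambda>mn. inverse (lat \<zeta> mn) ^ k) Q)"
    unfolding blk_cmult by (rule infsumI[symmetric])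
  also have "\<dots> = \<i> / 2 * Y * Ez \<zeta>" unfolding Ez_def by (rule infsum_cmult_right')
  finally have De: "D = \<i> / 2 * Y * Ez \<zeta>" .
  show ?thesis using D(1) unfolding De Y_def .
qed

lemma Gz_biholo:
  assumes g: "good C z0"
  shows "biholo z0 (cnj z0) (1 / (16 * C)) Gz"
  unfolding biholo_def
proof (intro conjI ballI allI impI)
  have r: "1 / (16 * C) > 0" using g by (simp add: good_def)
  fix \<zeta> assume "\<zeta> \<in> ball (cnj z0) (1 / (16 * C))"
  hence zeta: "norm (\<zeta> - cnj z0) \<le> 1 / (16 * C)" by (simp add: dist_norm norm_minus_commute)
  have "\<exists>D. ((\<lambda>z. Gz z \<zeta>) has_field_derivative D) (at z)" if z: "z \<in> ball z0 (1 / (16 * C))" for z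
  proof -
    have "\<exists>D. ((\<lambda>z. \<Sum>\<^sub>\<infinity>Q\<in>UNIV. blk N B \<kappa> (gk k z \<zeta>) Q) has_field_derivative D) (at z) \<and>
        ((\<lambda>Q. blk N B \<kappa> (\<lambda>mn. deriv (\<lambda>z. gk k z \<zeta> mn) z) Q) has_sum D) UNIV"
    proof (rule has_field_derivative_infsum[OF r _ _ _ z])
      fix Q x assume "x \<in> cball z0 (1 / (16 * C))"
      hence x: "norm (x - z0) \<le> 1 / (16 * C)" by (simp add: dist_norm norm_minus_commute)
      note gn = good_near[OF g x zeta]
      show "((\<lambda>z. blk N B \<kappa> (gk k z \<zeta>) Q) has_field_derivative
         blk N B \<kappa> (\<lambda>mn. deriv (\<lambda>z. gk k z \<zeta> mn) x) Q) (at x)"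
      proof (rule blk_deriv)
        fix mn
        have "(\<lambda>z. gk k z \<zeta> mn) field_differentiable (at x)"
        proof (cases "mn = (0, 0)")
          case True
          thus ?thesis using k by (simp add: gk_zero)
        next
          case False
          thus ?thesis using gn by (intro gk_differentiable_z k) auto
        qed
        thus "((\<lambda>z. gk k z \<zeta> mn) has_field_derivative deriv (\<lambda>z. gk k z \<zeta> mn) x) (at x)"
          by (simp add: DERIV_deriv_iff_field_differentiable)
      qed
      show "norm (blk N B \<kappa> (gk k x \<zeta>) Q) \<le> Gb C * hgt Q powr (- 5 / 2)"
        by (rule gk_bound[OF g x zeta])
    qed (rule summable_hgt')
    thus ?thesis unfolding Gz_def[abs_def] by blast
  qed
  thus "(\<lambda>z. Gz z \<zeta>) holomorphic_on ball z0 (1 / (16 * C))"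
    by (simp add: holomorphic_on_open)
next
  fix z assume "z \<in> ball z0 (1 / (16 * C))"
  hence z: "norm (z - z0) \<le> 1 / (16 * C)" by (simp add: dist_norm norm_minus_commute)
  have "\<exists>D. (Gz z has_field_derivative D) (at x)" if "x \<in> ball (cnj z0) (1 / (16 * C))" for x
  proof -
    have "norm (x - cnj z0) < 1 / (16 * C)" using that by (simp add: dist_norm norm_minus_commute)
    from Gz_deriv_zeta[OF g z this] show ?thesis by blast
  qed
  thus "Gz z holomorphic_on ball (cnj z0) (1 / (16 * C))"
    by (simp add: holomorphic_on_open)
next
  fix s assume s: "s < 1 / (16 * C)"
  show "\<exists>M. \<forall>z\<in>ball z0 s. \<forall>\<zeta>\<in>ball (cnj z0) s. norm (Gz z \<zeta>) \<le> M"
  proof (intro exI ballI)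
    fix z \<zeta> assume "z \<in> ball z0 s" "\<zeta> \<in> ball (cnj z0) s"
    hence "norm (z - z0) < s" "norm (\<zeta> - cnj z0) < s" by (simp_all add: dist_norm norm_minus_commute)
    hence "norm (z - z0) \<le> 1 / (16 * C)" "norm (\<zeta> - cnj z0) \<le> 1 / (16 * C)" using s by linarith+
    from gk_has_sum(2)[OF g this]
    show "norm (Gz z \<zeta>) \<le> Gb C * (\<Sum>\<^sub>\<infinity>Q. hgt Q powr (- 5 / 2))" .
  qed
qed

definition Fz :: "complex \<Rightarrow> complex" where
  "Fz z = 1 / 2 * Gz z (cnj z)"

text \<open>Write E for \<open>Ez (cnj z0)\<close>. The \<zeta>-derivative of H is (i/4) y^(k-2) E,
  and a further z-derivative acts on y^(k-2) only. In the Laplacian the second-order part becomes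
  (k-2)/2 y^(k-1) E and the first-order part (2-k)/2 y^(k-1) E, and these cancel.\<close>

lemma Fz_local:
  assumes z0: "Im z0 > 0"
  shows "\<exists>r>0. \<exists>b :: nat \<Rightarrow> nat \<Rightarrow> complex. \<forall>x y :: real. \<bar>x\<bar> < r \<and> \<bar>y\<bar> < r \<longrightarrow>
     ((\<lambda>(m, n). b m n * of_real x ^ m * of_real y ^ n) has_sum Fz (z0 + Complex x y)) UNIV"
    and "wirtinger_bar Fz z0 = \<i> / 4 * of_real (Im z0) powi (int k - 2) * Ez (cnj z0)"
    and "laplace_op (2 - int k) Fz z0 = 0"
proof -
  obtain C where g: "good C z0" using good_exists[OF z0] by blast
  define r where "r = 1 / (16 * C)"
  have r: "r > 0" using g by (simp add: good_def r_def)
  define H where "H = (\<lambda>z \<zeta>. 1 / 2 * Gz z \<zeta>)"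
  have bG: "biholo z0 (cnj z0) r Gz" using Gz_biholo[OF g] by (simp add: r_def)
  have H: "biholo z0 (cnj z0) r H"
    unfolding biholo_def
  proof (intro conjI ballI allI impI)
    show "(\<lambda>z. H z \<zeta>) holomorphic_on ball z0 r" if "\<zeta> \<in> ball (cnj z0) r" for \<zeta>
      using bG that unfolding biholo_def H_def by (intro holomorphic_intros) auto
    show "H z holomorphic_on ball (cnj z0) r" if "z \<in> ball z0 r" for z
      using bG that unfolding biholo_def H_def by (intro holomorphic_intros) auto
    fix s assume "s < r"
    then obtain M where M: "\<forall>z\<in>ball z0 s. \<forall>\<zeta>\<in>ball (cnj z0) s. norm (Gz z \<zeta>) \<le> M"
      using bG unfolding biholo_def by blast
    show "\<exists>M. \<forall>z\<in>ball z0 s. \<forall>\<zeta>\<in>ball (cnj z0) s. norm (H z \<zeta>) \<le> M"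
    proof (intro exI[of _ "1 / 2 * M"] ballI)
      fix z \<zeta> assume "z \<in> ball z0 s" "\<zeta> \<in> ball (cnj z0) s"
      hence "norm (Gz z \<zeta>) \<le> M" using M by blast
      thus "norm (H z \<zeta>) \<le> 1 / 2 * M" by (simp add: H_def norm_mult)
    qed
  qed
  have FH: "Fz z = H z (cnj z)" for z by (simp add: Fz_def H_def)
  note D = biholo_diagonal[OF H r FH]
  show "\<exists>r>0. \<exists>b :: nat \<Rightarrow> nat \<Rightarrow> complex. \<forall>x y :: real. \<bar>x\<bar> < r \<and> \<bar>y\<bar> < r \<longrightarrow>
     ((\<lambda>(m, n). b m n * of_real x ^ m * of_real y ^ n) has_sum Fz (z0 + Complex x y)) UNIV"
    by (rule D(1))
  define E where "E = Ez (cnj z0)"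
  have dH: "deriv (H z) (cnj z0) = \<i> / 4 * ((z - cnj z0) / (2 * \<i>)) powi (int k - 2) * E"
    if "norm (z - z0) < r" for z
  proof (rule DERIV_imp_deriv)
    have "(Gz z has_field_derivative (\<i> / 2 * ((z - cnj z0) / (2 * \<i>)) powi (int k - 2) * Ez (cnj z0))) (at (cnj z0))"
      by (rule Gz_deriv_zeta[OF g]) (use that r in \<open>auto simp: r_def\<close>)
    from DERIV_cmult[OF this, of "1 / 2"]
    show "(H z has_field_derivative \<i> / 4 * ((z - cnj z0) / (2 * \<i>)) powi (int k - 2) * E) (at (cnj z0))"
      by (simp add: H_def E_def)
  qed
  define y where "y = complex_of_real (Im z0)"
  have y: "(z0 - cnj z0) / (2 * \<i>) = y" by (simp only: diff_cnj_div y_def)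
  have y0: "y \<noteq> 0" using z0 by (simp add: y_def)
  have d1: "deriv (H z0) (cnj z0) = \<i> / 4 * y powi (int k - 2) * E"
    using dH[of z0] r y by simp
  show "wirtinger_bar Fz z0 = \<i> / 4 * of_real (Im z0) powi (int k - 2) * Ez (cnj z0)"
    using D(2) d1 by (simp add: y_def E_def)
  \<comment> \<open>\<open>biholo_diagonal\<close> has the z-derivative inside; the order is
    exchanged because the \<zeta>-derivative is the explicit one.\<close>
  have "deriv (\<lambda>\<zeta>. deriv (\<lambda>z. H z \<zeta>) z0) (cnj z0) = deriv (\<lambda>z. deriv (H z) (cnj z0)) z0"
    by (rule biholo_mixed[OF H r])
  also have "\<dots> = \<i> / 4 * (of_int (int k - 2) * y powi (int k - 2 - 1) * (1 / (2 * \<i>))) * E"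
  proof (rule DERIV_imp_deriv)
    have dY: "((\<lambda>z. (z - cnj z0) / (2 * \<i>)) has_field_derivative (1 / (2 * \<i>))) (at z0)"
      by (auto intro!: derivative_eq_intros)
    have "((\<lambda>z. ((z - cnj z0) / (2 * \<i>)) powi (int k - 2)) has_field_derivative
        of_int (int k - 2) * y powi (int k - 2 - 1) * (1 / (2 * \<i>))) (at z0)"
      by (rule DERIV_chain2[OF _ dY]) (unfold y, rule powi_deriv[OF y0])
    hence "((\<lambda>z. \<i> / 4 * ((z - cnj z0) / (2 * \<i>)) powi (int k - 2) * E) has_field_derivative
        \<i> / 4 * (of_int (int k - 2) * y powi (int k - 2 - 1) * (1 / (2 * \<i>))) * E) (at z0)"
      by (intro DERIV_cmult_right DERIV_cmult)
    thus "((\<lambda>z. deriv (H z) (cnj z0)) has_field_derivative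
        \<i> / 4 * (of_int (int k - 2) * y powi (int k - 2 - 1) * (1 / (2 * \<i>))) * E) (at z0)"
    proof (rule has_field_derivative_transform_within_open[of _ _ _ "ball z0 r"])
      fix x assume "x \<in> ball z0 r"
      hence "norm (x - z0) < r" by (simp add: dist_norm norm_minus_commute)
      from dH[OF this] show "\<i> / 4 * ((x - cnj z0) / (2 * \<i>)) powi (int k - 2) * E = deriv (H x) (cnj z0)" ..
    qed (use r in auto)
  qed
  also have "\<i> / 4 * (x * (1 / (2 * \<i>))) * E = x * E / 8" for x
    by (simp add: field_simps)
  finally have d2: "deriv (\<lambda>\<zeta>. deriv (\<lambda>z. H z \<zeta>) z0) (cnj z0) =
      of_int (int k - 2) * y powi (int k - 2 - 1) * E / 8" .
  have yy: "y ^ 2 * y powi (int k - 2 - 1) = y * y powi (int k - 2)"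
  proof -
    have "y powi (int k - 2) = y powi (1 + (int k - 2 - 1))" by simp
    also have "\<dots> = y * y powi (int k - 2 - 1)" using y0 by (subst power_int_add) auto
    finally show ?thesis by (simp add: power2_eq_square mult.assoc)
  qed
  have "laplace_op (2 - int k) Fz z0 = y ^ 2 * (4 * (of_int (int k - 2) * y powi (int k - 2 - 1) * E / 8))
      - \<i> * of_int (2 - int k) * y * (2 * (\<i> / 4 * y powi (int k - 2) * E))"
    unfolding laplace_op_def D(3) D(4) d1 d2 y_def[symmetric] ..
  also have "\<dots> = of_int (int k - 2) * E / 2 * (y ^ 2 * y powi (int k - 2 - 1)) +
      of_int (2 - int k) * E / 2 * (y * y powi (int k - 2))"
  proof -
    have e1: "a * (4 * (n * P * E / 8)) = n * E / 2 * (a * P)" for a n P by simp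
    have e2: "\<i> * m * b * (2 * (\<i> / 4 * R * E)) = - (m * E / 2 * (b * R))" for m b R
      by (simp add: algebra_simps)
    show ?thesis unfolding e1 e2 by simp
  qed
  also have "\<dots> = (of_int (int k - 2) + of_int (2 - int k)) * E / 2 * (y * y powi (int k - 2))"
    unfolding yy by (simp only: distrib_right add_divide_distrib)
  also have "\<dots> = 0" by simp
  finally show "laplace_op (2 - int k) Fz z0 = 0" .
qed

lemma Fz_real_analytic: "real_analytic_on Fz upper_half_plane"
  unfolding real_analytic_on_def upper_half_plane_def using Fz_local(1) by auto

lemma Fz_xi:
  assumes "Im z > 0"
  shows "xi_op (2 - int k) Fz z = 1 / 2 * cnj (Ez (cnj z))"
proof -
  define y where "y = complex_of_real (Im z)"
  have y: "y \<noteq> 0" "cnj y = y" using assms by (auto simp: y_def)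
  have "y powi (2 - int k) * y powi (int k - 2) = y powi (2 - int k + (int k - 2))"
    using y by (subst power_int_add) auto
  hence yy: "y powi (2 - int k) * y powi (int k - 2) = 1" by simp
  have "cnj (y powi (int k - 2)) = y powi (int k - 2)" using y by (simp add: complex_cnj_power_int)
  hence "xi_op (2 - int k) Fz z = (y powi (2 - int k) * y powi (int k - 2)) * (1 / 2 * cnj (Ez (cnj z)))"
    unfolding xi_op_def Fz_local(2)[OF assms] y_def[symmetric] by simp
  thus ?thesis unfolding yy by simp
qed

text \<open>On the strip the constant of \<open>good_exists\<close> is at most 2 + 2R + Im z, and
  \<open>Gb\<close> is at most exponential in it. The coefficient c = 2k + 12 adds up the
  coefficients 4, k + 6 and k + 2 of C in the three exponentials.\<close>

lemma Fz_growth: "\<exists>A c. \<forall>z. Im z \<ge> 1 \<longrightarrow> \<bar>Re z\<bar> \<le> R \<longrightarrow> norm (Fz z) \<le> A * exp (c * Im z)"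
proof -
  define T where "T = (\<Sum>\<^sub>\<infinity>Q. hgt Q powr (- 5 / 2))"
  have T: "T \<ge> 0" unfolding T_def by (rule infsum_nonneg) auto
  define c where "c = 2 * real k + 12"
  define A0 where "A0 = Sk * 2 * (4 / 3) ^ k * exp pi * (4096 * 4096 * real N ^ 2) * 9 * exp (4 + 2 * (real k + 6) + real (k + 2))"
  have A0: "A0 \<ge> 0" unfolding A0_def using Sk_nonneg by (intro mult_nonneg_nonneg) auto
  have GbA: "Gb C \<le> A0 * exp (c * C)" if C: "C \<ge> 1" for C
  proof -
    have "8 + exp (real (k + 2) * (C + 1)) \<le> 9 * exp (real (k + 2) * (C + 1))" using C by simp
    hence "Gb C \<le> Kb 1 C * (9 * exp (real (k + 2) * (C + 1)))"
      unfolding Gb_def by (intro mult_left_mono Kb_nonneg)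
    also have "\<dots> = Sk * 2 * (4 / 3) ^ k * exp pi * (4096 * 4096 * real N ^ 2) * 9 *
        (exp ((1 + 1) * (2 + 2 * C)) * exp ((real k + 6) * (C + 2)) * exp (real (k + 2) * (C + 1)))"
      by (simp add: Kb_def fab_const_def mult_ac)
    also have "exp ((1 + 1) * (2 + 2 * C)) * exp ((real k + 6) * (C + 2)) * exp (real (k + 2) * (C + 1)) =
        exp (4 + 2 * (real k + 6) + real (k + 2)) * exp (c * C)"
      unfolding exp_add[symmetric] by (rule arg_cong[of _ _ exp]) (simp add: c_def algebra_simps)
    finally show ?thesis by (simp add: A0_def mult.assoc)
  qed
  show ?thesis
  proof (intro exI allI impI)
    fix z assume z: "Im z \<ge> 1" "\<bar>Re z\<bar> \<le> R"
    define C where "C = 1 + norm z + (1 + \<bar>Re z\<bar>) / Im z"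
    have g: "good C z" unfolding C_def by (rule good_exists) (use z in auto)
    have C1: "C \<ge> 1" using g by (simp add: good_def)
    have "norm z \<le> R + Im z" using cmod_le[of z] z by simp
    moreover have "(1 + \<bar>Re z\<bar>) / Im z \<le> (1 + R) / 1" using z by (intro frac_le) auto
    ultimately have CR: "C \<le> 2 + 2 * R + Im z" by (simp add: C_def)
    have "norm (Gz z (cnj z)) \<le> Gb C * T"
      unfolding T_def by (rule gk_has_sum(2)[OF g]) (use C1 in auto)
    also have "\<dots> \<le> (A0 * exp (c * (2 + 2 * R + Im z))) * T"
    proof (intro mult_right_mono T order_trans[OF GbA[OF C1]] mult_left_mono A0)
      show "exp (c * C) \<le> exp (c * (2 + 2 * R + Im z))"
        using CR by (simp add: c_def mult_left_mono)
    qed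
    also have "\<dots> = (A0 * exp (c * (2 + 2 * R)) * T) * exp (c * Im z)"
      by (simp add: distrib_left exp_add mult_ac)
    finally have "norm (Gz z (cnj z)) \<le> (A0 * exp (c * (2 + 2 * R)) * T) * exp (c * Im z)" .
    moreover have "norm (Fz z) \<le> norm (Gz z (cnj z))" by (simp add: Fz_def norm_mult)
    ultimately show "norm (Fz z) \<le> (A0 * exp (c * (2 + 2 * R)) * T) * exp (c * Im z)" by linarith
  qed
qed

lemma Ez_eq_Su: "Ez (cnj z) = Su 0 k z 0"
  by (simp add: Ez_def Su_def fab_def)

lemma Fz_eq_Su:
  assumes "k \<ge> 2"
  shows "Fz z = of_real (Im z) ^ (k - 1) / of_nat (k - 1) * (1 / 2 * Su 1 (k - 1) z 0)"
proof -
  have y: "(z - cnj z) / (2 * \<i>) = of_real (Im z)" by (rule diff_cnj_div)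
  have "gk k z (cnj z) = (\<lambda>mn. of_real (Im z) ^ (k - 1) / of_nat (k - 1) *
      fab 1 (k - 1) 0 (lat z mn) (lat (cnj z) mn))"
    unfolding gk_def y fab_def using assms by (intro ext) simp
  hence "Gz z (cnj z) = (\<Sum>\<^sub>\<infinity>Q. of_real (Im z) ^ (k - 1) / of_nat (k - 1) *
      blk N B \<kappa> (\<lambda>mn. fab 1 (k - 1) 0 (lat z mn) (lat (cnj z) mn)) Q)"
    unfolding Gz_def blk_cmult[symmetric] by (simp only:)
  also have "\<dots> = of_real (Im z) ^ (k - 1) / of_nat (k - 1) * Su 1 (k - 1) z 0"
    unfolding Su_def by (rule infsum_cmult_right')
  finally show ?thesis by (simp add: Fz_def)
qed

text \<open>In weight 1 the harmonic form is a derivative at 0. The product rule gives Ln y times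
  the value plus the derivative of the sum, in agreement with the two logarithms in
  \<open>gk\<close>.\<close>

lemma Fz_eq_deriv:
  assumes k1: "k = 1" and z: "Im z > 0"
  shows "((\<lambda>u. of_real (Im z) powr u * (1 / 2 * Su 1 0 z u)) has_field_derivative Fz z) (at 0)"
proof -
  define y where "y = complex_of_real (Im z)"
  have y0: "y \<noteq> 0" using z by (simp add: y_def)
  have y: "(z - cnj z) / (2 * \<i>) = y" by (simp only: diff_cnj_div y_def)
  have u0: "Re 0 > - 1 / 4" by simp
  have ab: "1 + 0 = k" using k1 by simp
  have ge: "gk k z (cnj z) = (\<lambda>mn. Ln y * fab 1 0 0 (lat z mn) (lat (cnj z) mn) +
      fab 1 0 0 (lat z mn) (lat (cnj z) mn) * (- Ln (lat z mn * lat (cnj z) mn)))"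
    unfolding gk_def y fab_def using k1 by (intro ext) (simp add: algebra_simps)
  obtain D where D: "(Su 1 0 z has_field_derivative D) (at 0)"
    "((\<lambda>Q. blk N B \<kappa> (\<lambda>mn. fab 1 0 0 (lat z mn) (lat (cnj z) mn) * (- Ln (lat z mn * lat (cnj z) mn))) Q) has_sum D) UNIV"
    using Su_deriv[OF ab z u0] by blast
  from has_sum_add[OF has_sum_cmult_right[OF Su_has_sum[OF ab z u0], of "Ln y"] D(2)]
  have "((\<lambda>Q. blk N B \<kappa> (gk k z (cnj z)) Q) has_sum (Ln y * Su 1 0 z 0 + D)) UNIV"
    unfolding blk_cmult[symmetric] blk_add[symmetric] ge .
  hence "Gz z (cnj z) = Ln y * Su 1 0 z 0 + D" unfolding Gz_def by (rule infsumI)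
  moreover have "((\<lambda>u. y powr u * (1 / 2 * Su 1 0 z u)) has_field_derivative
      (Ln y * y powr 0) * (1 / 2 * Su 1 0 z 0) + (1 / 2 * D) * y powr 0) (at 0)"
  proof (rule DERIV_mult)
    show "((\<lambda>u. y powr u) has_field_derivative Ln y * y powr 0) (at 0)"
      using y0 by (auto simp: powr_def intro!: derivative_eq_intros)
    show "((\<lambda>u. 1 / 2 * Su 1 0 z u) has_field_derivative (1 / 2 * D)) (at 0)"
      by (rule DERIV_cmult[OF D(1)])
  qed
  ultimately show ?thesis using y0 by (simp add: y_def[symmetric] Fz_def algebra_simps)
qed

end

section \<open>Periodic weights on the lattice and the correction of their moments\<close>

definition pbox :: "nat \<Rightarrow> (int \<times> int) set" where "pbox N = {0..<int N} \<times> {0..<int N}"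
definition pcbox :: "nat \<Rightarrow> (int \<times> int) set" where "pcbox N = {0..int N} \<times> {0..int N}"

definition al :: "nat \<Rightarrow> (int \<times> int \<Rightarrow> complex) \<Rightarrow> complex" where
  "al N \<phi> = (\<Sum>b\<in>pbox N. of_int (fst b) * \<phi> b)"
definition be :: "nat \<Rightarrow> (int \<times> int \<Rightarrow> complex) \<Rightarrow> complex" where
  "be N \<phi> = (\<Sum>b\<in>pbox N. of_int (snd b) * \<phi> b)"

text \<open>For \<open>k \<le> 2\<close> the restriction of \<open>\<phi>\<close> to one period is corrected by multiples of
  \<open>\<delta>\<^bsub>(N, 0)\<^esub> - \<delta>\<^bsub>(0, 0)\<^esub>\<close> and \<open>\<delta>\<^bsub>(0, N)\<^esub> - \<delta>\<^bsub>(0, 0)\<^esub>\<close>, which cancel in the sum over all periods but make the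
  first moments vanish.\<close>

definition kap :: "nat \<Rightarrow> nat \<Rightarrow> (int \<times> int \<Rightarrow> complex) \<Rightarrow> int \<times> int \<Rightarrow> complex" where
  "kap k N \<phi> b = (if b \<in> pbox N then \<phi> b else 0) + (if k \<ge> 3 then 0 else
     - al N \<phi> / of_nat N * ((if b = (int N, 0) then 1 else 0) - (if b = (0, 0) then 1 else 0))
     - be N \<phi> / of_nat N * ((if b = (0, int N) then 1 else 0) - (if b = (0, 0) then 1 else 0)))"

definition periodic :: "nat \<Rightarrow> (int \<times> int \<Rightarrow> complex) \<Rightarrow> bool" where
  "periodic N \<phi> \<longleftrightarrow> (\<forall>m n. \<phi> (m + int N, n) = \<phi> (m, n) \<and> \<phi> (m, n + int N) = \<phi> (m, n))"

text \<open>The corrections in \<open>kap\<close> have total weight 0, so they cannot create a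
  vanishing zeroth moment; for k \<le> 2 it is demanded of \<phi>.\<close>

definition admissible :: "nat \<Rightarrow> nat \<Rightarrow> (int \<times> int \<Rightarrow> complex) \<Rightarrow> bool" where
  "admissible k N \<phi> \<longleftrightarrow> k \<ge> 1 \<and> N \<ge> 1 \<and> periodic N \<phi> \<and> (k \<ge> 3 \<or> (\<Sum>b\<in>pbox N. \<phi> b) = 0)"

lemma finite_box: "finite (pbox N)" "finite (pcbox N)"
  by (auto simp: pbox_def pcbox_def)

lemma box_subset: "pbox N \<subseteq> pcbox N"
  by (auto simp: pbox_def pcbox_def)

lemma periodic_mult:
  assumes "periodic N \<phi>"
  shows "\<phi> (m + int N * p, n + int N * q) = \<phi> (m, n)"
proof -
  have 1: "\<phi> (m + int N * int p, n) = \<phi> (m, n)" for p m n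
  proof (induction p)
    case (Suc p)
    have "\<phi> (m + int N * int (Suc p), n) = \<phi> (m + int N * int p + int N, n)" by (simp add: algebra_simps)
    also have "\<dots> = \<phi> (m + int N * int p, n)" using assms unfolding periodic_def by blast
    finally show ?case using Suc by simp
  qed simp
  have 2: "\<phi> (m, n + int N * int p) = \<phi> (m, n)" for p m n
  proof (induction p)
    case (Suc p)
    have "\<phi> (m, n + int N * int (Suc p)) = \<phi> (m, n + int N * int p + int N)" by (simp add: algebra_simps)
    also have "\<dots> = \<phi> (m, n + int N * int p)" using assms unfolding periodic_def by blast
    finally show ?case using Suc by simp
  qed simp
  have 3: "\<phi> (m + int N * p, n) = \<phi> (m, n)" for m n p
  proof (cases p rule: int_cases2)
    case (nonpos i)
    thus ?thesis using 1[of "m + int N * p" i n] by simp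
  qed (simp add: 1)
  have 4: "\<phi> (m, n + int N * p) = \<phi> (m, n)" for m n p
  proof (cases p rule: int_cases2)
    case (nonpos i)
    thus ?thesis using 2[of m "n + int N * p" i] by simp
  qed (simp add: 2)
  show ?thesis by (simp add: 3 4)
qed

lemma periodic_mod:
  assumes "periodic N \<phi>"
  shows "\<phi> (m mod int N, n mod int N) = \<phi> (m, n)"
proof -
  have "\<phi> (m, n) = \<phi> (m mod int N + int N * (m div int N), n mod int N + int N * (n div int N))" by simp
  also have "\<dots> = \<phi> (m mod int N, n mod int N)" by (rule periodic_mult[OF assms])
  finally show ?thesis ..
qed

lemma periodic_bounded:
  assumes "periodic N \<phi>" "N \<ge> 1"
  obtains M where "M \<ge> 0" "\<And>mn. norm (\<phi> mn) \<le> M"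
proof
  show "(\<Sum>b\<in>pbox N. norm (\<phi> b)) \<ge> 0" by (rule sum_nonneg) auto
  fix mn :: "int \<times> int"
  obtain m n where mn: "mn = (m, n)" by force
  have "(m mod int N, n mod int N) \<in> pbox N" using assms(2) by (auto simp: pbox_def)
  hence "norm (\<phi> (m mod int N, n mod int N)) \<le> (\<Sum>b\<in>pbox N. norm (\<phi> b))"
    by (rule member_le_sum) (auto simp: finite_box)
  thus "norm (\<phi> mn) \<le> (\<Sum>b\<in>pbox N. norm (\<phi> b))" by (simp add: mn periodic_mod[OF assms(1)])
qed

lemma sum_kap:
  assumes "N \<ge> 1"
  shows "(\<Sum>b\<in>pcbox N. kap k N \<phi> b * g b) = (\<Sum>b\<in>pbox N. \<phi> b * g b) + (if k \<ge> 3 then 0 else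
     - al N \<phi> / of_nat N * (g (int N, 0) - g (0, 0)) - be N \<phi> / of_nat N * (g (0, int N) - g (0, 0)))"
proof -
  have d: "(\<Sum>b\<in>pcbox N. (if b = x then 1 else 0) * g b) = g x" if "x \<in> pcbox N" for x
  proof -
    have "(\<Sum>b\<in>pcbox N. (if b = x then 1 else 0) * g b) = (\<Sum>b\<in>pcbox N. if b = x then g b else 0)"
      by (intro sum.cong) auto
    also have "\<dots> = g x" using that by (subst sum.delta) (auto simp: finite_box)
    finally show ?thesis .
  qed
  have x: "(int N, 0) \<in> pcbox N" "(0, 0) \<in> pcbox N" "(0, int N) \<in> pcbox N" by (auto simp: pcbox_def)
  have b: "(\<Sum>b\<in>pcbox N. (if b \<in> pbox N then \<phi> b else 0) * g b) = (\<Sum>b\<in>pbox N. \<phi> b * g b)"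
  proof -
    have "(\<Sum>b\<in>pcbox N. (if b \<in> pbox N then \<phi> b else 0) * g b) = (\<Sum>b\<in>pcbox N. if b \<in> pbox N then \<phi> b * g b else 0)"
      by (intro sum.cong) auto
    also have "\<dots> = (\<Sum>b\<in>pcbox N \<inter> pbox N. \<phi> b * g b)" by (rule sum.inter_restrict[OF finite_box(2), symmetric])
    also have "pcbox N \<inter> pbox N = pbox N" using box_subset by blast
    finally show ?thesis .
  qed
  show ?thesis
  proof (cases "k \<ge> 3")
    case True
    thus ?thesis using b by (simp add: kap_def)
  next
    case False
    have "(\<Sum>b\<in>pcbox N. kap k N \<phi> b * g b) =
        (\<Sum>b\<in>pcbox N. (if b \<in> pbox N then \<phi> b else 0) * g b +
          (- al N \<phi> / of_nat N * ((if b = (int N, 0) then 1 else 0) * g b - (if b = (0, 0) then 1 else 0) * g b)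
           - be N \<phi> / of_nat N * ((if b = (0, int N) then 1 else 0) * g b - (if b = (0, 0) then 1 else 0) * g b)))"
      using False by (intro sum.cong refl) (simp add: kap_def algebra_simps)
    also have "\<dots> = (\<Sum>b\<in>pbox N. \<phi> b * g b) + (- al N \<phi> / of_nat N * (g (int N, 0) - g (0, 0))
        - be N \<phi> / of_nat N * (g (0, int N) - g (0, 0)))"
      unfolding sum.distrib sum_subtractf sum_distrib_left[symmetric] b d[OF x(1)] d[OF x(2)] d[OF x(3)] ..
    finally show ?thesis using False by simp
  qed
qed

lemma latsum_kap:
  assumes "admissible k N \<phi>"
  shows "latsum N (pcbox N) (kap k N \<phi>) k"
proof
  have N: "N \<ge> 1" and k: "k \<ge> 1" and z: "k \<ge> 3 \<or> (\<Sum>b\<in>pbox N. \<phi> b) = 0"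
    using assms by (auto simp: admissible_def)
  show "finite (pcbox N)" "N \<ge> 1" "k \<ge> 1" by (fact finite_box N k)+
  show "pcbox N \<subseteq> {0..int N} \<times> {0..int N}" by (simp add: pcbox_def)
  show "3 \<le> k \<or> (\<Sum>b\<in>pcbox N. kap k N \<phi> b) = 0 \<and>
    (\<Sum>b\<in>pcbox N. kap k N \<phi> b * of_int (fst b)) = 0 \<and> (\<Sum>b\<in>pcbox N. kap k N \<phi> b * of_int (snd b)) = 0"
  proof (cases "k \<ge> 3")
    case False
    have "(\<Sum>b\<in>pcbox N. kap k N \<phi> b * 1) = 0" unfolding sum_kap[OF N] using z False by simp
    moreover have "(\<Sum>b\<in>pcbox N. kap k N \<phi> b * of_int (fst b)) = 0"
      unfolding sum_kap[OF N] using False N by (simp add: al_def mult.commute)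
    moreover have "(\<Sum>b\<in>pcbox N. kap k N \<phi> b * of_int (snd b)) = 0"
      unfolding sum_kap[OF N] using False N by (simp add: be_def mult.commute)
    ultimately show ?thesis by simp
  qed simp
qed

lemma blk_kap:
  assumes "N \<ge> 1"
  shows "blk N (pcbox N) (kap k N \<phi>) g Q = (\<Sum>b\<in>pbox N. \<phi> b * g (int N * fst Q + fst b, int N * snd Q + snd b)) +
    (if k \<ge> 3 then 0 else
     - al N \<phi> / of_nat N * (g (int N * (fst Q + 1), int N * snd Q) - g (int N * fst Q, int N * snd Q))
     - be N \<phi> / of_nat N * (g (int N * fst Q, int N * (snd Q + 1)) - g (int N * fst Q, int N * snd Q)))"
  unfolding blk_def by (subst sum_kap[OF assms]) (simp add: algebra_simps)

text \<open>Under absolute convergence each correction contributes the difference of two sums over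
  the multiples of N that agree after shifting the block index by one, hence nothing.\<close>

lemma has_sum_blk_kap:
  fixes g :: "int \<times> int \<Rightarrow> complex"
  assumes N: "N \<ge> 1" and per: "periodic N \<phi>" and g: "g summable_on UNIV"
    and S: "((\<lambda>mn. \<phi> mn * g mn) has_sum S) UNIV"
  shows "(blk N (pcbox N) (kap k N \<phi>) g has_sum S) UNIV"
proof -
  have "((\<lambda>(Q, b). \<phi> b * g (int N * fst Q + fst b, int N * snd Q + snd b)) has_sum S) (UNIV \<times> pbox N)"
  proof (rule iffD2[OF has_sum_reindex_bij_witness[where T = UNIV
        and j = "\<lambda>(Q, b). (int N * fst Q + fst b, int N * snd Q + snd b)"
        and i = "\<lambda>mn. ((fst mn div int N, snd mn div int N), (fst mn mod int N, snd mn mod int N))"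
        and h = "\<lambda>mn. \<phi> mn * g mn"] S])
    fix a :: "(int \<times> int) \<times> int \<times> int" assume a: "a \<in> UNIV \<times> pbox N"
    obtain p q i j where ae: "a = ((p, q), (i, j))" by (metis surj_pair)
    have ij: "0 \<le> i" "i < int N" "0 \<le> j" "j < int N" using a by (auto simp: ae pbox_def)
    have dv: "(int N * P + I) div int N = P" "(int N * P + I) mod int N = I" if "0 \<le> I" "I < int N" for P I
      using that by (simp_all add: div_mult_self4 add.commute)
    show "(case case a of (Q, b) \<Rightarrow> (int N * fst Q + fst b, int N * snd Q + snd b) of
        mn \<Rightarrow> ((fst mn div int N, snd mn div int N), (fst mn mod int N, snd mn mod int N))) = a"
      using ij by (simp add: ae dv[OF ij(1,2)] dv[OF ij(3,4)] mod_pos_pos_trivial)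
    show "\<phi> (case a of (Q, b) \<Rightarrow> (int N * fst Q + fst b, int N * snd Q + snd b)) *
        g (case a of (Q, b) \<Rightarrow> (int N * fst Q + fst b, int N * snd Q + snd b)) =
       (case a of (Q, b) \<Rightarrow> \<phi> b * g (int N * fst Q + fst b, int N * snd Q + snd b))"
      using periodic_mult[OF per, of i p j q] by (simp add: ae add.commute)
  qed (use N in \<open>auto simp: pbox_def\<close>)
  hence 1: "((\<lambda>Q. \<Sum>b\<in>pbox N. \<phi> b * g (int N * fst Q + fst b, int N * snd Q + snd b)) has_sum S) UNIV"
    by (rule has_sum_SigmaD) (auto intro!: has_sum_finiteI simp: finite_box)
  have "g summable_on ((\<lambda>Q. (int N * fst Q, int N * snd Q)) ` UNIV)"
    using g by (rule summable_on_subset_banach) auto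
  hence "(g \<circ> (\<lambda>Q. (int N * fst Q, int N * snd Q))) summable_on UNIV"
    by (subst (asm) summable_on_reindex) (use N in \<open>auto intro!: injI\<close>)
  then obtain T where T: "((\<lambda>Q. g (int N * fst Q, int N * snd Q)) has_sum T) UNIV"
    by (auto simp: summable_on_def o_def)
  have T1: "((\<lambda>Q. g (int N * (fst Q + 1), int N * snd Q)) has_sum T) UNIV"
    by (rule iffD2[OF has_sum_reindex_bij_witness[where T = UNIV and j = "\<lambda>Q. (fst Q + 1, snd Q)"
      and i = "\<lambda>Q. (fst Q - 1, snd Q)"] T]) auto
  have T2: "((\<lambda>Q. g (int N * fst Q, int N * (snd Q + 1))) has_sum T) UNIV"
    by (rule iffD2[OF has_sum_reindex_bij_witness[where T = UNIV and j = "\<lambda>Q. (fst Q, snd Q + 1)"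
      and i = "\<lambda>Q. (fst Q, snd Q - 1)"] T]) auto
  have 2: "((\<lambda>Q. g (int N * (fst Q + 1), int N * snd Q) - g (int N * fst Q, int N * snd Q)) has_sum 0) UNIV"
    using has_sum_add[OF T1 has_sum_uminusI[OF T]] by simp
  have 3: "((\<lambda>Q. g (int N * fst Q, int N * (snd Q + 1)) - g (int N * fst Q, int N * snd Q)) has_sum 0) UNIV"
    using has_sum_add[OF T2 has_sum_uminusI[OF T]] by simp
  show ?thesis
  proof (cases "k \<ge> 3")
    case True
    thus ?thesis using 1 by (simp add: blk_kap[OF N, abs_def])
  next
    case False
    from has_sum_add[OF 1 has_sum_add[OF has_sum_cmult_right[OF 2, of "- al N \<phi> / of_nat N"]
       has_sum_uminusI[OF has_sum_cmult_right[OF 3, of "be N \<phi> / of_nat N"]]]]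
    show ?thesis using False by (simp add: blk_kap[OF N, abs_def])
  qed
qed

lemma fab_diag:
  assumes "w \<noteq> 0"
  shows "fab a b u w (cnj w) = inverse w ^ a * inverse (cnj w) ^ b * of_real (norm w) powr (- 2 * u)"
proof -
  have "w * cnj w = of_real (norm w ^ 2)" by (rule complex_norm_square[symmetric])
  moreover have "norm w ^ 2 > 0" using assms by simp
  ultimately have "Ln (w * cnj w) = of_real (ln (norm w ^ 2))" by (simp only: Ln_of_real)
  also have "ln (norm w ^ 2) = 2 * ln (norm w)" using assms by (simp add: ln_realpow)
  finally have L: "Ln (w * cnj w) = of_real (2 * ln (norm w))" .
  have "of_real (norm w) powr (- 2 * u) = exp (- 2 * u * of_real (ln (norm w)))"
    using assms by (simp add: powr_def Ln_of_real)
  also have "\<dots> = exp (- u * Ln (w * cnj w))" unfolding L by (simp add: mult_ac)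
  finally show ?thesis by (simp add: fab_def)
qed

lemma norm_fab_diag:
  assumes "w \<noteq> 0"
  shows "norm (fab a b u w (cnj w)) = norm w powr (- (real (a + b) + 2 * Re u))"
proof -
  have n: "norm w > 0" using assms by simp
  have "norm (of_real (norm w) powr (- 2 * u)) = norm w powr (- 2 * Re u)"
    using n by (subst norm_powr_real_powr) auto
  moreover have "norm (inverse w ^ a * inverse (cnj w) ^ b) = norm w powr (- real (a + b))"
  proof -
    have "norm (inverse w ^ a * inverse (cnj w) ^ b) = inverse (norm w) ^ (a + b)"
      by (simp add: norm_mult norm_power norm_inverse power_add)
    thus ?thesis unfolding powr_minus powr_realpow[OF n] power_inverse .
  qed
  ultimately have "norm (fab a b u w (cnj w)) = norm w powr (- real (a + b)) * norm w powr (- 2 * Re u)"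
    unfolding fab_diag[OF assms] norm_mult by simp
  thus ?thesis by (simp add: powr_add[symmetric])
qed

lemma fab_summable:
  assumes z: "Im z > 0" and ab: "a + b \<ge> 1" and u: "real (a + b) + 2 * Re u > 2"
  shows "(\<lambda>mn. norm (fab a b u (lat z mn) (lat (cnj z) mn))) summable_on UNIV"
proof -
  obtain C where g: "good C z" using good_exists[OF z] by blast
  have C: "C \<ge> 1" using g by (simp add: good_def)
  define s where "s = real (a + b) + 2 * Re u"
  have s: "s > 2" using u by (simp add: s_def)
  show ?thesis
  proof (rule Infinite_Sum.abs_summable_on_comparison_test'[where
        f = "\<lambda>mn. fab a b u (lat z mn) (lat (cnj z) mn)" and g = "\<lambda>mn. (2 * C) powr s * hgt mn powr (- s)"])
    show "(\<lambda>mn. (2 * C) powr s * hgt mn powr (- s)) summable_on UNIV"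
      by (intro summable_on_cmult_right summable_hgt s)
    fix mn :: "int \<times> int"
    show "norm (fab a b u (lat z mn) (lat (cnj z) mn)) \<le> (2 * C) powr s * hgt mn powr (- s)"
    proof (cases "mn = (0, 0)")
      case True
      thus ?thesis using fab_zero[OF ab] by simp
    next
      case False
      note gl = good_lat[OF g False]
      have "\<bar>of_int (fst mn)\<bar> + \<bar>of_int (snd mn)\<bar> \<le> C * norm (lat z mn)"
        using g unfolding good_def by blast
      hence h: "hgt mn / (2 * C) \<le> norm (lat z mn)"
        using gl C by (simp add: hgt_def field_simps)
      have "norm (fab a b u (lat z mn) (lat (cnj z) mn)) = norm (lat z mn) powr (- s)"
        unfolding s_def using norm_fab_diag[OF gl(2)] by (simp add: cnj_lat)
      also have "\<dots> \<le> (hgt mn / (2 * C)) powr (- s)"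
        using s h C hgt_ge_1[of mn] by (intro powr_mono2') auto
      also have "\<dots> = (2 * C) powr s * hgt mn powr (- s)"
        using C hgt_ge_1[of mn] by (simp add: powr_divide powr_minus_divide)
      finally show ?thesis .
    qed
  qed
qed

definition Ser :: "(int \<times> int \<Rightarrow> complex) \<Rightarrow> nat \<Rightarrow> nat \<Rightarrow> complex \<Rightarrow> complex \<Rightarrow> complex" where
  "Ser \<phi> a b z u = (\<Sum>\<^sub>\<infinity>mn. \<phi> mn * fab a b u (lat z mn) (lat (cnj z) mn))"

lemma Ser_has_sum:
  assumes z: "Im z > 0" and ab: "a + b \<ge> 1" and u: "real (a + b) + 2 * Re u > 2"
    and \<phi>: "periodic N \<phi>" "N \<ge> 1"
  shows "((\<lambda>mn. \<phi> mn * fab a b u (lat z mn) (lat (cnj z) mn)) has_sum Ser \<phi> a b z u) UNIV"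
proof -
  obtain M where M: "M \<ge> 0" "\<And>mn. norm (\<phi> mn) \<le> M" using periodic_bounded[OF \<phi>] by blast
  have "(\<lambda>mn. norm (\<phi> mn * fab a b u (lat z mn) (lat (cnj z) mn))) summable_on UNIV"
    by (rule Infinite_Sum.abs_summable_on_comparison_test'[where
        f = "\<lambda>mn. \<phi> mn * fab a b u (lat z mn) (lat (cnj z) mn)" and
        g = "\<lambda>mn. M * norm (fab a b u (lat z mn) (lat (cnj z) mn))"])
      (use M in \<open>auto simp: norm_mult intro!: summable_on_cmult_right fab_summable[OF z ab u] mult_right_mono\<close>)
  hence "(\<lambda>mn. \<phi> mn * fab a b u (lat z mn) (lat (cnj z) mn)) summable_on UNIV"
    by (rule Infinite_Sum.abs_summable_summable)
  thus ?thesis unfolding Ser_def by (rule has_sum_infsum)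
qed

definition Sphi :: "nat \<Rightarrow> nat \<Rightarrow> (int \<times> int \<Rightarrow> complex) \<Rightarrow> nat \<Rightarrow> nat \<Rightarrow> complex \<Rightarrow> complex \<Rightarrow> complex" where
  "Sphi k N \<phi> a b z u = latsum.Su N (pcbox N) (kap k N \<phi>) a b z u"

definition Fphi :: "nat \<Rightarrow> nat \<Rightarrow> (int \<times> int \<Rightarrow> complex) \<Rightarrow> complex \<Rightarrow> complex" where
  "Fphi k N \<phi> z = latsum.Fz N (pcbox N) (kap k N \<phi>) k z"

lemma Sphi_eq_Ser:
  assumes adm: "admissible k N \<phi>" and ab: "a + b = k" and z: "Im z > 0"
    and u: "Re u > - 1 / 4" "real k + 2 * Re u > 2"
  shows "Sphi k N \<phi> a b z u = Ser \<phi> a b z u"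
proof -
  interpret latsum N "pcbox N" "kap k N \<phi>" k by (rule latsum_kap[OF adm])
  have k: "a + b \<ge> 1" "real (a + b) + 2 * Re u > 2" and N: "N \<ge> 1" and per: "periodic N \<phi>"
    using adm ab u by (auto simp: admissible_def)
  have "(blk N (pcbox N) (kap k N \<phi>) (\<lambda>mn. fab a b u (lat z mn) (lat (cnj z) mn)) has_sum Ser \<phi> a b z u) UNIV"
    by (rule has_sum_blk_kap[OF N per _ Ser_has_sum[OF z k per N]])
       (rule Infinite_Sum.abs_summable_summable[OF fab_summable[OF z k]])
  thus ?thesis using Su_has_sum[OF ab z u(1)] unfolding Sphi_def by (rule has_sum_unique[rotated])
qed

lemma Sphi_holomorphic:
  assumes adm: "admissible k N \<phi>" and ab: "a + b = k" and z: "Im z > 0"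
  shows "Sphi k N \<phi> a b z holomorphic_on {u. Re u > - 1 / 4}"
proof -
  interpret latsum N "pcbox N" "kap k N \<phi>" k by (rule latsum_kap[OF adm])
  have o: "open {u. Re u > - 1 / 4}" by (rule open_halfspace_Re_gt)
  show ?thesis
    unfolding holomorphic_on_open[OF o] Sphi_def[abs_def] using Su_deriv[OF ab z] by blast
qed

lemma half_plane_eqI:
  assumes f: "f holomorphic_on {u. Re u > c}" and g: "g holomorphic_on {u. Re u > c}"
    and eq: "\<And>u. Re u > d \<Longrightarrow> Re u > c \<Longrightarrow> f u = g u" and u: "Re u > c"
  shows "f u = g u"
proof (rule analytic_continuation_open[of "{u. Re u > max c d}" "{u. Re u > c}" f g])
  show "open {u. Re u > max c d}" "open {u. Re u > c}" by (rule open_halfspace_Re_gt)+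
  have "c < \<bar>c\<bar> + \<bar>d\<bar> + 1" "d < \<bar>c\<bar> + \<bar>d\<bar> + 1" by linarith+
  hence "of_real (\<bar>c\<bar> + \<bar>d\<bar> + 1) \<in> {u. Re u > max c d}" by simp
  thus "{u. Re u > max c d} \<noteq> {}" by blast
  show "connected {u. Re u > c}" by (intro convex_connected convex_halfspace_Re_gt)
qed (use assms in auto)

section \<open>Modular transformations\<close>

text \<open>The row vector (m, n) is multiplied by \<gamma> from the right, because
  \<open>lat\<close> of \<gamma>z at (m, n) equals \<open>lat z\<close> at (m, n)\<gamma>, divided
  by cz + d.\<close>

definition rmul :: "int \<times> int \<times> int \<times> int \<Rightarrow> int \<times> int \<Rightarrow> int \<times> int" where
  "rmul = (\<lambda>(a, b, c, d) (m, n). (m * a + n * c, m * b + n * d))"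

text \<open>(d, -b, -c, a) is the inverse matrix: the weight composed with the inverse of \<gamma>
  is what appears after the lattice has been reindexed by \<gamma>.\<close>

definition pull :: "(int \<times> int \<Rightarrow> complex) \<Rightarrow> int \<times> int \<times> int \<times> int \<Rightarrow> int \<times> int \<Rightarrow> complex" where
  "pull \<phi> = (\<lambda>(a, b, c, d) mn. \<phi> (rmul (d, - b, - c, a) mn))"

lemma rmul_inv:
  assumes "a * d - b * c = 1"
  shows "rmul (d, - b, - c, a) (rmul (a, b, c, d) mn) = mn" "rmul (a, b, c, d) (rmul (d, - b, - c, a) mn) = mn"
proof -
  obtain m n where mn: "mn = (m, n)" by force
  have 1: "m * a * d - m * b * c = m" "n * a * d - n * b * c = n"
    using arg_cong[OF assms, of "\<lambda>x. m * x"] arg_cong[OF assms, of "\<lambda>x. n * x"] by (simp_all add: algebra_simps)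
  show "rmul (d, - b, - c, a) (rmul (a, b, c, d) mn) = mn" "rmul (a, b, c, d) (rmul (d, - b, - c, a) mn) = mn"
    using 1 by (simp_all add: mn rmul_def algebra_simps)
qed

lemma SL2Z_denom_nz:
  assumes "(a, b, c, d) \<in> SL2Z" "Im z > 0"
  shows "of_int c * z + of_int d \<noteq> (0 :: complex)"
proof
  assume 0: "of_int c * z + of_int d = (0 :: complex)"
  hence "Im (of_int c * z + of_int d) = 0" by simp
  hence c: "c = 0" using assms by simp
  with 0 have "d = 0" by simp
  with c assms show False by (simp add: SL2Z_def)
qed

lemma Im_act:
  assumes "(a, b, c, d) \<in> SL2Z" "Im z > 0"
  shows "Im (act (a, b, c, d) z) = Im z / norm (of_int c * z + of_int d) ^ 2" "Im (act (a, b, c, d) z) > 0"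
proof -
  have j: "of_int c * z + of_int d \<noteq> (0 :: complex)" by (rule SL2Z_denom_nz[OF assms])
  have ad: "real_of_int a * real_of_int d - real_of_int b * real_of_int c = 1"
    using assms(1) by (simp add: SL2Z_def flip: of_int_mult of_int_diff)
  have "Im ((of_int a * z + of_int b) * cnj (of_int c * z + of_int d)) =
      (real_of_int a * real_of_int d - real_of_int b * real_of_int c) * Im z" by (simp add: algebra_simps)
  hence "Im ((of_int a * z + of_int b) * cnj (of_int c * z + of_int d)) = Im z" by (simp add: ad)
  moreover have "act (a, b, c, d) z = (of_int a * z + of_int b) * cnj (of_int c * z + of_int d) /
      of_real (norm (of_int c * z + of_int d) ^ 2)"
    unfolding act_def prod.case complex_div_cnj[of "of_int a * z + of_int b"] by simp
  ultimately show 1: "Im (act (a, b, c, d) z) = Im z / norm (of_int c * z + of_int d) ^ 2"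
    by (simp only: Im_divide_of_real)
  show "Im (act (a, b, c, d) z) > 0" unfolding 1 using assms(2) j by simp
qed

lemma lat_act:
  assumes "(a, b, c, d) \<in> SL2Z" "Im z > 0"
  shows "lat (act (a, b, c, d) z) mn = lat z (rmul (a, b, c, d) mn) / (of_int c * z + of_int d)"
  using SL2Z_denom_nz[OF assms] by (cases mn) (simp add: lat_def act_def rmul_def field_simps)

text \<open>For conjugate arguments the logarithm in \<open>fab\<close> is that of a positive
  number, so the powers split without a branch correction.\<close>

lemma fab_divide:
  assumes "j \<noteq> 0" "w \<noteq> 0"
  shows "fab a b u (w / j) (cnj (w / j)) = j ^ a * cnj j ^ b * of_real (norm j) powr (2 * u) * fab a b u w (cnj w)"
proof -
  have wj: "w / j \<noteq> 0" using assms by simp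
  have p: "norm w > 0" "norm j > 0" "norm (w / j) > 0" using assms by simp_all
  have "ln (norm (w / j)) = ln (norm w) - ln (norm j)" using assms by (simp add: norm_divide ln_div)
  hence "of_real (norm (w / j)) powr (- 2 * u) = exp (- 2 * u * of_real (ln (norm w) - ln (norm j)))"
    using wj by (simp add: powr_def Ln_of_real[OF p(3)])
  also have "\<dots> = exp (2 * u * of_real (ln (norm j))) * exp (- 2 * u * of_real (ln (norm w)))"
    by (simp add: algebra_simps flip: exp_add)
  also have "\<dots> = of_real (norm j) powr (2 * u) * of_real (norm w) powr (- 2 * u)"
    using assms by (simp add: powr_def Ln_of_real[OF p(1)] Ln_of_real[OF p(2)])
  finally have "of_real (norm (w / j)) powr (- 2 * u) = of_real (norm j) powr (2 * u) * of_real (norm w) powr (- 2 * u)" .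
  thus ?thesis unfolding fab_diag[OF wj] fab_diag[OF assms(2)]
    by (simp add: power_divide power_inverse field_simps)
qed

lemma periodic_pull:
  assumes "periodic N \<phi>"
  shows "periodic N (pull \<phi> \<gamma>)"
proof -
  obtain a b c d where g: "\<gamma> = (a, b, c, d)" by (metis surj_pair)
  have "rmul (d, - b, - c, a) (m + int N, n) = (m * d + n * - c + int N * d, m * - b + n * a + int N * (- b))"
    "rmul (d, - b, - c, a) (m, n + int N) = (m * d + n * - c + int N * (- c), m * - b + n * a + int N * a)" for m n
    by (simp_all add: rmul_def algebra_simps)
  moreover have "rmul (d, - b, - c, a) (m, n) = (m * d + n * - c, m * - b + n * a)" for m n
    by (simp add: rmul_def)
  ultimately show ?thesis
    unfolding periodic_def g pull_def prod.case by (simp only: periodic_mult[OF assms] simp_thms)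
qed

text \<open>\<gamma> permutes the pairs of residues modulo N. The mean of the weight is therefore
  preserved, and with it admissibility.\<close>

lemma sum_pull:
  assumes per: "periodic N \<phi>" and N: "N \<ge> 1" and g: "\<gamma> \<in> SL2Z"
  shows "(\<Sum>x\<in>pbox N. pull \<phi> \<gamma> x) = (\<Sum>x\<in>pbox N. \<phi> x)"
proof -
  obtain a b c d where ge: "\<gamma> = (a, b, c, d)" by (metis surj_pair)
  have ad: "a * d - b * c = 1" using g by (simp add: ge SL2Z_def)
  define md where "md = (\<lambda>(m, n). (m mod int N, n mod int N))"
  have mdbox: "md x \<in> pbox N" for x using N by (cases x) (auto simp: md_def pbox_def)
  have mdid: "md x = x" if "x \<in> pbox N" for x using that by (cases x) (auto simp: md_def pbox_def)
  have mdr: "md (rmul \<delta> (md x)) = md (rmul \<delta> x)" for \<delta> x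
  proof -
    obtain a b c d where de: "\<delta> = (a, b, c, d)" by (metis surj_pair)
    have "(m mod int N * A + n mod int N * B) mod int N = (m * A + n * B) mod int N" for m n A B
      by (metis mod_add_cong mod_mult_left_eq)
    thus ?thesis by (cases x) (simp add: md_def rmul_def de)
  qed
  show ?thesis
  proof (rule sum.reindex_bij_witness[where j = "\<lambda>x. md (rmul (d, - b, - c, a) x)" and i = "\<lambda>x. md (rmul (a, b, c, d) x)"])
    show "md (rmul (a, b, c, d) (md (rmul (d, - b, - c, a) x))) = x" if "x \<in> pbox N" for x
      unfolding mdr rmul_inv(2)[OF ad] by (rule mdid[OF that])
    show "md (rmul (d, - b, - c, a) (md (rmul (a, b, c, d) x))) = x" if "x \<in> pbox N" for x
      unfolding mdr rmul_inv(1)[OF ad] by (rule mdid[OF that])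
    show "\<phi> (md (rmul (d, - b, - c, a) x)) = pull \<phi> \<gamma> x" for x
      by (cases "rmul (d, - b, - c, a) x") (simp add: md_def ge pull_def periodic_mod[OF per])
  qed (use mdbox in auto)
qed

lemma admissible_pull:
  assumes "admissible k N \<phi>" "\<gamma> \<in> SL2Z"
  shows "admissible k N (pull \<phi> \<gamma>)"
  using assms sum_pull[of N \<phi> \<gamma>] periodic_pull[of N \<phi> \<gamma>] by (auto simp: admissible_def)

lemma Ser_act:
  assumes g: "(a, b, c, d) \<in> SL2Z" and z: "Im z > 0" and ij: "i + j \<ge> 1"
  shows "Ser \<phi> i j (act (a, b, c, d) z) u = (of_int c * z + of_int d) ^ i * cnj (of_int c * z + of_int d) ^ j *
     of_real (norm (of_int c * z + of_int d)) powr (2 * u) * Ser (pull \<phi> (a, b, c, d)) i j z u"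
proof -
  define J where "J = of_int c * z + of_int d"
  have J: "J \<noteq> 0" unfolding J_def by (rule SL2Z_denom_nz[OF g z])
  define K where "K = J ^ i * cnj J ^ j * of_real (norm J) powr (2 * u)"
  define z' where "z' = act (a, b, c, d) z"
  have ad: "a * d - b * c = 1" using g by (simp add: SL2Z_def)
  have "\<phi> mn * fab i j u (lat z' mn) (lat (cnj z') mn) =
      K * (pull \<phi> (a, b, c, d) (rmul (a, b, c, d) mn) *
        fab i j u (lat z (rmul (a, b, c, d) mn)) (lat (cnj z) (rmul (a, b, c, d) mn)))" for mn
  proof -
    have l: "lat z' mn = lat z (rmul (a, b, c, d) mn) / J" unfolding z'_def J_def by (rule lat_act[OF g z])
    have l': "lat (cnj z') mn = cnj (lat z (rmul (a, b, c, d) mn) / J)" unfolding l[symmetric] by (simp add: cnj_lat)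
    have p: "pull \<phi> (a, b, c, d) (rmul (a, b, c, d) mn) = \<phi> mn" by (simp add: pull_def rmul_inv[OF ad])
    show ?thesis
    proof (cases "lat z (rmul (a, b, c, d) mn) = 0")
      case True
      hence "lat (cnj z) (rmul (a, b, c, d) mn) = 0" by (metis cnj_lat complex_cnj_zero)
      thus ?thesis unfolding l l' True using fab_zero[OF ij] by simp
    next
      case False
      show ?thesis unfolding l l' fab_divide[OF J False] p K_def by (simp add: cnj_lat mult_ac)
    qed
  qed
  hence "Ser \<phi> i j z' u = (\<Sum>\<^sub>\<infinity>mn. K * (pull \<phi> (a, b, c, d) (rmul (a, b, c, d) mn) *
        fab i j u (lat z (rmul (a, b, c, d) mn)) (lat (cnj z) (rmul (a, b, c, d) mn))))"
    unfolding Ser_def by (simp only:)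
  also have "\<dots> = K * (\<Sum>\<^sub>\<infinity>mn. pull \<phi> (a, b, c, d) (rmul (a, b, c, d) mn) *
        fab i j u (lat z (rmul (a, b, c, d) mn)) (lat (cnj z) (rmul (a, b, c, d) mn)))"
    by (rule infsum_cmult_right')
  also have "(\<Sum>\<^sub>\<infinity>mn. pull \<phi> (a, b, c, d) (rmul (a, b, c, d) mn) *
        fab i j u (lat z (rmul (a, b, c, d) mn)) (lat (cnj z) (rmul (a, b, c, d) mn))) = Ser (pull \<phi> (a, b, c, d)) i j z u"
    unfolding Ser_def
    by (rule infsum_reindex_bij_witness[where j = "rmul (a, b, c, d)" and i = "rmul (d, - b, - c, a)"])
       (use rmul_inv[OF ad] in auto)
  finally show ?thesis by (simp add: z'_def K_def J_def)
qed

text \<open>The corrections in \<open>kap\<close> are tied to the box and do not transform under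
  \<gamma>. The formula is proved for Re u > 1, where they have no effect, and then extended by the
  identity theorem.\<close>

lemma Sphi_act:
  assumes adm: "admissible k N \<phi>" and ij: "i + j = k" and g: "(a, b, c, d) \<in> SL2Z" and z: "Im z > 0"
    and u: "Re u > - 1 / 4"
  shows "Sphi k N \<phi> i j (act (a, b, c, d) z) u = (of_int c * z + of_int d) ^ i * cnj (of_int c * z + of_int d) ^ j *
     of_real (norm (of_int c * z + of_int d)) powr (2 * u) * Sphi k N (pull \<phi> (a, b, c, d)) i j z u"
proof (rule half_plane_eqI[where d = 1, OF _ _ _ u])
  have adm': "admissible k N (pull \<phi> (a, b, c, d))" by (rule admissible_pull[OF adm g])
  have k: "i + j \<ge> 1" using adm ij by (simp add: admissible_def)
  have J: "of_real (norm (of_int c * z + of_int d)) \<noteq> (0 :: complex)" using SL2Z_denom_nz[OF g z] by simp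
  show "(\<lambda>u. Sphi k N \<phi> i j (act (a, b, c, d) z) u) holomorphic_on {u. Re u > - 1 / 4}"
    by (rule Sphi_holomorphic[OF adm ij Im_act(2)[OF g z]])
  show "(\<lambda>u. (of_int c * z + of_int d) ^ i * cnj (of_int c * z + of_int d) ^ j *
     of_real (norm (of_int c * z + of_int d)) powr (2 * u) * Sphi k N (pull \<phi> (a, b, c, d)) i j z u)
     holomorphic_on {u. Re u > - 1 / 4}"
    by (intro holomorphic_intros Sphi_holomorphic[OF adm' ij z] J)
  fix u :: complex assume u: "Re u > 1" "Re u > - 1 / 4"
  have r: "real k + 2 * Re u > 2" using u by simp
  show "Sphi k N \<phi> i j (act (a, b, c, d) z) u = (of_int c * z + of_int d) ^ i * cnj (of_int c * z + of_int d) ^ j *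
     of_real (norm (of_int c * z + of_int d)) powr (2 * u) * Sphi k N (pull \<phi> (a, b, c, d)) i j z u"
    unfolding Sphi_eq_Ser[OF adm ij Im_act(2)[OF g z] u(2) r] Sphi_eq_Ser[OF adm' ij z u(2) r]
    by (rule Ser_act[OF g z k])
qed

lemma Fphi_eq_Sphi:
  assumes "admissible k N \<phi>" "k \<ge> 2"
  shows "Fphi k N \<phi> z = of_real (Im z) ^ (k - 1) / of_nat (k - 1) * (1 / 2 * Sphi k N \<phi> 1 (k - 1) z 0)"
  unfolding Fphi_def Sphi_def by (rule latsum.Fz_eq_Su[OF latsum_kap[OF assms(1)] assms(2)])

lemma Fphi_deriv:
  assumes "admissible 1 N \<phi>" "Im z > 0"
  shows "((\<lambda>u. of_real (Im z) powr u * (1 / 2 * Sphi 1 N \<phi> 1 0 z u)) has_field_derivative Fphi 1 N \<phi> z) (at 0)"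
  unfolding Fphi_def Sphi_def by (rule latsum.Fz_eq_deriv[OF latsum_kap[OF assms(1)] refl assms(2)])

lemma Fphi_xi:
  assumes "admissible k N \<phi>" "Im z > 0"
  shows "xi_op (2 - int k) (Fphi k N \<phi>) z = 1 / 2 * cnj (Sphi k N \<phi> 0 k z 0)"
proof -
  interpret latsum N "pcbox N" "kap k N \<phi>" k by (rule latsum_kap[OF assms(1)])
  have "Fphi k N \<phi> = Fz" by (simp add: Fphi_def fun_eq_iff)
  thus ?thesis using Fz_xi[OF assms(2)] by (simp add: Ez_eq_Su Sphi_def)
qed

lemma Fphi_real_analytic:
  assumes "admissible k N \<phi>"
  shows "real_analytic_on (Fphi k N \<phi>) upper_half_plane"
proof -
  interpret latsum N "pcbox N" "kap k N \<phi>" k by (rule latsum_kap[OF assms(1)])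
  have "Fphi k N \<phi> = Fz" by (simp add: Fphi_def fun_eq_iff)
  thus ?thesis using Fz_real_analytic by simp
qed

lemma Fphi_laplace:
  assumes "admissible k N \<phi>" "Im z > 0"
  shows "laplace_op (2 - int k) (Fphi k N \<phi>) z = 0"
proof -
  interpret latsum N "pcbox N" "kap k N \<phi>" k by (rule latsum_kap[OF assms(1)])
  have "Fphi k N \<phi> = Fz" by (simp add: Fphi_def fun_eq_iff)
  thus ?thesis using Fz_local(3)[OF assms(2)] by simp
qed

lemma Fphi_growth:
  assumes "admissible k N \<phi>"
  shows "\<exists>A c. \<forall>z. Im z \<ge> 1 \<longrightarrow> \<bar>Re z\<bar> \<le> R \<longrightarrow> norm (Fphi k N \<phi> z) \<le> A * exp (c * Im z)"
  unfolding Fphi_def by (rule latsum.Fz_growth[OF latsum_kap[OF assms(1)]])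

text \<open>The power of y contributes |J|^(-2(k-1)) and the sum J (cnj J)^(k-1), together J^(2-k).
  For k = 1 the factor |J|^(2u) is cancelled by y^u before differentiation, so no logarithm of |J|
  appears.\<close>

lemma Fphi_act:
  assumes adm: "admissible k N \<phi>" and g: "(a, b, c, d) \<in> SL2Z" and z: "Im z > 0"
  shows "Fphi k N \<phi> (act (a, b, c, d) z) = (of_int c * z + of_int d) powi (2 - int k) * Fphi k N (pull \<phi> (a, b, c, d)) z"
proof -
  define J where "J = of_int c * z + of_int d"
  have J: "J \<noteq> 0" unfolding J_def by (rule SL2Z_denom_nz[OF g z])
  have JJ: "of_real (norm J ^ 2) = J * cnj J" by (rule complex_norm_square)
  have adm': "admissible k N (pull \<phi> (a, b, c, d))" by (rule admissible_pull[OF adm g])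
  define z' where "z' = act (a, b, c, d) z"
  have z': "Im z' > 0" "Im z' = Im z / norm J ^ 2" using Im_act[OF g z] by (simp_all add: z'_def J_def)
  have k: "k \<ge> 1" using adm by (simp add: admissible_def)
  note SA = Sphi_act[OF adm _ g z, folded J_def z'_def]
  show ?thesis
  proof (cases "k = 1")
    case False
    hence k2: "k \<ge> 2" using k by simp
    have S: "Sphi k N \<phi> 1 (k - 1) z' 0 = J ^ 1 * cnj J ^ (k - 1) * Sphi k N (pull \<phi> (a, b, c, d)) 1 (k - 1) z 0"
      using SA[of 1 "k - 1" 0] k J by simp
    have "of_real (Im z') = of_real (Im z) / (J * cnj J)" unfolding z'(2) JJ[symmetric] by simp
    hence y: "of_real (Im z') ^ (k - 1) = of_real (Im z) ^ (k - 1) / (J ^ (k - 1) * cnj J ^ (k - 1))"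
      by (simp add: power_divide power_mult_distrib)
    have "J powi (2 - int k) = J powi (1 + - int (k - 1))" using k2 by (simp add: of_nat_diff)
    also have "\<dots> = J * inverse (J ^ (k - 1))" using J by (subst power_int_add) (auto simp: power_int_minus)
    finally have Jp: "J powi (2 - int k) = J / J ^ (k - 1)" by (simp add: divide_inverse)
    have cJ: "cnj J ^ (k - 1) \<noteq> 0" "J ^ (k - 1) \<noteq> 0" using J by auto
    have "Fphi k N \<phi> z' = of_real (Im z) ^ (k - 1) / (J ^ (k - 1) * cnj J ^ (k - 1)) / of_nat (k - 1) *
        (1 / 2 * (J ^ 1 * cnj J ^ (k - 1) * Sphi k N (pull \<phi> (a, b, c, d)) 1 (k - 1) z 0))"
      unfolding Fphi_eq_Sphi[OF adm k2] S y ..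
    also have "\<dots> = J / J ^ (k - 1) * (of_real (Im z) ^ (k - 1) / of_nat (k - 1) * (1 / 2 * Sphi k N (pull \<phi> (a, b, c, d)) 1 (k - 1) z 0))"
    proof -
      have "x / (p * q) / m * (1 / 2 * (j ^ 1 * q * s)) = j / p * (x / m * (1 / 2 * s))" if "q \<noteq> 0" for x p q m j s :: complex
        using that by (simp add: mult_ac)
      from this[OF cJ(1)] show ?thesis .
    qed
    also have "\<dots> = J powi (2 - int k) * Fphi k N (pull \<phi> (a, b, c, d)) z"
      unfolding Fphi_eq_Sphi[OF adm' k2] Jp ..
    finally show ?thesis by (simp add: z'_def J_def)
  next
    case True
    note adm1 = adm[unfolded True] and adm1' = adm'[unfolded True]
    have p: "Im z > 0" "norm J > 0" "Im z' > 0" using z J z' by auto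
    have eq: "of_real (Im z') powr u * (1 / 2 * Sphi 1 N \<phi> 1 0 z' u) =
        J * (of_real (Im z) powr u * (1 / 2 * Sphi 1 N (pull \<phi> (a, b, c, d)) 1 0 z u))"
      if "u \<in> {u. Re u > - 1 / 4}" for u
    proof -
      have "ln (Im z') = ln (Im z) - 2 * ln (norm J)" unfolding z'(2) using p by (simp add: ln_div ln_realpow)
      hence "of_real (Im z') powr u * of_real (norm J) powr (2 * u) = exp (u * of_real (ln (Im z) - 2 * ln (norm J))) * exp (2 * u * of_real (ln (norm J)))"
        using p by (simp add: powr_def Ln_of_real[OF p(2)] Ln_of_real[OF p(3)])
      also have "\<dots> = exp (u * of_real (ln (Im z)))" by (simp add: algebra_simps flip: exp_add)
      also have "\<dots> = of_real (Im z) powr u" using p by (simp add: powr_def Ln_of_real[OF p(1)])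
      finally have pw: "of_real (Im z') powr u * of_real (norm J) powr (2 * u) = of_real (Im z) powr u" .
      have S: "Sphi 1 N \<phi> 1 0 z' u = J ^ 1 * cnj J ^ 0 * of_real (norm J) powr (2 * u) * Sphi 1 N (pull \<phi> (a, b, c, d)) 1 0 z u"
        using SA[of 1 0 u] that True by simp
      show ?thesis unfolding S pw[symmetric] by (simp only: power_one_right power_0 mult_1_right mult_1_left mult_ac)
    qed
    have "((\<lambda>u. of_real (Im z') powr u * (1 / 2 * Sphi 1 N \<phi> 1 0 z' u)) has_field_derivative
        J * Fphi 1 N (pull \<phi> (a, b, c, d)) z) (at 0)"
      by (rule has_field_derivative_transform_within_open[OF DERIV_cmult[OF Fphi_deriv[OF adm1' z]]
            open_halfspace_Re_gt _ eq[symmetric]]) auto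
    from DERIV_unique[OF Fphi_deriv[OF adm1 z'(1)] this]
    show ?thesis using True by (simp add: z'_def J_def)
  qed
qed

lemma xi_Fphi_act:
  assumes adm: "admissible k N \<phi>" and g: "(a, b, c, d) \<in> SL2Z" and z: "Im z > 0"
  shows "xi_op (2 - int k) (Fphi k N \<phi>) (act (a, b, c, d) z) =
    (of_int c * z + of_int d) ^ k * xi_op (2 - int k) (Fphi k N (pull \<phi> (a, b, c, d))) z"
proof -
  have J: "of_int c * z + of_int d \<noteq> (0 :: complex)" by (rule SL2Z_denom_nz[OF g z])
  have "Sphi k N \<phi> 0 k (act (a, b, c, d) z) 0 = cnj (of_int c * z + of_int d) ^ k * Sphi k N (pull \<phi> (a, b, c, d)) 0 k z 0"
    using Sphi_act[OF adm _ g z, of 0 k 0] J by simp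
  thus ?thesis
    unfolding Fphi_xi[OF adm Im_act(2)[OF g z]] Fphi_xi[OF admissible_pull[OF adm g] z] by simp
qed

text \<open>Slashing by \<gamma> replaces the weight by its pullback, so only i\<infinity> has to be
  treated. There the bound is known on strips, and since translations by N fix a weight of period N,
  every z can be moved to |Re z| \<le> N.\<close>

lemma Fphi_cusp_growth:
  assumes adm: "admissible k N \<phi>"
  shows "linear_exp_growth_at_cusps (2 - int k) (Fphi k N \<phi>)"
  unfolding linear_exp_growth_at_cusps_def
proof
  fix \<gamma> assume g: "\<gamma> \<in> SL2Z"
  obtain a b c d where ge: "\<gamma> = (a, b, c, d)" by (metis surj_pair)
  note g' = g[unfolded ge]
  define \<theta> where "\<theta> = pull \<phi> \<gamma>"
  have adm': "admissible k N \<theta>" unfolding \<theta>_def by (rule admissible_pull[OF adm g])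
  have per: "periodic N \<theta>" and N: "N \<ge> 1" using adm' by (auto simp: admissible_def)
  obtain A C where AC: "\<And>z. Im z \<ge> 1 \<Longrightarrow> \<bar>Re z\<bar> \<le> real N \<Longrightarrow> norm (Fphi k N \<theta> z) \<le> A * exp (C * Im z)"
    using Fphi_growth[OF adm', of "real N"] by blast
  have shift: "Fphi k N \<theta> (z + of_int (int N * l)) = Fphi k N \<theta> z" if z: "Im z > 0" for z l
  proof -
    have S: "(1, int N * l, 0, 1) \<in> SL2Z" by (simp add: SL2Z_def)
    have "pull \<theta> (1, int N * l, 0, 1) = \<theta>"
    proof
      fix x show "pull \<theta> (1, int N * l, 0, 1) x = \<theta> x"
        using periodic_mult[OF per, of "fst x" 0 "snd x" "- (fst x * l)"]
        by (cases x) (simp add: pull_def rmul_def algebra_simps)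
    qed
    with Fphi_act[OF adm' S z] show ?thesis by (simp add: act_def)
  qed
  show "\<exists>A C Y. \<forall>z\<in>upper_half_plane. Y < Im z \<longrightarrow> norm (slash (2 - int k) (Fphi k N \<phi>) \<gamma> z) \<le> A * exp (C * Im z)"
  proof (intro exI ballI impI)
    fix z assume "z \<in> upper_half_plane" and z1: "1 < Im z"
    hence z: "Im z > 0" by (simp add: upper_half_plane_def)
    define J where "J = of_int c * z + of_int d"
    have J: "J \<noteq> 0" unfolding J_def by (rule SL2Z_denom_nz[OF g' z])
    have "slash (2 - int k) (Fphi k N \<phi>) \<gamma> z = J powi (- (2 - int k)) * (J powi (2 - int k) * Fphi k N \<theta> z)"
      unfolding slash_def ge prod.case J_def[symmetric] using Fphi_act[OF adm g' z]
      by (simp only: J_def[symmetric] \<theta>_def ge)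
    also have "\<dots> = Fphi k N \<theta> z"
    proof -
      have "J powi (- n) * J powi n = 1" for n using J by (simp add: power_int_minus)
      thus ?thesis by (simp only: mult.assoc[symmetric] mult_1_left)
    qed
    finally have sl: "slash (2 - int k) (Fphi k N \<phi>) \<gamma> z = Fphi k N \<theta> z" .
    define l where "l = - \<lfloor>Re z / real N\<rfloor>"
    define z' where "z' = z + of_int (int N * l)"
    define fl where "fl = real_of_int \<lfloor>Re z / real N\<rfloor>"
    have "fl \<le> Re z / real N" "Re z / real N < fl + 1" unfolding fl_def by linarith+
    hence "real N * fl \<le> Re z" "Re z < real N * fl + real N"
      using N by (simp_all add: field_simps)
    hence "\<bar>Re z'\<bar> \<le> real N" by (simp add: z'_def l_def fl_def)
    moreover have "Im z' = Im z" by (simp add: z'_def)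
    ultimately have "norm (Fphi k N \<theta> z') \<le> A * exp (C * Im z)" using AC[of z'] z1 by simp
    thus "norm (slash (2 - int k) (Fphi k N \<phi>) \<gamma> z) \<le> A * exp (C * Im z)"
      unfolding sl using shift[OF z, of l] by (simp add: z'_def)
  qed
qed

section \<open>The analytic continuation\<close>

text \<open>The difference g - h need not be nicely meromorphic at common poles, so the identity
  theorem is applied to its \<open>remove_sings\<close>. Agreement near s then passes to s itself,
  since the value there is either the limit or, at a pole, the default 0.\<close>

lemma nicely_meromorphic_half_plane_unique:
  assumes g: "g nicely_meromorphic_on {w. Re w > c}" and h: "h nicely_meromorphic_on {w. Re w > c'}"
    and eq: "\<And>w. Re w > \<sigma> \<Longrightarrow> g w = h w" and s: "Re s > c" "Re s > c'"
  shows "g s = h s"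
proof -
  define A where "A = {w. Re w > max c c'}"
  have A: "open A" "connected A" "s \<in> A"
    unfolding A_def by (rule open_halfspace_Re_gt, rule convex_connected[OF convex_halfspace_Re_gt]) (use s in simp)
  have gA: "g nicely_meromorphic_on A" "h nicely_meromorphic_on A"
    by (rule nicely_meromorphic_on_subset[OF g], force simp: A_def, rule nicely_meromorphic_on_subset[OF h], force simp: A_def)
  hence mero: "(\<lambda>w. g w - h w) meromorphic_on A"
    unfolding nicely_meromorphic_on_def by (intro meromorphic_intros) auto
  define r where "r = remove_sings (\<lambda>w. g w - h w)"
  have rn: "r nicely_meromorphic_on A" unfolding r_def by (rule remove_sings_nicely_meromorphic[OF mero])
  define p where "p = complex_of_real (\<bar>c\<bar> + \<bar>c'\<bar> + \<bar>\<sigma>\<bar> + 1)"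
  have p: "p \<in> A" "Re p > \<sigma>" by (auto simp: p_def A_def)
  have op: "open {w. Re w > \<sigma>}" by (rule open_halfspace_Re_gt)
  have "eventually (\<lambda>w. w \<in> {w. Re w > \<sigma>}) (at p)"
    by (rule eventually_at_in_open'[OF op]) (use p in auto)
  hence "eventually (\<lambda>w. r w = 0) (at p)"
  proof eventually_elim
    case (elim w)
    have "eventually (\<lambda>x. x \<in> {w. Re w > \<sigma>}) (at w)"
      by (rule eventually_at_in_open'[OF op]) (use elim in auto)
    hence "eventually (\<lambda>x. g x - h x = 0) (at w)"
      by eventually_elim (use eq in auto)
    hence "(\<lambda>w. g w - h w) \<midarrow>w\<rightarrow> 0" by (rule tendsto_eventually)
    thus ?case unfolding r_def by (rule remove_sings_eqI)
  qed
  hence "frequently (\<lambda>w. r w = 0) (at p)" by (rule eventually_frequently[rotated]) simp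
  from frequently_eq_meromorphic_imp_constant[OF this rn A(1,2) p(1)]
  have r0: "r w = 0" if "w \<in> A" for w using that by blast
  have "(\<lambda>w. g w - h w) meromorphic_on {s}" using mero by (rule meromorphic_on_subset) (use A in auto)
  hence "eventually (\<lambda>w. r w = g w - h w) (at s)"
    unfolding r_def by (intro eventually_remove_sings_eq_at) (auto simp: meromorphic_on_isolated_singularity)
  moreover have "eventually (\<lambda>w. w \<in> A) (at s)" by (rule eventually_at_in_open'[OF A(1,3)])
  ultimately have ev: "eventually (\<lambda>w. g w = h w) (at s)"
    by eventually_elim (use r0 in auto)
  have gs: "is_pole g s \<and> g s = 0 \<or> g \<midarrow>s\<rightarrow> g s" and hs: "is_pole h s \<and> h s = 0 \<or> h \<midarrow>s\<rightarrow> h s"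
    using gA A(3) by (auto simp: nicely_meromorphic_on_def)
  have iff: "is_pole g s \<longleftrightarrow> is_pole h s" by (rule is_pole_cong[OF ev refl])
  show ?thesis
  proof (cases "is_pole g s")
    case True
    hence "\<not> g \<midarrow>s\<rightarrow> g s" "\<not> h \<midarrow>s\<rightarrow> h s"
      using iff is_pole_def not_tendsto_and_filterlim_at_infinity[of "at s" g "g s"]
        not_tendsto_and_filterlim_at_infinity[of "at s" h "h s"] by auto
    thus ?thesis using gs hs by simp
  next
    case False
    hence "g \<midarrow>s\<rightarrow> g s" "h \<midarrow>s\<rightarrow> h s" using gs hs iff by auto
    moreover from this(2) have "g \<midarrow>s\<rightarrow> h s"
      by (rule Lim_transform_eventually) (use ev in \<open>auto elim: eventually_mono\<close>)
    ultimately show ?thesis by (intro tendsto_unique[of "at s" g]) auto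
  qed
qed

lemma continuation_eqI:
  assumes g: "g nicely_meromorphic_on {w. Re w > c}" and eq: "\<And>w. Re w > \<sigma> \<Longrightarrow> g w = f w" and s: "Re s > c"
  shows "continuation \<sigma> f s = g s"
  unfolding continuation_def
proof (rule the_equality)
  show "\<exists>c ga. c < Re s \<and> ga nicely_meromorphic_on {w. c < Re w} \<and> (\<forall>w. \<sigma> < Re w \<longrightarrow> ga w = f w) \<and> g s = ga s"
    using assms by blast
  fix v assume "\<exists>c g. c < Re s \<and> g nicely_meromorphic_on {w. c < Re w} \<and> (\<forall>w. \<sigma> < Re w \<longrightarrow> g w = f w) \<and> v = g s"
  then obtain c' h where h: "c' < Re s" "h nicely_meromorphic_on {w. c' < Re w}" "\<forall>w. \<sigma> < Re w \<longrightarrow> h w = f w" "v = h s"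
    by blast
  show "v = g s"
    unfolding h(4) by (rule nicely_meromorphic_half_plane_unique[OF h(2) g, of \<sigma>]) (use h eq s in auto)
qed

lemma continuation_holomorphicI:
  assumes g: "g holomorphic_on {w. Re w > c}" and eq: "\<And>w. Re w > \<sigma> \<Longrightarrow> Re w > c \<Longrightarrow> g w = f w" and s: "Re s > c"
  shows "continuation \<sigma> f s = g s"
proof -
  \<comment> \<open>\<open>continuation\<close> demands agreement with f on all of Re w > \<sigma>,
    which may reach to the left of c; there h is simply taken to be f.\<close>
  define h where "h = (\<lambda>w. if Re w > c then g w else f w)"
  have "h holomorphic_on {w. Re w > c}"
    by (rule holomorphic_transform[OF g]) (auto simp: h_def)
  hence "h analytic_on {w. Re w > c}" using analytic_on_open[OF open_halfspace_Re_gt] by blast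
  hence "h nicely_meromorphic_on {w. Re w > c}" by (rule analytic_on_imp_nicely_meromorphic_on)
  hence "continuation \<sigma> f s = h s"
    by (rule continuation_eqI) (use eq s in \<open>auto simp: h_def\<close>)
  thus ?thesis using s by (simp add: h_def)
qed

text \<open>The series at Tz runs over the vectors (Tm, n). Regarding these as vectors for z itself
  moves T from the argument into the weight, so that different T share one lattice.\<close>

definition phi :: "nat \<Rightarrow> (int \<Rightarrow> complex) \<Rightarrow> (int \<Rightarrow> complex) \<Rightarrow> int \<times> int \<Rightarrow> complex" where
  "phi T \<alpha> \<beta> mn = (if int T dvd fst mn then \<alpha> (fst mn div int T) else 0) * \<beta> (snd mn)"

lemma eis_nonhol_series_eq_Ser:
  assumes k: "k \<ge> 1" and T: "T \<ge> 1" and z: "Im z > 0"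
  shows "eis_nonhol_series (2 - int k) (of_nat T * z) s \<alpha> \<beta> = 1 / 2 * Ser (phi T \<alpha> \<beta>) 1 (k - 1) z (s - of_nat (k - 1))"
proof -
  define u where "u = s - of_nat (k - 1)"
  define f where "f = (\<lambda>mn. phi T \<alpha> \<beta> mn * fab 1 (k - 1) u (lat z mn) (lat (cnj z) mn))"
  have "(\<Sum>\<^sub>\<infinity>(m, n)\<in>UNIV - {(0, 0)}. \<alpha> m * \<beta> n * (of_int m * (of_nat T * z) + of_int n) powi (- (2 - int k))
       * of_real (norm (of_int m * (of_nat T * z) + of_int n)) powr (- 2 * s)) =
     (\<Sum>\<^sub>\<infinity>mn\<in>UNIV - {(0, 0)}. f (int T * fst mn, snd mn))"
  proof (rule infsum_cong)
    fix mn :: "int \<times> int" assume mn0: "mn \<in> UNIV - {(0, 0)}"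
    obtain m n where mn: "mn = (m, n)" by force
    define w where "w = of_int m * (of_nat T * z) + of_int n"
    have wl: "w = lat z (int T * m, n)" by (simp add: w_def lat_def mult_ac)
    obtain C where gC: "good C z" using good_exists[OF z] by blast
    have "(int T * m, n) \<noteq> (0, 0)" using mn0 mn T by auto
    from good_lat(2)[OF gC this] have w0: "w \<noteq> 0" unfolding wl .
    have ph: "phi T \<alpha> \<beta> (int T * m, n) = \<alpha> m * \<beta> n" using T by (simp add: phi_def)
    have wc: "lat (cnj z) (int T * m, n) = cnj w" by (simp add: wl cnj_lat)
    have nw: "of_real (norm w) \<noteq> (0 :: complex)" using w0 by simp
    have e1: "w powi (- (2 - int k)) = w ^ (k - 1) * inverse w"
    proof -
      have "w powi (- (2 - int k)) = w powi (int (k - 1) + (- 1))" using k by (simp add: of_nat_diff)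
      also have "\<dots> = w ^ (k - 1) * inverse w" using w0 by (subst power_int_add) (auto simp: power_int_minus)
      finally show ?thesis .
    qed
    have e2: "of_real (norm w) powr (- 2 * s) = of_real (norm w) powr (- 2 * u) * inverse (w * cnj w) ^ (k - 1)"
    proof -
      have "of_real (norm w) powr (- 2 * s) = of_real (norm w) powr (- 2 * u + - of_nat (2 * (k - 1)))"
        by (rule arg_cong[of _ _ "\<lambda>x. of_real (norm w) powr x"]) (simp only: u_def of_nat_mult of_nat_numeral, simp add: algebra_simps)
      also have "\<dots> = of_real (norm w) powr (- 2 * u) * of_real (norm w) powr (- of_nat (2 * (k - 1)))"
        by (rule powr_add)
      also have "of_real (norm w) powr (- of_nat (2 * (k - 1))) = inverse (of_real (norm w) powr of_nat (2 * (k - 1)) :: complex)"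
        by (rule powr_minus)
      also have "of_real (norm w) powr of_nat (2 * (k - 1)) = (of_real (norm w) :: complex) ^ (2 * (k - 1))"
        using nw by (rule powr_nat'[OF disjI1])
      also have "\<dots> = (of_real (norm w ^ 2)) ^ (k - 1)" by (simp add: power_mult)
      also have "of_real (norm w ^ 2) = w * cnj w" by (rule complex_norm_square)
      finally show ?thesis by (simp only: power_inverse)
    qed
    have "w * inverse (w * cnj w) = inverse (cnj w)" using w0 by simp
    hence "w ^ (k - 1) * inverse (w * cnj w) ^ (k - 1) = inverse (cnj w) ^ (k - 1)"
      by (simp only: power_mult_distrib[symmetric])
    hence e3: "w powi (- (2 - int k)) * of_real (norm w) powr (- 2 * s) =
        inverse w ^ 1 * inverse (cnj w) ^ (k - 1) * of_real (norm w) powr (- 2 * u)"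
      unfolding e1 e2 by (metis mult.assoc mult.commute power_one_right)
    show "(case mn of (m, n) \<Rightarrow> \<alpha> m * \<beta> n * (of_int m * (of_nat T * z) + of_int n) powi (- (2 - int k))
       * of_real (norm (of_int m * (of_nat T * z) + of_int n)) powr (- 2 * s)) = f (int T * fst mn, snd mn)"
      unfolding mn prod.case fst_conv snd_conv f_def w_def[symmetric] ph wc wl[symmetric] fab_diag[OF w0]
      unfolding mult.assoc[of "\<alpha> m * \<beta> n"] e3 ..
  qed
  also have "\<dots> = (\<Sum>\<^sub>\<infinity>mn. f (int T * fst mn, snd mn))"
  proof (rule infsum_cong_neutral)
    \<comment> \<open>The origin, excluded from the Eisenstein series, may be included here: inverse
      0 = 0 makes its term vanish.\<close>
    have "f (0, 0) = 0" using k by (simp add: f_def fab_zero)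
    thus "f (int T * fst x, snd x) = 0" if "x \<in> UNIV - (UNIV - {(0, 0)})" for x using that by auto
  qed auto
  also have "\<dots> = infsum f ((\<lambda>mn. (int T * fst mn, snd mn)) ` UNIV)"
    by (subst infsum_reindex) (use T in \<open>auto simp: inj_on_def o_def\<close>)
  also have "\<dots> = infsum f UNIV"
  proof (rule infsum_cong_neutral)
    fix x :: "int \<times> int" assume x: "x \<in> UNIV - (\<lambda>mn. (int T * fst mn, snd mn)) ` UNIV"
    have "\<not> int T dvd fst x"
    proof
      assume "int T dvd fst x"
      hence "x = (\<lambda>mn. (int T * fst mn, snd mn)) (fst x div int T, snd x)" by simp
      thus False using x by blast
    qed
    thus "f x = 0" by (simp add: f_def phi_def)
  qed auto
  finally show ?thesis by (simp add: eis_nonhol_series_def f_def Ser_def u_def)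
qed

text \<open>The half-plane is a neighbourhood of s = k - 1, the point from which the harmonic form
  is taken for every k, be it as a value or, for k = 1, as a derivative.\<close>

lemma eis_nonhol_eq_Sphi:
  assumes adm: "admissible k N (phi T \<alpha> \<beta>)" and T: "T \<ge> 1" and z: "Im z > 0"
    and s: "Re s > real (k - 1) - 1 / 4"
  shows "eis_nonhol (2 - int k) (of_nat T * z) s \<alpha> \<beta> = 1 / 2 * Sphi k N (phi T \<alpha> \<beta>) 1 (k - 1) z (s - of_nat (k - 1))"
  unfolding eis_nonhol_def
proof (rule continuation_holomorphicI[OF _ _ s])
  have k: "k \<ge> 1" using adm by (simp add: admissible_def)
  hence ab: "1 + (k - 1) = k" by simp
  show "(\<lambda>s. 1 / 2 * Sphi k N (phi T \<alpha> \<beta>) 1 (k - 1) z (s - of_nat (k - 1))) holomorphic_on {w. Re w > real (k - 1) - 1 / 4}"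
    by (intro holomorphic_intros holomorphic_on_compose_gen[OF _ Sphi_holomorphic[OF adm ab z], unfolded o_def]) auto
  fix w assume w: "Re w > 1 - of_int (2 - int k) / 2" "Re w > real (k - 1) - 1 / 4"
  hence u: "Re (w - of_nat (k - 1)) > - 1 / 4" "real k + 2 * Re (w - of_nat (k - 1)) > 2"
    using k by (auto simp: of_nat_diff field_simps)
  show "1 / 2 * Sphi k N (phi T \<alpha> \<beta>) 1 (k - 1) z (w - of_nat (k - 1)) = eis_nonhol_series (2 - int k) (of_nat T * z) w \<alpha> \<beta>"
    unfolding eis_nonhol_series_eq_Ser[OF k T z] Sphi_eq_Ser[OF adm ab z u] ..
qed

lemma sum_periods:
  fixes f :: "int \<Rightarrow> complex"
  assumes "\<And>n. f (n + int P) = f n"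
  shows "(\<Sum>n\<in>{0..<int (q * P)}. f n) = of_nat q * (\<Sum>n\<in>{0..<int P}. f n)"
proof (induction q)
  case (Suc q)
  have f: "f (n + int q * int P) = f n" for n
  proof (induction q)
    case (Suc q)
    have "f (n + int (Suc q) * int P) = f (n + int q * int P + int P)" by (simp add: algebra_simps)
    thus ?case using Suc assms by simp
  qed simp
  have "{0..<int (Suc q * P)} = {0..<int (q * P)} \<union> {int (q * P)..<int (Suc q * P)}"
    by (intro ivl_disj_un_two(3)[symmetric]) auto
  hence "(\<Sum>n\<in>{0..<int (Suc q * P)}. f n) = (\<Sum>n\<in>{0..<int (q * P)}. f n) + (\<Sum>n\<in>{int (q * P)..<int (Suc q * P)}. f n)"
    by (simp add: sum.union_disjoint ivl_disj_int)
  also have "(\<Sum>n\<in>{int (q * P)..<int (Suc q * P)}. f n) = (\<Sum>n\<in>{0..<int P}. f n)"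
    by (rule sum.reindex_bij_witness[where i = "\<lambda>n. n + int q * int P" and j = "\<lambda>n. n - int q * int P"])
       (use f[of "_ - int q * int P"] in \<open>auto simp: algebra_simps\<close>)
  finally show ?case using Suc by (simp add: algebra_simps)
qed simp

lemma sum_multiples:
  fixes f :: "int \<Rightarrow> complex"
  assumes "T \<ge> 1"
  shows "(\<Sum>m\<in>{0..<int (T * R)}. if int T dvd m then f (m div int T) else 0) = (\<Sum>m\<in>{0..<int R}. f m)"
proof -
  have "(\<Sum>m\<in>{0..<int (T * R)}. if int T dvd m then f (m div int T) else 0) =
      (\<Sum>m\<in>{m \<in> {0..<int (T * R)}. int T dvd m}. f (m div int T))"
    by (rule sum.inter_filter[symmetric]) auto
  also have "\<dots> = (\<Sum>m\<in>{0..<int R}. f m)"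
    by (rule sum.reindex_bij_witness[where i = "\<lambda>m. int T * m" and j = "\<lambda>m. m div int T"])
       (use assms in \<open>auto elim!: dvdE simp: zero_le_mult_iff mult_less_cancel_left\<close>)
  finally show ?thesis .
qed

lemma sum_box_phi:
  assumes "T \<ge> 1"
  shows "(\<Sum>b\<in>pbox (T * R). phi T \<alpha> \<beta> b) = (\<Sum>m\<in>{0..<int R}. \<alpha> m) * (\<Sum>n\<in>{0..<int (T * R)}. \<beta> n)"
proof -
  have "(\<Sum>b\<in>pbox (T * R). phi T \<alpha> \<beta> b) =
      (\<Sum>m\<in>{0..<int (T * R)}. \<Sum>n\<in>{0..<int (T * R)}. (if int T dvd m then \<alpha> (m div int T) else 0) * \<beta> n)"
    unfolding pbox_def by (subst sum.cartesian_product) (simp add: phi_def case_prod_unfold)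
  also have "\<dots> = (\<Sum>m\<in>{0..<int (T * R)}. if int T dvd m then \<alpha> (m div int T) else 0) * (\<Sum>n\<in>{0..<int (T * R)}. \<beta> n)"
    by (simp only: sum_product)
  finally show ?thesis unfolding sum_multiples[OF assms] .
qed

lemma periodic_multiple:
  assumes "\<And>n. f (n + int P) = f n" "int P dvd q"
  shows "f (n + q) = (f n :: complex)"
proof -
  have 1: "f (n + int P * int i) = f n" for n i
  proof (induction i)
    case (Suc i)
    have "f (n + int P * int (Suc i)) = f (n + int P * int i + int P)" by (simp add: algebra_simps)
    thus ?case using Suc assms by simp
  qed simp
  obtain x where x: "q = int P * x" using assms(2) by blast
  show ?thesis
  proof (cases x rule: int_cases2)
    case (nonpos i)
    thus ?thesis using 1[of "n + q" i] x by simp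
  qed (use 1 x in auto)
qed

lemma periodic_phi:
  assumes a: "\<And>n. \<alpha> (n + int L) = \<alpha> n" and b: "\<And>n. \<beta> (n + int M) = \<beta> n"
    and N: "T * L dvd N" "M dvd N" and T: "T \<ge> 1"
  shows "periodic N (phi T \<alpha> \<beta>)"
  unfolding periodic_def
proof (intro allI conjI)
  fix m n
  obtain x where x: "N = T * L * x" using N(1) by (rule dvdE)
  have d: "int T dvd (m + int N) \<longleftrightarrow> int T dvd m" by (simp add: x dvd_add_left_iff mult.assoc)
  have "(m + int N) div int T = m div int T + int (L * x)" if "int T dvd m"
    using T by (simp add: x mult.assoc)
  moreover have "\<alpha> (m div int T + int (L * x)) = \<alpha> (m div int T)"
    by (rule periodic_multiple[of \<alpha> L, OF a]) simp
  ultimately show "phi T \<alpha> \<beta> (m + int N, n) = phi T \<alpha> \<beta> (m, n)"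
    using d by (simp add: phi_def)
  have "\<beta> (n + int N) = \<beta> n" by (rule periodic_multiple[of \<beta> M, OF b]) (use N in simp)
  thus "phi T \<alpha> \<beta> (m, n + int N) = phi T \<alpha> \<beta> (m, n)" by (simp add: phi_def)
qed

section \<open>The residue at \<open>s = 1\<close> for weight \<open>0\<close>\<close>

lemma Ser_linear:
  assumes z: "Im z > 0" and ab: "a + b \<ge> 1" and u: "real (a + b) + 2 * Re u > 2" and N: "N \<ge> 1"
    and per: "periodic N \<phi>" "periodic N \<psi>"
  shows "Ser (\<lambda>mn. \<phi> mn + c * \<psi> mn) a b z u = Ser \<phi> a b z u + c * Ser \<psi> a b z u"
proof -
  have "((\<lambda>mn. \<phi> mn * fab a b u (lat z mn) (lat (cnj z) mn) + c * (\<psi> mn * fab a b u (lat z mn) (lat (cnj z) mn))) has_sum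
      (Ser \<phi> a b z u + c * Ser \<psi> a b z u)) UNIV"
    by (intro has_sum_add has_sum_cmult_right Ser_has_sum[OF z ab u _ N] per)
  hence "((\<lambda>mn. (\<phi> mn + c * \<psi> mn) * fab a b u (lat z mn) (lat (cnj z) mn)) has_sum
      (Ser \<phi> a b z u + c * Ser \<psi> a b z u)) UNIV"
    by (simp add: algebra_simps)
  thus ?thesis unfolding Ser_def by (rule infsumI)
qed

lemma periodic_linear:
  assumes "periodic N \<phi>" "periodic N \<psi>"
  shows "periodic N (\<lambda>mn. \<phi> mn + c * \<psi> mn)"
  using assms by (simp add: periodic_def)

lemma periodic_const: "periodic N (\<lambda>_. c)"
  by (simp add: periodic_def)

definition ev2 :: "int \<times> int \<Rightarrow> complex" where
  "ev2 mn = (if even (fst mn) \<and> even (snd mn) then 1 else 0)"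

text \<open>A weight of mean zero modulo 2: one of the four classes has weight -3, the others 1. It
  links the constant weight, whose sum has a pole at u = 0, to an admissible one.\<close>

definition chi2 :: "int \<times> int \<Rightarrow> complex" where
  "chi2 mn = 1 + (- 4) * ev2 mn"

lemma periodic_ev2: "periodic 2 ev2" "periodic 2 chi2"
  by (auto simp: periodic_def ev2_def chi2_def)

lemma admissible_chi2: "admissible 2 2 chi2"
proof -
  have "pbox 2 = {(0, 0), (0, 1), (1, 0), (1, 1)}"
  proof -
    have "{0..<2::int} = {0, 1}" by auto
    thus ?thesis by (auto simp: pbox_def)
  qed
  thus ?thesis by (simp add: admissible_def periodic_ev2 chi2_def ev2_def)
qed

text \<open>The sum over the sublattice of index \<open>4\<close> is \<open>4\<^sup>-\<^sup>1\<^sup>-\<^sup>u\<close> times the full sum, so a combination of the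
  two has vanishing mean; this continues the full sum meromorphically.\<close>

lemma Ser_chi2:
  assumes z: "Im z > 0" and u: "Re u > 0"
  shows "Ser chi2 1 1 z u = (1 - 4 powr (- u)) * Ser (\<lambda>_. 1) 1 1 z u"
proof -
  define f where "f = (\<lambda>mn. fab 1 1 u (lat z mn) (lat (cnj z) mn))"
  have dbl: "f (2 * fst mn, 2 * snd mn) = 1 / 4 * 4 powr (- u) * f mn" for mn
  proof (cases "lat z mn = 0")
    case True
    hence "lat (cnj z) mn = 0" by (metis cnj_lat complex_cnj_zero)
    moreover have "lat x (2 * fst mn, 2 * snd mn) = 2 * lat x mn" for x by (simp add: lat_def)
    ultimately show ?thesis using True by (simp add: f_def fab_zero)
  next
    case False
    have l: "lat z (2 * fst mn, 2 * snd mn) = lat z mn / (1 / 2)" by (simp add: lat_def)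
    have l': "lat (cnj z) (2 * fst mn, 2 * snd mn) = cnj (lat z mn / (1 / 2))" by (simp add: lat_def)
    have l4: "ln 4 = 2 * ln (2::real)" using ln_realpow[of 2 2] by simp
    have "of_real (norm (1 / 2 :: complex)) powr (2 * u) = exp (2 * u * of_real (ln (1 / 2)))"
      using Ln_of_real[of "1/2"] by (simp add: powr_def norm_divide)
    also have "\<dots> = exp (- u * of_real (ln 4))" unfolding l4 by (simp add: ln_div mult_ac)
    also have "\<dots> = 4 powr (- u)" using Ln_of_real[of 4] by (simp add: powr_def)
    finally have p: "of_real (norm (1 / 2 :: complex)) powr (2 * u) = 4 powr (- u)" .
    have "fab 1 1 u (lat z mn / (1 / 2)) (cnj (lat z mn / (1 / 2))) =
        (1 / 2) ^ 1 * cnj (1 / 2) ^ 1 * of_real (norm (1 / 2 :: complex)) powr (2 * u) * fab 1 1 u (lat z mn) (cnj (lat z mn))"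
      by (rule fab_divide[OF _ False]) simp
    thus ?thesis unfolding f_def l l' p by (simp only: cnj_lat) simp
  qed
  have "Ser ev2 1 1 z u = infsum (\<lambda>mn. ev2 mn * f mn) UNIV" by (simp add: Ser_def f_def)
  also have "\<dots> = infsum f ((\<lambda>mn. (2 * fst mn, 2 * snd mn)) ` UNIV)"
  proof (rule infsum_cong_neutral)
    fix x :: "int \<times> int" assume x: "x \<in> UNIV - (\<lambda>mn. (2 * fst mn, 2 * snd mn)) ` UNIV"
    have "\<not> (even (fst x) \<and> even (snd x))"
    proof
      assume "even (fst x) \<and> even (snd x)"
      hence "x = (\<lambda>mn. (2 * fst mn, 2 * snd mn)) (fst x div 2, snd x div 2)" by simp
      thus False using x by blast
    qed
    thus "ev2 x * f x = 0" by (auto simp: ev2_def)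
  qed (auto simp: ev2_def)
  also have "\<dots> = (\<Sum>\<^sub>\<infinity>mn. f (2 * fst mn, 2 * snd mn))"
    by (subst infsum_reindex) (auto simp: inj_on_def o_def)
  also have "\<dots> = 1 / 4 * 4 powr (- u) * Ser (\<lambda>_. 1) 1 1 z u"
    unfolding dbl by (subst infsum_cmult_right') (simp add: Ser_def f_def)
  finally have e: "Ser ev2 1 1 z u = 1 / 4 * 4 powr (- u) * Ser (\<lambda>_. 1) 1 1 z u" .
  have "Ser chi2 1 1 z u = Ser (\<lambda>_. 1) 1 1 z u + (- 4) * Ser ev2 1 1 z u"
    unfolding chi2_def[abs_def] by (rule Ser_linear[OF z, of _ _ _ 2]) (use u periodic_ev2 periodic_const in auto)
  thus ?thesis unfolding e by (simp add: algebra_simps)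
qed

lemma one_minus_4_powr_nz:
  fixes u :: complex
  assumes "Re u > 0"
  shows "1 - 4 powr (- u) \<noteq> 0"
proof
  assume "1 - 4 powr (- u) = 0"
  hence "norm (4 powr (- u)) = 1" by simp
  moreover have "norm ((4::complex) powr (- u)) = 4 powr (- Re u)"
    by (subst norm_powr_real_powr) auto
  ultimately show False using assms powr_less_one[of 4 "- Re u"] by simp
qed

text \<open>The zeros of 1 - 4^(-u) are the multiples of 2 pi i / ln 4; inside |u| < 1 / ln 4 only u
  = 0 remains.\<close>

lemma one_minus_4_powr_nz_near: "eventually (\<lambda>s::complex. 1 - 4 powr (- (s - 1)) \<noteq> 0) (at 1)"
proof -
  have l4: "ln 4 > (0::real)" by simp
  have "eventually (\<lambda>s. s \<in> ball 1 (1 / ln 4)) (at (1::complex))"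
    by (rule eventually_at_in_open') (use l4 in auto)
  moreover have "eventually (\<lambda>s. s \<noteq> 1) (at (1::complex))" by (rule eventually_neq_at_within)
  ultimately show ?thesis
  proof eventually_elim
    case (elim s)
    have n: "norm (s - 1) * ln 4 < 1" using elim(1) l4 by (simp add: dist_norm norm_minus_commute field_simps)
    show ?case
    proof
      assume "1 - 4 powr (- (s - 1)) = 0"
      hence "exp (- (s - 1) * of_real (ln 4)) = 1" using Ln_of_real[of 4] by (simp add: powr_def)
      then obtain j :: int where j: "Re (- (s - 1) * of_real (ln 4)) = 0" "Im (- (s - 1) * of_real (ln 4)) = of_int (2 * j) * pi"
        unfolding exp_eq_1 by auto
      have "\<bar>Im (- (s - 1) * of_real (ln 4))\<bar> \<le> norm (- (s - 1) * of_real (ln 4))" by (rule abs_Im_le_cmod)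
      also have "\<dots> < 1" using n l4 by (simp add: norm_mult norm_minus_commute)
      finally have "\<bar>of_int (2 * j) * pi\<bar> < 1" unfolding j(2) .
      hence "\<bar>real_of_int j\<bar> * (2 * pi) < 1" by (simp add: abs_mult mult_ac)
      moreover have "1 < 2 * pi" using pi_gt3 by simp
      ultimately have "\<bar>real_of_int j\<bar> < 1"
        using mult_right_mono[of 1 "\<bar>real_of_int j\<bar>" "2 * pi"] by linarith
      hence "j = 0" by linarith
      with j l4 have "Re (s - 1) = 0" "Im (s - 1) = 0" by auto
      hence "s = 1" by (simp add: complex_eq_iff)
      with elim(2) show False by simp
    qed
  qed
qed

definition cmean :: "nat \<Rightarrow> (int \<times> int \<Rightarrow> complex) \<Rightarrow> complex" where
  "cmean N \<phi> = (\<Sum>b\<in>pbox N. \<phi> b) / of_nat N ^ 2"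

lemma admissible_minus_mean:
  assumes "periodic N \<phi>" "N \<ge> 1"
  shows "admissible 2 N (\<lambda>mn. \<phi> mn + (- cmean N \<phi>) * 1)"
proof -
  have "card (pbox N) = N ^ 2" by (simp add: pbox_def power2_eq_square)
  hence "(\<Sum>b\<in>pbox N. \<phi> b + (- cmean N \<phi>) * 1) = (\<Sum>b\<in>pbox N. \<phi> b) - of_nat (N ^ 2) * cmean N \<phi>"
    by (simp add: sum_subtractf)
  also have "\<dots> = 0" using assms(2) by (simp add: cmean_def)
  finally show ?thesis
    using assms periodic_linear[OF assms(1) periodic_const[of N 1], of "- cmean N \<phi>"]
    unfolding admissible_def by (intro conjI disjI2) auto
qed

text \<open>The weight is split into a part of mean zero, whose sum continues past s = 1, and its
  mean, a constant weight that is continued through \<open>chi2\<close>. A pole at s = 1 can then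
  come only from the denominator 1 - 4^(-(s-1)).\<close>

lemma eis_nonhol_near_1:
  assumes T: "T \<ge> 1" and z: "Im z > 0" and N: "N \<ge> 1" and per: "periodic N (phi T \<alpha> \<beta>)"
  shows "eventually (\<lambda>s. eis_nonhol 0 (of_nat T * z) s \<alpha> \<beta> =
    1 / 2 * (Sphi 2 N (\<lambda>mn. phi T \<alpha> \<beta> mn + (- cmean N (phi T \<alpha> \<beta>)) * 1) 1 1 z (s - 1) +
      cmean N (phi T \<alpha> \<beta>) * Sphi 2 2 chi2 1 1 z (s - 1) / (1 - 4 powr (- (s - 1))))) (at 1)"
proof -
  define \<mu> where "\<mu> = cmean N (phi T \<alpha> \<beta>)"
  define \<phi>0 where "\<phi>0 = (\<lambda>mn. phi T \<alpha> \<beta> mn + (- \<mu>) * 1)"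
  have adm: "admissible 2 N \<phi>0" unfolding \<phi>0_def \<mu>_def by (rule admissible_minus_mean[OF per N])
  define G where "G = (\<lambda>s. 1 / 2 * (Sphi 2 N \<phi>0 1 1 z (s - 1) + \<mu> * Sphi 2 2 chi2 1 1 z (s - 1) / (1 - 4 powr (- (s - 1)))))"
  define H where "H = {w::complex. Re w > 3 / 4}"
  have oH: "open H" unfolding H_def by (rule open_halfspace_Re_gt)
  have ab: "1 + 1 = (2::nat)" by simp
  have hol: "(\<lambda>s. Sphi 2 N' \<theta> 1 1 z (s - 1)) holomorphic_on H" if "admissible 2 N' \<theta>" for N' \<theta>
  proof -
    have "Sphi 2 N' \<theta> 1 1 z \<circ> (\<lambda>s. s - 1) holomorphic_on H"
      by (rule holomorphic_on_compose_gen[OF _ Sphi_holomorphic[OF that ab z]])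
         (auto intro!: holomorphic_intros simp: H_def)
    thus ?thesis by (simp add: o_def)
  qed
  have an: "(\<lambda>s. Sphi 2 N' \<theta> 1 1 z (s - 1)) analytic_on H" if "admissible 2 N' \<theta>" for N' \<theta>
    using hol[OF that] analytic_on_open[OF oH] by blast
  have and4: "(\<lambda>s. 1 - 4 powr (- (s - 1))) analytic_on X" for X :: "complex set"
    by (intro analytic_intros) auto
  have GA: "G analytic_on {s}" if s: "s \<in> H" "1 - 4 powr (- (s - 1)) \<noteq> 0" for s
    unfolding G_def using s an[OF adm] an[OF admissible_chi2]
    by (intro analytic_intros and4) (auto elim: analytic_on_subset)
  have mero: "G meromorphic_on H"
    unfolding G_def
    by (intro meromorphic_intros analytic_on_imp_meromorphic_on an and4 adm admissible_chi2)
  \<comment> \<open>At zeros of the denominator G carries the value of a division by 0, which need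
    not be that of the continuation; \<open>remove_sings\<close> supplies the nicely meromorphic
    representative.\<close>
  define R where "R = remove_sings G"
  have Rn: "R nicely_meromorphic_on {w. Re w > 3 / 4}"
    using remove_sings_nicely_meromorphic[OF mero] by (simp add: R_def H_def)
  have RG: "R s = G s" if "s \<in> H" "1 - 4 powr (- (s - 1)) \<noteq> 0" for s
    unfolding R_def by (rule remove_sings_at_analytic[OF GA[OF that]])
  have cont: "eis_nonhol 0 (of_nat T * z) s \<alpha> \<beta> = R s" if s: "Re s > 3 / 4" for s
    unfolding eis_nonhol_def
  proof (rule continuation_eqI[OF Rn _ s])
    fix w :: complex assume "1 - of_int 0 / 2 < Re w"
    hence w: "Re w > 1" by simp
    hence u: "Re (w - 1) > - 1 / 4" "real 2 + 2 * Re (w - 1) > 2" "Re (w - 1) > 0" by auto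
    have u': "real (1 + 1) + 2 * Re (w - 1) > 2" using w by simp
    have nz: "1 - 4 powr (- (w - 1)) \<noteq> 0" by (rule one_minus_4_powr_nz[OF u(3)])
    have "R w = G w" by (rule RG) (use w nz in \<open>auto simp: H_def\<close>)
    also have "\<dots> = 1 / 2 * (Ser \<phi>0 1 1 z (w - 1) + \<mu> * Ser (\<lambda>_. 1) 1 1 z (w - 1))"
      unfolding G_def Sphi_eq_Ser[OF adm ab z u(1,2)] Sphi_eq_Ser[OF admissible_chi2 ab z u(1,2)] Ser_chi2[OF z u(3)]
      using nz by simp
    also have "Ser \<phi>0 1 1 z (w - 1) = Ser (phi T \<alpha> \<beta>) 1 1 z (w - 1) + (- \<mu>) * Ser (\<lambda>_. 1) 1 1 z (w - 1)"
      unfolding \<phi>0_def by (rule Ser_linear[OF z _ u' N per periodic_const]) simp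
    finally have R: "R w = 1 / 2 * Ser (phi T \<alpha> \<beta>) 1 1 z (w - 1)" by simp
    have "eis_nonhol_series (2 - int 2) (of_nat T * z) w \<alpha> \<beta> = 1 / 2 * Ser (phi T \<alpha> \<beta>) 1 (2 - 1) z (w - of_nat (2 - 1))"
      by (rule eis_nonhol_series_eq_Ser[OF _ T z]) simp
    thus "R w = eis_nonhol_series 0 (of_nat T * z) w \<alpha> \<beta>" unfolding R by simp
  qed
  have "eventually (\<lambda>s. s \<in> H) (at 1)" by (rule eventually_at_in_open'[OF oH]) (simp add: H_def)
  with one_minus_4_powr_nz_near show ?thesis
  proof eventually_elim
    case (elim s)
    hence "eis_nonhol 0 (of_nat T * z) s \<alpha> \<beta> = G s" using cont[of s] RG[of s] by (simp add: H_def)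
    thus ?case by (simp add: G_def \<phi>0_def \<mu>_def)
  qed
qed

text \<open>Admissibility of the combination forces \<mu>1 = c \<mu>2 for the means, and both
  singular parts contain the same \<open>chi2\<close> sum. They cancel identically in s, not merely
  in the residue, so the limit is the value of a continuous function.\<close>

lemma Fphi_trivial_limit:
  assumes T: "T1 \<ge> 1" "T2 \<ge> 1" and z: "Im z > 0" and N: "N \<ge> 1"
    and per: "periodic N (phi T1 \<alpha> \<beta>)" "periodic N (phi T2 \<alpha> \<beta>)"
    and adm: "admissible 2 N (\<lambda>mn. phi T1 \<alpha> \<beta> mn + (- c) * phi T2 \<alpha> \<beta> mn)"
  shows "((\<lambda>s. of_real (Im z) powr s * eis_nonhol 0 (of_nat T1 * z) s \<alpha> \<beta> -
      c * of_real (Im z) powr s * eis_nonhol 0 (of_nat T2 * z) s \<alpha> \<beta>) \<longlongrightarrow>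
      Fphi 2 N (\<lambda>mn. phi T1 \<alpha> \<beta> mn + (- c) * phi T2 \<alpha> \<beta> mn) z) (at 1)"
proof -
  define \<phi>1 \<phi>2 where "\<phi>1 = phi T1 \<alpha> \<beta>" and "\<phi>2 = phi T2 \<alpha> \<beta>"
  define \<mu>1 \<mu>2 where "\<mu>1 = cmean N \<phi>1" and "\<mu>2 = cmean N \<phi>2"
  define \<theta> where "\<theta> = (\<lambda>mn. \<phi>1 mn + (- c) * \<phi>2 mn)"
  have adm': "admissible 2 N \<theta>" using adm by (simp add: \<theta>_def \<phi>1_def \<phi>2_def)
  have "(\<Sum>b\<in>pbox N. \<theta> b) = 0" using adm' by (simp add: admissible_def)
  hence "(\<Sum>b\<in>pbox N. \<phi>1 b) = c * (\<Sum>b\<in>pbox N. \<phi>2 b)"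
    by (simp add: \<theta>_def sum_subtractf sum_distrib_left)
  hence mu: "\<mu>1 = c * \<mu>2" by (simp add: \<mu>1_def \<mu>2_def cmean_def)
  note p1 = per(1)[folded \<phi>1_def] and p2 = per(2)[folded \<phi>2_def]
  have a1: "admissible 2 N (\<lambda>mn. \<phi>1 mn + (- \<mu>1) * 1)" and a2: "admissible 2 N (\<lambda>mn. \<phi>2 mn + (- \<mu>2) * 1)"
    unfolding \<mu>1_def \<mu>2_def by (rule admissible_minus_mean[OF p1 N], rule admissible_minus_mean[OF p2 N])
  have ab: "1 + 1 = (2::nat)" by simp
  have lin: "Sphi 2 N (\<lambda>mn. \<phi>1 mn + (- \<mu>1) * 1) 1 1 z u - c * Sphi 2 N (\<lambda>mn. \<phi>2 mn + (- \<mu>2) * 1) 1 1 z u = Sphi 2 N \<theta> 1 1 z u"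
    if "Re u > - 1 / 4" for u
  proof (rule half_plane_eqI[where d = 1, OF _ _ _ that])
    show "(\<lambda>u. Sphi 2 N (\<lambda>mn. \<phi>1 mn + (- \<mu>1) * 1) 1 1 z u - c * Sphi 2 N (\<lambda>mn. \<phi>2 mn + (- \<mu>2) * 1) 1 1 z u) holomorphic_on {u. Re u > - 1 / 4}"
      by (intro holomorphic_intros Sphi_holomorphic[OF a1 ab z] Sphi_holomorphic[OF a2 ab z])
    show "Sphi 2 N \<theta> 1 1 z holomorphic_on {u. Re u > - 1 / 4}" by (rule Sphi_holomorphic[OF adm' ab z])
    fix u :: complex assume u: "Re u > 1" "Re u > - 1 / 4"
    hence u2: "real 2 + 2 * Re u > 2" "real (1 + 1) + 2 * Re u > 2" by auto
    show "Sphi 2 N (\<lambda>mn. \<phi>1 mn + (- \<mu>1) * 1) 1 1 z u - c * Sphi 2 N (\<lambda>mn. \<phi>2 mn + (- \<mu>2) * 1) 1 1 z u = Sphi 2 N \<theta> 1 1 z u"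
    proof -
      have s: "Ser (\<lambda>mn. \<phi>1 mn + (- \<mu>1) * 1) 1 1 z u = Ser \<phi>1 1 1 z u + (- \<mu>1) * Ser (\<lambda>_. 1) 1 1 z u"
        "Ser (\<lambda>mn. \<phi>2 mn + (- \<mu>2) * 1) 1 1 z u = Ser \<phi>2 1 1 z u + (- \<mu>2) * Ser (\<lambda>_. 1) 1 1 z u"
        "Ser \<theta> 1 1 z u = Ser \<phi>1 1 1 z u + (- c) * Ser \<phi>2 1 1 z u"
        unfolding \<theta>_def by (rule Ser_linear[OF z _ u2(2) N], simp, intro p1 p2 periodic_const, intro p1 p2 periodic_const)+
      show ?thesis
        unfolding Sphi_eq_Ser[OF a1 ab z u(2) u2(1)] Sphi_eq_Ser[OF a2 ab z u(2) u2(1)] Sphi_eq_Ser[OF adm' ab z u(2) u2(1)] s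
        unfolding mu by (simp add: algebra_simps)
    qed
  qed
  define y where "y = complex_of_real (Im z)"
  have y0: "y \<noteq> 0" using z by (simp add: y_def)
  have "isCont (\<lambda>s. y powr s * (1 / 2 * Sphi 2 N \<theta> 1 1 z (s - 1))) 1"
  proof -
    have "(\<lambda>s. Sphi 2 N \<theta> 1 1 z (s - 1)) holomorphic_on {w. Re w > 3 / 4}"
    proof -
      have "Sphi 2 N \<theta> 1 1 z \<circ> (\<lambda>s. s - 1) holomorphic_on {w. Re w > 3 / 4}"
        by (rule holomorphic_on_compose_gen[OF _ Sphi_holomorphic[OF adm' ab z]])
           (auto intro!: holomorphic_intros)
      thus ?thesis by (simp add: o_def)
    qed
    hence "continuous_on {w. Re w > 3 / 4} (\<lambda>s. Sphi 2 N \<theta> 1 1 z (s - 1))"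
      by (rule holomorphic_on_imp_continuous_on)
    hence "\<forall>x\<in>{w. Re w > 3 / 4}. isCont (\<lambda>s. Sphi 2 N \<theta> 1 1 z (s - 1)) x"
      by (simp only: continuous_on_eq_continuous_at[OF open_halfspace_Re_gt])
    hence "isCont (\<lambda>s. Sphi 2 N \<theta> 1 1 z (s - 1)) 1" by (rule bspec) simp
    thus ?thesis using z by (intro continuous_intros) (auto simp: y_def)
  qed
  hence lim: "(\<lambda>s. y powr s * (1 / 2 * Sphi 2 N \<theta> 1 1 z (s - 1))) \<midarrow>1\<rightarrow> y powr 1 * (1 / 2 * Sphi 2 N \<theta> 1 1 z (1 - 1))"
    by (rule isContD)
  have "y powr 1 * (1 / 2 * Sphi 2 N \<theta> 1 1 z (1 - 1)) = Fphi 2 N \<theta> z"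
    using Fphi_eq_Sphi[OF adm', of z] y0 by (simp add: y_def)
  note lim = lim[unfolded this]
  have "eventually (\<lambda>s. s \<in> {w. Re w > 3 / 4}) (at (1::complex))"
    by (rule eventually_at_in_open'[OF open_halfspace_Re_gt]) simp
  with eis_nonhol_near_1[OF T(1) z N per(1)] eis_nonhol_near_1[OF T(2) z N per(2)]
  have ev: "eventually (\<lambda>s. y powr s * (1 / 2 * Sphi 2 N \<theta> 1 1 z (s - 1)) = y powr s * eis_nonhol 0 (of_nat T1 * z) s \<alpha> \<beta> -
      c * y powr s * eis_nonhol 0 (of_nat T2 * z) s \<alpha> \<beta>) (at 1)"
  proof eventually_elim
    case (elim s)
    have "Re (s - 1) > - 1 / 4" using elim(3) by simp
    note l = lin[OF this]
    have alg: "y * (1 / 2 * (A + c * m * X / D)) - c * y * (1 / 2 * (B + m * X / D)) = y * (1 / 2 * (A - c * B))"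
      for y A B m X D :: complex by (simp add: algebra_simps)
    show ?case
      unfolding elim(1) elim(2) \<phi>1_def[symmetric] \<phi>2_def[symmetric] \<mu>1_def[symmetric] \<mu>2_def[symmetric] l[symmetric] 
      unfolding mu alg ..
  qed
  show ?thesis
    using Lim_transform_eventually[OF lim ev] by (simp add: y_def \<theta>_def \<phi>1_def \<phi>2_def)
qed

section \<open>The Lipschitz formula\<close>

text \<open>The product rGamma z * rGamma (1 - z) = sin (pi z) / pi is differentiated in two ways,
  by the product rule and through its closed form.\<close>

lemma Digamma_reflection:
  fixes z :: complex
  assumes z: "z \<notin> \<int>"
  shows "Digamma (1 - z) - Digamma z = of_real pi * cos (of_real pi * z) / sin (of_real pi * z)"
proof -
  have z1: "z \<notin> \<int>\<^sub>\<le>\<^sub>0" using z nonpos_Ints_subset_Ints by blast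
  have z2: "1 - z \<notin> \<int>\<^sub>\<le>\<^sub>0"
  proof
    assume "1 - z \<in> \<int>\<^sub>\<le>\<^sub>0"
    hence "1 - (1 - z) \<in> \<int>" using nonpos_Ints_subset_Ints by (intro Ints_diff) auto
    thus False using z by simp
  qed
  have d1: "(rGamma has_field_derivative - rGamma z * Digamma z) (at z)"
    by (rule has_field_derivative_rGamma_no_nonpos_int[OF z1])
  have d2: "((\<lambda>z. rGamma (1 - z)) has_field_derivative (- rGamma (1 - z) * Digamma (1 - z)) * (- 1)) (at z)"
  proof -
    have 1: "(rGamma has_field_derivative - rGamma (1 - z) * Digamma (1 - z)) (at ((\<lambda>z. 1 - z) z))"
      using has_field_derivative_rGamma_no_nonpos_int[OF z2, of UNIV] by simp
    have 2: "((\<lambda>z. 1 - z) has_field_derivative (- 1)) (at z)" by (auto intro!: derivative_eq_intros)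
    show ?thesis by (rule DERIV_chain2[OF 1 2])
  qed
  have "((\<lambda>z. rGamma z * rGamma (1 - z)) has_field_derivative
      (- rGamma z * Digamma z) * rGamma (1 - z) + ((- rGamma (1 - z) * Digamma (1 - z)) * (- 1)) * rGamma z) (at z)"
    by (rule DERIV_mult[OF d1 d2])
  moreover have "((\<lambda>z. rGamma z * rGamma (1 - z)) has_field_derivative cos (of_real pi * z)) (at z)"
  proof -
    have "((\<lambda>z. sin (of_real pi * z) / of_real pi) has_field_derivative cos (of_real pi * z)) (at z)"
      by (auto intro!: derivative_eq_intros)
    thus ?thesis by (simp add: rGamma_reflection_complex)
  qed
  ultimately have "(- rGamma z * Digamma z) * rGamma (1 - z) + ((- rGamma (1 - z) * Digamma (1 - z)) * (- 1)) * rGamma z =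
      cos (of_real pi * z)" by (rule DERIV_unique)
  hence e: "(rGamma z * rGamma (1 - z)) * (Digamma (1 - z) - Digamma z) = cos (of_real pi * z)"
    by (simp add: algebra_simps)
  have "sin (of_real pi * z) \<noteq> 0"
  proof
    assume "sin (of_real pi * z) = 0"
    hence "rGamma z * rGamma (1 - z) = 0" by (simp add: rGamma_reflection_complex)
    thus False using z1 z2 by (auto simp: rGamma_eq_zero_iff)
  qed
  thus ?thesis using e by (simp add: rGamma_reflection_complex field_simps)
qed

lemma sum_sym_interval:
  fixes f :: "int \<Rightarrow> complex"
  shows "(\<Sum>q\<in>{- int m..<int m}. f q) = (\<Sum>n<m. f (int n)) + (\<Sum>n<m. f (- 1 - int n))"
proof (induction m)
  case (Suc m)
  have "{- int (Suc m)..<int (Suc m)} = insert (- 1 - int m) (insert (int m) {- int m..<int m})" by auto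
  thus ?case using Suc by simp
qed simp

text \<open>The limit formula for Digamma is used at z, giving the terms q \<ge> 0, and at 1 - z,
  giving q < 0. There are m terms of each kind, so the two logarithms cancel; this is the origin of
  the half-open intervals used from here on.\<close>

lemma cot_partial_fractions:
  fixes z :: complex
  assumes z: "z \<notin> \<int>"
  shows "(\<lambda>m. \<Sum>q\<in>{- int m..<int m}. inverse (z + of_int q)) \<longlonglongrightarrow> of_real pi * cos (of_real pi * z) / sin (of_real pi * z)"
proof -
  have nz: "z \<noteq> 0" "1 - z \<noteq> 0"
    using z by (auto simp: eq_iff_diff_eq_0[symmetric])
  have "(\<lambda>m. (of_real (ln (real m)) - (\<Sum>n<m. inverse (1 - z + of_nat n))) -
      (of_real (ln (real m)) - (\<Sum>n<m. inverse (z + of_nat n)))) \<longlonglongrightarrow> Digamma (1 - z) - Digamma z"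
    by (intro tendsto_diff Digamma_LIMSEQ nz)
  moreover have "(of_real (ln (real m)) - (\<Sum>n<m. inverse (1 - z + of_nat n))) -
      (of_real (ln (real m)) - (\<Sum>n<m. inverse (z + of_nat n))) = (\<Sum>q\<in>{- int m..<int m}. inverse (z + of_int q))" for m
  proof -
    have "inverse (z + of_int (- 1 - int n)) = - inverse (1 - z + of_nat n)" for n
      by (simp flip: inverse_minus_eq)
    thus ?thesis unfolding sum_sym_interval by (simp add: sum_negf)
  qed
  ultimately show ?thesis unfolding Digamma_reflection[OF z] by simp
qed

definition Lr :: "nat \<Rightarrow> complex \<Rightarrow> complex" where
  "Lr k \<tau> = (\<Sum>\<^sub>\<infinity>c. of_nat (Suc c) ^ (k - 1) * exp (2 * of_real pi * \<i> * of_nat (Suc c) * \<tau>))"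

text \<open>Half of the exponential pays for the polynomial, through y^m \<le> exp (m y) with y = a
  x / (2 (m + 1)); the other half is a geometric series. Taking m + 1 in the denominator keeps it
  nonzero for m = 0.\<close>

lemma summable_pow_exp:
  assumes a: "a > 0"
  shows "(\<lambda>c. real (Suc c) ^ m * exp (- a * real (Suc c))) summable_on UNIV"
proof -
  define K where "K = (2 * real (Suc m) / a) ^ m"
  have K: "K \<ge> 0" using a by (simp add: K_def)
  have g: "summable (\<lambda>c. K * exp (- a / 2) ^ Suc c)"
    using a by (intro summable_mult summable_Suc_iff[THEN iffD2] summable_geometric) auto
  have "summable (\<lambda>c. real (Suc c) ^ m * exp (- a * real (Suc c)))"
  proof (rule summable_comparison_test[OF _ g], intro exI allI impI)
    fix c :: nat
    define x where "x = real (Suc c)"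
    have x: "x > 0" by (simp add: x_def)
    define y where "y = a * x / (2 * real (Suc m))"
    have y: "y \<ge> 0" using a x by (simp add: y_def)
    have "y ^ m \<le> exp (real m * y)" by (rule power_le_exp[OF y])
    also have "\<dots> \<le> exp (a * x / 2)"
    proof -
      have "real m * y \<le> real (Suc m) * y" using y by (intro mult_right_mono) auto
      also have "\<dots> = a * x / 2" by (simp add: y_def del: of_nat_Suc)
      finally show ?thesis by simp
    qed
    finally have ym: "y ^ m \<le> exp (a * x / 2)" .
    have "x = 2 * real (Suc m) / a * y" using a by (simp add: y_def del: of_nat_Suc)
    hence "x ^ m = K * y ^ m" by (simp only: K_def power_mult_distrib)
    also have "\<dots> \<le> K * exp (a * x / 2)" using ym K by (intro mult_left_mono) auto
    finally have "x ^ m * exp (- a * x) \<le> K * exp (a * x / 2) * exp (- a * x)"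
      by (intro mult_right_mono) auto
    also have "\<dots> = K * exp (- a / 2 * x)" by (simp add: mult.assoc flip: exp_add)
    also have "exp (- a / 2 * x) = exp (- a / 2) ^ Suc c"
      unfolding exp_of_nat_mult[symmetric] x_def by (simp add: mult.commute)
    finally show "norm (real (Suc c) ^ m * exp (- a * real (Suc c))) \<le> K * exp (- a / 2) ^ Suc c"
      using x by (simp add: x_def)
  qed
  thus ?thesis by (subst summable_on_UNIV_nonneg_real_iff) auto
qed

lemma norm_exp_2pi: "norm (exp (2 * of_real pi * \<i> * of_nat c * \<tau>)) = exp (- (2 * pi * Im \<tau>) * real c)"
  by (simp add: norm_exp_eq_Re mult_ac)

lemma Lr_has_sum:
  assumes "Im \<tau> > 0"
  shows "((\<lambda>c. of_nat (Suc c) ^ (k - 1) * exp (2 * of_real pi * \<i> * of_nat (Suc c) * \<tau>)) has_sum Lr k \<tau>) UNIV"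
proof -
  have "(\<lambda>c. norm (of_nat (Suc c) ^ (k - 1) * exp (2 * of_real pi * \<i> * of_nat (Suc c) * \<tau>))) summable_on UNIV"
    using summable_pow_exp[of "2 * pi * Im \<tau>" "k - 1"] assms
    unfolding norm_mult norm_exp_2pi norm_power norm_of_nat by simp
  hence "(\<lambda>c. of_nat (Suc c) ^ (k - 1) * exp (2 * of_real pi * \<i> * of_nat (Suc c) * \<tau>)) summable_on UNIV"
    by (rule Infinite_Sum.abs_summable_summable)
  thus ?thesis unfolding Lr_def by (rule has_sum_infsum)
qed

lemma Lr_deriv:
  assumes t: "Im \<tau> > 0" and k: "k \<ge> 1"
  shows "(Lr k has_field_derivative (2 * of_real pi * \<i> * Lr (Suc k) \<tau>)) (at \<tau>)"
proof -
  define r where "r = Im \<tau> / 2"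
  have r: "r > 0" using t by (simp add: r_def)
  have "\<exists>D. ((\<lambda>w. \<Sum>\<^sub>\<infinity>c\<in>UNIV. of_nat (Suc c) ^ (k - 1) * exp (2 * of_real pi * \<i> * of_nat (Suc c) * w)) has_field_derivative D) (at \<tau>) \<and>
      ((\<lambda>c. 2 * of_real pi * \<i> * (of_nat (Suc c) ^ (Suc k - 1) * exp (2 * of_real pi * \<i> * of_nat (Suc c) * \<tau>))) has_sum D) UNIV"
  proof (rule has_field_derivative_infsum[OF r])
    fix c w assume "w \<in> cball \<tau> r"
    hence "norm (\<tau> - w) \<le> r" by (simp add: dist_norm)
    hence w: "Im w \<ge> Im \<tau> / 2" using abs_Im_le_cmod[of "\<tau> - w"] by (simp add: r_def)
    have kk: "of_nat (Suc c) ^ (Suc k - 1) = of_nat (Suc c) * (of_nat (Suc c) ^ (k - 1) :: complex)"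
      using k by (cases k) auto
    have "((\<lambda>w. exp (2 * of_real pi * \<i> * of_nat (Suc c) * w)) has_field_derivative
        exp (2 * of_real pi * \<i> * of_nat (Suc c) * w) * (2 * of_real pi * \<i> * of_nat (Suc c))) (at w)"
      by (auto intro!: derivative_eq_intros)
    from DERIV_cmult[OF this, of "of_nat (Suc c) ^ (k - 1)"]
    show "((\<lambda>w. of_nat (Suc c) ^ (k - 1) * exp (2 * of_real pi * \<i> * of_nat (Suc c) * w)) has_field_derivative
        2 * of_real pi * \<i> * (of_nat (Suc c) ^ (Suc k - 1) * exp (2 * of_real pi * \<i> * of_nat (Suc c) * w))) (at w)"
      unfolding kk by (rule DERIV_cong) (simp only: mult_ac)
    show "norm (of_nat (Suc c) ^ (k - 1) * exp (2 * of_real pi * \<i> * of_nat (Suc c) * w)) \<le>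
        real (Suc c) ^ (k - 1) * exp (- (pi * Im \<tau>) * real (Suc c))"
      unfolding norm_mult norm_exp_2pi norm_power norm_of_nat
      using w by (intro mult_left_mono) (auto intro!: mult_right_mono)
  next
    show "(\<lambda>c. real (Suc c) ^ (k - 1) * exp (- (pi * Im \<tau>) * real (Suc c))) summable_on UNIV"
      by (rule summable_pow_exp) (use t in simp)
    show "\<tau> \<in> ball \<tau> r" using r by simp
  qed
  then obtain D where D: "(Lr k has_field_derivative D) (at \<tau>)"
      "((\<lambda>c. 2 * of_real pi * \<i> * (of_nat (Suc c) ^ (Suc k - 1) * exp (2 * of_real pi * \<i> * of_nat (Suc c) * \<tau>))) has_sum D) UNIV"
    unfolding Lr_def[abs_def] by blast
  have "D = 2 * of_real pi * \<i> * Lr (Suc k) \<tau>"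
    by (rule has_sum_unique[OF D(2) has_sum_cmult_right[OF Lr_has_sum[OF t]]])
  thus ?thesis using D(1) by simp
qed

definition Lq :: "nat \<Rightarrow> complex \<Rightarrow> complex" where
  "Lq k \<tau> = (\<Sum>\<^sub>\<infinity>q::int. inverse (\<tau> + of_int q) ^ k)"

lemma good_row:
  assumes g: "good C \<tau>0" and t: "norm (\<tau> - \<tau>0) \<le> 1 / (16 * C)"
  shows "1 + \<bar>real_of_int q\<bar> \<le> 2 * C * norm (\<tau> + of_int q)" "\<tau> + of_int q \<noteq> 0"
proof -
  have C: "C \<ge> 1" using g by (simp add: good_def)
  have l: "lat x (1, q) = x + of_int q" for x by (simp add: lat_def)
  have "\<forall>mn. \<bar>of_int (fst mn)\<bar> + \<bar>of_int (snd mn)\<bar> \<le> C * norm (lat \<tau>0 mn)" using g by (auto simp: good_def)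
  from spec[OF this, of "(1, q)"] have 1: "1 + \<bar>real_of_int q\<bar> \<le> C * norm (\<tau>0 + of_int q)" by (simp add: l)
  have "norm (\<tau> + of_int q - (\<tau>0 + of_int q)) \<le> norm (\<tau>0 + of_int q) / 16"
    using lat_diff_bound[OF g t, of "(1, q)"] by (simp add: l)
  hence "norm (\<tau>0 + of_int q) \<le> 2 * norm (\<tau> + of_int q)"
    using norm_triangle_sub[of "\<tau>0 + of_int q" "\<tau> + of_int q"] norm_ge_zero[of "\<tau>0 + of_int q"]
    by (simp only: norm_minus_commute)
  hence "C * norm (\<tau>0 + of_int q) \<le> C * (2 * norm (\<tau> + of_int q))" using C by (intro mult_left_mono) auto
  with 1 show 2: "1 + \<bar>real_of_int q\<bar> \<le> 2 * C * norm (\<tau> + of_int q)" by simp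
  show "\<tau> + of_int q \<noteq> 0"
  proof
    assume "\<tau> + of_int q = 0"
    with 2 show False by simp
  qed
qed

lemma inverse_row_bound:
  assumes g: "good C \<tau>0" and t: "norm (\<tau> - \<tau>0) \<le> 1 / (16 * C)"
  shows "norm (inverse (\<tau> + of_int q)) \<le> 2 * C / (1 + \<bar>real_of_int q\<bar>)"
proof -
  have C: "C \<ge> 1" using g by (simp add: good_def)
  have n: "norm (\<tau> + of_int q) > 0" using good_row(2)[OF g t] by simp
  have "inverse (norm (\<tau> + of_int q)) \<le> 2 * C / (1 + \<bar>real_of_int q\<bar>)"
    using good_row(1)[OF g t, of q] n by (simp add: field_simps)
  thus ?thesis by (simp only: norm_inverse)
qed

lemma summable_row: "(\<lambda>q::int. K * (1 + \<bar>real_of_int q\<bar>) powr (- 2)) summable_on UNIV"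
  by (intro summable_on_cmult_right summable_on_int_powr) simp

lemma inverse_row_power_bound:
  assumes g: "good C \<tau>0" and t: "norm (\<tau> - \<tau>0) \<le> 1 / (16 * C)" and k: "k \<ge> 2"
  shows "norm (inverse (\<tau> + of_int q) ^ k) \<le> (2 * C) ^ k * (1 + \<bar>real_of_int q\<bar>) powr (- 2)"
proof -
  have C: "C \<ge> 1" using g by (simp add: good_def)
  have "norm (inverse (\<tau> + of_int q) ^ k) \<le> (2 * C / (1 + \<bar>real_of_int q\<bar>)) ^ k"
    unfolding norm_power by (intro power_mono inverse_row_bound[OF g t]) auto
  also have "\<dots> = (2 * C) ^ k * (1 / (1 + \<bar>real_of_int q\<bar>)) ^ k" by (simp add: power_divide)
  also have "\<dots> \<le> (2 * C) ^ k * (1 / (1 + \<bar>real_of_int q\<bar>)) ^ 2"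
    using C k by (intro mult_left_mono power_decreasing) auto
  also have "(1 / (1 + \<bar>real_of_int q\<bar>)) ^ 2 = (1 + \<bar>real_of_int q\<bar>) powr (- 2)"
  proof -
    have p: "0 < 1 + \<bar>real_of_int q\<bar>" by simp
    have "(1 + \<bar>real_of_int q\<bar>) powr (- 2) = inverse ((1 + \<bar>real_of_int q\<bar>) powr 2)" by (rule powr_minus)
    also have "(1 + \<bar>real_of_int q\<bar>) powr 2 = (1 + \<bar>real_of_int q\<bar>) ^ 2"
      using powr_realpow[OF p, of 2] by simp
    finally show ?thesis by (simp add: power_one_over inverse_eq_divide)
  qed
  finally show ?thesis .
qed

lemma Lq_has_sum:
  assumes t: "Im \<tau> > 0" and k: "k \<ge> 2"
  shows "((\<lambda>q::int. inverse (\<tau> + of_int q) ^ k) has_sum Lq k \<tau>) UNIV"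
proof -
  obtain C where g: "good C \<tau>" using good_exists[OF t] by blast
  have C: "C \<ge> 1" using g by (simp add: good_def)
  have b: "norm (inverse (\<tau> + of_int q) ^ k) \<le> (2 * C) ^ k * (1 + \<bar>real_of_int q\<bar>) powr (- 2)" for q
    by (rule inverse_row_power_bound[OF g _ k]) (use C in simp)
  have "(\<lambda>q::int. norm (inverse (\<tau> + of_int q) ^ k)) summable_on UNIV"
    by (rule Infinite_Sum.abs_summable_on_comparison_test'[OF summable_row[of "(2 * C) ^ k"] b])
  hence "(\<lambda>q::int. inverse (\<tau> + of_int q) ^ k) summable_on UNIV" by (rule Infinite_Sum.abs_summable_summable)
  thus ?thesis unfolding Lq_def by (rule has_sum_infsum)
qed

lemma Lq_deriv:
  assumes t: "Im \<tau> > 0" and k: "k \<ge> 2"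
  shows "(Lq k has_field_derivative (- of_nat k * Lq (Suc k) \<tau>)) (at \<tau>)"
proof -
  obtain C where g: "good C \<tau>" using good_exists[OF t] by blast
  have C: "C \<ge> 1" using g by (simp add: good_def)
  define r where "r = 1 / (16 * C)"
  have r: "r > 0" using C by (simp add: r_def)
  have "\<exists>D. ((\<lambda>w. \<Sum>\<^sub>\<infinity>q::int\<in>UNIV. inverse (w + of_int q) ^ k) has_field_derivative D) (at \<tau>) \<and>
      ((\<lambda>q::int. - of_nat k * (inverse (\<tau> + of_int q) ^ Suc k)) has_sum D) UNIV"
  proof (rule has_field_derivative_infsum[OF r])
    fix q :: int and w assume "w \<in> cball \<tau> r"
    hence w: "norm (w - \<tau>) \<le> 1 / (16 * C)" by (simp add: dist_norm norm_minus_commute r_def)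
    have dw: "((\<lambda>w. w + of_int q) has_field_derivative 1) (at w)" by (auto intro!: derivative_eq_intros)
    from DERIV_chain2[OF inverse_power_deriv[OF good_row(2)[OF g w]] dw]
    show "((\<lambda>w. inverse (w + of_int q) ^ k) has_field_derivative - of_nat k * (inverse (w + of_int q) ^ Suc k)) (at w)"
      by (rule DERIV_cong) simp
    show "norm (inverse (w + of_int q) ^ k) \<le> (2 * C) ^ k * (1 + \<bar>real_of_int q\<bar>) powr (- 2)"
      by (rule inverse_row_power_bound[OF g w k])
  qed (use r summable_row in auto)
  then obtain D where D: "(Lq k has_field_derivative D) (at \<tau>)"
      "((\<lambda>q::int. - of_nat k * (inverse (\<tau> + of_int q) ^ Suc k)) has_sum D) UNIV"
    unfolding Lq_def[abs_def] by blast
  have "D = - of_nat k * Lq (Suc k) \<tau>"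
    by (rule has_sum_unique[OF D(2) has_sum_cmult_right[OF Lq_has_sum[OF t]]]) (use k in simp)
  thus ?thesis using D(1) by simp
qed

lemma filterlim_sym_interval:
  "filterlim (\<lambda>n. {- int n..<int n}) (finite_subsets_at_top UNIV) sequentially"
  unfolding filterlim_finite_subsets_at_top
proof (intro allI impI)
  fix X :: "int set" assume X: "finite X \<and> X \<subseteq> UNIV"
  define m where "m = nat (Max (insert 0 (abs ` X))) + 1"
  have m: "\<bar>x\<bar> < int m" if "x \<in> X" for x
  proof -
    have "\<bar>x\<bar> \<le> Max (insert 0 (abs ` X))" using X that by (intro Max_ge) auto
    moreover have "0 \<le> Max (insert 0 (abs ` X))" using X by (intro Max_ge) auto
    ultimately show ?thesis by (simp add: m_def)
  qed
  show "\<forall>\<^sub>F n in sequentially. finite {- int n..<int n} \<and> X \<subseteq> {- int n..<int n} \<and> {- int n..<int n} \<subseteq> UNIV"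
    using eventually_ge_at_top[of m]
  proof eventually_elim
    case (elim n)
    have "x \<in> {- int n..<int n}" if "x \<in> X" for x using m[OF that] elim by auto
    thus ?case by auto
  qed
qed

lemma has_sum_sym_LIMSEQ:
  assumes "(f has_sum S) (UNIV :: int set)"
  shows "(\<lambda>n. \<Sum>q\<in>{- int n..<int n}. f q) \<longlonglongrightarrow> S"
  using filterlim_compose[OF assms[unfolded has_sum_def] filterlim_sym_interval] by simp

text \<open>With E = exp (i pi \<tau>) and q = E^2 the cotangent is -i - 2i q/(1 - q), and q/(1 - q)
  is the geometric series \<open>Lr 1\<close>. The constant -pi i has no counterpart for larger k;
  it is responsible for the extra constant of weight 1.\<close>

lemma lipschitz_1:
  assumes t: "Im \<tau> > 0"
  shows "(\<lambda>n. \<Sum>q\<in>{- int n..<int n}. inverse (\<tau> + of_int q)) \<longlonglongrightarrow> - of_real pi * \<i> + (- 2 * of_real pi * \<i>) * Lr 1 \<tau>"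
proof -
  define q where "q = exp (2 * of_real pi * \<i> * \<tau>)"
  have nq: "norm q < 1" using t norm_exp_2pi[of 1 \<tau>] by (simp add: q_def)
  have q1: "q \<noteq> 1" using nq by auto
  have nz: "\<tau> \<notin> \<int>" using t by (auto elim!: Ints_cases)
  have pw: "q ^ Suc c = exp (2 * of_real pi * \<i> * of_nat (Suc c) * \<tau>)" for c
    unfolding q_def exp_of_nat_mult[symmetric] by (simp only: mult_ac)
  have "(\<lambda>c. q ^ Suc c) sums (q * (1 / (1 - q)))"
    using sums_mult[OF geometric_sums[OF nq], of q] by simp
  moreover have "(\<lambda>c. q ^ Suc c) sums Lr 1 \<tau>"
    using has_sum_imp_sums[OF Lr_has_sum[OF t, of 1]] unfolding pw by simp
  ultimately have L: "Lr 1 \<tau> = q * (1 / (1 - q))" by (rule sums_unique2[symmetric])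
  define E where "E = exp (\<i> * (of_real pi * \<tau>))"
  have E0: "E \<noteq> 0" by (simp add: E_def)
  have qE: "q = E ^ 2" unfolding q_def E_def power2_eq_square exp_add[symmetric] by (simp add: algebra_simps)
  have "cos (of_real pi * \<tau>) = (E + inverse E) / 2"
    unfolding cos_exp_eq E_def by (simp add: exp_minus)
  moreover have "sin (of_real pi * \<tau>) = (E - inverse E) / (2 * \<i>)"
    unfolding sin_exp_eq E_def by (simp add: exp_minus)
  moreover have "(a / 2) / (b / (2 * \<i>)) = \<i> * a / b" for a b
    by (cases "b = 0") (auto simp: field_simps)
  ultimately have "cos (of_real pi * \<tau>) / sin (of_real pi * \<tau>) = \<i> * (E + inverse E) / (E - inverse E)"
    by (simp only:)
  also have "\<dots> = \<i> * (E ^ 2 + 1) / (E ^ 2 - 1)"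
  proof -
    have "E + inverse E = (E ^ 2 + 1) / E" "E - inverse E = (E ^ 2 - 1) / E"
      using E0 by (simp_all add: field_simps power2_eq_square)
    thus ?thesis using E0 by simp
  qed
  also have "\<dots> = - \<i> + (- 2 * \<i>) * (q * (1 / (1 - q)))"
    unfolding qE[symmetric] using q1 by (simp add: field_simps)
  finally have "of_real pi * cos (of_real pi * \<tau>) / sin (of_real pi * \<tau>) = of_real pi * (- \<i> + (- 2 * \<i>) * (q * (1 / (1 - q))))"
    by (metis times_divide_eq_right)
  also have "\<dots> = - of_real pi * \<i> + (- 2 * of_real pi * \<i>) * Lr 1 \<tau>" unfolding L by (simp add: algebra_simps)
  finally show ?thesis using cot_partial_fractions[OF nz] by simp
qed

text \<open>Obtained by differentiating the case k = 1. Since that series converges only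
  conditionally, its value at the point i is first subtracted term by term; the differences are of
  order 1/q^2 and can be differentiated termwise.\<close>

lemma Lq_2: 
  assumes t: "Im \<tau> > 0"
  shows "Lq 2 \<tau> = (- 2 * of_real pi * \<i>) ^ 2 * Lr 2 \<tau>"
proof -
  define f where "f = (\<lambda>\<tau>. \<Sum>\<^sub>\<infinity>q::int. inverse (\<tau> + of_int q) - inverse (\<i> + of_int q))"
  have gi: "good (1 + norm \<i> + (1 + \<bar>Re \<i>\<bar>) / Im \<i>) \<i>" by (rule good_exists) simp
  define Ci where "Ci = 1 + norm \<i> + (1 + \<bar>Re \<i>\<bar>) / Im \<i>"
  have gi: "good Ci \<i>" unfolding Ci_def by (rule gi)
  have Ci: "Ci \<ge> 1" using gi by (simp add: good_def)
  have bd: "norm (inverse (w + of_int q) - inverse (\<i> + of_int q)) \<le> ((1 + norm w) * (2 * C) * (2 * Ci)) * (1 + \<bar>real_of_int q\<bar>) powr (- 2)"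
    if g: "good C \<tau>" and w: "norm (w - \<tau>) \<le> 1 / (16 * C)" for C \<tau> w q
  proof -
    have C: "C \<ge> 1" using g by (simp add: good_def)
    have n: "w + of_int q \<noteq> 0" "\<i> + of_int q \<noteq> 0"
      using good_row(2)[OF g w] good_row(2)[OF gi, of \<i>] Ci by auto
    have "inverse (w + of_int q) - inverse (\<i> + of_int q) = (\<i> - w) * (inverse (w + of_int q) * inverse (\<i> + of_int q))"
      using n by (simp add: field_simps)
    hence "norm (inverse (w + of_int q) - inverse (\<i> + of_int q)) =
        norm (\<i> - w) * (norm (inverse (w + of_int q)) * norm (inverse (\<i> + of_int q)))" by (simp add: norm_mult)
    also have "\<dots> \<le> (1 + norm w) * ((2 * C / (1 + \<bar>real_of_int q\<bar>)) * (2 * Ci / (1 + \<bar>real_of_int q\<bar>)))"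
    proof (intro mult_mono inverse_row_bound[OF g w] inverse_row_bound[OF gi])
      show "norm (\<i> - w) \<le> 1 + norm w" using norm_triangle_ineq4[of \<i> w] by simp
    qed (use C Ci in auto)
    also have "\<dots> = ((1 + norm w) * (2 * C) * (2 * Ci)) * (1 / (1 + \<bar>real_of_int q\<bar>)) ^ 2"
      by (simp add: power2_eq_square)
    also have "(1 / (1 + \<bar>real_of_int q\<bar>)) ^ 2 = (1 + \<bar>real_of_int q\<bar>) powr (- 2)"
    proof -
      have p: "0 < 1 + \<bar>real_of_int q\<bar>" by simp
      have "(1 + \<bar>real_of_int q\<bar>) powr (- 2) = inverse ((1 + \<bar>real_of_int q\<bar>) powr 2)" by (rule powr_minus)
      also have "(1 + \<bar>real_of_int q\<bar>) powr 2 = (1 + \<bar>real_of_int q\<bar>) ^ 2"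
        using powr_realpow[OF p, of 2] by simp
      finally show ?thesis by (simp add: power_one_over inverse_eq_divide)
    qed
    finally show ?thesis .
  qed
  have fval: "f w = (- of_real pi * \<i> + (- 2 * of_real pi * \<i>) * Lr 1 w) - (- of_real pi * \<i> + (- 2 * of_real pi * \<i>) * Lr 1 \<i>)"
    if w: "Im w > 0" for w
  proof -
    obtain C where g: "good C w" using good_exists[OF w] by blast
    have C: "C \<ge> 1" using g by (simp add: good_def)
    have b: "norm (inverse (w + of_int q) - inverse (\<i> + of_int q)) \<le> ((1 + norm w) * (2 * C) * (2 * Ci)) * (1 + \<bar>real_of_int q\<bar>) powr (- 2)" for q
      by (rule bd[OF g]) (use C in simp)
    have "(\<lambda>q::int. norm (inverse (w + of_int q) - inverse (\<i> + of_int q))) summable_on UNIV"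
      by (rule Infinite_Sum.abs_summable_on_comparison_test'[OF summable_row b])
    hence "(\<lambda>q::int. inverse (w + of_int q) - inverse (\<i> + of_int q)) summable_on UNIV"
      by (rule Infinite_Sum.abs_summable_summable)
    hence "((\<lambda>q::int. inverse (w + of_int q) - inverse (\<i> + of_int q)) has_sum f w) UNIV"
      unfolding f_def by (rule has_sum_infsum)
    from has_sum_sym_LIMSEQ[OF this]
    have "(\<lambda>n. (\<Sum>q\<in>{- int n..<int n}. inverse (w + of_int q)) - (\<Sum>q\<in>{- int n..<int n}. inverse (\<i> + of_int q))) \<longlonglongrightarrow> f w"
      by (simp add: sum_subtractf)
    moreover have "(\<lambda>n. (\<Sum>q\<in>{- int n..<int n}. inverse (w + of_int q)) - (\<Sum>q\<in>{- int n..<int n}. inverse (\<i> + of_int q))) \<longlonglongrightarrow>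
        (- of_real pi * \<i> + (- 2 * of_real pi * \<i>) * Lr 1 w) - (- of_real pi * \<i> + (- 2 * of_real pi * \<i>) * Lr 1 \<i>)"
      by (intro tendsto_diff lipschitz_1 w) simp
    ultimately show ?thesis by (rule LIMSEQ_unique)
  qed
  obtain C where g: "good C \<tau>" using good_exists[OF t] by blast
  have C: "C \<ge> 1" using g by (simp add: good_def)
  define r where "r = 1 / (16 * C)"
  have r: "r > 0" using C by (simp add: r_def)
  have "\<exists>D. ((\<lambda>w. \<Sum>\<^sub>\<infinity>q::int\<in>UNIV. inverse (w + of_int q) - inverse (\<i> + of_int q)) has_field_derivative D) (at \<tau>) \<and>
      ((\<lambda>q::int. - (inverse (\<tau> + of_int q) ^ 2)) has_sum D) UNIV"
  proof (rule has_field_derivative_infsum[OF r])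
    fix q :: int and w assume "w \<in> cball \<tau> r"
    hence w: "norm (w - \<tau>) \<le> 1 / (16 * C)" "norm (w - \<tau>) \<le> r" by (simp_all add: dist_norm norm_minus_commute r_def)
    show "((\<lambda>w. inverse (w + of_int q) - inverse (\<i> + of_int q)) has_field_derivative - (inverse (w + of_int q) ^ 2)) (at w)"
      using good_row(2)[OF g w(1)] by (auto intro!: derivative_eq_intros simp: power2_eq_square)
    have "norm w \<le> norm \<tau> + r" using norm_triangle_sub[of w \<tau>] w(2) by linarith
    hence "((1 + norm w) * (2 * C) * (2 * Ci)) \<le> ((1 + (norm \<tau> + r)) * (2 * C) * (2 * Ci))"
      using C Ci by (intro mult_right_mono) auto
    hence "((1 + norm w) * (2 * C) * (2 * Ci)) * (1 + \<bar>real_of_int q\<bar>) powr (- 2) \<le>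
        ((1 + (norm \<tau> + r)) * (2 * C) * (2 * Ci)) * (1 + \<bar>real_of_int q\<bar>) powr (- 2)"
      by (rule mult_right_mono) simp
    with bd[OF g w(1), of q]
    show "norm (inverse (w + of_int q) - inverse (\<i> + of_int q)) \<le> ((1 + (norm \<tau> + r)) * (2 * C) * (2 * Ci)) * (1 + \<bar>real_of_int q\<bar>) powr (- 2)"
      by (rule order_trans)
  qed (use r summable_row in auto)
  then obtain D where D: "(f has_field_derivative D) (at \<tau>)" "((\<lambda>q::int. - (inverse (\<tau> + of_int q) ^ 2)) has_sum D) UNIV"
    unfolding f_def by blast
  have 1: "D = - Lq 2 \<tau>"
    by (rule has_sum_unique[OF D(2) has_sum_uminusI[OF Lq_has_sum[OF t]]]) simp
  have "((\<lambda>w. (- of_real pi * \<i> + (- 2 * of_real pi * \<i>) * Lr 1 w) - (- of_real pi * \<i> + (- 2 * of_real pi * \<i>) * Lr 1 \<i>)) has_field_derivative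
      (0 + (- 2 * of_real pi * \<i>) * (2 * of_real pi * \<i> * Lr (Suc 1) \<tau>)) - 0) (at \<tau>)"
    by (intro DERIV_diff DERIV_add DERIV_cmult DERIV_const Lr_deriv t) simp
  hence "(f has_field_derivative (0 + (- 2 * of_real pi * \<i>) * (2 * of_real pi * \<i> * Lr (Suc 1) \<tau>)) - 0) (at \<tau>)"
    by (rule has_field_derivative_transform_within_open[of _ _ _ "{w. Im w > 0}"])
       (use t fval in \<open>auto simp: open_halfspace_Im_gt\<close>)
  from DERIV_unique[OF D(1) this] 1
  have "Lq 2 \<tau> = (2 * of_real pi * \<i>) * (2 * of_real pi * \<i> * Lr (Suc 1) \<tau>)" by simp
  thus ?thesis by (simp add: numeral_2_eq_2)
qed

text \<open>Differentiation in \<tau> raises k by one on both sides, with the factors -k and 2 pi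
  i.\<close>

lemma Lq_eq_Lr:
  assumes "k \<ge> 2"
  shows "\<forall>\<tau>. Im \<tau> > 0 \<longrightarrow> Lq k \<tau> = (- 2 * of_real pi * \<i>) ^ k / fact (k - 1) * Lr k \<tau>"
  using assms
proof (induction k rule: dec_induct)
  case base
  thus ?case by (simp add: Lq_2)
next
  case (step k)
  show ?case
  proof (intro allI impI)
    fix \<tau> :: complex assume t: "Im \<tau> > 0"
    have "((\<lambda>\<tau>. (- 2 * of_real pi * \<i>) ^ k / fact (k - 1) * Lr k \<tau>) has_field_derivative
        (- 2 * of_real pi * \<i>) ^ k / fact (k - 1) * (2 * of_real pi * \<i> * Lr (Suc k) \<tau>)) (at \<tau>)"
      by (intro DERIV_cmult Lr_deriv t) (use step in simp)
    hence "(Lq k has_field_derivative (- 2 * of_real pi * \<i>) ^ k / fact (k - 1) * (2 * of_real pi * \<i> * Lr (Suc k) \<tau>)) (at \<tau>)"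
      by (rule has_field_derivative_transform_within_open[of _ _ _ "{w. Im w > 0}"])
         (use t step.IH in \<open>auto simp: open_halfspace_Im_gt\<close>)
    from DERIV_unique[OF Lq_deriv[OF t step(1)] this]
    have e: "- of_nat k * Lq (Suc k) \<tau> = (- 2 * of_real pi * \<i>) ^ k / fact (k - 1) * (2 * of_real pi * \<i> * Lr (Suc k) \<tau>)" .
    have k0: "(of_nat k :: complex) \<noteq> 0" using step by simp
    have f: "fact k = of_nat k * (fact (k - 1) :: complex)" using step by (intro fact_reduce) simp
    have "Lq (Suc k) \<tau> = - inverse (of_nat k) * (- of_nat k * Lq (Suc k) \<tau>)" using k0 by simp
    also have "\<dots> = (- 2 * of_real pi * \<i>) ^ Suc k / fact (Suc k - 1) * Lr (Suc k) \<tau>"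
      unfolding e using k0 by (simp add: f field_simps)
    finally show "Lq (Suc k) \<tau> = (- 2 * of_real pi * \<i>) ^ Suc k / fact (Suc k - 1) * Lr (Suc k) \<tau>" .
  qed
qed

lemma lipschitz:
  assumes t: "Im \<tau> > 0" and k: "k \<ge> 1"
  shows "(\<lambda>n. \<Sum>q\<in>{- int n..<int n}. inverse (\<tau> + of_int q) ^ k) \<longlonglongrightarrow>
    (if k = 1 then - of_real pi * \<i> else 0) + (- 2 * of_real pi * \<i>) ^ k / fact (k - 1) * Lr k \<tau>"
proof (cases "k = 1")
  case True
  thus ?thesis using lipschitz_1[OF t] by simp
next
  case False
  hence k2: "k \<ge> 2" using k by simp
  show ?thesis
    using has_sum_sym_LIMSEQ[OF Lq_has_sum[OF t k2]] Lq_eq_Lr[OF k2] t False by simp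
qed

section \<open>Fourier expansion of the lattice sums\<close>

lemma sum_blocks:
  fixes f :: "int \<Rightarrow> complex"
  assumes N: "N \<ge> 1"
  shows "(\<Sum>p\<in>{- int P..<int P}. \<Sum>i\<in>{0..<int N}. f (int N * p + i)) = (\<Sum>m\<in>{- int (P * N)..<int (P * N)}. f m)"
proof -
  have "(\<Sum>p\<in>{- int P..<int P}. \<Sum>i\<in>{0..<int N}. f (int N * p + i)) =
      (\<Sum>x\<in>{- int P..<int P} \<times> {0..<int N}. f (int N * fst x + snd x))"
    by (subst sum.cartesian_product) (simp add: case_prod_unfold)
  also have "\<dots> = (\<Sum>m\<in>{- int (P * N)..<int (P * N)}. f m)"
  proof (rule sum.reindex_bij_witness[where j = "\<lambda>x. int N * fst x + snd x" and i = "\<lambda>m. (m div int N, m mod int N)"])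
    fix x assume x: "x \<in> {- int P..<int P} \<times> {0..<int N}"
    then obtain p i where xe: "x = (p, i)" and p: "- int P \<le> p" "p < int P" and i: "0 \<le> i" "i < int N" by auto
    show "((int N * fst x + snd x) div int N, (int N * fst x + snd x) mod int N) = x"
      using i by (simp add: xe div_mult_self4 mod_pos_pos_trivial)
    have "int N * (- int P) \<le> int N * p" using p by (intro mult_left_mono) auto
    moreover have "int N * (p + 1) \<le> int N * int P" using p by (intro mult_left_mono) auto
    ultimately show "int N * fst x + snd x \<in> {- int (P * N)..<int (P * N)}"
      using i by (simp add: xe algebra_simps)
  next
    fix m assume m: "m \<in> {- int (P * N)..<int (P * N)}"
    have "(- int P) * int N \<le> m" "m < int P * int N" using m by simp_all
    note mm = this
    have Np: "0 < int N" using N by simp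
    define d where "d = m div int N"
    have dm: "int N * d + m mod int N = m" by (simp add: d_def)
    have r: "0 \<le> m mod int N" "m mod int N < int N" using Np by simp_all
    have c: "d * int N = int N * d" "(d + 1) * int N = int N * d + int N" by (simp_all add: algebra_simps)
    have "d * int N < int P * int N" unfolding c(1) using dm r mm(2) by linarith
    hence d1: "d < int P" using Np by simp
    have "(- int P) * int N < (d + 1) * int N" unfolding c(2) using dm r mm(1) by linarith
    hence "- int P < d + 1" using Np by (simp only: mult_less_cancel_right_pos)
    with d1 have "- int P \<le> m div int N" "m div int N < int P" by (simp_all add: d_def)
    thus "(m div int N, m mod int N) \<in> {- int P..<int P} \<times> {0..<int N}" using N by simp
  qed simp_all
  finally show ?thesis .
qed

lemma sum_telescope_int:
  fixes h :: "int \<Rightarrow> complex"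
  shows "(\<Sum>q\<in>{- int n..<int n}. h (q + 1) - h q) = h (int n) - h (- int n)"
proof (induction n)
  case (Suc n)
  have "{- int (Suc n)..<int (Suc n)} = insert (- 1 - int n) (insert (int n) {- int n..<int n})" by auto
  thus ?case using Suc by (simp add: algebra_simps)
qed simp

text \<open>Over a finite rectangle of blocks the corrections telescope to the boundary. The terms
  with \<open>be\<close> will tend to 0 as n grows, but those with \<open>al\<close> need not: for k
  = 1 they leave a constant.\<close>

lemma sum_blk_kap:
  assumes N: "N \<ge> 1" and per: "periodic N \<theta>"
  shows "(\<Sum>p\<in>{- int P..<int P}. \<Sum>q\<in>{- int n..<int n}. blk N (pcbox N) (kap k N \<theta>) g (p, q)) =
    (\<Sum>m\<in>{- int (P * N)..<int (P * N)}. \<Sum>x\<in>{- int (n * N)..<int (n * N)}. \<theta> (m, x) * g (m, x)) +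
    (if k \<ge> 3 then 0 else
      - al N \<theta> / of_nat N * (\<Sum>q\<in>{- int n..<int n}. g (int N * int P, int N * q) - g (int N * (- int P), int N * q))
      - be N \<theta> / of_nat N * (\<Sum>p\<in>{- int P..<int P}. g (int N * p, int N * int n) - g (int N * p, int N * (- int n))))"
proof -
  have th: "\<theta> (i, j) = \<theta> (int N * p + i, int N * q + j)" for i j p q
    using periodic_mult[OF per, of i p j q] by (simp add: add.commute)
  have "(\<Sum>p\<in>{- int P..<int P}. \<Sum>q\<in>{- int n..<int n}. \<Sum>b\<in>pbox N. \<theta> b * g (int N * p + fst b, int N * q + snd b)) =
     (\<Sum>p\<in>{- int P..<int P}. \<Sum>q\<in>{- int n..<int n}. \<Sum>i\<in>{0..<int N}. \<Sum>j\<in>{0..<int N}.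
        \<theta> (int N * p + i, int N * q + j) * g (int N * p + i, int N * q + j))"
  proof (intro sum.cong refl)
    fix p q
    have "(\<Sum>b\<in>pbox N. \<theta> b * g (int N * p + fst b, int N * q + snd b)) =
        (\<Sum>(i, j)\<in>pbox N. \<theta> (int N * p + i, int N * q + j) * g (int N * p + i, int N * q + j))"
      by (intro sum.cong refl) (auto simp: th[symmetric])
    thus "(\<Sum>b\<in>pbox N. \<theta> b * g (int N * p + fst b, int N * q + snd b)) =
        (\<Sum>i\<in>{0..<int N}. \<Sum>j\<in>{0..<int N}. \<theta> (int N * p + i, int N * q + j) * g (int N * p + i, int N * q + j))"
      unfolding pbox_def by (simp only: sum.cartesian_product)
  qed
  also have "\<dots> = (\<Sum>p\<in>{- int P..<int P}. \<Sum>i\<in>{0..<int N}. \<Sum>q\<in>{- int n..<int n}. \<Sum>j\<in>{0..<int N}.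
        \<theta> (int N * p + i, int N * q + j) * g (int N * p + i, int N * q + j))"
    by (intro sum.cong refl sum.swap)
  also have "\<dots> = (\<Sum>p\<in>{- int P..<int P}. \<Sum>i\<in>{0..<int N}. \<Sum>x\<in>{- int (n * N)..<int (n * N)}.
        \<theta> (int N * p + i, x) * g (int N * p + i, x))"
    by (intro sum.cong refl sum_blocks[where P = n and f = "\<lambda>x. \<theta> (_, x) * g (_, x)", OF N])
  also have "\<dots> = (\<Sum>m\<in>{- int (P * N)..<int (P * N)}. \<Sum>x\<in>{- int (n * N)..<int (n * N)}. \<theta> (m, x) * g (m, x))"
    by (rule sum_blocks[where P = P and f = "\<lambda>m. \<Sum>x\<in>{- int (n * N)..<int (n * N)}. \<theta> (m, x) * g (m, x)", OF N])
  finally have main: "(\<Sum>p\<in>{- int P..<int P}. \<Sum>q\<in>{- int n..<int n}. \<Sum>b\<in>pbox N. \<theta> b * g (int N * p + fst b, int N * q + snd b)) =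
      (\<Sum>m\<in>{- int (P * N)..<int (P * N)}. \<Sum>x\<in>{- int (n * N)..<int (n * N)}. \<theta> (m, x) * g (m, x))" .
  have t1: "(\<Sum>p\<in>{- int P..<int P}. \<Sum>q\<in>{- int n..<int n}. g (int N * (p + 1), int N * q) - g (int N * p, int N * q)) =
      (\<Sum>q\<in>{- int n..<int n}. g (int N * int P, int N * q) - g (int N * (- int P), int N * q))"
    by (subst sum.swap) (intro sum.cong refl sum_telescope_int[of "\<lambda>p. g (int N * p, int N * _)"])
  have t2: "(\<Sum>p\<in>{- int P..<int P}. \<Sum>q\<in>{- int n..<int n}. g (int N * p, int N * (q + 1)) - g (int N * p, int N * q)) =
      (\<Sum>p\<in>{- int P..<int P}. g (int N * p, int N * int n) - g (int N * p, int N * (- int n)))"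
    by (intro sum.cong refl sum_telescope_int[of "\<lambda>q. g (int N * _, int N * q)"])
  show ?thesis
  proof (cases "k \<ge> 3")
    case True
    thus ?thesis using main by (simp add: blk_kap[OF N])
  next
    case False
    have "(\<Sum>p\<in>{- int P..<int P}. \<Sum>q\<in>{- int n..<int n}. blk N (pcbox N) (kap k N \<theta>) g (p, q)) =
       (\<Sum>p\<in>{- int P..<int P}. \<Sum>q\<in>{- int n..<int n}. \<Sum>b\<in>pbox N. \<theta> b * g (int N * p + fst b, int N * q + snd b)) +
       (- al N \<theta> / of_nat N * (\<Sum>p\<in>{- int P..<int P}. \<Sum>q\<in>{- int n..<int n}. g (int N * (p + 1), int N * q) - g (int N * p, int N * q))
       - be N \<theta> / of_nat N * (\<Sum>p\<in>{- int P..<int P}. \<Sum>q\<in>{- int n..<int n}. g (int N * p, int N * (q + 1)) - g (int N * p, int N * q)))"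
      using False unfolding blk_kap[OF N] fst_conv snd_conv sum_distrib_left sum_subtractf[symmetric] sum.distrib[symmetric]
      by (intro sum.cong refl) simp
    thus ?thesis unfolding main t1 t2 using False by simp
  qed
qed

lemma row_limit:
  assumes t: "Im \<tau> > 0" and k: "k \<ge> 1" and N: "N \<ge> 1"
  shows "(\<lambda>n. \<Sum>q\<in>{- int n..<int n}. inverse (\<tau> + of_int (int N * q)) ^ k) \<longlonglongrightarrow>
    inverse (of_nat N) ^ k * ((if k = 1 then - of_real pi * \<i> else 0) + (- 2 * of_real pi * \<i>) ^ k / fact (k - 1) * Lr k (\<tau> / of_nat N))"
proof -
  have "Im (\<tau> / of_nat N) > 0" using t N by (simp add: Im_divide_of_nat)
  from tendsto_mult_left[OF lipschitz[OF this k], of "inverse (of_nat N) ^ k"]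
  show ?thesis
  proof (rule Lim_transform_eventually, intro always_eventually allI)
    fix n
    have "inverse (of_nat N) ^ k * inverse (\<tau> / of_nat N + of_int q) ^ k = inverse (\<tau> + of_int (int N * q)) ^ k" for q
    proof -
      have "of_nat N * (\<tau> / of_nat N + of_int q) = \<tau> + of_int (int N * q)" using N by (simp add: field_simps)
      thus ?thesis by (metis inverse_mult_distrib power_mult_distrib)
    qed
    thus "inverse (of_nat N) ^ k * (\<Sum>q\<in>{- int n..<int n}. inverse (\<tau> / of_nat N + of_int q) ^ k) =
        (\<Sum>q\<in>{- int n..<int n}. inverse (\<tau> + of_int (int N * q)) ^ k)"
      by (simp only: sum_distrib_left)
  qed
qed

lemma inverse_shift_tendsto_0:
  assumes N: "N \<ge> 1" and k: "k \<ge> 1"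
  shows "(\<lambda>n. inverse (\<tau> + of_int (int N * int n)) ^ k) \<longlonglongrightarrow> (0 :: complex)"
    "(\<lambda>n. inverse (\<tau> + of_int (int N * (- int n))) ^ k) \<longlonglongrightarrow> (0 :: complex)"
proof -
  have f: "filterlim (\<lambda>n. \<tau> + c * of_nat n) at_infinity sequentially" if "c \<noteq> 0" for c :: complex
    by (intro tendsto_add_filterlim_at_infinity[OF tendsto_const]
        tendsto_mult_filterlim_at_infinity[OF tendsto_const that] tendsto_of_nat)
  have p: "(\<lambda>n. inverse (\<tau> + c * of_nat n) ^ k) \<longlonglongrightarrow> 0" if "c \<noteq> 0" for c :: complex
  proof -
    have "(\<lambda>n. inverse (\<tau> + c * of_nat n) ^ k) \<longlonglongrightarrow> 0 ^ k"
      by (intro tendsto_power filterlim_compose[OF tendsto_inverse_0 f[OF that]])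
    thus ?thesis using k by (simp add: power_0_left)
  qed
  show "(\<lambda>n. inverse (\<tau> + of_int (int N * int n)) ^ k) \<longlonglongrightarrow> (0 :: complex)"
    using p[of "of_nat N"] N by simp
  show "(\<lambda>n. inverse (\<tau> + of_int (int N * (- int n))) ^ k) \<longlonglongrightarrow> (0 :: complex)"
    using p[of "- of_nat N"] N by simp
qed

text \<open>Reflection exchanges the two ends of the half-open interval, one of which is missing;
  hence the two end terms.\<close>

lemma sum_reflect:
  fixes f :: "int \<Rightarrow> complex"
  shows "(\<Sum>q\<in>{- int n..<int n}. f (- q)) = (\<Sum>q\<in>{- int n..<int n}. f q) + f (int n) - f (- int n)"
proof -
  have "(\<Sum>q\<in>{- int n..<int n}. f (- q) - f q) = f (int n) - f (- int n)"
  proof (induction n)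
    case (Suc n)
    have "{- int (Suc n)..<int (Suc n)} = insert (- 1 - int n) (insert (int n) {- int n..<int n})" by auto
    thus ?case using Suc by (simp add: algebra_simps)
  qed simp
  thus ?thesis by (simp add: sum_subtractf algebra_simps)
qed

text \<open>The finite Fourier transform in the second variable. It arises when a row is split into
  residue classes modulo N and the Lipschitz formula is applied to each class.\<close>

definition fhat :: "nat \<Rightarrow> (int \<times> int \<Rightarrow> complex) \<Rightarrow> int \<Rightarrow> nat \<Rightarrow> complex" where
  "fhat N \<theta> m c = (\<Sum>j\<in>{0..<int N}. \<theta> (m, j) * exp (2 * of_real pi * \<i> * of_nat c * of_int j / of_nat N))"

definition fcoef :: "nat \<Rightarrow> nat \<Rightarrow> (int \<times> int \<Rightarrow> complex) \<Rightarrow> nat \<Rightarrow> nat \<Rightarrow> complex" where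
  "fcoef k N \<theta> m c = (- 2 * of_real pi * \<i> / of_nat N) ^ k / fact (k - 1) * of_nat c ^ (k - 1) * fhat N \<theta> (int m) c"

text \<open>The pair (m, c) stands for row m + 1 and frequency c + 1. Negative rows are not listed;
  parity identifies their contribution with that of the positive ones.\<close>

definition fterm :: "nat \<Rightarrow> nat \<Rightarrow> (int \<times> int \<Rightarrow> complex) \<Rightarrow> complex \<Rightarrow> nat \<times> nat \<Rightarrow> complex" where
  "fterm k N \<theta> z = (\<lambda>(m, c). fcoef k N \<theta> (Suc m) (Suc c) *
     exp (2 * of_real pi * \<i> * of_nat (Suc m * Suc c) * z / of_nat N))"

text \<open>For positive integers m + c \<le> 2mc, so the exponential in mc splits into one in m and
  one in c.\<close>

lemma fterm_abs_summable:
  assumes N: "N \<ge> 1" and per: "periodic N \<theta>" and z: "Im z > 0"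
  shows "(\<lambda>x. norm (fterm k N \<theta> z x)) summable_on UNIV"
proof -
  obtain M where M: "M \<ge> 0" "\<And>mn. norm (\<theta> mn) \<le> M" using periodic_bounded[OF per N] by blast
  define K where "K = norm ((- 2 * of_real pi * \<i> / of_nat N) ^ k / fact (k - 1) :: complex)"
  define a where "a = pi * Im z / real N"
  have a: "a > 0" using z N by (simp add: a_def)
  have fh: "norm (fhat N \<theta> m c) \<le> real N * M" for m c
  proof -
    have "norm (fhat N \<theta> m c) \<le> (\<Sum>j\<in>{0..<int N}. M)"
      unfolding fhat_def
    proof (rule sum_norm_le)
      fix j
      have "norm (exp (2 * of_real pi * \<i> * of_nat c * of_int j / of_nat N :: complex)) = 1"
        by (simp add: norm_exp_eq_Re Re_divide_of_nat)
      thus "norm (\<theta> (m, j) * exp (2 * of_real pi * \<i> * of_nat c * of_int j / of_nat N)) \<le> M"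
        using M by (simp add: norm_mult)
    qed
    thus ?thesis by simp
  qed
  have "(\<lambda>(m, c). (K * (real N * M)) * ((real (Suc m) ^ 0 * exp (- a * real (Suc m))) * (real (Suc c) ^ (k - 1) * exp (- a * real (Suc c)))))
      summable_on (UNIV \<times> UNIV)"
    using summable_on_cmult_right[OF summable_on_product[OF summable_pow_exp[OF a, of 0] summable_pow_exp[OF a, of "k - 1"]], of "K * (real N * M)"]
    by (simp add: case_prod_unfold)
  hence S: "(\<lambda>x. (K * (real N * M)) * (exp (- a * real (Suc (fst x))) * (real (Suc (snd x)) ^ (k - 1) * exp (- a * real (Suc (snd x))))))
      summable_on UNIV" by (simp add: case_prod_unfold)
  show ?thesis
  proof (rule Infinite_Sum.abs_summable_on_comparison_test'[OF S])
    fix x :: "nat \<times> nat"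
    obtain m c where x: "x = (m, c)" by force
    have "norm (exp (2 * of_real pi * \<i> * of_nat (Suc m * Suc c) * z / of_nat N)) = exp (- (2 * a) * real (Suc m * Suc c))"
      by (simp add: norm_exp_eq_Re Re_divide_of_nat a_def mult_ac del: of_nat_Suc of_nat_mult mult_Suc)
    also have "\<dots> \<le> exp (- a * real (Suc m)) * exp (- a * real (Suc c))"
    proof -
      have "real (Suc m) + real (Suc c) \<le> 2 * real (Suc m * Suc c)"
      proof -
        have "Suc m + Suc c \<le> 2 * (Suc m * Suc c)" by simp
        hence "real (Suc m + Suc c) \<le> real (2 * (Suc m * Suc c))" by (simp only: of_nat_le_iff)
        thus ?thesis by simp
      qed
      hence "a * (real (Suc m) + real (Suc c)) \<le> a * (2 * real (Suc m * Suc c))" using a by (intro mult_left_mono) auto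
      thus ?thesis unfolding exp_add[symmetric] exp_le_cancel_iff
        by (simp only: distrib_left mult_minus_left mult_ac)
    qed
    finally have e: "norm (exp (2 * of_real pi * \<i> * of_nat (Suc m * Suc c) * z / of_nat N)) \<le> exp (- a * real (Suc m)) * exp (- a * real (Suc c))" .
    have "norm (fterm k N \<theta> z x) = K * real (Suc c) ^ (k - 1) * norm (fhat N \<theta> (int (Suc m)) (Suc c)) *
        norm (exp (2 * of_real pi * \<i> * of_nat (Suc m * Suc c) * z / of_nat N))"
      unfolding x fterm_def fcoef_def prod.case norm_mult norm_power norm_of_nat K_def by simp
    also have "\<dots> \<le> K * real (Suc c) ^ (k - 1) * (real N * M) * (exp (- a * real (Suc m)) * exp (- a * real (Suc c)))"
      using M by (intro mult_mono fh e order_refl mult_nonneg_nonneg) (auto simp: K_def)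
    also have "\<dots> = (K * (real N * M)) * (exp (- a * real (Suc m)) * (real (Suc c) ^ (k - 1) * exp (- a * real (Suc c))))"
      by (simp only: mult_ac)
    finally show "norm (fterm k N \<theta> z x) \<le> (K * (real N * M)) * (exp (- a * real (Suc (fst x))) * (real (Suc (snd x)) ^ (k - 1) * exp (- a * real (Suc (snd x)))))"
      by (simp add: x)
  qed
qed

lemma has_sum_sum:
  fixes f :: "'a \<Rightarrow> 'b \<Rightarrow> complex"
  assumes "finite J" "\<And>j. j \<in> J \<Longrightarrow> (f j has_sum S j) A"
  shows "((\<lambda>x. \<Sum>j\<in>J. f j x) has_sum (\<Sum>j\<in>J. S j)) A"
  using assms by (induction J rule: finite_induct) (auto intro: has_sum_add)

lemma fterm_row:
  assumes N: "N \<ge> 1" and z: "Im z > 0"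
  shows "((\<lambda>c. fterm k N \<theta> z (m, c)) has_sum
    (\<Sum>j\<in>{0..<int N}. \<theta> (int (Suc m), j) * (inverse (of_nat N) ^ k * ((- 2 * of_real pi * \<i>) ^ k / fact (k - 1) *
      Lr k ((of_int (int (Suc m)) * z + of_int j) / of_nat N))))) UNIV"
proof -
  have t: "Im ((of_int (int (Suc m)) * z + of_int j) / of_nat N) > 0" for j
    using z N by (simp add: Im_divide_of_nat)
  have "((\<lambda>c. \<Sum>j\<in>{0..<int N}. \<theta> (int (Suc m), j) * (inverse (of_nat N) ^ k * ((- 2 * of_real pi * \<i>) ^ k / fact (k - 1) *
      (of_nat (Suc c) ^ (k - 1) * exp (2 * of_real pi * \<i> * of_nat (Suc c) * ((of_int (int (Suc m)) * z + of_int j) / of_nat N)))))) has_sum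
    (\<Sum>j\<in>{0..<int N}. \<theta> (int (Suc m), j) * (inverse (of_nat N) ^ k * ((- 2 * of_real pi * \<i>) ^ k / fact (k - 1) *
      Lr k ((of_int (int (Suc m)) * z + of_int j) / of_nat N))))) UNIV"
    by (intro has_sum_sum has_sum_cmult_right Lr_has_sum t) simp
  moreover have "(\<Sum>j\<in>{0..<int N}. \<theta> (int (Suc m), j) * (inverse (of_nat N) ^ k * ((- 2 * of_real pi * \<i>) ^ k / fact (k - 1) *
      (of_nat (Suc c) ^ (k - 1) * exp (2 * of_real pi * \<i> * of_nat (Suc c) * ((of_int (int (Suc m)) * z + of_int j) / of_nat N)))))) =
      fterm k N \<theta> z (m, c)" for c
  proof -
    have e: "exp (2 * of_real pi * \<i> * of_nat (Suc c) * ((of_int (int (Suc m)) * z + of_int j) / of_nat N)) =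
        exp (2 * of_real pi * \<i> * of_nat (Suc c) * of_int j / of_nat N) *
        exp (2 * of_real pi * \<i> * of_nat (Suc m * Suc c) * z / of_nat N)" for j
      unfolding exp_add[symmetric]
      by (rule arg_cong[of _ _ exp]) (simp only: of_nat_mult of_int_of_nat_eq add_divide_distrib distrib_left, simp only: times_divide_eq_right mult_ac, rule add.commute)
    have Q: "(- 2 * of_real pi * \<i> / of_nat N) ^ k / fact (k - 1) = inverse (of_nat N) ^ k * ((- 2 * of_real pi * \<i>) ^ k / fact (k - 1) :: complex)"
    proof -
      have "(c / n) ^ k = inverse n ^ k * c ^ k" for c n :: complex
        by (simp only: divide_inverse power_mult_distrib mult.commute)
      thus ?thesis by (simp only: times_divide_eq_right)
    qed
    show ?thesis
      unfolding e fterm_def prod.case fcoef_def fhat_def Q sum_distrib_left sum_distrib_right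
      by (intro sum.cong refl) (simp only: mult_ac)
  qed
  ultimately show ?thesis by simp
qed

text \<open>Up to a nonzero constant the values are the row sums of the absolutely summable
  \<open>fterm\<close> for N = 1 and constant weight; they form a convergent series and thus tend to
  0.\<close>

lemma Lr_tendsto_0:
  assumes z: "Im z > 0" and k: "k \<ge> 1"
  shows "(\<lambda>P. Lr k (of_nat (Suc P) * z)) \<longlonglongrightarrow> 0"
proof -
  define A where "A = (- 2 * of_real pi * \<i>) ^ k / (fact (k - 1) :: complex)"
  have A: "A \<noteq> 0" by (simp add: A_def)
  have per: "periodic 1 (\<lambda>_. 1)" by (rule periodic_const)
  have S: "fterm k 1 (\<lambda>_. 1) z summable_on (UNIV \<times> UNIV)"
    using Infinite_Sum.abs_summable_summable[OF fterm_abs_summable[OF _ per z, of k]] by simp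
  obtain S where S: "(fterm k 1 (\<lambda>_. 1) z has_sum S) (UNIV \<times> UNIV)" using S by (auto simp: summable_on_def)
  have r: "((\<lambda>c. fterm k 1 (\<lambda>_. 1) z (m, c)) has_sum (A * Lr k (of_nat (Suc m) * z))) UNIV" for m
  proof -
    have "{0..<int 1} = {0}" by auto
    thus ?thesis using fterm_row[OF _ z, of 1 k "\<lambda>_. 1" m] by (simp add: A_def)
  qed
  have "((\<lambda>m. A * Lr k (of_nat (Suc m) * z)) has_sum S) UNIV" by (rule has_sum_SigmaD[OF S r])
  hence "summable (\<lambda>m. A * Lr k (of_nat (Suc m) * z))" using has_sum_imp_sums sums_summable by blast
  hence "(\<lambda>m. A * Lr k (of_nat (Suc m) * z)) \<longlonglongrightarrow> 0" by (rule summable_LIMSEQ_zero)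
  from tendsto_mult_left[OF this, of "inverse A"] show ?thesis using A by (simp flip: mult.assoc)
qed

text \<open>The block sum is evaluated over rectangles, first with n and then with P tending to
  infinity. Rows m and -m agree in the limit by parity. Row 0 is treated indirectly: everything else
  has a limit, so it has one too, and V is half of it. This covers k = 1, where the row does not
  converge absolutely.\<close>

lemma fourier_expansion:
  assumes adm: "admissible k N \<theta>" and par: "\<And>m n. \<theta> (- m, - n) = (- 1) ^ k * \<theta> (m, n)" and z: "Im z > 0"
  obtains V where "(\<lambda>n. \<Sum>x<n * N. \<theta> (0, int (Suc x)) * inverse (of_nat (Suc x)) ^ k) \<longlonglongrightarrow> V"
    "1 / 2 * Sphi k N \<theta> k 0 z 0 = V + (if k = 1 then of_real pi * \<i> * al N \<theta> / of_nat N ^ 2 else 0) +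
      infsum (fterm k N \<theta> z) UNIV"
proof -
  interpret latsum N "pcbox N" "kap k N \<theta>" k by (rule latsum_kap[OF adm])
  have N1: "N \<ge> 1" and k1: "k \<ge> 1" and per: "periodic N \<theta>" and zm: "k \<ge> 3 \<or> (\<Sum>b\<in>pbox N. \<theta> b) = 0"
    using adm by (auto simp: admissible_def)
  define g where "g = (\<lambda>mn. inverse (lat z mn) ^ k)"
  define EE where "EE = Sphi k N \<theta> k 0 z 0"
  \<comment> \<open>\<open>dl\<close> is the constant of the Lipschitz formula for k = 1.
    \<open>Rl\<close> is the limit of a row restricted to multiples of N, \<open>Rw\<close> that of
    a full weighted row, and \<open>T\<close> is \<open>Rw\<close> without the constant.\<close>
  define dl where "dl = (if k = 1 then - of_real pi * \<i> else (0 :: complex))"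
  define A where "A = (- 2 * of_real pi * \<i>) ^ k / (fact (k - 1) :: complex)"
  define iN where "iN = inverse (of_nat N :: complex) ^ k"
  define Rl where "Rl = (\<lambda>\<tau>. iN * (dl + A * Lr k (\<tau> / of_nat N)))"
  define Rw where "Rw = (\<lambda>m::nat. \<Sum>j\<in>{0..<int N}. \<theta> (int m, j) * Rl (of_int (int m) * z + of_int j))"
  define T where "T = (\<lambda>m::nat. \<Sum>j\<in>{0..<int N}. \<theta> (int m, j) * (iN * (A * Lr k ((of_int (int m) * z + of_int j) / of_nat N))))"
  define \<Phi> where "\<Phi> = (\<lambda>m::int. \<Sum>j\<in>{0..<int N}. \<theta> (m, j))"
  define W where "W = (\<lambda>n m. \<Sum>x\<in>{- int (n * N)..<int (n * N)}. \<theta> (m, x) * g (m, x))"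
  define B where "B = blk N (pcbox N) (kap k N \<theta>) g"
  have thN: "\<theta> (m, int N * q) = \<theta> (m, 0)" for m q using periodic_mult[OF per, of m 0 0 q] by simp
  have thj: "\<theta> (m, int N * q + j) = \<theta> (m, j)" for m q j using periodic_mult[OF per, of m 0 j q] by (simp add: add.commute)
  have gneg: "g (- m, - n) = (- 1) ^ k * g (m, n)" for m n
  proof -
    have "lat z (- m, - n) = - lat z (m, n)" by (simp add: lat_def)
    hence "g (- m, - n) = (- inverse (lat z (m, n))) ^ k" by (simp add: g_def)
    also have "\<dots> = (- 1) ^ k * g (m, n)" unfolding g_def by (rule power_minus)
    finally show ?thesis .
  qed
  have sq: "(- 1) ^ k * (- 1) ^ k = (1 :: complex)" by (simp flip: power_mult_distrib)
  have g0: "(\<lambda>n. c * g (m, int N * int n)) \<longlonglongrightarrow> 0" "(\<lambda>n. c * g (m, int N * (- int n))) \<longlonglongrightarrow> 0" for c m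
    using tendsto_mult_right_zero[OF inverse_shift_tendsto_0(1)[OF N1 k1, of "of_int m * z"], of c]
      tendsto_mult_right_zero[OF inverse_shift_tendsto_0(2)[OF N1 k1, of "of_int m * z"], of c]
    by (simp_all add: g_def lat_def)
  have Wpos: "(\<lambda>n. W n (int m)) \<longlonglongrightarrow> Rw m" if m: "m \<ge> 1" for m
  proof -
    have t: "Im (of_int (int m) * z + of_int j) > 0" for j using m z by simp
    have e: "W n (int m) = (\<Sum>j\<in>{0..<int N}. \<theta> (int m, j) * (\<Sum>q\<in>{- int n..<int n}. inverse (of_int (int m) * z + of_int j + of_int (int N * q)) ^ k))" for n
    proof -
      have "W n (int m) = (\<Sum>q\<in>{- int n..<int n}. \<Sum>j\<in>{0..<int N}. \<theta> (int m, int N * q + j) * g (int m, int N * q + j))"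
        unfolding W_def by (rule sum_blocks[where P = n and f = "\<lambda>x. \<theta> (int m, x) * g (int m, x)", OF N1, symmetric])
      also have "\<dots> = (\<Sum>j\<in>{0..<int N}. \<Sum>q\<in>{- int n..<int n}. \<theta> (int m, j) * g (int m, int N * q + j))"
        unfolding thj by (rule sum.swap)
      also have "\<dots> = (\<Sum>j\<in>{0..<int N}. \<theta> (int m, j) * (\<Sum>q\<in>{- int n..<int n}. inverse (of_int (int m) * z + of_int j + of_int (int N * q)) ^ k))"
        unfolding sum_distrib_left by (intro sum.cong refl) (simp add: g_def lat_def add_ac)
      finally show ?thesis .
    qed
    show ?thesis unfolding e Rw_def Rl_def iN_def dl_def A_def
      by (intro tendsto_sum tendsto_mult_left row_limit t k1 N1)
  qed
  have Wneg: "(\<lambda>n. W n (- int m)) \<longlonglongrightarrow> Rw m" if m: "m \<ge> 1" for m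
  proof -
    have e: "W n (- int m) = W n (int m) + \<theta> (int m, 0) * g (int m, int N * int n) - \<theta> (int m, 0) * g (int m, int N * (- int n))" for n
    proof -
      have "\<theta> (- int m, x) * g (- int m, x) = \<theta> (int m, - x) * g (int m, - x)" for x
        using par[of "int m" "- x"] gneg[of "int m" "- x"] sq by (simp add: algebra_simps)
      hence "W n (- int m) = (\<Sum>x\<in>{- int (n * N)..<int (n * N)}. \<theta> (int m, - x) * g (int m, - x))"
        unfolding W_def by simp
      also have "\<dots> = W n (int m) + \<theta> (int m, int (n * N)) * g (int m, int (n * N)) - \<theta> (int m, - int (n * N)) * g (int m, - int (n * N))"
        unfolding W_def by (rule sum_reflect)
      also have "int (n * N) = int N * int n" by simp
      finally show ?thesis using thN[of "int m" "int n"] thN[of "int m" "- int n"] by simp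
    qed
    have "(\<lambda>n. W n (int m) + \<theta> (int m, 0) * g (int m, int N * int n) - \<theta> (int m, 0) * g (int m, int N * (- int n))) \<longlonglongrightarrow> Rw m + 0 - 0"
      by (intro tendsto_add tendsto_diff Wpos m g0)
    thus ?thesis unfolding e by simp
  qed
  have Cpos: "(\<lambda>n. \<Sum>q\<in>{- int n..<int n}. g (int N * int P, int N * q)) \<longlonglongrightarrow> Rl (of_int (int N * int P) * z)" if P: "P \<ge> 1" for P
  proof -
    have "Im (of_int (int N * int P) * z) > 0" using N1 P z by simp
    from row_limit[OF this k1 N1] show ?thesis by (simp add: g_def lat_def Rl_def iN_def dl_def A_def)
  qed
  have Cneg: "(\<lambda>n. \<Sum>q\<in>{- int n..<int n}. g (int N * (- int P), int N * q)) \<longlonglongrightarrow> (- 1) ^ k * Rl (of_int (int N * int P) * z)" if P: "P \<ge> 1" for P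
  proof -
    have e: "(\<Sum>q\<in>{- int n..<int n}. g (int N * (- int P), int N * q)) =
        (- 1) ^ k * ((\<Sum>q\<in>{- int n..<int n}. g (int N * int P, int N * q)) + 1 * g (int N * int P, int N * int n) - 1 * g (int N * int P, int N * (- int n)))" for n
    proof -
      have "g (int N * (- int P), int N * q) = (- 1) ^ k * g (int N * int P, int N * (- q))" for q
        using gneg[of "int N * int P" "int N * (- q)"] by simp
      hence "(\<Sum>q\<in>{- int n..<int n}. g (int N * (- int P), int N * q)) = (- 1) ^ k * (\<Sum>q\<in>{- int n..<int n}. g (int N * int P, int N * (- q)))"
        by (simp only: sum_distrib_left)
      also have "(\<Sum>q\<in>{- int n..<int n}. g (int N * int P, int N * (- q))) = (\<Sum>q\<in>{- int n..<int n}. g (int N * int P, int N * q)) + g (int N * int P, int N * int n) - g (int N * int P, int N * (- int n))"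
        by (rule sum_reflect)
      finally show ?thesis by simp
    qed
    have "(\<lambda>n. (- 1) ^ k * ((\<Sum>q\<in>{- int n..<int n}. g (int N * int P, int N * q)) + 1 * g (int N * int P, int N * int n) - 1 * g (int N * int P, int N * (- int n)))) \<longlonglongrightarrow>
        (- 1) ^ k * (Rl (of_int (int N * int P) * z) + 0 - 0)"
      by (intro tendsto_mult_left tendsto_add tendsto_diff Cpos P g0)
    thus ?thesis unfolding e by simp
  qed
  \<comment> \<open>What survives of the boundary as n grows: the ends in q disappear, the rows at P
    and -P remain. They are \<open>Rl\<close> and (-1)^k \<open>Rl\<close>, which coincide for k =
    2.\<close>
  define cor where "cor = (\<lambda>P::nat. if k \<ge> 3 then 0 else - al N \<theta> / of_nat N * (Rl (of_int (int N * int P) * z) - (- 1) ^ k * Rl (of_int (int N * int P) * z)))"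
  have corlim: "(\<lambda>n. if k \<ge> 3 then 0 else
      - al N \<theta> / of_nat N * (\<Sum>q\<in>{- int n..<int n}. g (int N * int P, int N * q) - g (int N * (- int P), int N * q))
      - be N \<theta> / of_nat N * (\<Sum>p\<in>{- int P..<int P}. g (int N * p, int N * int n) - g (int N * p, int N * (- int n)))) \<longlonglongrightarrow> cor P"
    if P: "P \<ge> 1" for P
  proof (cases "k \<ge> 3")
    case False
    have "(\<lambda>n. - al N \<theta> / of_nat N * ((\<Sum>q\<in>{- int n..<int n}. g (int N * int P, int N * q)) - (\<Sum>q\<in>{- int n..<int n}. g (int N * (- int P), int N * q)))
      - be N \<theta> / of_nat N * (\<Sum>p\<in>{- int P..<int P}. 1 * g (int N * p, int N * int n) - 1 * g (int N * p, int N * (- int n)))) \<longlonglongrightarrow>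
       - al N \<theta> / of_nat N * (Rl (of_int (int N * int P) * z) - (- 1) ^ k * Rl (of_int (int N * int P) * z)) - be N \<theta> / of_nat N * (\<Sum>p\<in>{- int P..<int P}. 0 - 0)"
      by (intro tendsto_diff tendsto_mult_left tendsto_sum Cpos Cneg P g0)
    thus ?thesis using False by (simp add: cor_def sum_subtractf)
  qed (simp add: cor_def)
  have hs: "(B has_sum EE) (UNIV \<times> UNIV)"
    using Su_has_sum[of k 0 z 0] z by (simp add: B_def EE_def Sphi_def fab_def g_def)
  define r where "r = (\<lambda>p. \<Sum>\<^sub>\<infinity>q. B (p, q))"
  have row: "((\<lambda>q. B (p, q)) has_sum r p) UNIV" for p
    unfolding r_def
    by (intro has_sum_infsum summable_on_SigmaD1[of "\<lambda>p q. B (p, q)" UNIV "\<lambda>_. UNIV"]) (use hs in \<open>auto simp: summable_on_def\<close>)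
  have rsum: "(r has_sum EE) UNIV" by (rule has_sum_SigmaD[OF hs row])
  define DP where "DP = (\<lambda>P. \<Sum>p\<in>{- int P..<int P}. r p)"
  have DP_lim: "DP \<longlonglongrightarrow> EE" unfolding DP_def by (rule has_sum_sym_LIMSEQ[OF rsum])
  have Wsum: "(\<lambda>n. \<Sum>m\<in>{- int (P * N)..<int (P * N)}. W n m) \<longlonglongrightarrow> DP P - cor P" if P: "P \<ge> 1" for P
  proof -
    have "(\<lambda>n. \<Sum>p\<in>{- int P..<int P}. \<Sum>q\<in>{- int n..<int n}. B (p, q)) \<longlonglongrightarrow> DP P"
      unfolding DP_def by (intro tendsto_sum has_sum_sym_LIMSEQ row)
    from tendsto_diff[OF this corlim[OF P]] show ?thesis
      unfolding B_def sum_blk_kap[OF N1 per] W_def by simp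
  qed
  \<comment> \<open>The half-open interval of rows reaches from -PN to PN - 1, hence one more
    negative row than positive ones.\<close>
  have split: "(\<Sum>m\<in>{- int (P * N)..<int (P * N)}. W n m) = W n 0 + (\<Sum>i<P * N - 1. W n (int (Suc i))) + (\<Sum>i<P * N. W n (- int (Suc i)))"
    if P: "P \<ge> 1" for P n
  proof -
    obtain K where K: "P * N = Suc K" using P N1 by (cases "P * N") auto
    have "(\<Sum>i<Suc K. W n (int i)) = W n 0 + (\<Sum>i<K. W n (int (Suc i)))"
      unfolding sum.lessThan_Suc_shift by simp
    thus ?thesis unfolding sum_sym_interval K by (simp add: algebra_simps)
  qed
  \<comment> \<open>Row 0 is isolated as the difference of quantities with known limits. Its limit
    cannot depend on P, so comparing with P = 1 yields \<open>DPeq\<close> for all P.\<close>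
  have W0: "(\<lambda>n. W n 0) \<longlonglongrightarrow> DP P - cor P - (\<Sum>i<P * N - 1. Rw (Suc i)) - (\<Sum>i<P * N. Rw (Suc i))" if P: "P \<ge> 1" for P
  proof -
    have e: "W n 0 = (\<Sum>m\<in>{- int (P * N)..<int (P * N)}. W n m) - (\<Sum>i<P * N - 1. W n (int (Suc i))) - (\<Sum>i<P * N. W n (- int (Suc i)))" for n
      unfolding split[OF P] by simp
    show ?thesis unfolding e by (intro tendsto_diff tendsto_sum Wsum P Wpos Wneg) auto
  qed
  define R0 where "R0 = DP 1 - cor 1 - (\<Sum>i<1 * N - 1. Rw (Suc i)) - (\<Sum>i<1 * N. Rw (Suc i))"
  have W0R: "(\<lambda>n. W n 0) \<longlonglongrightarrow> R0" unfolding R0_def by (rule W0) simp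
  have DPeq: "DP P = R0 + cor P + (\<Sum>i<P * N - 1. Rw (Suc i)) + (\<Sum>i<P * N. Rw (Suc i))" if P: "P \<ge> 1" for P
    using LIMSEQ_unique[OF W0R W0[OF P]] by simp
  define V where "V = (\<lambda>n. \<Sum>x<n * N. \<theta> (0, int (Suc x)) * inverse (of_nat (Suc x)) ^ k)"
  have Vlim: "V \<longlonglongrightarrow> R0 / 2"
  proof -
    define f where "f = (\<lambda>x. \<theta> (0, x) * g (0, x))"
    have fneg: "f (- x) = f x" for x
      using par[of 0 x] gneg[of 0 x] sq by (simp add: f_def algebra_simps)
    have f0: "f 0 = 0" using k1 by (simp add: f_def g_def)
    have fV: "(\<Sum>x<n * N. f (int (Suc x))) = V n" for n
      unfolding V_def f_def g_def lat_def by (intro sum.cong refl) simp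
    \<comment> \<open>f is even and vanishes at 0, so the row is twice its positive half, except
      that the half-open interval omits the point nN.\<close>
    have "W n 0 = 2 * V n - f (int (n * N))" for n
    proof -
      have "W n 0 = (\<Sum>i<n * N. f (int i)) + (\<Sum>i<n * N. f (- 1 - int i))"
        unfolding W_def f_def[symmetric] by (rule sum_sym_interval)
      also have "(\<Sum>i<n * N. f (- 1 - int i)) = V n"
        unfolding fV[symmetric] using fneg[of "int (Suc _)"] by (intro sum.cong refl) simp
      also have "(\<Sum>i<n * N. f (int i)) = V n - f (int (n * N))"
        using sum_lessThan_telescope[of "\<lambda>i. f (int i)" "n * N"] f0 unfolding fV[symmetric]
        by (simp add: sum_subtractf algebra_simps)
      finally show ?thesis by simp
    qed
    hence e: "V n = (W n 0 + \<theta> (0, 0) * g (0, int N * int n)) / 2" for n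
      using thN[of 0 "int n"] by (simp add: f_def mult.commute)
    have "(\<lambda>n. (W n 0 + \<theta> (0, 0) * g (0, int N * int n)) / 2) \<longlonglongrightarrow> (R0 + 0) / 2"
      by (intro tendsto_divide tendsto_add W0R g0 tendsto_const) simp
    thus ?thesis unfolding e[symmetric] by simp
  qed
  have RwT: "Rw m = iN * dl * \<Phi> (int m) + T m" for m
    unfolding Rw_def T_def Rl_def \<Phi>_def sum_distrib_left sum.distrib[symmetric]
    by (intro sum.cong refl) (simp add: algebra_simps)
  define TT where "TT = infsum (fterm k N \<theta> z) UNIV"
  have "(fterm k N \<theta> z has_sum TT) (UNIV \<times> UNIV)"
    unfolding TT_def using Infinite_Sum.abs_summable_summable[OF fterm_abs_summable[OF N1 per z, of k]] by simp
  from has_sum_SigmaD[OF this fterm_row[OF N1 z]] 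
  have "((\<lambda>m. T (Suc m)) has_sum TT) UNIV" unfolding T_def iN_def A_def .
  hence Tlim: "(\<lambda>n. \<Sum>i<n. T (Suc i)) \<longlonglongrightarrow> TT" using has_sum_imp_sums sums_def by blast
  have PN: "filterlim (\<lambda>P. Suc P * N) sequentially sequentially" "filterlim (\<lambda>P. Suc P * N - 1) sequentially sequentially"
  proof -
    have "P \<le> Suc P * N" "P \<le> Suc P * N - 1" for P
      using N1 by (cases N; simp)+
    thus "filterlim (\<lambda>P. Suc P * N) sequentially sequentially" "filterlim (\<lambda>P. Suc P * N - 1) sequentially sequentially"
      by (auto intro!: filterlim_at_top_mono[OF filterlim_ident] always_eventually)
  qed
  \<comment> \<open>For k = 1 each row carries -pi i times its sum \<Phi> over a period. Over full
    periods of rows these cancel, as the weight has mean zero, and \<Phi> vanishes at multiples of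
    N, as the weight is odd; so leaving out or adding such a row changes nothing.\<close>
  have delta0: "iN * dl * (\<Sum>i<P * N - 1. \<Phi> (int (Suc i))) + iN * dl * (\<Sum>i<P * N. \<Phi> (int (Suc i))) = 0" if P: "P \<ge> 1" for P
  proof (cases "k = 1")
    case True
    have per\<Phi>: "\<Phi> (m + int N) = \<Phi> m" for m
      unfolding \<Phi>_def using per by (intro sum.cong refl) (simp add: periodic_def)
    have "\<Phi> 0 = - \<Phi> 0"
    proof -
      have "\<Phi> 0 = (\<Sum>j\<in>{0..<int N}. \<theta> (0, (- j) mod int N))"
        unfolding \<Phi>_def
        by (rule sum.reindex_bij_witness[where i = "\<lambda>j. (- j) mod int N" and j = "\<lambda>j. (- j) mod int N"])
           (use N1 in \<open>auto simp: mod_minus_eq\<close>)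
      also have "\<dots> = (\<Sum>j\<in>{0..<int N}. - \<theta> (0, j))"
      proof (intro sum.cong refl)
        fix j
        have "\<theta> (0, (- j) mod int N) = \<theta> (0, - j)" using periodic_mod[OF per, of 0 "- j"] by simp
        also have "\<dots> = - \<theta> (0, j)" using par[of 0 j] True by simp
        finally show "\<theta> (0, (- j) mod int N) = - \<theta> (0, j)" .
      qed
      finally show ?thesis by (simp add: \<Phi>_def sum_negf)
    qed
    hence \<Phi>0: "\<Phi> 0 = 0" by simp
    have "(\<Sum>m\<in>{0..<int N}. \<Phi> m) = (\<Sum>b\<in>pbox N. \<theta> b)"
      unfolding \<Phi>_def pbox_def by (simp add: sum.cartesian_product)
    hence "(\<Sum>m\<in>{0..<int (P * N)}. \<Phi> m) = 0"
      using sum_periods[of \<Phi> N P, OF per\<Phi>] zm True by simp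
    moreover have "(\<Sum>m\<in>{0..<int n}. \<Phi> m) = (\<Sum>i<n. \<Phi> (int i))" for n
      by (rule sum.reindex_bij_witness[where i = int and j = nat]) auto
    ultimately have s0: "(\<Sum>i<P * N. \<Phi> (int i)) = 0" by metis
    have \<Phi>P: "\<Phi> (int (P * N)) = 0"
    proof -
      have "\<Phi> (0 + int (P * N)) = \<Phi> 0" by (rule periodic_multiple[of \<Phi> N, OF per\<Phi>]) simp
      thus ?thesis using \<Phi>0 by simp
    qed
    have s1: "(\<Sum>i<P * N. \<Phi> (int (Suc i))) = 0"
      using sum_lessThan_telescope[of "\<lambda>i. \<Phi> (int i)" "P * N"] s0 \<Phi>0 \<Phi>P by (simp add: sum_subtractf)
    have s2: "(\<Sum>i<P * N - 1. \<Phi> (int (Suc i))) = 0"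
    proof -
      obtain K where K: "P * N = Suc K" using P N1 by (cases "P * N") auto
      have "(\<Sum>i<Suc K. \<Phi> (int i)) = \<Phi> 0 + (\<Sum>i<K. \<Phi> (int (Suc i)))" unfolding sum.lessThan_Suc_shift by simp
      thus ?thesis using s0 \<Phi>0 unfolding K by simp
    qed
    show ?thesis unfolding s1 s2 by simp
  qed (simp add: dl_def)
  have DPT: "DP (Suc P) = R0 + cor (Suc P) + (\<Sum>i<Suc P * N - 1. T (Suc i)) + (\<Sum>i<Suc P * N. T (Suc i))" for P
  proof -
    have "DP (Suc P) = R0 + cor (Suc P) + (\<Sum>i<Suc P * N - 1. Rw (Suc i)) + (\<Sum>i<Suc P * N. Rw (Suc i))" by (rule DPeq) simp
    also have "\<dots> = R0 + cor (Suc P) + (\<Sum>i<Suc P * N - 1. T (Suc i)) + (\<Sum>i<Suc P * N. T (Suc i)) +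
        (iN * dl * (\<Sum>i<Suc P * N - 1. \<Phi> (int (Suc i))) + iN * dl * (\<Sum>i<Suc P * N. \<Phi> (int (Suc i))))"
      unfolding RwT sum.distrib sum_distrib_left by (simp add: algebra_simps)
    also have "iN * dl * (\<Sum>i<Suc P * N - 1. \<Phi> (int (Suc i))) + iN * dl * (\<Sum>i<Suc P * N. \<Phi> (int (Suc i))) = 0"
      by (rule delta0) simp
    finally show ?thesis by simp
  qed
  \<comment> \<open>For k = 1 the boundary rows at P and -P reinforce each other. Their exponential
    parts tend to 0, and 2 (-pi i)/N times -al/N survives.\<close>
  have corl: "(\<lambda>P. cor (Suc P)) \<longlonglongrightarrow> (if k = 1 then 2 * of_real pi * \<i> * al N \<theta> / of_nat N ^ 2 else 0)"
  proof (cases "k = 1")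
    case False
    hence "cor P = 0" for P using k1 by (cases "k = 2") (auto simp: cor_def)
    thus ?thesis using False by simp
  next
    case True
    have e: "cor (Suc P) = - al N \<theta> / of_nat N * (2 * (iN * (dl + A * Lr k (of_nat (Suc P) * z))))" for P
      unfolding cor_def Rl_def using True N1 by simp
    have "(\<lambda>P. - al N \<theta> / of_nat N * (2 * (iN * (dl + A * Lr k (of_nat (Suc P) * z))))) \<longlonglongrightarrow>
        - al N \<theta> / of_nat N * (2 * (iN * (dl + A * 0)))"
      by (intro tendsto_mult_left tendsto_add tendsto_const Lr_tendsto_0 z k1)
    also have "- al N \<theta> / of_nat N * (2 * (iN * (dl + A * 0))) = 2 * of_real pi * \<i> * al N \<theta> / of_nat N ^ 2"
      using True N1 by (simp add: iN_def dl_def field_simps power2_eq_square)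
    finally show ?thesis unfolding e using True by simp
  qed
  have "(\<lambda>P. DP (Suc P)) \<longlonglongrightarrow> R0 + (if k = 1 then 2 * of_real pi * \<i> * al N \<theta> / of_nat N ^ 2 else 0) + TT + TT"
    unfolding DPT
    by (intro tendsto_add tendsto_const corl filterlim_compose[OF Tlim PN(1)] filterlim_compose[OF Tlim PN(2)])
  moreover have "(\<lambda>P. DP (Suc P)) \<longlonglongrightarrow> EE" using DP_lim by (rule LIMSEQ_Suc)
  ultimately have "EE = R0 + (if k = 1 then 2 * of_real pi * \<i> * al N \<theta> / of_nat N ^ 2 else 0) + TT + TT"
    using LIMSEQ_unique by blast
  hence "1 / 2 * EE = R0 / 2 + (if k = 1 then of_real pi * \<i> * al N \<theta> / of_nat N ^ 2 else 0) + TT"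
    by (simp add: add_divide_distrib)
  with Vlim that show thesis unfolding V_def EE_def TT_def by blast
qed

section \<open>The \<xi>-image at all cusps and membership in the space of harmonic Maass
  forms\<close>

lemma cnj_kap: "cnj (kap k N \<phi> b) = kap k N (\<lambda>x. cnj (\<phi> x)) b"
  by (simp add: kap_def al_def be_def)

lemma cnj_Sphi: "cnj (Sphi k N \<phi> 0 k z 0) = Sphi k N (\<lambda>x. cnj (\<phi> x)) k 0 z 0" if "admissible k N \<phi>"
proof -
  have adm': "admissible k N (\<lambda>x. cnj (\<phi> x))"
    using that by (auto simp: admissible_def periodic_def simp flip: cnj_sum)
  have "cnj (blk N (pcbox N) (kap k N \<phi>) (\<lambda>mn. fab 0 k 0 (lat z mn) (lat (cnj z) mn)) Q) =
      blk N (pcbox N) (kap k N (\<lambda>x. cnj (\<phi> x))) (\<lambda>mn. fab k 0 0 (lat z mn) (lat (cnj z) mn)) Q" for Q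
    by (simp add: blk_def fab_def cnj_kap cnj_lat)
  thus ?thesis
    unfolding Sphi_def latsum.Su_def[OF latsum_kap[OF that]] latsum.Su_def[OF latsum_kap[OF adm']]
    by (simp flip: infsum_cnj)
qed

lemma kap_cmult: "kap k N (\<lambda>x. c * \<phi> x) b = c * kap k N \<phi> b"
proof -
  have e: "al N (\<lambda>x. c * \<phi> x) = c * al N \<phi>" "be N (\<lambda>x. c * \<phi> x) = c * be N \<phi>"
    unfolding al_def be_def sum_distrib_left by (simp_all add: mult.left_commute)
  show ?thesis unfolding kap_def e by (simp add: algebra_simps)
qed

lemma Fphi_cmult:
  assumes adm: "admissible k N \<phi>"
  shows "Fphi k N (\<lambda>x. c * \<phi> x) z = c * Fphi k N \<phi> z"
proof -
  have adm': "admissible k N (\<lambda>x. c * \<phi> x)"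
    using assms by (auto simp: admissible_def periodic_def simp flip: sum_distrib_left)
  have "blk N (pcbox N) (kap k N (\<lambda>x. c * \<phi> x)) g = (\<lambda>Q. c * blk N (pcbox N) (kap k N \<phi>) g Q)" for g
    by (rule ext) (unfold blk_def kap_cmult sum_distrib_left, simp only: mult.assoc)
  thus ?thesis
    unfolding Fphi_def latsum.Fz_def[OF latsum_kap[OF adm]] latsum.Fz_def[OF latsum_kap[OF adm']]
      latsum.Gz_def[OF latsum_kap[OF adm]] latsum.Gz_def[OF latsum_kap[OF adm']]
    by (simp add: infsum_cmult_right')
qed

text \<open>A pair of positive integers (m, c) is the same as n = mc together with a divisor c of n.
  The subtractions of 1 in the index maps are never truncated, as both factors are positive.\<close>

lemma has_sum_divisor_grouping:
  fixes F :: "nat \<Rightarrow> nat \<Rightarrow> complex"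
  assumes "((\<lambda>(m, c). F (Suc m) (Suc c)) has_sum S) UNIV"
  shows "((\<lambda>n. \<Sum>c | c dvd Suc n. F (Suc n div c) c) has_sum S) UNIV"
proof -
  have pos: "c > 0" "Suc n div c > 0" if "c dvd Suc n" for c n
  proof -
    have "Suc n div c * c = Suc n" using that by simp
    thus "c > 0" "Suc n div c > 0" by (cases c; cases "Suc n div c"; simp)+
  qed
  have "((\<lambda>(n, c). F (Suc n div c) c) has_sum S) (Sigma UNIV (\<lambda>n. {c. c dvd Suc n})) \<longleftrightarrow>
      ((\<lambda>(m, c). F (Suc m) (Suc c)) has_sum S) UNIV"
  proof (rule has_sum_reindex_bij_witness[where i = "\<lambda>(m, c). (Suc m * Suc c - 1, Suc c)" and
        j = "\<lambda>(n, c). (Suc n div c - 1, c - 1)"])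
    fix a assume "a \<in> Sigma UNIV (\<lambda>n. {c. c dvd Suc n})"
    then obtain n c where a: "a = (n, c)" and c: "c dvd Suc n" by auto
    have S: "Suc (Suc n div c - 1) = Suc n div c" "Suc (c - 1) = c" using pos[OF c] by simp_all
    have p: "Suc n div c * c = Suc n" using c by simp
    show "(case (case a of (n, c) \<Rightarrow> (Suc n div c - 1, c - 1)) of (m, c) \<Rightarrow> (Suc m * Suc c - 1, Suc c)) = a"
      unfolding a prod.case S p by simp
    show "(case (case a of (n, c) \<Rightarrow> (Suc n div c - 1, c - 1)) of (m, c) \<Rightarrow> F (Suc m) (Suc c)) = (case a of (n, c) \<Rightarrow> F (Suc n div c) c)"
      unfolding a prod.case S by simp
  next
    fix b :: "nat \<times> nat"
    obtain m c where b: "b = (m, c)" by (cases b)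
    have S: "Suc (Suc m * Suc c - 1) = Suc m * Suc c" by simp
    have q: "Suc m * Suc c div Suc c = Suc m" by (rule nonzero_mult_div_cancel_right) simp
    show "(case (case b of (m, c) \<Rightarrow> (Suc m * Suc c - 1, Suc c)) of (n, c) \<Rightarrow> (Suc n div c - 1, c - 1)) = b"
      unfolding b prod.case S q by simp
    show "(case b of (m, c) \<Rightarrow> (Suc m * Suc c - 1, Suc c)) \<in> Sigma UNIV (\<lambda>n. {c. c dvd Suc n})"
      unfolding b prod.case by (rule SigmaI[OF UNIV_I]) (simp only: mem_Collect_eq S dvd_triv_right)
  qed simp_all
  hence "((\<lambda>(n, c). F (Suc n div c) c) has_sum S) (Sigma UNIV (\<lambda>n. {c. c dvd Suc n}))"
    using assms by simp
  from has_sum_SigmaD[OF this, where g = "\<lambda>n. \<Sum>c | c dvd Suc n. F (Suc n div c) c"] show ?thesis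
    by simp
qed

definition qcoef :: "nat \<Rightarrow> nat \<Rightarrow> (int \<times> int \<Rightarrow> complex) \<Rightarrow> nat \<Rightarrow> complex" where
  "qcoef k N \<theta> n = (\<Sum>c | c dvd n. fcoef k N \<theta> (n div c) c)"

lemma fterm_grouped:
  assumes N: "N \<ge> 1" and per: "periodic N \<theta>" and z: "Im z > 0"
  shows "((\<lambda>n. qcoef k N \<theta> (Suc n) * exp (2 * of_real pi * \<i> * of_nat (Suc n) * z / of_nat N)) has_sum
    infsum (fterm k N \<theta> z) UNIV) UNIV"
proof -
  define F where "F = (\<lambda>m c. fcoef k N \<theta> m c * exp (2 * of_real pi * \<i> * of_nat (m * c) * z / of_nat N))"
  have "fterm k N \<theta> z = (\<lambda>(m, c). F (Suc m) (Suc c))" by (simp only: fterm_def F_def)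
  moreover have "(fterm k N \<theta> z has_sum infsum (fterm k N \<theta> z) UNIV) UNIV"
    by (rule has_sum_infsum) (rule Infinite_Sum.abs_summable_summable[OF fterm_abs_summable[OF N per z]])
  ultimately have "((\<lambda>n. \<Sum>c | c dvd Suc n. F (Suc n div c) c) has_sum infsum (fterm k N \<theta> z) UNIV) UNIV"
    using has_sum_divisor_grouping[of F] by simp
  moreover have "(\<Sum>c | c dvd Suc n. F (Suc n div c) c) = qcoef k N \<theta> (Suc n) * exp (2 * of_real pi * \<i> * of_nat (Suc n) * z / of_nat N)" for n
    unfolding qcoef_def sum_distrib_right F_def
    by (intro sum.cong refl) (simp only: mem_Collect_eq dvd_div_mult_self)
  ultimately show ?thesis by simp
qed

text \<open>V is a limit in which z does not occur, so the constants that
  \<open>fourier_expansion\<close> provides for different z coincide; the one for the point i fixes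
  it.\<close>

lemma xi_Fphi_expansion:
  assumes adm: "admissible k N \<phi>" and par: "\<And>m n. \<phi> (- m, - n) = (- 1) ^ k * \<phi> (m, n)"
  defines "\<theta> \<equiv> \<lambda>x. cnj (\<phi> x)"
  obtains V where "(\<lambda>n. \<Sum>x<n * N. \<theta> (0, int (Suc x)) * inverse (of_nat (Suc x)) ^ k) \<longlonglongrightarrow> V"
    "\<And>z. Im z > 0 \<Longrightarrow> xi_op (2 - int k) (Fphi k N \<phi>) z =
      V + (if k = 1 then of_real pi * \<i> * al N \<theta> / of_nat N ^ 2 else 0) + infsum (fterm k N \<theta> z) UNIV"
proof -
  have adm': "admissible k N \<theta>"
    using adm by (auto simp: \<theta>_def admissible_def periodic_def simp flip: cnj_sum)
  have par': "\<theta> (- m, - n) = (- 1) ^ k * \<theta> (m, n)" for m n by (simp add: \<theta>_def par)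
  have xi: "xi_op (2 - int k) (Fphi k N \<phi>) z = 1 / 2 * Sphi k N \<theta> k 0 z 0" if "Im z > 0" for z
    using Fphi_xi[OF adm that] cnj_Sphi[OF adm] by (simp add: \<theta>_def)
  obtain V where V: "(\<lambda>n. \<Sum>x<n * N. \<theta> (0, int (Suc x)) * inverse (of_nat (Suc x)) ^ k) \<longlonglongrightarrow> V"
    using fourier_expansion[OF adm' par', of \<i>] by auto
  show thesis
  proof (rule that[OF V])
    fix z :: complex assume z: "Im z > 0"
    obtain V' where V': "(\<lambda>n. \<Sum>x<n * N. \<theta> (0, int (Suc x)) * inverse (of_nat (Suc x)) ^ k) \<longlonglongrightarrow> V'"
      and e: "1 / 2 * Sphi k N \<theta> k 0 z 0 = V' + (if k = 1 then of_real pi * \<i> * al N \<theta> / of_nat N ^ 2 else 0) +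
      infsum (fterm k N \<theta> z) UNIV"
      using fourier_expansion[OF adm' par' z] by blast
    have "V' = V" by (rule LIMSEQ_unique[OF V' V])
    thus "xi_op (2 - int k) (Fphi k N \<phi>) z =
      V + (if k = 1 then of_real pi * \<i> * al N \<theta> / of_nat N ^ 2 else 0) + infsum (fterm k N \<theta> z) UNIV"
      unfolding xi[OF z] e by simp
  qed
qed

lemma pull_parity:
  assumes "\<And>m n. \<phi> (- m, - n) = (- 1) ^ k * \<phi> (m, n)"
  shows "pull \<phi> \<gamma> (- m, - n) = (- 1) ^ k * pull \<phi> \<gamma> (m, n)"
proof -
  obtain a b c d where g: "\<gamma> = (a, b, c, d)" by (cases \<gamma>)
  show ?thesis
    using assms[of "m * d + n * (- c)" "m * (- b) + n * a"] by (simp add: g pull_def rmul_def)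
qed

text \<open>The slashed function is the \<xi>-image belonging to the pulled-back weight, which is
  again admissible, with the same parity and the same period. Its expansion runs in powers of exp (2
  pi i z / N), so h = N serves every cusp.\<close>

lemma xi_Fphi_holomorphic_at_cusps:
  assumes adm: "admissible k N \<phi>" and par: "\<And>m n. \<phi> (- m, - n) = (- 1) ^ k * \<phi> (m, n)"
  shows "holomorphic_at_cusps (int k) (xi_op (2 - int k) (Fphi k N \<phi>))"
  unfolding holomorphic_at_cusps_def
proof
  fix \<gamma> assume g: "\<gamma> \<in> SL2Z"
  obtain a b c d where abcd: "\<gamma> = (a, b, c, d)" by (cases \<gamma>)
  define \<phi>' where "\<phi>' = pull \<phi> \<gamma>"
  define \<theta> where "\<theta> = (\<lambda>x. cnj (\<phi>' x))"
  have adm': "admissible k N \<phi>'" unfolding \<phi>'_def by (rule admissible_pull[OF adm g])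
  have N: "N \<ge> 1" and per: "periodic N \<theta>" using adm' by (auto simp: admissible_def \<theta>_def periodic_def)
  have par': "\<phi>' (- m, - n) = (- 1) ^ k * \<phi>' (m, n)" for m n unfolding \<phi>'_def by (rule pull_parity[OF par])
  obtain V where e: "\<And>z. Im z > 0 \<Longrightarrow> xi_op (2 - int k) (Fphi k N \<phi>') z =
      V + (if k = 1 then of_real pi * \<i> * al N \<theta> / of_nat N ^ 2 else 0) + infsum (fterm k N \<theta> z) UNIV"
    unfolding \<theta>_def by (rule xi_Fphi_expansion[OF adm' par']) blast
  define D where "D = V + (if k = 1 then of_real pi * \<i> * al N \<theta> / of_nat N ^ 2 else 0)"
  define A where "A = (\<lambda>n. if n = 0 then D else qcoef k N \<theta> n)"
  have "(\<lambda>n. A n * exp (2 * of_real pi * \<i> * of_nat n * z / of_nat N)) sums slash (int k) (xi_op (2 - int k) (Fphi k N \<phi>)) \<gamma> z"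
    if "z \<in> upper_half_plane" for z
  proof -
    have z: "Im z > 0" using that by (simp add: upper_half_plane_def)
    have nz: "of_int c * z + of_int d \<noteq> 0" using SL2Z_denom_nz g z unfolding abcd by blast
    have "slash (int k) (xi_op (2 - int k) (Fphi k N \<phi>)) \<gamma> z = xi_op (2 - int k) (Fphi k N \<phi>') z"
      using xi_Fphi_act[OF adm g[unfolded abcd] z] nz
      by (simp add: slash_def abcd \<phi>'_def power_int_minus)
    also have "\<dots> = infsum (fterm k N \<theta> z) UNIV + D" using e[OF z] by (simp add: D_def)
    finally have sl: "slash (int k) (xi_op (2 - int k) (Fphi k N \<phi>)) \<gamma> z = infsum (fterm k N \<theta> z) UNIV + A 0 * exp (2 * of_real pi * \<i> * of_nat 0 * z / of_nat N)"
      by (simp add: A_def)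
    have "(\<lambda>n. A (Suc n) * exp (2 * of_real pi * \<i> * of_nat (Suc n) * z / of_nat N)) sums infsum (fterm k N \<theta> z) UNIV"
      using has_sum_imp_sums[OF fterm_grouped[OF N per z, of k]] by (simp add: A_def)
    thus ?thesis unfolding sl by (rule sums_Suc)
  qed
  thus "\<exists>h::nat. h > 0 \<and> (\<exists>a :: nat \<Rightarrow> complex. \<forall>z\<in>upper_half_plane.
       (\<lambda>n. a n * exp (2 * of_real pi * \<i> * of_nat n * z / of_nat h)) sums slash (int k) (xi_op (2 - int k) (Fphi k N \<phi>)) \<gamma> z)"
    using N by (intro exI[of _ N] conjI exI[of _ A]) auto
qed

lemma Fphi_in_harmonic_maass_space:
  assumes adm: "admissible k N \<phi>" and par: "\<And>m n. \<phi> (- m, - n) = (- 1) ^ k * \<phi> (m, n)"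
    and tr: "\<And>a b c d mn. (a, b, c, d) \<in> Gamma0 N' \<Longrightarrow> pull \<phi> (a, b, c, d) mn = \<eta> d * \<phi> mn"
  shows "Fphi k N \<phi> \<in> harmonic_maass_space (2 - int k) N' \<eta>"
  unfolding harmonic_maass_space_def
proof (intro CollectI conjI)
  show "\<forall>(a, b, c, d)\<in>Gamma0 N'. \<forall>z\<in>upper_half_plane.
      Fphi k N \<phi> (act (a, b, c, d) z) = \<eta> d * (of_int c * z + of_int d) powi (2 - int k) * Fphi k N \<phi> z"
  proof (clarify)
    fix a b c d :: int and z assume g: "(a, b, c, d) \<in> Gamma0 N'" and z: "z \<in> upper_half_plane"
    have s: "(a, b, c, d) \<in> SL2Z" using g by (simp add: Gamma0_def)
    have "pull \<phi> (a, b, c, d) = (\<lambda>mn. \<eta> d * \<phi> mn)" using tr[OF g] by (simp add: fun_eq_iff)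
    thus "Fphi k N \<phi> (act (a, b, c, d) z) = \<eta> d * (of_int c * z + of_int d) powi (2 - int k) * Fphi k N \<phi> z"
      using Fphi_act[OF adm s, of z] z Fphi_cmult[OF adm, of "\<eta> d" z] by (simp add: upper_half_plane_def)
  qed
  show "\<forall>z\<in>upper_half_plane. laplace_op (2 - int k) (Fphi k N \<phi>) z = 0"
    using Fphi_laplace[OF adm] by (simp add: upper_half_plane_def)
  show "holomorphic_at_cusps (2 - (2 - int k)) (xi_op (2 - int k) (Fphi k N \<phi>))"
    using xi_Fphi_holomorphic_at_cusps[OF adm par] by simp
qed (rule Fphi_real_analytic[OF adm], rule Fphi_cusp_growth[OF adm])

section \<open>Dependence on values in the upper half-plane only\<close>

lemma open_upper_half_plane: "open upper_half_plane"
  unfolding upper_half_plane_def by (rule open_halfspace_Im_gt)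

text \<open>Off the upper half-plane the functions are arbitrary; openness turns agreement on it
  into agreement near each point, which is what a derivative sees.\<close>

lemma partial_cong:
  assumes "\<And>z. z \<in> upper_half_plane \<Longrightarrow> F z = G z" and z: "z \<in> upper_half_plane"
  shows "partial_x F z = partial_x G z" "partial_y F z = partial_y G z"
proof -
  have ev: "eventually (\<lambda>u::real. F (z + c * of_real u) = G (z + c * of_real u)) (nhds 0)" for c
  proof -
    have "continuous (at 0) (\<lambda>u::real. z + c * of_real u)" by (intro continuous_intros)
    hence "filterlim (\<lambda>u::real. z + c * of_real u) (nhds z) (nhds 0)"
      using tendsto_at_iff_tendsto_nhds[of "\<lambda>u::real. z + c * of_real u" 0] by (simp add: continuous_at)
    hence "eventually (\<lambda>u::real. z + c * of_real u \<in> upper_half_plane) (nhds 0)"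
      using open_upper_half_plane z by (rule topological_tendstoD)
    thus ?thesis by eventually_elim (rule assms)
  qed
  show "partial_x F z = partial_x G z" unfolding partial_x_def
    by (rule vector_derivative_cong_eq) (use ev[of 1] in auto)
  show "partial_y F z = partial_y G z" unfolding partial_y_def
    by (rule vector_derivative_cong_eq) (use ev[of \<i>] in auto)
qed

lemma xi_op_cong:
  assumes "\<And>z. z \<in> upper_half_plane \<Longrightarrow> F z = G z" and z: "z \<in> upper_half_plane"
  shows "xi_op w F z = xi_op w G z"
  using partial_cong[OF assms] by (simp add: xi_op_def wirtinger_bar_def)

lemma laplace_op_cong:
  assumes "\<And>z. z \<in> upper_half_plane \<Longrightarrow> F z = G z" and z: "z \<in> upper_half_plane"
  shows "laplace_op w F z = laplace_op w G z"
proof -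
  have "partial_x (partial_x F) z = partial_x (partial_x G) z"
    by (rule partial_cong(1)[OF _ z]) (rule partial_cong(1)[OF assms(1)])
  moreover have "partial_y (partial_y F) z = partial_y (partial_y G) z"
    by (rule partial_cong(2)[OF _ z]) (rule partial_cong(2)[OF assms(1)])
  ultimately show ?thesis using partial_cong[OF assms] by (simp add: laplace_op_def)
qed

lemma act_in_upper_half_plane:
  assumes "\<gamma> \<in> SL2Z" "z \<in> upper_half_plane"
  shows "act \<gamma> z \<in> upper_half_plane"
  using assms Im_act(2) by (cases \<gamma>) (auto simp: upper_half_plane_def)

lemma slash_cong:
  assumes "\<And>z. z \<in> upper_half_plane \<Longrightarrow> F z = G z" and "\<gamma> \<in> SL2Z" "z \<in> upper_half_plane"
  shows "slash w F \<gamma> z = slash w G \<gamma> z"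
  using assms(1)[OF act_in_upper_half_plane[OF assms(2,3)]] by (cases \<gamma>) (simp add: slash_def)

lemma real_analytic_on_cong:
  assumes eq: "\<And>z. z \<in> upper_half_plane \<Longrightarrow> F z = G z" and F: "real_analytic_on F upper_half_plane"
  shows "real_analytic_on G upper_half_plane"
  unfolding real_analytic_on_def
proof
  fix z0 assume z0: "z0 \<in> upper_half_plane"
  then obtain r a where r: "r > 0" and a: "\<And>x y :: real. \<bar>x\<bar> < r \<Longrightarrow> \<bar>y\<bar> < r \<Longrightarrow>
      ((\<lambda>(m, n). a m n * of_real x ^ m * of_real y ^ n) has_sum F (z0 + Complex x y)) (UNIV :: (nat \<times> nat) set)"
    using F unfolding real_analytic_on_def by meson
  show "\<exists>r>0. \<exists>a :: nat \<Rightarrow> nat \<Rightarrow> complex. \<forall>x y :: real. \<bar>x\<bar> < r \<and> \<bar>y\<bar> < r \<longrightarrow>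
     ((\<lambda>(m, n). a m n * of_real x ^ m * of_real y ^ n) has_sum G (z0 + Complex x y)) UNIV"
  proof (intro exI[of _ "min r (Im z0)"] conjI exI[of _ a] allI impI)
    show "min r (Im z0) > 0" using r z0 by (simp add: upper_half_plane_def)
    fix x y :: real assume xy: "\<bar>x\<bar> < min r (Im z0) \<and> \<bar>y\<bar> < min r (Im z0)"
    have "G (z0 + Complex x y) = F (z0 + Complex x y)"
      by (rule eq[symmetric]) (use xy in \<open>auto simp: upper_half_plane_def\<close>)
    thus "((\<lambda>(m, n). a m n * of_real x ^ m * of_real y ^ n) has_sum G (z0 + Complex x y)) UNIV"
      using a[of x y] xy by simp
  qed
qed

lemma harmonic_maass_space_cong:
  assumes eq: "\<And>z. z \<in> upper_half_plane \<Longrightarrow> F z = G z" and F: "F \<in> harmonic_maass_space w N \<eta>"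
  shows "G \<in> harmonic_maass_space w N \<eta>"
proof -
  have eq': "G z = F z" if "z \<in> upper_half_plane" for z using eq[OF that] by simp
  have sl: "slash v G \<gamma> z = slash v F \<gamma> z" "slash v (xi_op w G) \<gamma> z = slash v (xi_op w F) \<gamma> z"
    if "\<gamma> \<in> SL2Z" "z \<in> upper_half_plane" for v \<gamma> z
    using that by (auto intro!: slash_cong xi_op_cong eq')
  have "real_analytic_on G upper_half_plane" using F real_analytic_on_cong[OF eq] by (simp add: harmonic_maass_space_def)
  moreover have "\<forall>(a, b, c, d)\<in>Gamma0 N. \<forall>z\<in>upper_half_plane.
      G (act (a, b, c, d) z) = \<eta> d * (of_int c * z + of_int d) powi w * G z"
  proof clarify
    fix a b c d z assume g: "(a, b, c, d) \<in> Gamma0 N" and z: "z \<in> upper_half_plane"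
    have s: "(a, b, c, d) \<in> SL2Z" using g by (simp add: Gamma0_def)
    have "F (act (a, b, c, d) z) = \<eta> d * (of_int c * z + of_int d) powi w * F z"
      using F g z by (auto simp: harmonic_maass_space_def)
    thus "G (act (a, b, c, d) z) = \<eta> d * (of_int c * z + of_int d) powi w * G z"
      using eq[OF z] eq[OF act_in_upper_half_plane[OF s z]] by simp
  qed
  moreover have "\<forall>z\<in>upper_half_plane. laplace_op w G z = 0"
    using F laplace_op_cong[OF eq'] by (simp add: harmonic_maass_space_def)
  moreover have "linear_exp_growth_at_cusps w G"
    unfolding linear_exp_growth_at_cusps_def
  proof
    fix \<gamma> assume g: "\<gamma> \<in> SL2Z"
    have "linear_exp_growth_at_cusps w F" using F by (simp add: harmonic_maass_space_def)
    then obtain A C Y where "\<And>z. z \<in> upper_half_plane \<Longrightarrow> Im z > Y \<Longrightarrow> norm (slash w F \<gamma> z) \<le> A * exp (C * Im z)"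
      using g unfolding linear_exp_growth_at_cusps_def by meson
    thus "\<exists>A C Y :: real. \<forall>z\<in>upper_half_plane. Im z > Y \<longrightarrow> norm (slash w G \<gamma> z) \<le> A * exp (C * Im z)"
      by (intro exI[of _ A] exI[of _ C] exI[of _ Y]) (simp add: sl(1)[OF g])
  qed
  moreover have "holomorphic_at_cusps (2 - w) (xi_op w G)"
    unfolding holomorphic_at_cusps_def
  proof
    fix \<gamma> assume g: "\<gamma> \<in> SL2Z"
    have "holomorphic_at_cusps (2 - w) (xi_op w F)" using F by (simp add: harmonic_maass_space_def)
    then obtain h a where "h > 0" "\<And>z. z \<in> upper_half_plane \<Longrightarrow>
       (\<lambda>n. a n * exp (2 * of_real pi * \<i> * of_nat n * z / of_nat h)) sums slash (2 - w) (xi_op w F) \<gamma> z"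
      using g unfolding holomorphic_at_cusps_def by meson
    thus "\<exists>h::nat. h > 0 \<and> (\<exists>a :: nat \<Rightarrow> complex. \<forall>z\<in>upper_half_plane.
       (\<lambda>n. a n * exp (2 * of_real pi * \<i> * of_nat n * z / of_nat h)) sums slash (2 - w) (xi_op w G) \<gamma> z)"
      by (intro exI[of _ h] conjI exI[of _ a]) (simp_all add: sl(2)[OF g])
  qed
  ultimately show ?thesis by (simp add: harmonic_maass_space_def)
qed

section \<open>\<open>L\<close>-series of periodic functions\<close>

lemma holomorphic_on_suminf_M_test:
  assumes S: "open S" and h: "\<And>n. f n holomorphic_on S"
    and M: "\<And>x. x \<in> S \<Longrightarrow> \<exists>d M. d > 0 \<and> cball x d \<subseteq> S \<and> summable M \<and> (\<forall>n. \<forall>w\<in>cball x d. norm (f n w) \<le> M n)"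
  shows "(\<lambda>w. \<Sum>n. f n w :: complex) holomorphic_on S"
proof (rule holomorphic_uniform_sequence[OF S, where f = "\<lambda>n w. \<Sum>i<n. f i w"])
  fix x assume "x \<in> S"
  then obtain d M where d: "d > 0" "cball x d \<subseteq> S" and s: "summable M" and b: "\<And>n w. w \<in> cball x d \<Longrightarrow> norm (f n w) \<le> M n"
    using M by meson
  have "uniform_limit (cball x d) (\<lambda>n w. \<Sum>i<n. f i w) (\<lambda>w. \<Sum>n. f n w) sequentially"
    by (rule Weierstrass_m_test[OF b s])
  thus "\<exists>d>0. cball x d \<subseteq> S \<and> uniform_limit (cball x d) (\<lambda>n w. \<Sum>i<n. f i w) (\<lambda>w. \<Sum>n. f n w) sequentially"
    using d by blast
qed (intro holomorphic_intros h)

lemma periodic_nat_bounded: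
  fixes F :: "nat \<Rightarrow> complex"
  assumes "L \<ge> 1" "\<And>n. F (n + L) = F n"
  obtains B where "B > 0" "\<And>n. norm (F n) \<le> B"
proof -
  have e: "F (n mod L + q * L) = F (n mod L)" for n q
  proof (induction q)
    case (Suc q)
    have "n mod L + Suc q * L = (n mod L + q * L) + L" by simp
    thus ?case using assms(2)[of "n mod L + q * L"] Suc by (simp only:)
  qed simp
  have m: "F n = F (n mod L)" for n using e[of n "n div L"] by (simp only: mod_mult_div_eq mod_div_mult_eq)
  show thesis
  proof (rule that[of "1 + (\<Sum>i<L. norm (F i))"])
    show "1 + (\<Sum>i<L. norm (F i)) > 0" by (simp add: add_pos_nonneg sum_nonneg)
    fix n
    have "norm (F (n mod L)) \<le> (\<Sum>i<L. norm (F i))"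
      by (rule member_le_sum) (use assms(1) in auto)
    thus "norm (F n) \<le> 1 + (\<Sum>i<L. norm (F i))" using m[of n] by simp
  qed
qed

lemma sum_periodic_shift:
  fixes f :: "nat \<Rightarrow> complex"
  assumes p: "\<And>n. f (n + L) = f n" and z: "(\<Sum>i<L. f i) = 0"
  shows "(\<Sum>i<n + L. f i) = (\<Sum>i<n. f i)"
proof (induction n)
  case (Suc n)
  thus ?case using p[of n] by simp
qed (simp add: z)

lemma abel_summation:
  fixes a g :: "nat \<Rightarrow> complex"
  shows "(\<Sum>i<K. a i * g i) = (\<Sum>j<K. a j) * g K + (\<Sum>i<K. (\<Sum>j<Suc i. a j) * (g i - g (Suc i)))"
  by (induction K) (simp_all add: algebra_simps)

lemma norm_of_real_powr:
  assumes "t > 0"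
  shows "norm (complex_of_real t powr s) = t powr Re s"
  using assms by (intro trans[OF norm_powr_real_powr]) auto

lemma powr_difference_bound:
  fixes w :: complex
  assumes x: "x \<ge> 1" and w: "Re w < 0"
  shows "norm (complex_of_real x powr w - of_real (x + 1) powr w) \<le> norm w * x powr (Re w - 1)"
proof -
  have der: "((\<lambda>z. z powr w) has_field_derivative (w * z powr (w - 1))) (at z within closed_segment (of_real x) (of_real (x + 1)))"
    and bd: "norm (w * z powr (w - 1)) \<le> norm w * x powr (Re w - 1)"
    if zs: "z \<in> closed_segment (complex_of_real x) (of_real (x + 1))" for z
  proof -
    obtain t where z: "z = of_real t" and t: "t \<ge> x"
    proof -
      obtain u where u: "0 \<le> u" "z = (1 - u) *\<^sub>R complex_of_real x + u *\<^sub>R of_real (x + 1)"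
        using zs by (auto simp: in_segment)
      have "z = of_real (x + u)" unfolding u(2) by (simp add: scaleR_conv_of_real algebra_simps)
      with u(1) show thesis by (intro that[of "x + u"]) auto
    qed
    have "z \<notin> \<real>\<^sub>\<le>\<^sub>0" using z t x by (auto simp: complex_nonpos_Reals_iff)
    thus "((\<lambda>z. z powr w) has_field_derivative (w * z powr (w - 1))) (at z within closed_segment (of_real x) (of_real (x + 1)))"
      by (rule has_field_derivative_at_within[OF has_field_derivative_powr])
    have "t powr (Re w - 1) \<le> x powr (Re w - 1)" by (rule powr_mono2') (use x t w in auto)
    thus "norm (w * z powr (w - 1)) \<le> norm w * x powr (Re w - 1)"
      using x t by (simp add: z norm_mult norm_of_real_powr mult_left_mono)
  qed
  have "norm (complex_of_real x powr w - of_real (x + 1) powr w) \<le> norm w * x powr (Re w - 1) * norm (complex_of_real x - of_real (x + 1))"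
    by (rule field_differentiable_bound[OF convex_closed_segment der bd]) auto
  thus ?thesis by (simp add: norm_minus_commute)
qed

text \<open>The mean value inequality for z^w - (z + 1)^w, whose derivative is w times a first
  difference with exponent w - 1.\<close>

lemma powr_second_difference_bound:
  fixes w :: complex
  assumes x: "x \<ge> 1" and w: "Re w < 1"
  shows "norm (complex_of_real x powr w - of_real (x + 1) powr w - (of_real (x + 1) powr w - of_real (x + 2) powr w)) \<le>
    norm w * norm (w - 1) * x powr (Re w - 2)"
proof -
  define g where "g = (\<lambda>z::complex. z powr w - (z + 1) powr w)"
  have der: "(g has_field_derivative (w * z powr (w - 1) - w * (z + 1) powr (w - 1))) (at z within closed_segment (of_real x) (of_real (x + 1)))"
    and bd: "norm (w * z powr (w - 1) - w * (z + 1) powr (w - 1)) \<le> norm w * (norm (w - 1) * x powr (Re w - 2))"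
    if zs: "z \<in> closed_segment (complex_of_real x) (of_real (x + 1))" for z
  proof -
    obtain t where z: "z = of_real t" and t: "t \<ge> x"
    proof -
      obtain u where u: "0 \<le> u" "z = (1 - u) *\<^sub>R complex_of_real x + u *\<^sub>R of_real (x + 1)"
        using zs by (auto simp: in_segment)
      have "z = of_real (x + u)" unfolding u(2) by (simp add: scaleR_conv_of_real algebra_simps)
      with u(1) show thesis by (intro that[of "x + u"]) auto
    qed
    have nr: "z \<notin> \<real>\<^sub>\<le>\<^sub>0" "z + 1 \<notin> \<real>\<^sub>\<le>\<^sub>0" using z t x by (auto simp: complex_nonpos_Reals_iff)
    have d2: "((\<lambda>z. (z + 1) powr w) has_field_derivative (w * (z + 1) powr (w - 1) * 1)) (at z)"
      by (rule DERIV_chain'[where f = "\<lambda>z. z + 1" and g = "\<lambda>z. z powr w", OF _ has_field_derivative_powr[OF nr(2)]]) (auto intro!: derivative_eq_intros)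
    have d3: "(g has_field_derivative (w * z powr (w - 1) - w * (z + 1) powr (w - 1) * 1)) (at z)"
      unfolding g_def by (rule DERIV_diff[OF has_field_derivative_powr[OF nr(1)] d2])
    show "(g has_field_derivative (w * z powr (w - 1) - w * (z + 1) powr (w - 1))) (at z within closed_segment (of_real x) (of_real (x + 1)))"
      using has_field_derivative_at_within[OF d3] by (simp only: mult_1_right)
    have "norm (complex_of_real t powr (w - 1) - of_real (t + 1) powr (w - 1)) \<le> norm (w - 1) * t powr (Re (w - 1) - 1)"
      by (rule powr_difference_bound) (use x t w in auto)
    also have "t powr (Re (w - 1) - 1) \<le> x powr (Re (w - 1) - 1)" by (rule powr_mono2') (use x t w in auto)
    finally have "norm (complex_of_real t powr (w - 1) - of_real (t + 1) powr (w - 1)) \<le> norm (w - 1) * x powr (Re w - 2)"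
      by (simp add: mult_left_mono)
    thus "norm (w * z powr (w - 1) - w * (z + 1) powr (w - 1)) \<le> norm w * (norm (w - 1) * x powr (Re w - 2))"
      by (simp add: z norm_mult mult_left_mono flip: right_diff_distrib)
  qed
  have "norm (g (complex_of_real x) - g (of_real (x + 1))) \<le> norm w * (norm (w - 1) * x powr (Re w - 2)) * norm (complex_of_real x - of_real (x + 1))"
    by (rule field_differentiable_bound[OF convex_closed_segment der bd]) auto
  moreover have "norm (complex_of_real x - of_real (x + 1)) = 1" by simp
  moreover have "complex_of_real (x + 1) + 1 = of_real (x + 2)" "complex_of_real x + 1 = of_real (x + 1)" by simp_all
  ultimately show ?thesis unfolding g_def by (simp only: mult_1_right mult.assoc)
qed

lemma summable_Suc_powr:
  assumes "s < - 1"
  shows "summable (\<lambda>n. real (Suc n) powr s)"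
  using summable_real_powr_iff[of s] assms summable_Suc_iff[of "\<lambda>n. real n powr s"] by simp

lemma Dirichlet_series_holomorphic:
  assumes a: "\<And>n. norm (a n) \<le> B"
  shows "(\<lambda>w. \<Sum>n. a n * of_nat (Suc n) powr (- w)) holomorphic_on {w. Re w > 1}"
proof (rule holomorphic_on_suminf_M_test)
  show "open {w. Re w > (1::real)}" by (rule open_halfspace_Re_gt)
  show "(\<lambda>w. a n * of_nat (Suc n) powr (- w)) holomorphic_on {w. Re w > 1}" for n
    by (intro holomorphic_intros)
  fix x :: complex assume "x \<in> {w. Re w > 1}"
  hence x: "Re x > 1" by simp
  define d where "d = (Re x - 1) / 2"
  have B: "B \<ge> 0" using a[of 0] norm_ge_zero order_trans by blast
  have re: "Re w \<ge> 1 + d" if "w \<in> cball x d" for w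
  proof -
    have "\<bar>Re (x - w)\<bar> \<le> d" using that abs_Re_le_cmod[of "x - w"] by (simp add: dist_norm)
    hence "Re x - Re w \<le> d" by simp
    moreover have "d + d = Re x - 1" by (simp add: d_def)
    ultimately show ?thesis by linarith
  qed
  have b: "norm (a n * of_nat (Suc n) powr (- w)) \<le> B * real (Suc n) powr (- (1 + d))" if "w \<in> cball x d" for n w
  proof -
    have "norm (of_real (real (Suc n)) powr (- w)) = real (Suc n) powr (- Re w)"
      using norm_of_real_powr[of "real (Suc n)" "- w"] by simp
    also have "\<dots> \<le> real (Suc n) powr (- (1 + d))" by (rule powr_mono) (use re[OF that] in auto)
    finally show ?thesis using mult_mono[OF a[of n] _ B norm_ge_zero] by (simp add: norm_mult)
  qed
  show "\<exists>d M. d > 0 \<and> cball x d \<subseteq> {w. Re w > 1} \<and> summable M \<and> (\<forall>n. \<forall>w\<in>cball x d. norm (a n * of_nat (Suc n) powr (- w)) \<le> M n)"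
  proof (intro exI conjI allI ballI)
    show d: "d > 0" using x by (simp add: d_def)
    show "cball x d \<subseteq> {w. Re w > 1}" using re d by fastforce
    show "summable (\<lambda>n. B * real (Suc n) powr (- (1 + d)))"
      by (intro summable_mult summable_Suc_powr) (use d in simp)
  qed (rule b)
qed

lemma Dirichlet_L_eq_series:
  assumes a: "\<And>n. norm (\<eta> (int (Suc n))) \<le> B" and s: "Re s > 1"
  shows "Dirichlet_L s \<eta> = (\<Sum>n. \<eta> (int (Suc n)) * of_nat (Suc n) powr (- s))"
  unfolding Dirichlet_L_def
  by (rule continuation_holomorphicI[where c = 1, OF Dirichlet_series_holomorphic[where a = "\<lambda>n. \<eta> (int (Suc n))", OF a] _ s]) simp

text \<open>Two summations by parts continue the \<open>L\<close>-series of a periodic function of mean zero to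
  \<open>Re w > -1/2\<close>; in the second one the mean \<open>c\<close> of the partial sums is split off and contributes
  the value at \<open>0\<close>.\<close>

lemma Dirichlet_L_mean_zero:
  fixes \<eta> :: "int \<Rightarrow> complex"
  assumes L: "L \<ge> 1" and per: "\<And>n. \<eta> (n + int L) = \<eta> n" and zero: "(\<Sum>i<L. \<eta> (int (Suc i))) = 0"
  shows "Re w > 0 \<Longrightarrow> (\<lambda>K. \<Sum>i<K. \<eta> (int (Suc i)) * of_nat (Suc i) powr (- w)) \<longlonglongrightarrow> Dirichlet_L w \<eta>"
    and "Dirichlet_L 0 \<eta> = - (\<Sum>i<L. of_nat (Suc i) * \<eta> (int (Suc i))) / of_nat L"
proof -
  define a where "a = (\<lambda>i. \<eta> (int (Suc i)))"
  define A where "A = (\<lambda>n. \<Sum>i<n. a i)"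
  define c where "c = (\<Sum>i<L. A (Suc i)) / of_nat L"
  define T where "T = (\<lambda>i. A (Suc i) - c)"
  define U where "U = (\<lambda>n. \<Sum>i<n. T i)"
  define g where "g = (\<lambda>w n. complex_of_nat (Suc n) powr (- w))"
  define h where "h = (\<lambda>w n. g w n - g w (Suc n))"
  define D2 where "D2 = (\<lambda>w n. h w n - h w (Suc n))"
  define G where "G = (\<lambda>w. c + (\<Sum>n. U (Suc n) * D2 w n))"
  have aper: "a (n + L) = a n" for n using per[of "int (Suc n)"] by (simp add: a_def add_ac)
  have a0: "(\<Sum>i<L. a i) = 0" using zero by (simp add: a_def)
  have Aper: "A (n + L) = A n" for n unfolding A_def by (rule sum_periodic_shift[OF aper a0])
  have Tper: "T (n + L) = T n" for n using Aper[of "Suc n"] by (simp add: T_def)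
  have T0: "(\<Sum>i<L. T i) = 0" using L by (simp add: T_def sum_subtractf c_def)
  have Uper: "U (n + L) = U n" for n unfolding U_def by (rule sum_periodic_shift[OF Tper T0])
  obtain BA where BA: "BA > 0" "\<And>n. norm (A n) \<le> BA" using periodic_nat_bounded[where F = A, OF L Aper] by blast
  obtain BU where BU: "BU > 0" "\<And>n. norm (U n) \<le> BU" using periodic_nat_bounded[where F = U, OF L Uper] by blast
  obtain Ba where Ba: "Ba > 0" "\<And>n. norm (a n) \<le> Ba" using periodic_nat_bounded[where F = a, OF L aper] by blast
  \<comment> \<open>Both summations by parts in one exact identity, valid for all w and K. For Re w
    > 0 the terms at the upper end K tend to 0, which leaves c plus the series of second
    differences.\<close>
  have fin: "(\<Sum>i<K. a i * g w i) = A K * g w K + c * (1 - g w K) + U K * h w K + (\<Sum>i<K. U (Suc i) * D2 w i)" for K w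
  proof -
    have "(\<Sum>i<K. a i * g w i) = A K * g w K + (\<Sum>i<K. A (Suc i) * h w i)"
      unfolding A_def h_def by (rule abel_summation)
    also have "(\<Sum>i<K. A (Suc i) * h w i) = c * (\<Sum>i<K. h w i) + (\<Sum>i<K. T i * h w i)"
      unfolding sum_distrib_left sum.distrib[symmetric] T_def by (intro sum.cong refl) (simp add: algebra_simps)
    also have "(\<Sum>i<K. h w i) = 1 - g w K"
      unfolding h_def sum_lessThan_telescope' by (simp add: g_def)
    also have "(\<Sum>i<K. T i * h w i) = U K * h w K + (\<Sum>i<K. U (Suc i) * D2 w i)"
      unfolding U_def D2_def by (rule abel_summation)
    finally show ?thesis by simp
  qed
  have D2b: "norm (D2 w n) \<le> norm w * (norm w + 1) * real (Suc n) powr (- 3 / 2)" if w: "Re w > - 1 / 2" for w n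
  proof -
    have "norm (D2 w n) \<le> norm (- w) * norm (- w - 1) * real (Suc n) powr (Re (- w) - 2)"
      using powr_second_difference_bound[of "real (Suc n)" "- w"] w by (simp add: D2_def h_def g_def add_ac)
    also have "\<dots> \<le> norm w * (norm w + 1) * real (Suc n) powr (- 3 / 2)"
    proof (intro mult_mono powr_mono)
      show "norm (- w - 1) \<le> norm w + 1" using norm_triangle_ineq4[of "- w" 1] by simp
      show "Re (- w) - 2 \<le> - 3 / 2" using w by (simp add: field_simps)
    qed auto
    finally show ?thesis .
  qed
  have sm: "summable (\<lambda>n. C * real (Suc n) powr (- 3 / 2))" for C :: real
    by (intro summable_mult summable_Suc_powr) simp
  have Gh: "G holomorphic_on {w. Re w > - 1 / 2}"
    unfolding G_def
  proof (rule holomorphic_on_add[OF holomorphic_on_const holomorphic_on_suminf_M_test])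
    show "open {w. Re w > (- 1 / 2 :: real)}" by (rule open_halfspace_Re_gt)
    show "(\<lambda>w. U (Suc n) * D2 w n) holomorphic_on {w. Re w > - 1 / 2}" for n
      unfolding D2_def h_def g_def by (intro holomorphic_intros)
    fix x :: complex assume "x \<in> {w. Re w > - 1 / 2}"
    then obtain d where d: "d > 0" "cball x d \<subseteq> {w. Re w > - 1 / 2}"
      using open_contains_cball[of "{w. Re w > (- 1 / 2 :: real)}"] open_halfspace_Re_gt by blast
    define R where "R = norm x + d"
    have "norm (U (Suc n) * D2 w n) \<le> BU * (R * (R + 1)) * real (Suc n) powr (- 3 / 2)" if w: "w \<in> cball x d" for n w
    proof -
      have "norm w \<le> R" using w norm_triangle_ineq2[of w x] by (simp add: R_def dist_norm norm_minus_commute)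
      moreover have R: "R \<ge> 0" using d by (simp add: R_def)
      ultimately have "norm w * (norm w + 1) * real (Suc n) powr (- 3 / 2) \<le> R * (R + 1) * real (Suc n) powr (- 3 / 2)"
        by (intro mult_mono) auto
      moreover have "norm (D2 w n) \<le> norm w * (norm w + 1) * real (Suc n) powr (- 3 / 2)"
        by (rule D2b) (use w d in blast)
      ultimately have "norm (D2 w n) \<le> R * (R + 1) * real (Suc n) powr (- 3 / 2)" by (rule order_trans[rotated])
      from mult_mono[OF BU(2) this less_imp_le[OF BU(1)] norm_ge_zero] show ?thesis by (simp only: norm_mult mult.assoc)
    qed
    thus "\<exists>d M. d > 0 \<and> cball x d \<subseteq> {w. Re w > - 1 / 2} \<and> summable M \<and> (\<forall>n. \<forall>w\<in>cball x d. norm (U (Suc n) * D2 w n) \<le> M n)"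
      using d sm by blast
  qed
  have Glim: "(\<lambda>K. \<Sum>i<K. a i * g w i) \<longlonglongrightarrow> G w" if w: "Re w > 0" for w
  proof -
    have "summable (\<lambda>n. U (Suc n) * D2 w n)"
    proof (rule summable_comparison_test'[OF sm])
      fix n
      have "norm (D2 w n) \<le> norm w * (norm w + 1) * real (Suc n) powr (- 3 / 2)" by (rule D2b) (use w in simp)
      from mult_mono[OF BU(2) this less_imp_le[OF BU(1)] norm_ge_zero]
      show "norm (U (Suc n) * D2 w n) \<le> BU * (norm w * (norm w + 1)) * real (Suc n) powr (- 3 / 2)"
        by (simp only: norm_mult mult.assoc)
    qed
    hence l: "(\<lambda>K. \<Sum>i<K. U (Suc i) * D2 w i) \<longlonglongrightarrow> (\<Sum>n. U (Suc n) * D2 w n)" by (rule summable_LIMSEQ)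
    have "(\<lambda>n. real (Suc n) powr (- Re w)) \<longlonglongrightarrow> 0"
      by (rule tendsto_neg_powr[OF _ filterlim_compose[OF filterlim_real_sequentially filterlim_Suc]]) (use w in simp)
    moreover have "norm (g w n) = real (Suc n) powr (- Re w)" for n
      using norm_of_real_powr[of "real (Suc n)" "- w"] by (simp add: g_def)
    ultimately have g0: "(g w) \<longlonglongrightarrow> 0" by (simp add: tendsto_norm_zero_iff[symmetric, of "g w"])
    have h0: "(h w) \<longlonglongrightarrow> 0" unfolding h_def using tendsto_diff[OF g0 LIMSEQ_Suc[OF g0]] by simp
    have bz: "(\<lambda>K. X K * Y K) \<longlonglongrightarrow> 0" if "\<And>n. norm (X n) \<le> B" "Y \<longlonglongrightarrow> 0" for X Y :: "nat \<Rightarrow> complex" and B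
    proof (rule Lim_null_comparison)
      show "eventually (\<lambda>n. norm (X n * Y n) \<le> B * norm (Y n)) sequentially"
        using that(1) by (simp add: norm_mult mult_right_mono)
      show "(\<lambda>n. B * norm (Y n)) \<longlonglongrightarrow> 0"
        using tendsto_mult_right_zero[OF tendsto_norm_zero[OF that(2)]] .
    qed
    have "(\<lambda>K. A K * g w K + c * (1 - g w K) + U K * h w K + (\<Sum>i<K. U (Suc i) * D2 w i)) \<longlonglongrightarrow>
        0 + c * (1 - 0) + 0 + (\<Sum>n. U (Suc n) * D2 w n)"
      by (intro tendsto_add tendsto_mult_left tendsto_diff tendsto_const l g0 bz[OF BA(2) g0] bz[OF BU(2) h0])
    thus ?thesis unfolding fin by (simp add: G_def)
  qed
  have LG: "Dirichlet_L s \<eta> = G s" if s: "Re s > - 1 / 2" for s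
    unfolding Dirichlet_L_def
  proof (rule continuation_holomorphicI[OF Gh _ s])
    fix w :: complex assume w: "Re w > 1" "Re w > - 1 / 2"
    have "(\<lambda>n. a n * g w n) sums G w" unfolding sums_def by (rule Glim) (use w in simp)
    thus "G w = (\<Sum>n. \<eta> (int (Suc n)) * of_nat (Suc n) powr (- w))"
      by (simp add: sums_iff a_def g_def)
  qed
  show "(\<lambda>K. \<Sum>i<K. \<eta> (int (Suc i)) * of_nat (Suc i) powr (- w)) \<longlonglongrightarrow> Dirichlet_L w \<eta>" if "Re w > 0"
    using Glim[OF that] LG[of w] that by (simp add: a_def g_def)
  have "(\<Sum>i<L. A (Suc i)) + (\<Sum>i<L. of_nat (Suc i) * a i) = (of_nat L + 1) * A L"
  proof -
    have "(\<Sum>i<K. A (Suc i)) + (\<Sum>i<K. of_nat (Suc i) * a i) = (of_nat K + 1) * A K" for K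
      by (induction K) (simp_all add: A_def algebra_simps)
    thus ?thesis .
  qed
  hence "(\<Sum>i<L. A (Suc i)) = - (\<Sum>i<L. of_nat (Suc i) * a i)"
    using a0 by (simp add: A_def add_eq_0_iff2 minus_equation_iff)
  \<comment> \<open>At w = 0 all powers are 1 and their differences vanish, so G(0) = c, the average
    of the partial sums, which the identity above expresses by the first moment.\<close>
  moreover have "D2 0 n = 0" for n by (simp add: D2_def h_def g_def del: of_nat_Suc)
  ultimately show "Dirichlet_L 0 \<eta> = - (\<Sum>i<L. of_nat (Suc i) * \<eta> (int (Suc i))) / of_nat L"
    using LG[of 0] by (simp add: G_def c_def a_def)
qed

section \<open>Dirichlet characters and Gauss sums\<close>

lemma periodic_cong:
  assumes "\<And>n. f (n + int N) = (f n :: complex)" "[a = b] (mod int N)"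
  shows "f a = f b"
proof -
  have "int N dvd a - b" using assms(2) by (simp add: cong_iff_dvd_diff)
  from periodic_multiple[of f N "a - b" b, OF assms(1) this] show ?thesis by simp
qed

lemma sum_residues_mult:
  fixes f :: "int \<Rightarrow> complex"
  assumes N: "N \<ge> 1" and per: "\<And>n. f (n + int N) = f n" and u: "coprime u (int N)"
  shows "(\<Sum>a\<in>{0..<int N}. f (u * a)) = (\<Sum>a\<in>{0..<int N}. f a)"
proof -
  obtain v where v: "[u * v = 1] (mod int N)" using cong_solve_coprime_int[OF u] by blast
  have inv: "u * (v * a mod int N) mod int N = a" "v * (u * a mod int N) mod int N = a" if "a \<in> {0..<int N}" for a
  proof -
    have "[u * v * a = 1 * a] (mod int N)" by (rule cong_mult[OF v cong_refl])
    thus "u * (v * a mod int N) mod int N = a" "v * (u * a mod int N) mod int N = a"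
      using that by (simp_all add: cong_def mod_mult_right_eq mult_ac)
  qed
  have "(\<Sum>a\<in>{0..<int N}. f (u * a)) = (\<Sum>a\<in>{0..<int N}. f (u * a mod int N))"
    by (intro sum.cong refl periodic_cong[where f = f and N = N, OF per]) (simp add: cong_def)
  also have "\<dots> = (\<Sum>a\<in>{0..<int N}. f a)"
    by (rule sum.reindex_bij_witness[where i = "\<lambda>a. v * a mod int N" and j = "\<lambda>a. u * a mod int N"])
       (use N inv in auto)
  finally show ?thesis .
qed

lemma dcharacterD:
  assumes "dcharacter N \<eta>"
  shows "N \<ge> 1" "\<eta> (a * b) = \<eta> a * \<eta> b" "\<eta> (a + int N) = \<eta> a" "\<eta> a = 0 \<longleftrightarrow> \<not> coprime a (int N)"
  using assms unfolding dcharacter_def by auto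

lemma dcharacter_1:
  assumes "dcharacter N \<eta>"
  shows "\<eta> 1 = 1"
proof -
  have "\<eta> 1 * \<eta> 1 = \<eta> 1" using dcharacterD(2)[OF assms, of 1 1] by simp
  moreover have "\<eta> 1 \<noteq> 0" using dcharacterD(4)[OF assms, of 1] by simp
  ultimately show ?thesis by simp
qed

lemma dcharacter_cong:
  assumes "dcharacter N \<eta>" "[a = b] (mod int N)"
  shows "\<eta> a = \<eta> b"
  by (rule periodic_cong[where f = \<eta> and N = N, OF dcharacterD(3)[OF assms(1)] assms(2)])

lemma dcharacter_power:
  assumes "dcharacter N \<eta>"
  shows "\<eta> (a ^ n) = \<eta> a ^ n"
  by (induction n) (simp_all add: dcharacter_1[OF assms] dcharacterD(2)[OF assms])

text \<open>By Euler's theorem the value is a root of unity.\<close>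

lemma norm_dcharacter:
  assumes chi: "dcharacter N \<eta>" and a: "coprime a (int N)"
  shows "norm (\<eta> a) = 1"
proof -
  have N: "N \<ge> 1" by (rule dcharacterD(1)[OF chi])
  define b where "b = nat (a mod int N)"
  have b: "int b = a mod int N" using N by (simp add: b_def)
  have "coprime (int b) (int N)" unfolding b by (rule cong_imp_coprime[OF _ a]) (simp add: cong_def)
  hence "[b ^ totient N = 1] (mod N)" by (intro euler_theorem) simp
  hence "[int b ^ totient N = 1] (mod int N)"
    using cong_int_iff[of "b ^ totient N" 1 N] by simp
  hence "\<eta> (int b) ^ totient N = 1"
    using dcharacter_cong[OF chi] dcharacter_power[OF chi] dcharacter_1[OF chi] by metis
  moreover have "\<eta> (int b) = \<eta> a" by (rule dcharacter_cong[OF chi]) (simp add: b cong_def)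
  ultimately have "norm (\<eta> a) ^ totient N = 1" using norm_power[of "\<eta> a" "totient N"] by simp
  moreover have "totient N > 0" using N by simp
  ultimately show ?thesis using power_eq_imp_eq_base[of "norm (\<eta> a)" "totient N" 1] by simp
qed

lemma norm_dcharacter_le: "dcharacter N \<eta> \<Longrightarrow> norm (\<eta> a) \<le> 1"
  using norm_dcharacter[of N \<eta> a] dcharacterD(4)[of N \<eta> a] by (cases "coprime a (int N)") auto

lemma dcharacter_cnj_mult:
  assumes "dcharacter N \<eta>" "coprime a (int N)"
  shows "\<eta> a * cnj (\<eta> a) = 1"
  using norm_dcharacter[OF assms] complex_norm_square[of "\<eta> a"] by simp

lemma dcharacter_inverse:
  assumes chi: "dcharacter N \<eta>" and ad: "[a * d = 1] (mod int N)"
  shows "\<eta> a = cnj (\<eta> d)"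
proof -
  have d: "coprime d (int N)" using ad by (metis cong_imp_coprime cong_sym coprime_1_left coprime_mult_left_iff)
  have "\<eta> a * \<eta> d = 1"
    using dcharacter_cong[OF chi ad] dcharacterD(2)[OF chi] dcharacter_1[OF chi] by simp
  hence "\<eta> a * (\<eta> d * cnj (\<eta> d)) = cnj (\<eta> d)" by (simp flip: mult.assoc)
  thus ?thesis by (simp add: dcharacter_cnj_mult[OF chi d])
qed

lemma dcharacter_cnj: "dcharacter N \<eta> \<Longrightarrow> dcharacter N (\<lambda>a. cnj (\<eta> a))"
  by (simp add: dcharacter_def)

lemma dcharacter_uminus:
  assumes "dcharacter N \<eta>"
  shows "\<eta> (- a) = \<eta> (- 1) * \<eta> a"
  using dcharacterD(2)[OF assms, of "- 1" a] by simp

lemma dcharacter_trivial: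
  assumes "N \<ge> 1"
  shows "dcharacter N (trivial_char N)"
proof -
  have "coprime (a + int N) (int N) \<longleftrightarrow> coprime a (int N)" for a
    by (simp add: coprime_iff_gcd_eq_1)
  thus ?thesis using assms by (simp add: dcharacter_def trivial_char_def)
qed

text \<open>Multiplication by some c with \<eta>(c) different from 0 and 1 permutes the residues and
  multiplies the sum by \<eta>(c).\<close>

lemma sum_nontrivial_dcharacter:
  assumes chi: "dcharacter N \<eta>" and nt: "\<eta> \<noteq> trivial_char N"
  shows "(\<Sum>a\<in>{0..<int N}. \<eta> a) = 0"
proof -
  obtain c where c: "\<eta> c \<noteq> trivial_char N c" using nt by (auto simp: fun_eq_iff)
  hence co: "coprime c (int N)" and c1: "\<eta> c \<noteq> 1"
    using dcharacterD(4)[OF chi, of c] by (auto simp: trivial_char_def split: if_splits)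
  have "(\<Sum>a\<in>{0..<int N}. \<eta> (c * a)) = (\<Sum>a\<in>{0..<int N}. \<eta> a)"
    by (rule sum_residues_mult[where f = \<eta>, OF dcharacterD(1,3)[OF chi] co])
  hence "(1 - \<eta> c) * (\<Sum>a\<in>{0..<int N}. \<eta> a) = 0"
    unfolding dcharacterD(2)[OF chi] sum_distrib_left[symmetric] by (simp add: left_diff_distrib)
  thus ?thesis using c1 by simp
qed

lemma totient_prod_complex:
  "of_nat (totient N) = of_nat N * (\<Prod>p\<in>prime_factors N. 1 - 1 / of_nat p :: complex)"
  using arg_cong[OF totient_formula2[of N], of complex_of_real] by simp

lemma sum_interval_shift:
  fixes f :: "int \<Rightarrow> complex"
  assumes per: "f (int N) = f 0"
  shows "(\<Sum>i<N. f (int (Suc i))) = (\<Sum>a\<in>{0..<int N}. f a)"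
proof -
  have "(\<Sum>i<n. f (int (Suc i))) = (\<Sum>i<n. f (int i)) + f (int n) - f 0" for n
    by (induction n) auto
  moreover have "(\<Sum>i<N. f (int i)) = (\<Sum>a\<in>{0..<int N}. f a)"
    by (rule sum.reindex_bij_witness[where i = nat and j = int]) auto
  ultimately show ?thesis using per by simp
qed

lemma sum_trivial_char:
  assumes "N \<ge> 1"
  shows "(\<Sum>a\<in>{0..<int N}. trivial_char N a) = of_nat N * (\<Prod>p\<in>prime_factors N. 1 - 1 / of_nat p)"
proof -
  have "(\<Sum>a\<in>{0..<int N}. trivial_char N a) = (\<Sum>i<N. trivial_char N (int (Suc i)))"
    by (rule sum_interval_shift[symmetric]) (simp add: trivial_char_def)
  also have "\<dots> = (\<Sum>k\<in>{0<..N}. if coprime k N then 1 else 0)"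
    by (rule sum.reindex_bij_witness[where j = Suc and i = "\<lambda>k. k - 1"]) (auto simp: trivial_char_def simp del: of_nat_Suc)
  also have "\<dots> = of_nat (totient N)"
    by (simp add: totient_def totatives_def sum.If_cases Int_def)
  finally show ?thesis using totient_prod_complex[of N] by simp
qed

lemma moebius_prime_mult:
  assumes p: "prime p" and d: "\<not> p dvd d" "d > 0"
  shows "moebius_fun (p * d) = - moebius_fun d"
proof -
  have co: "coprime p d" using p d by (simp add: prime_imp_coprime)
  have "squarefree (p * d) \<longleftrightarrow> squarefree d"
    using squarefree_mult_coprime[OF co squarefree_prime[OF p]] squarefree_multD(2) by blast
  moreover have "prime_factors (p * d) = insert p (prime_factors d)"
    using p d prime_factors_product[of p d] prime_prime_factors[OF p] by auto
  moreover have "p \<notin> prime_factors d" using d by auto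
  ultimately show ?thesis by (simp add: moebius_fun_def)
qed

text \<open>For a prime p dividing n, the divisors divisible by p^2 contribute 0 and the others pair
  up as d and pd with opposite values.\<close>

lemma sum_moebius_divisors:
  assumes n: "n > 0"
  shows "(\<Sum>d | d dvd n. moebius_fun d) = (if n = 1 then 1 else 0)"
proof (cases "n = 1")
  case True
  thus ?thesis by (simp add: moebius_fun_def)
next
  case False
  then obtain p where p: "prime p" "p dvd n" using prime_factor_nat by blast
  have fin: "finite {d. d dvd n}" using n by simp
  have z: "moebius_fun d = 0" if "p * p dvd d" for d
  proof -
    have "\<not> squarefree d" using that p(1) by (metis not_prime_unit power2_eq_square squarefree_def)
    thus ?thesis by (simp add: moebius_fun_def)
  qed
  define D where "D = {d. d dvd n \<and> \<not> p dvd d}"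
  define D' where "D' = {d. d dvd n \<and> p dvd d \<and> \<not> p * p dvd d}"
  have fD: "finite D" "finite D'" using fin by (auto simp: D_def D'_def intro: finite_subset[of _ "{d. d dvd n}"])
  have "(\<Sum>d | d dvd n. moebius_fun d) = (\<Sum>d\<in>D \<union> D'. moebius_fun d)"
    by (rule sum.mono_neutral_right[OF fin]) (auto simp: D_def D'_def intro: z)
  also have "\<dots> = (\<Sum>d\<in>D. moebius_fun d) + (\<Sum>d\<in>D'. moebius_fun d)"
    by (rule sum.union_disjoint[OF fD]) (auto simp: D_def D'_def)
  also have "(\<Sum>d\<in>D'. moebius_fun d) = (\<Sum>d\<in>D. moebius_fun (p * d))"
  proof (rule sum.reindex_bij_witness[where i = "\<lambda>d. p * d" and j = "\<lambda>d. d div p"])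
    have p0: "p > 0" using p(1) prime_gt_0_nat by blast
    fix d assume "d \<in> D"
    hence d: "d dvd n" "\<not> p dvd d" by (auto simp: D_def)
    show "p * d div p = d" using p0 by simp
    have "coprime p d" using p d by (simp add: prime_imp_coprime)
    hence "p * d dvd n" using p d by (simp add: divides_mult)
    thus "p * d \<in> D'" using d p0 by (simp add: D'_def)
  next
    fix d assume "d \<in> D'"
    then obtain e where e: "d = p * e" "d dvd n" "\<not> p * p dvd d" by (auto simp: D'_def)
    have p0: "p > 0" using p(1) prime_gt_0_nat by blast
    show "p * (d div p) = d" using e p0 by simp
    show "d div p \<in> D" using e p0 by (auto simp: D_def intro: dvd_trans[of e "p * e" n])
    show "moebius_fun (p * (d div p)) = moebius_fun d" using e p0 by simp
  qed
  also have "\<dots> = (\<Sum>d\<in>D. - moebius_fun d)"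
    by (rule sum.cong[OF refl moebius_prime_mult[OF p(1)]]) (use n in \<open>auto simp: D_def intro: Nat.gr0I\<close>)
  finally show ?thesis using False by (simp add: sum_negf)
qed

section \<open>Additive characters, primitive characters and the separability of Gauss sums\<close>

definition ee :: "nat \<Rightarrow> int \<Rightarrow> complex" where
  "ee N a = exp (2 * of_real pi * \<i> * of_int a / of_nat N)"

lemma ee_add: "ee N (a + b) = ee N a * ee N b"
  unfolding ee_def exp_add[symmetric] by (rule arg_cong[of _ _ exp]) (simp add: distrib_left add_divide_distrib)

lemma ee_eq_1_iff:
  assumes "N \<ge> 1"
  shows "ee N a = 1 \<longleftrightarrow> int N dvd a"
proof -
  have "2 * of_real pi * \<i> * of_int a / of_nat N = \<i> * complex_of_real (2 * pi * of_int a / of_nat N)" by simp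
  hence "ee N a = 1 \<longleftrightarrow> (\<exists>n::int. 2 * pi * of_int a / real N = of_int (2 * n) * pi)"
    unfolding ee_def exp_eq_1 by simp
  also have "\<dots> \<longleftrightarrow> (\<exists>n::int. a = int N * n)"
  proof (rule ex_cong1)
    fix n :: int
    have "2 * pi * of_int a / real N = of_int (2 * n) * pi \<longleftrightarrow> real_of_int a = real_of_int (int N * n)"
      using assms by (simp add: field_simps)
    thus "2 * pi * of_int a / real N = of_int (2 * n) * pi \<longleftrightarrow> a = int N * n"
      by (simp only: of_int_eq_iff)
  qed
  finally show ?thesis by (auto simp: dvd_def)
qed

lemma ee_periodic: "N \<ge> 1 \<Longrightarrow> ee N (a + int N) = ee N a"
  using ee_eq_1_iff[of N "int N"] by (simp add: ee_add)

lemma ee_cong: "N \<ge> 1 \<Longrightarrow> [a = b] (mod int N) \<Longrightarrow> ee N a = ee N b"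
  by (rule periodic_cong[where f = "ee N" and N = N, OF ee_periodic])

lemma ee_cancel: "d \<ge> 1 \<Longrightarrow> ee (d * N) (int d * a) = ee N a"
  unfolding ee_def by (rule arg_cong[of _ _ exp]) (cases "N = 0"; simp add: field_simps)

lemma sum_residues_shift:
  fixes f :: "int \<Rightarrow> complex"
  assumes N: "N \<ge> 1" and per: "\<And>n. f (n + int N) = f n"
  shows "(\<Sum>a\<in>{0..<int N}. f (a + s)) = (\<Sum>a\<in>{0..<int N}. f a)"
proof -
  have "(\<Sum>a\<in>{0..<int N}. f (a + s)) = (\<Sum>a\<in>{0..<int N}. f ((a + s) mod int N))"
    by (intro sum.cong refl periodic_cong[where f = f and N = N, OF per]) (simp add: cong_def)
  also have "\<dots> = (\<Sum>a\<in>{0..<int N}. f a)"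
    by (rule sum.reindex_bij_witness[where i = "\<lambda>a. (a - s) mod int N" and j = "\<lambda>a. (a + s) mod int N"])
       (use N in \<open>auto simp: mod_diff_left_eq mod_add_left_eq\<close>)
  finally show ?thesis .
qed

text \<open>The witness is a + mJ, where J is the product of the primes that divide M but not a. A
  prime of M that divides a divides neither m nor J; one that does not divide a divides J. Neither
  kind divides a + mJ.\<close>

lemma exists_coprime_lift:
  fixes a :: int
  assumes am: "coprime a (int m)" and M: "M \<ge> 1"
  shows "\<exists>b. [b = a] (mod int m) \<and> coprime b (int M)"
proof -
  define P where "P = {p \<in> prime_factors (int M). \<not> p dvd a}"
  define J where "J = \<Prod>P"
  have fP: "finite P" by (simp add: P_def)
  have "coprime (a + int m * J) (int M)"
  proof (rule ccontr)
    assume "\<not> coprime (a + int m * J) (int M)"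
    hence "\<not> is_unit (gcd (a + int m * J) (int M))" by (simp add: coprime_iff_gcd_eq_1)
    moreover have "gcd (a + int m * J) (int M) \<noteq> 0" using M by simp
    ultimately obtain p where p: "prime p" "p dvd gcd (a + int m * J) (int M)" using prime_divisorE by blast
    hence pa: "p dvd a + int m * J" and pM: "p dvd int M" by simp_all
    have "p \<in> prime_factors (int M)" using p(1) pM M by (auto simp: in_prime_factors_iff)
    show False
    proof (cases "p dvd a")
      case True
      hence "p dvd int m * J" using pa by (simp add: dvd_add_right_iff)
      moreover have "\<not> p dvd int m" using True am p(1) by (metis coprime_common_divisor not_prime_unit)
      ultimately have "p dvd J" using p(1) by (simp add: prime_dvd_mult_iff)
      then obtain q where q: "q \<in> P" "p dvd q" unfolding J_def using prime_dvd_prod_iff[OF fP p(1), of "\<lambda>x. x"] by auto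
      hence "prime q" "\<not> q dvd a" by (auto simp: P_def)
      thus False using q(2) p(1) True primes_dvd_imp_eq by blast
    next
      case False
      hence "p \<in> P" using \<open>p \<in> prime_factors (int M)\<close> by (simp add: P_def)
      hence "p dvd J" unfolding J_def by (rule dvd_prodI[OF fP])
      thus False using pa False by (simp add: dvd_add_left_iff)
    qed
  qed
  moreover have "[a + int m * J = a] (mod int m)" by (simp add: cong_iff_dvd_diff)
  ultimately show ?thesis by blast
qed

text \<open>Every residue coprime to m has a representative coprime to M, at which both characters
  equal \<eta>. Uniqueness justifies the definite description in
  \<open>primitive_char\<close>.\<close>

lemma induces_unique:
  assumes "induces m \<eta>1 M \<eta>" "induces m \<eta>2 M \<eta>"
  shows "\<eta>1 = \<eta>2"
proof
  fix a
  have d: "dcharacter m \<eta>1" "dcharacter m \<eta>2" "dcharacter M \<eta>" using assms by (auto simp: induces_def)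
  show "\<eta>1 a = \<eta>2 a"
  proof (cases "coprime a (int m)")
    case True
    then obtain b where b: "[b = a] (mod int m)" "coprime b (int M)"
      using exists_coprime_lift[OF _ dcharacterD(1)[OF d(3)]] by blast
    thus ?thesis
      using assms dcharacter_cong[OF d(1) b(1)] dcharacter_cong[OF d(2) b(1)] by (auto simp: induces_def)
  next
    case False
    hence "\<eta>1 a = 0" "\<eta>2 a = 0" using dcharacterD(4)[OF d(1), of a] dcharacterD(4)[OF d(2), of a] by simp_all
    thus ?thesis by simp
  qed
qed

lemma primitive_char_induces:
  assumes "dcharacter M \<eta>"
  shows "induces (conductor M \<eta>) (primitive_char M \<eta>) M \<eta>"
proof -
  have "\<exists>\<eta>'. induces M \<eta>' M \<eta>" using assms by (auto simp: induces_def)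
  hence "\<exists>\<eta>'. induces (conductor M \<eta>) \<eta>' M \<eta>"
    unfolding conductor_def by (rule LeastI)
  hence "\<exists>!\<eta>'. induces (conductor M \<eta>) \<eta>' M \<eta>" using induces_unique by blast
  thus ?thesis unfolding primitive_char_def by (rule theI')
qed

lemma conductor_le: "induces m \<eta>' M \<eta> \<Longrightarrow> conductor M \<eta> \<le> m"
  unfolding conductor_def by (rule Least_le) blast

text \<open>Otherwise the primitive character would depend, on units, only on the class modulo m'.
  Evaluating it at coprime lifts would define a character modulo m' that induces \<eta>, against the
  minimality of the conductor.\<close>

lemma primitive_char_nontrivial_on_kernel:
  assumes chi: "dcharacter M \<eta>" and m': "m' dvd conductor M \<eta>" "m' < conductor M \<eta>"
  shows "\<exists>u. coprime u (int (conductor M \<eta>)) \<and> [u = 1] (mod int m') \<and> primitive_char M \<eta> u \<noteq> 1"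
proof (rule ccontr)
  define m where "m = conductor M \<eta>"
  define r where "r = primitive_char M \<eta>"
  assume "\<not> ?thesis"
  hence triv: "r u = 1" if "coprime u (int m)" "[u = 1] (mod int m')" for u
    using that by (auto simp: m_def r_def)
  have ind: "induces m r M \<eta>" unfolding m_def r_def by (rule primitive_char_induces[OF chi])
  hence mM: "m dvd M" and dr: "dcharacter m r" and er: "\<And>a. coprime a (int M) \<Longrightarrow> \<eta> a = r a"
    by (auto simp: induces_def)
  have m1: "m \<ge> 1" by (rule dcharacterD(1)[OF dr])
  have m'1: "m' \<ge> 1" using m'(1) m1 by (auto simp: m_def intro: Nat.gr0I)
  have m'm: "m' dvd m" using m'(1) by (simp add: m_def)
  \<comment> \<open>Multiplying a by an inverse c of b modulo m gives a unit congruent to 1 modulo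
    m', at which r is 1 by assumption.\<close>
  have well: "r a = r b" if ab: "coprime a (int m)" "coprime b (int m)" "[a = b] (mod int m')" for a b
  proof -
    obtain c where c: "[b * c = 1] (mod int m)" using cong_solve_coprime_int[OF ab(2)] by blast
    have c': "[b * c = 1] (mod int m')" by (rule cong_dvd_modulus[OF c]) (use m'm in simp)
    have "coprime (b * c) (int m)" by (rule cong_imp_coprime[OF cong_sym[OF c]]) simp
    hence "coprime (a * c) (int m)" using ab(1) by simp
    moreover have "[a * c = 1] (mod int m')" using cong_trans[OF cong_mult[OF ab(3) cong_refl] c'] .
    ultimately have "r (a * c) = 1" by (rule triv)
    moreover have "r (b * c) = 1" using dcharacter_cong[OF dr c] dcharacter_1[OF dr] by simp
    ultimately have "r a * r c = r b * r c" "r c \<noteq> 0" using dcharacterD(2)[OF dr] by auto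
    thus ?thesis by simp
  qed
  define lift where "lift = (\<lambda>a. SOME b. [b = a] (mod int m') \<and> coprime b (int m))"
  have lift: "[lift a = a] (mod int m')" "coprime (lift a) (int m)" if "coprime a (int m')" for a
    using someI_ex[OF exists_coprime_lift[OF that m1]] unfolding lift_def by auto
  define s where "s = (\<lambda>a. if coprime a (int m') then r (lift a) else 0)"
  have s_eq: "s a = r b" if "[b = a] (mod int m')" "coprime b (int m)" for a b
  proof -
    have "coprime b (int m')" using that(2) m'm by (meson coprime_divisors dvd_refl of_nat_dvd_iff)
    hence a: "coprime a (int m')" by (rule cong_imp_coprime[OF that(1)])
    have "r (lift a) = r b" by (rule well[OF lift(2)[OF a] that(2) cong_trans[OF lift(1)[OF a] cong_sym[OF that(1)]]])
    thus ?thesis using a by (simp add: s_def)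
  qed
  have "dcharacter m' s"
    unfolding dcharacter_def
  proof (intro conjI allI)
    show "m' > 0" using m'1 by simp
    fix a b :: int
    show "s (a * b) = s a * s b"
    proof (cases "coprime a (int m') \<and> coprime b (int m')")
      case True
      hence a: "coprime a (int m')" and b: "coprime b (int m')" by auto
      have "s (a * b) = r (lift a * lift b)"
        by (rule s_eq[OF cong_mult[OF lift(1)[OF a] lift(1)[OF b]]]) (use lift(2)[OF a] lift(2)[OF b] in simp)
      thus ?thesis using a b dcharacterD(2)[OF dr] by (simp add: s_def)
    qed (auto simp: s_def)
    show "s (a + int m') = s a"
    proof (cases "coprime a (int m')")
      case True
      have "[lift a = a + int m'] (mod int m')" using lift(1)[OF True] by (simp add: cong_def)
      from s_eq[OF this lift(2)[OF True]] show ?thesis using True by (simp add: s_def)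
    next
      case False
      thus ?thesis by (simp add: s_def coprime_iff_gcd_eq_1)
    qed
    show "s a = 0 \<longleftrightarrow> \<not> coprime a (int m')"
      using lift(2)[of a] dcharacterD(4)[OF dr, of "lift a"] by (simp add: s_def)
  qed
  moreover have "\<eta> a = s a" if "coprime a (int M)" for a
  proof -
    have "coprime a (int m)" using that mM by (meson coprime_divisors dvd_refl of_nat_dvd_iff)
    thus ?thesis using s_eq[OF cong_refl, of a] er[OF that] by simp
  qed
  ultimately have "induces m' s M \<eta>" using chi dvd_trans[OF m'm mM] by (simp add: induces_def)
  from conductor_le[OF this] show False using m'(2) by simp
qed

lemma gauss_sum_eq:
  assumes "dcharacter m \<eta>"
  shows "gauss_sum m \<eta> = (\<Sum>a\<in>{0..<int m}. \<eta> a * ee m a)"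
proof -
  have "gauss_sum m \<eta> = (\<Sum>i<m. \<eta> (int (Suc i)) * ee m (int (Suc i)))"
    unfolding gauss_sum_def ee_def
    by (rule sum.reindex_bij_witness[where i = Suc and j = "\<lambda>n. n - 1"]) (auto simp del: of_nat_Suc)
  also have "\<dots> = (\<Sum>a\<in>{0..<int m}. \<eta> a * ee m a)"
    by (rule sum_interval_shift)
       (use dcharacterD(1)[OF assms] dcharacterD(3)[OF assms, of 0] ee_periodic[of m 0] in simp)
  finally show ?thesis .
qed

text \<open>For c coprime to m, substitute ca for a. Otherwise c shares a divisor g > 1 with m, and
  a unit u congruent to 1 modulo m/g with r(u) \<noteq> 1 fixes the exponentials but multiplies the
  sum by the conjugate of r(u); so the sum vanishes, as does r(c).\<close>

lemma primitive_gauss_sum: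
  fixes c :: int
  assumes chi: "dcharacter M \<eta>"
  defines "m \<equiv> conductor M \<eta>" and "r \<equiv> primitive_char M \<eta>"
  shows "(\<Sum>a\<in>{0..<int m}. cnj (r a) * ee m (a * c)) = r c * gauss_sum m (\<lambda>a. cnj (r a))"
proof -
  have dr: "dcharacter m r" using primitive_char_induces[OF chi] by (simp add: induces_def m_def r_def)
  have m1: "m \<ge> 1" by (rule dcharacterD(1)[OF dr])
  show ?thesis
  proof (cases "coprime c (int m)")
    case True
    define f where "f = (\<lambda>a. cnj (r a) * ee m a)"
    have per: "f (n + int m) = f n" for n using dcharacterD(3)[OF dr] ee_periodic[OF m1] by (simp add: f_def)
    have "(\<Sum>a\<in>{0..<int m}. f (c * a)) = (\<Sum>a\<in>{0..<int m}. f a)"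
      by (rule sum_residues_mult[where f = f, OF m1 per True])
    moreover have "f (c * a) = cnj (r c) * (cnj (r a) * ee m (a * c))" for a
      using dcharacterD(2)[OF dr] by (simp add: f_def mult.commute)
    ultimately have "cnj (r c) * (\<Sum>a\<in>{0..<int m}. cnj (r a) * ee m (a * c)) = gauss_sum m (\<lambda>a. cnj (r a))"
      unfolding gauss_sum_eq[OF dcharacter_cnj[OF dr]] by (simp add: f_def flip: sum_distrib_left)
    hence "r c * cnj (r c) * (\<Sum>a\<in>{0..<int m}. cnj (r a) * ee m (a * c)) = r c * gauss_sum m (\<lambda>a. cnj (r a))"
      by simp
    thus ?thesis by (simp only: dcharacter_cnj_mult[OF dr True] mult_1_left)
  next
    case False
    define g where "g = nat (gcd c (int m))"
    have g: "int g = gcd c (int m)" by (simp add: g_def)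
    have "g \<noteq> 1" using False g by (auto simp: coprime_iff_gcd_eq_1)
    moreover have "g \<noteq> 0"
    proof -
      have "gcd c (int m) \<noteq> 0" using m1 by simp
      thus ?thesis unfolding g[symmetric] by simp
    qed
    ultimately have g2: "g > 1" by simp
    have "int g dvd int m" unfolding g by simp
    then obtain m' where m': "m = g * m'" unfolding int_dvd_int_iff by (rule dvdE)
    have m'1: "m' \<ge> 1" using m1 m' by (cases m') auto
    obtain c' where c': "c = int g * c'" using g by (metis gcd_dvd1 dvdE)
    have "m' dvd m" "m' < m" using m' g2 m'1 by auto
    then obtain u where u: "coprime u (int m)" "[u = 1] (mod int m')" "r u \<noteq> 1"
      using primitive_char_nontrivial_on_kernel[OF chi] unfolding m_def r_def by blast
    have uc: "[u * c = c] (mod int m)"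
    proof -
      obtain j where j: "u - 1 = int m' * j" using u(2) by (auto simp: cong_iff_dvd_diff dvd_def)
      have "u * c - c = int m * (j * c')"
      proof -
        have "u * c - c = (u - 1) * c" by (simp add: left_diff_distrib)
        also have "\<dots> = int m * (j * c')" unfolding j m' c' by simp
        finally show ?thesis .
      qed
      thus ?thesis by (simp add: cong_iff_dvd_diff)
    qed
    define f where "f = (\<lambda>a. cnj (r a) * ee m (a * c))"
    have per: "f (n + int m) = f n" for n
    proof -
      have "ee m ((n + int m) * c) = ee m (n * c)" by (rule ee_cong[OF m1]) (simp add: cong_iff_dvd_diff algebra_simps)
      thus ?thesis using dcharacterD(3)[OF dr] by (simp add: f_def)
    qed
    have "(\<Sum>a\<in>{0..<int m}. f (u * a)) = (\<Sum>a\<in>{0..<int m}. f a)"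
      by (rule sum_residues_mult[where f = f, OF m1 per u(1)])
    moreover have "f (u * a) = cnj (r u) * f a" for a
    proof -
      have "[a * (u * c) = a * c] (mod int m)" by (rule cong_mult[OF cong_refl uc])
      hence "ee m (u * a * c) = ee m (a * c)" by (intro ee_cong[OF m1]) (simp add: mult_ac)
      thus ?thesis using dcharacterD(2)[OF dr] by (simp add: f_def)
    qed
    ultimately have "(1 - cnj (r u)) * (\<Sum>a\<in>{0..<int m}. f a) = 0"
      by (simp add: left_diff_distrib flip: sum_distrib_left)
    moreover have "1 - cnj (r u) \<noteq> 0" using u(3) by (metis complex_cnj_cnj complex_cnj_one eq_iff_diff_eq_0)
    ultimately have "(\<Sum>a\<in>{0..<int m}. f a) = 0" by simp
    thus ?thesis using dcharacterD(4)[OF dr, of c] False by (simp add: f_def)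
  qed
qed

text \<open>If e divides c, the summand has period m. If not, a shift by m multiplies the sum by exp
  (2 pi i c / e) \<noteq> 1, so it is 0.\<close>

lemma sum_periodic_ee:
  fixes c :: nat and f :: "int \<Rightarrow> complex"
  assumes m1: "m \<ge> 1" and e: "e \<ge> 1" and f: "\<And>b. f (b + int m) = f b"
  shows "(\<Sum>b\<in>{0..<int (e * m)}. f b * ee (e * m) (b * int c)) =
    (if e dvd c then of_nat e * (\<Sum>b\<in>{0..<int m}. f b * ee m (b * int (c div e))) else 0)"
proof (cases "e dvd c")
  case True
  then obtain c' where c': "c = e * c'" by auto
  have eq: "ee (e * m) (b * int c) = ee m (b * int c')" for b
    using ee_cancel[OF e, of m "b * int c'"] by (simp add: c' mult_ac)
  have per: "f (b + int m) * ee m ((b + int m) * int c') = f b * ee m (b * int c')" for b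
  proof -
    have "ee m ((b + int m) * int c') = ee m (b * int c')" by (rule ee_cong[OF m1]) (simp add: cong_iff_dvd_diff algebra_simps)
    thus ?thesis using f by simp
  qed
  have "(\<Sum>b\<in>{0..<int (e * m)}. f b * ee m (b * int c')) = of_nat e * (\<Sum>b\<in>{0..<int m}. f b * ee m (b * int c'))"
    by (rule sum_periods[of "\<lambda>b. f b * ee m (b * int c')" m e, OF per])
  thus ?thesis unfolding eq using e by (simp add: c')
next
  case False
  define F where "F = (\<lambda>b. f b * ee (e * m) (b * int c))"
  have em: "e * m \<ge> 1" using e m1 by simp
  have per: "F (b + int (e * m)) = F b" for b
  proof -
    have "ee (e * m) ((b + int (e * m)) * int c) = ee (e * m) (b * int c)"
      by (rule ee_cong[OF em]) (simp add: cong_iff_dvd_diff algebra_simps)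
    moreover have "f (b + int (e * m)) = f b"
      by (rule periodic_cong[where f = f and N = m, OF f]) (simp add: cong_iff_dvd_diff)
    ultimately show ?thesis by (simp add: F_def)
  qed
  have "F (b + int m) = ee e (int c) * F b" for b
  proof -
    have "ee (e * m) ((b + int m) * int c) = ee (e * m) (b * int c) * ee (m * e) (int m * int c)"
      unfolding distrib_right ee_add by (simp only: mult.commute[of m e])
    thus ?thesis using ee_cancel[OF m1, of e "int c"] f by (simp add: F_def)
  qed
  hence "ee e (int c) * (\<Sum>b\<in>{0..<int (e * m)}. F b) = (\<Sum>b\<in>{0..<int (e * m)}. F b)"
    using sum_residues_shift[where f = F and s = "int m", OF em per] by (simp flip: sum_distrib_left)
  moreover have "ee e (int c) \<noteq> 1" using ee_eq_1_iff[OF e, of "int c"] False by simp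
  ultimately show ?thesis using False by (simp add: F_def)
qed

text \<open>\<eta> is the primitive character times the indicator of being coprime to l = M/m, the
  primes of m being killed by r already. Moebius inversion resolves the indicator,
  \<open>sum_periodic_ee\<close> evaluates the sum over multiples of each d, and replacing d by l/d
  brings out the inner sum of \<open>sigma_char\<close>.\<close>

lemma gauss_sum_imprimitive:
  fixes c :: nat
  assumes chi: "dcharacter M \<eta>"
  defines "m \<equiv> conductor M \<eta>" and "r \<equiv> primitive_char M \<eta>"
  defines "l \<equiv> M div m"
  shows "(\<Sum>a\<in>{0..<int M}. cnj (\<eta> a) * ee M (a * int c)) =
    gauss_sum m (\<lambda>a. cnj (r a)) *
      (\<Sum>d | d dvd gcd l c. of_nat d * moebius_fun (l div d) * cnj (r (int (l div d))) * r (int (c div d)))"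
proof -
  have dr: "dcharacter m r" and mM: "m dvd M" and er: "\<And>a. coprime a (int M) \<Longrightarrow> \<eta> a = r a"
    using primitive_char_induces[OF chi] by (simp_all add: induces_def m_def r_def)
  have m1: "m \<ge> 1" by (rule dcharacterD(1)[OF dr])
  have M: "M = m * l" using mM by (simp add: l_def)
  have l1: "l \<ge> 1" using dcharacterD(1)[OF chi] M by (cases l) auto
  have fl: "finite {d. d dvd l}" using l1 by simp
  have conv: "cnj (\<eta> a) = (\<Sum>d | d dvd l. if int d dvd a then moebius_fun d * cnj (r a) else 0)" for a
  proof -
    define n where "n = gcd l (nat \<bar>a\<bar>)"
    have n0: "n > 0" using l1 by (simp add: n_def)
    have s: "{d. d dvd n} = {d \<in> {d. d dvd l}. int d dvd a}"
    proof -
      have k: "d dvd nat \<bar>a\<bar> \<longleftrightarrow> int d dvd a" for d using int_dvd_int_iff[of d "nat \<bar>a\<bar>"] by simp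
      show ?thesis unfolding n_def gcd_greatest_iff k by blast
    qed
    have "coprime a (int l) \<longleftrightarrow> coprime (nat \<bar>a\<bar>) l" using coprime_int_iff[of "nat \<bar>a\<bar>" l] by simp
    hence n1: "n = 1 \<longleftrightarrow> coprime a (int l)"
      unfolding n_def gcd.commute[of l] coprime_iff_gcd_eq_1[symmetric] by simp
    have "(\<Sum>d | d dvd l. if int d dvd a then moebius_fun d * cnj (r a) else 0) = (\<Sum>d | d dvd n. moebius_fun d) * cnj (r a)"
      unfolding s sum_distrib_right by (rule sum.inter_filter[OF fl, symmetric])
    also have "\<dots> = (if coprime a (int l) then cnj (r a) else 0)"
      unfolding sum_moebius_divisors[OF n0] n1[symmetric] by simp
    also have "\<dots> = cnj (\<eta> a)"
    proof -
      have cM: "coprime a (int M) \<longleftrightarrow> coprime a (int m) \<and> coprime a (int l)" by (simp add: M)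
      show ?thesis
      proof (cases "coprime a (int M)")
        case True
        thus ?thesis using cM er by simp
      next
        case False
        hence "\<eta> a = 0" using dcharacterD(4)[OF chi] by simp
        moreover have "\<not> coprime a (int l) \<or> r a = 0" using False cM dcharacterD(4)[OF dr] by auto
        ultimately show ?thesis by auto
      qed
    qed
    finally show ?thesis by simp
  qed
  define W where "W = gauss_sum m (\<lambda>a. cnj (r a))"
  have inner: "(\<Sum>a\<in>{0..<int M}. if int d dvd a then moebius_fun d * cnj (r a) * ee M (a * int c) else 0) =
      (if l div d dvd c then moebius_fun d * cnj (r (int d)) * (of_nat (l div d) * r (int (c div (l div d))) * W) else 0)"
    if d: "d dvd l" for d
  proof -
    define e where "e = l div d"
    have l: "l = d * e" using d by (simp add: e_def)
    have d1: "d \<ge> 1" and e1: "e \<ge> 1" using l1 l by (cases d; cases e; simp)+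
    have Me: "M = d * (e * m)" by (simp add: M l)
    define f where "f = (\<lambda>b. moebius_fun d * cnj (r (int d)) * (cnj (r b) * ee (e * m) (b * int c)))"
    have t: "(if int d dvd a then moebius_fun d * cnj (r a) * ee M (a * int c) else 0) = (if int d dvd a then f (a div int d) else 0)" for a
    proof (cases "int d dvd a")
      case True
      then obtain b where b: "a = int d * b" by auto
      have "ee M (a * int c) = ee (e * m) (b * int c)"
        unfolding Me b using ee_cancel[OF d1, of "e * m" "b * int c"] by (simp add: mult.assoc)
      moreover have "r a = r (int d) * r b" unfolding b by (rule dcharacterD(2)[OF dr])
      ultimately show ?thesis using b d1 by (simp add: f_def)
    qed simp
    have "(\<Sum>a\<in>{0..<int M}. if int d dvd a then f (a div int d) else 0) = (\<Sum>b\<in>{0..<int (e * m)}. f b)"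
      unfolding Me by (rule sum_multiples[OF d1])
    also have "\<dots> = moebius_fun d * cnj (r (int d)) * (\<Sum>b\<in>{0..<int (e * m)}. cnj (r b) * ee (e * m) (b * int c))"
      unfolding f_def sum_distrib_left ..
    also have "(\<Sum>b\<in>{0..<int (e * m)}. cnj (r b) * ee (e * m) (b * int c)) =
        (if e dvd c then of_nat e * r (int (c div e)) * W else 0)"
    proof -
      have "cnj (r (b + int m)) = cnj (r b)" for b using dcharacterD(3)[OF dr] by simp
      from sum_periodic_ee[where f = "\<lambda>b. cnj (r b)", OF m1 e1 this]
      show ?thesis unfolding W_def m_def r_def primitive_gauss_sum[OF chi] by (simp only: mult.assoc)
    qed
    finally show ?thesis unfolding t e_def[symmetric] by simp
  qed
  have "(\<Sum>a\<in>{0..<int M}. cnj (\<eta> a) * ee M (a * int c)) =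
      (\<Sum>a\<in>{0..<int M}. \<Sum>d | d dvd l. if int d dvd a then moebius_fun d * cnj (r a) * ee M (a * int c) else 0)"
    unfolding conv sum_distrib_right by (intro sum.cong refl) simp
  also have "\<dots> = (\<Sum>d | d dvd l. \<Sum>a\<in>{0..<int M}. if int d dvd a then moebius_fun d * cnj (r a) * ee M (a * int c) else 0)"
    by (rule sum.swap)
  also have "\<dots> = (\<Sum>d | d dvd l. if l div d dvd c then moebius_fun d * cnj (r (int d)) * (of_nat (l div d) * r (int (c div (l div d))) * W) else 0)"
    by (rule sum.cong[OF refl]) (simp add: inner)
  also have "\<dots> = (\<Sum>d | d dvd l. if d dvd c then moebius_fun (l div d) * cnj (r (int (l div d))) * (of_nat d * r (int (c div d)) * W) else 0)"
  proof (rule sum.reindex_bij_witness[where i = "\<lambda>d. l div d" and j = "\<lambda>d. l div d"])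
    fix d assume "d \<in> {d. d dvd l}"
    then obtain e where l: "l = d * e" by auto
    hence "d \<ge> 1" "e \<ge> 1" using l1 by (cases d; cases e; simp)+
    thus inv: "l div (l div d) = d" and "l div d \<in> {d. d dvd l}" by (auto simp: l)
    thus "l div (l div d) = d" and "l div d \<in> {d. d dvd l}" by blast+
    show "(if l div d dvd c then moebius_fun (l div (l div d)) * cnj (r (int (l div (l div d)))) * (of_nat (l div d) * r (int (c div (l div d))) * W) else 0) =
      (if l div d dvd c then moebius_fun d * cnj (r (int d)) * (of_nat (l div d) * r (int (c div (l div d))) * W) else 0)"
      unfolding inv by simp
  qed
  also have "\<dots> = (\<Sum>d\<in>{d \<in> {d. d dvd l}. d dvd c}. moebius_fun (l div d) * cnj (r (int (l div d))) * (of_nat d * r (int (c div d)) * W))"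
    by (rule sum.inter_filter[OF fl, symmetric])
  also have "{d \<in> {d. d dvd l}. d dvd c} = {d. d dvd gcd l c}" by auto
  also have "(\<Sum>d | d dvd gcd l c. moebius_fun (l div d) * cnj (r (int (l div d))) * (of_nat d * r (int (c div d)) * W)) =
      W * (\<Sum>d | d dvd gcd l c. of_nat d * moebius_fun (l div d) * cnj (r (int (l div d))) * r (int (c div d)))"
    unfolding sum_distrib_left by (intro sum.cong refl) (simp only: mult_ac)
  finally show ?thesis unfolding W_def .
qed

section \<open>Eisenstein series attached to characters\<close>

lemma phi_minus:
  assumes a: "\<And>m. \<alpha> (- m) = \<alpha> (- 1) * \<alpha> m" and b: "\<And>n. \<beta> (- n) = \<beta> (- 1) * \<beta> n"
  shows "phi T \<alpha> \<beta> (- m, - n) = (\<alpha> (- 1) * \<beta> (- 1)) * phi T \<alpha> \<beta> (m, n)"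
proof (cases "int T dvd m")
  case True
  hence "(- m) div int T = - (m div int T)" by (rule dvd_neg_div[symmetric, THEN sym])
  thus ?thesis using True a[of "m div int T"] b[of n] by (simp add: phi_def)
qed (simp add: phi_def)

text \<open>The inverse of \<gamma> sends (m, n) to (md - nc, na - mb). As TL divides c, the first
  entry is md modulo TL; as M divides T, the second is na modulo M whenever T divides m. Finally a
  is inverse to d modulo M, which turns \<beta>(a) into a conjugate.\<close>

lemma pull_phi:
  assumes psi: "dcharacter L \<alpha>" and rho: "dcharacter M \<beta>" and T: "M dvd T" "T \<ge> 1" and N: "T * L dvd N" "M dvd N"
    and g: "(a, b, c, d) \<in> Gamma0 N"
  shows "pull (phi T \<alpha> \<beta>) (a, b, c, d) mn = \<alpha> d * cnj (\<beta> d) * phi T \<alpha> \<beta> mn"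
proof -
  obtain m n where mn: "mn = (m, n)" by (cases mn)
  have det: "a * d - b * c = 1" and Nc: "int N dvd c" using g by (auto simp: Gamma0_def SL2Z_def)
  have "int (T * L) dvd c" using N(1) Nc by (meson dvd_trans int_dvd_int_iff)
  then obtain c' where c': "c = int T * (int L * c')" by (auto simp: dvd_def mult.assoc)
  have ad: "[a * d = 1] (mod int q)" if "int q dvd c" for q
  proof -
    have "a * d - 1 = b * c" using det by simp
    thus ?thesis using that by (simp add: cong_iff_dvd_diff)
  qed
  have cT: "int T dvd c" by (simp add: c')
  have Mc: "int M dvd c" using T(1) cT by (meson dvd_trans int_dvd_int_iff)
  have "coprime (a * d) (int T)" by (rule cong_imp_coprime[OF cong_sym[OF ad[OF cT]]]) simp
  hence dT: "coprime (int T) d" by (simp add: coprime_commute)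
  have iff: "int T dvd m * d + n * (- c) \<longleftrightarrow> int T dvd m"
  proof -
    have "int T dvd n * (- c)" using cT by simp
    hence "int T dvd m * d + n * (- c) \<longleftrightarrow> int T dvd m * d" by (rule dvd_add_left_iff)
    also have "\<dots> \<longleftrightarrow> int T dvd m" using dT by (simp add: coprime_dvd_mult_left_iff)
    finally show ?thesis .
  qed
  show ?thesis
  proof (cases "int T dvd m")
    case True
    then obtain m' where m': "m = int T * m'" by auto
    have T0: "int T \<noteq> 0" using T(2) by simp
    have e: "m * d + n * (- c) = int T * (m' * d + int L * (- (n * c')))" by (simp add: m' c' algebra_simps)
    have "\<alpha> ((m * d + n * (- c)) div int T) = \<alpha> (m' * d + int L * (- (n * c')))" unfolding e using T0 by simp
    also have "\<dots> = \<alpha> (m' * d)" by (rule dcharacter_cong[OF psi]) (simp add: cong_iff_dvd_diff)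
    also have "\<dots> = \<alpha> m' * \<alpha> d" by (rule dcharacterD(2)[OF psi])
    finally have A: "\<alpha> ((m * d + n * (- c)) div int T) = \<alpha> m' * \<alpha> d" .
    have "int M dvd m" using T(1) True by (meson dvd_trans int_dvd_int_iff)
    hence "\<beta> (m * (- b) + n * a) = \<beta> (n * a)" by (intro dcharacter_cong[OF rho]) (simp add: cong_iff_dvd_diff)
    also have "\<dots> = \<beta> n * cnj (\<beta> d)" using dcharacterD(2)[OF rho] dcharacter_inverse[OF rho ad[OF Mc]] by simp
    finally have B: "\<beta> (m * (- b) + n * a) = \<beta> n * cnj (\<beta> d)" .
    have "pull (phi T \<alpha> \<beta>) (a, b, c, d) mn = (\<alpha> m' * \<alpha> d) * (\<beta> n * cnj (\<beta> d))"
      unfolding pull_def rmul_def phi_def prod.case mn fst_conv snd_conv iff A B using True by simp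
    moreover have "phi T \<alpha> \<beta> mn = \<alpha> m' * \<beta> n" unfolding phi_def mn using T0 by (simp add: m')
    ultimately show ?thesis by (simp only: mult_ac)
  next
    case False
    thus ?thesis unfolding pull_def rmul_def phi_def prod.case mn fst_conv snd_conv iff by simp
  qed
qed

lemma fhat_phi:
  assumes N: "N = e * M" and e: "e \<ge> 1" and M: "M \<ge> 1" and b: "\<And>n. \<beta> (n + int M) = \<beta> n"
  shows "fhat N (phi T \<alpha> \<beta>) m c = (if int T dvd m then \<alpha> (m div int T) else 0) *
    (if e dvd c then of_nat e * (\<Sum>j\<in>{0..<int M}. \<beta> j * ee M (j * int (c div e))) else 0)"
proof -
  have "fhat N (phi T \<alpha> \<beta>) m c = (if int T dvd m then \<alpha> (m div int T) else 0) * (\<Sum>j\<in>{0..<int (e * M)}. \<beta> j * ee (e * M) (j * int c))"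
    unfolding fhat_def phi_def ee_def sum_distrib_left N
    by (intro sum.cong refl) (simp add: mult.assoc mult.commute[of "complex_of_nat c"])
  thus ?thesis unfolding sum_periodic_ee[where f = \<beta>, OF M e b] .
qed

text \<open>The transform of \<open>phi\<close> is supported on rows divisible by T and frequencies
  divisible by e; this renumbers the surviving terms.\<close>

lemma has_sum_dilate:
  fixes f :: "nat \<times> nat \<Rightarrow> complex"
  assumes f: "(f has_sum S) UNIV" and TE: "T \<ge> 1" "E \<ge> 1"
    and z: "\<And>m c. \<not> (T dvd Suc m \<and> E dvd Suc c) \<Longrightarrow> f (m, c) = 0"
  shows "((\<lambda>(m, c). f (T * Suc m - 1, E * Suc c - 1)) has_sum S) UNIV"
proof -
  define h where "h = (\<lambda>(m, c). (T * Suc m - 1, E * Suc c - 1))"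
  have pos: "Suc (K * Suc n - 1) = K * Suc n" if "K \<ge> 1" for K n using that by simp
  have inj: "inj h"
  proof (rule injI)
    fix x y assume "h x = h y"
    hence "Suc (T * Suc (fst x) - 1) = Suc (T * Suc (fst y) - 1)" "Suc (E * Suc (snd x) - 1) = Suc (E * Suc (snd y) - 1)"
      by (simp_all only: h_def case_prod_beta prod.inject)
    hence "Suc (fst x) = Suc (fst y)" "Suc (snd x) = Suc (snd y)"
      unfolding pos[OF TE(1)] pos[OF TE(2)] using TE by simp_all
    thus "x = y" by (simp add: prod_eq_iff)
  qed
  have "(f has_sum S) (range h) \<longleftrightarrow> (f has_sum S) UNIV"
  proof (rule has_sum_cong_neutral)
    fix x assume "x \<in> UNIV - range h"
    hence nr: "x \<notin> range h" by simp
    obtain m c where x: "x = (m, c)" by (cases x)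
    have "\<not> (T dvd Suc m \<and> E dvd Suc c)"
    proof
      assume "T dvd Suc m \<and> E dvd Suc c"
      then obtain p q where pq: "Suc m = T * p" "Suc c = E * q" by (auto simp: dvd_def)
      then obtain p' q' where "p = Suc p'" "q = Suc q'" by (cases p; cases q; simp)
      with pq have "x = h (p', q')" unfolding x h_def prod.case by (metis diff_Suc_1)
      thus False using nr by blast
    qed
    thus "f x = 0" unfolding x by (rule z)
  qed auto
  hence "(f has_sum S) (range h)" using f by simp
  hence "((f \<circ> h) has_sum S) UNIV" using has_sum_reindex[OF inj, of f S] by simp
  moreover have "f \<circ> h = (\<lambda>(m, c). f (T * Suc m - 1, E * Suc c - 1))"
    by (rule ext) (simp only: h_def o_def case_prod_beta)
  ultimately show ?thesis by (simp only:)
qed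

text \<open>The dilation s and the period N = eM are kept independent, so that the levels M and tM
  can be expanded with a common N, as the trivial case of weight 2 requires. The powers of e from
  the transform and from the frequencies cancel against N^k.\<close>

lemma fterm_phi_eq_eis_q_part:
  assumes psi: "dcharacter L \<psi>" and rho: "dcharacter M \<rho>" and z: "Im z > 0"
    and s: "s \<ge> 1" and e: "e \<ge> 1" "s * L dvd e" and k: "k \<ge> 1"
  shows "infsum (fterm k (e * M) (phi (s * M) \<psi> (\<lambda>n. cnj (\<rho> n))) z) UNIV = eis_q_part k M \<psi> \<rho> (of_nat s * z)"
proof -
  define T where "T = s * M"
  define N where "N = e * M"
  define \<theta> where "\<theta> = phi T \<psi> (\<lambda>n. cnj (\<rho> n))"
  define W where "W = gauss_sum (conductor M \<rho>) (\<lambda>n. cnj (primitive_char M \<rho> n))"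
  define S where "S = (\<lambda>c. \<Sum>d | d dvd gcd (M div conductor M \<rho>) c. of_nat d * moebius_fun (M div conductor M \<rho> div d)
          * cnj (primitive_char M \<rho> (int (M div conductor M \<rho> div d))) * primitive_char M \<rho> (int (c div d)))"
  define A where "A = (- 2 * of_real pi * \<i> / of_nat M) ^ k * (W / fact (k - 1))"
  define q where "q = exp (2 * of_real pi * \<i> * (of_nat s * z))"
  define F where "F = (\<lambda>m c::nat. A * (\<psi> (int m) * of_nat c ^ (k - 1) * S c * q ^ (m * c)))"
  have M1: "M \<ge> 1" by (rule dcharacterD(1)[OF rho])
  have T1: "T \<ge> 1" and N1: "N \<ge> 1" using M1 s e by (simp_all add: T_def N_def)
  have per: "periodic N \<theta>" unfolding \<theta>_def
  proof (rule periodic_phi[where \<alpha> = \<psi> and \<beta> = "\<lambda>n. cnj (\<rho> n)" and L = L and M = M, OF dcharacterD(3)[OF psi] dcharacterD(3)[OF dcharacter_cnj[OF rho]]])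
    have "s * M * L = s * L * M" by simp
    also have "\<dots> dvd e * M" using e(2) by (intro mult_dvd_mono) auto
    finally show "T * L dvd N" by (simp only: T_def N_def)
  qed (use T1 in \<open>auto simp: N_def\<close>)
  have fh: "fhat N \<theta> m c = (if int T dvd m then \<psi> (m div int T) else 0) * (if e dvd c then of_nat e * (W * S (c div e)) else 0)" for m c
    unfolding \<theta>_def fhat_phi[where \<beta> = "\<lambda>n. cnj (\<rho> n)", OF N_def e(1) M1 dcharacterD(3)[OF dcharacter_cnj[OF rho]]]
      gauss_sum_imprimitive[OF rho] W_def S_def ..
  have tz: "fterm k N \<theta> z (m, c) = 0" if "\<not> (T dvd Suc m \<and> e dvd Suc c)" for m c
  proof -
    have "fhat N \<theta> (int (Suc m)) (Suc c) = 0" unfolding fh int_dvd_int_iff using that by auto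
    thus ?thesis by (simp add: fterm_def fcoef_def)
  qed
  have "(fterm k N \<theta> z has_sum infsum (fterm k N \<theta> z) UNIV) UNIV"
    by (rule has_sum_infsum) (rule Infinite_Sum.abs_summable_summable[OF fterm_abs_summable[OF N1 per z]])
  from has_sum_dilate[OF this T1 e(1) tz]
  have "((\<lambda>(m, c). fterm k N \<theta> z (T * Suc m - 1, e * Suc c - 1)) has_sum infsum (fterm k N \<theta> z) UNIV) UNIV" .
  moreover have "fterm k N \<theta> z (T * Suc m - 1, e * Suc c - 1) = F (Suc m) (Suc c)" for m c
  proof -
    have pos: "Suc (T * Suc m - 1) = T * Suc m" "Suc (e * Suc c - 1) = e * Suc c" using T1 e(1) by simp_all
    have T0: "int T \<noteq> 0" "e \<noteq> 0" using T1 e(1) by simp_all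
    have q: "exp (2 * of_real pi * \<i> * of_nat (T * Suc m * (e * Suc c)) * z / of_nat N) = q ^ (Suc m * Suc c)"
    proof -
      have "2 * of_real pi * \<i> * of_nat (T * a * (e * b)) * z / of_nat N = of_nat (a * b) * (2 * of_real pi * \<i> * (of_nat s * z))" for a b
        using M1 e(1) by (simp add: T_def N_def field_simps)
      thus ?thesis unfolding q_def exp_of_nat_mult[symmetric] by (simp only:)
    qed
    have fhv: "fhat N \<theta> (int (T * Suc m)) (e * Suc c) = \<psi> (int (Suc m)) * (of_nat e * (W * S (Suc c)))"
    proof -
      have "int (T * Suc m) div int T = int (Suc m)" unfolding of_nat_mult by (rule nonzero_mult_div_cancel_left[OF T0(1)])
      moreover have "e * Suc c div e = Suc c" by (rule nonzero_mult_div_cancel_left[OF T0(2)])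
      moreover have "int T dvd int (T * Suc m)" "e dvd e * Suc c" by simp_all
      ultimately show ?thesis unfolding fh by (simp only: if_True)
    qed
    have pw: "(- 2 * of_real pi * \<i> / of_nat N) ^ k / fact (k - 1) * of_nat (e * Suc c) ^ (k - 1) * (P * (of_nat e * (W * Q))) =
        A * (P * of_nat (Suc c) ^ (k - 1) * Q)" for P Q :: complex
    proof -
      obtain k' where k': "k = Suc k'" using k by (cases k) auto
      have g: "(x / (E * m)) ^ Suc k' / f * (E * y) ^ k' * (P * (E * (W * Q))) = (x / m) ^ Suc k' * (W / f) * (P * y ^ k' * Q)"
        if "E \<noteq> 0" for x m E f y :: complex
      proof -
        have "(x / m) = E * (x / (E * m))" using that by simp
        hence "(x / m) ^ Suc k' = E ^ Suc k' * (x / (E * m)) ^ Suc k'" by (simp only: power_mult_distrib)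
        hence "(x / m) ^ Suc k' * (W / f) * (P * y ^ k' * Q) = E ^ Suc k' * (x / (E * m)) ^ Suc k' * (W / f) * (P * y ^ k' * Q)" by (simp only:)
        also have "\<dots> = (x / (E * m)) ^ Suc k' / f * (E * y) ^ k' * (P * (E * (W * Q)))"
          by (simp only: power_mult_distrib power_Suc[of E] divide_inverse[of W] divide_inverse[of "(x / (E * m)) ^ Suc k'"] mult_ac)
        finally show ?thesis by simp
      qed
      show ?thesis unfolding A_def N_def of_nat_mult k' diff_Suc_1 by (rule g) (use e(1) in simp)
    qed
    show ?thesis unfolding fterm_def prod.case fcoef_def pos q fhv pw F_def by (simp only: mult_ac)
  qed
  ultimately have "((\<lambda>(m, c). F (Suc m) (Suc c)) has_sum infsum (fterm k N \<theta> z) UNIV) UNIV" by simp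
  from has_sum_divisor_grouping[OF this]
  have "((\<lambda>n. \<Sum>c | c dvd Suc n. F (Suc n div c) c) has_sum infsum (fterm k N \<theta> z) UNIV) UNIV" .
  moreover have "(\<Sum>c | c dvd Suc n. F (Suc n div c) c) = A * (sigma_char k M \<psi> \<rho> (Suc n) * q ^ Suc n)" for n
  proof -
    have "F (Suc n div c) c = A * (\<psi> (int (Suc n div c)) * of_nat c ^ (k - 1) * S c * q ^ Suc n)" if "c dvd Suc n" for c
      using that unfolding F_def by (simp only: dvd_div_mult_self)
    hence "(\<Sum>c | c dvd Suc n. F (Suc n div c) c) = (\<Sum>c | c dvd Suc n. A * (\<psi> (int (Suc n div c)) * of_nat c ^ (k - 1) * S c * q ^ Suc n))"
      by (intro sum.cong refl) simp
    also have "\<dots> = A * (sigma_char k M \<psi> \<rho> (Suc n) * q ^ Suc n)"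
      unfolding sigma_char_def Let_def S_def by (simp only: sum_distrib_left sum_distrib_right mult.assoc)
    finally show ?thesis .
  qed
  ultimately have hs: "((\<lambda>n. A * (sigma_char k M \<psi> \<rho> (Suc n) * q ^ Suc n)) has_sum infsum (fterm k N \<theta> z) UNIV) UNIV" by simp
  have "infsum (fterm k N \<theta> z) UNIV = A * (\<Sum>n. sigma_char k M \<psi> \<rho> (Suc n) * q ^ Suc n)"
  proof (cases "A = 0")
    case True
    thus ?thesis using infsumI[OF hs] by simp
  next
    case False
    have sm: "(\<lambda>n. A * (sigma_char k M \<psi> \<rho> (Suc n) * q ^ Suc n)) sums infsum (fterm k N \<theta> z) UNIV"
      by (rule has_sum_imp_sums[OF hs])
    have smb: "summable (\<lambda>n. sigma_char k M \<psi> \<rho> (Suc n) * q ^ Suc n)"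
      by (rule summable_mult_D[OF sums_summable[OF sm] False])
    show ?thesis by (rule trans[OF sums_unique[OF sm] suminf_mult[OF smb]])
  qed
  thus ?thesis unfolding eis_q_part_def A_def W_def q_def \<theta>_def T_def N_def .
qed

text \<open>For k \<ge> 2 the series converges absolutely. For k = 1 nontriviality provides the mean
  zero that \<open>Dirichlet_L_mean_zero\<close> asks for.\<close>

lemma Dirichlet_L_partial_sums:
  assumes chi: "dcharacter M \<eta>" and k: "k \<ge> 1" and nt: "k = 1 \<Longrightarrow> \<eta> \<noteq> trivial_char M"
  shows "(\<lambda>K. \<Sum>i<K. \<eta> (int (Suc i)) * inverse (of_nat (Suc i)) ^ k) \<longlonglongrightarrow> Dirichlet_L (of_nat k) \<eta>"
proof -
  have pw: "of_nat (Suc i) powr (- of_nat k) = inverse (of_nat (Suc i) :: complex) ^ k" for i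
    by (simp add: powr_minus powr_nat' power_inverse del: of_nat_Suc)
  show ?thesis
  proof (cases "k = 1")
    case True
    have M1: "M \<ge> 1" by (rule dcharacterD(1)[OF chi])
    have "(\<Sum>i<M. \<eta> (int (Suc i))) = (\<Sum>a\<in>{0..<int M}. \<eta> a)"
      by (rule sum_interval_shift) (use dcharacterD(3)[OF chi, of 0] in simp)
    hence "(\<Sum>i<M. \<eta> (int (Suc i))) = 0" using sum_nontrivial_dcharacter[OF chi nt[OF True]] by simp
    from Dirichlet_L_mean_zero(1)[where \<eta> = \<eta> and w = "of_nat k", OF M1 dcharacterD(3)[OF chi] this]
    show ?thesis using k unfolding pw by simp
  next
    case False
    hence k2: "k \<ge> 2" using k by simp
    have L: "Dirichlet_L (of_nat k) \<eta> = (\<Sum>n. \<eta> (int (Suc n)) * of_nat (Suc n) powr (- of_nat k))"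
      by (rule Dirichlet_L_eq_series[where B = 1]) (use norm_dcharacter_le[OF chi] k2 in auto)
    have "summable (\<lambda>n. \<eta> (int (Suc n)) * inverse (of_nat (Suc n)) ^ k)"
    proof (rule summable_comparison_test'[OF summable_Suc_powr[of "- real k"]])
      show "- real k < - 1" using k2 by simp
      fix n
      have "norm (\<eta> (int (Suc n)) * inverse (of_nat (Suc n)) ^ k) \<le> 1 * norm (inverse (of_nat (Suc n) :: complex) ^ k)"
        unfolding norm_mult by (intro mult_right_mono norm_dcharacter_le[OF chi]) simp
      also have "\<dots> = real (Suc n) powr (- real k)"
        by (simp add: norm_power norm_inverse powr_minus powr_realpow power_inverse del: of_nat_Suc)
      finally show "norm (\<eta> (int (Suc n)) * inverse (of_nat (Suc n)) ^ k) \<le> real (Suc n) powr (- real k)" .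
    qed
    from summable_LIMSEQ[OF this] show ?thesis unfolding L pw .
  qed
qed

text \<open>0 is coprime to the modulus only if the modulus is 1. This is why row 0 contributes, as
  \<open>const_C\<close>, for one character \<psi> only.\<close>

lemma dcharacter_at_0:
  assumes "dcharacter L \<psi>"
  shows "\<psi> 0 = (if \<psi> = trivial_char 1 then 1 else 0)"
proof (cases "L = 1")
  case True
  have "\<psi> a = trivial_char 1 a" for a
  proof -
    have "\<psi> a = \<psi> 1" by (rule dcharacter_cong[OF assms]) (simp add: True cong_def)
    thus ?thesis using dcharacter_1[OF assms] by (simp add: trivial_char_def)
  qed
  hence "\<psi> = trivial_char 1" by (rule ext)
  thus ?thesis by (simp add: trivial_char_def)
next
  case False
  hence "\<psi> 0 = 0" using dcharacterD(4)[OF assms, of 0] by simp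
  thus ?thesis by (auto simp: trivial_char_def)
qed

lemma constant_row_limit:
  assumes psi: "dcharacter L \<psi>" and rho: "dcharacter M \<rho>" and k: "k \<ge> 1" and N: "N \<ge> 1"
    and nt: "k = 1 \<Longrightarrow> \<psi> \<noteq> trivial_char 1 \<or> \<rho> \<noteq> trivial_char M"
  shows "(\<lambda>n. \<Sum>x<n * N. phi T \<psi> (\<lambda>n. cnj (\<rho> n)) (0, int (Suc x)) * inverse (of_nat (Suc x)) ^ k) \<longlonglongrightarrow> const_C k \<psi> \<rho>"
proof (cases "\<psi> = trivial_char 1")
  case True
  have nt': "(\<lambda>n. cnj (\<rho> n)) \<noteq> trivial_char M" if "k = 1"
  proof
    assume "(\<lambda>n. cnj (\<rho> n)) = trivial_char M"
    hence "cnj (\<rho> n) = trivial_char M n" for n by (rule fun_cong)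
    hence "\<rho> n = cnj (trivial_char M n)" for n by (metis complex_cnj_cnj)
    hence "\<rho> n = trivial_char M n" for n by (simp add: trivial_char_def)
    thus False using nt[OF that] True by blast
  qed
  have "filterlim (\<lambda>n. n * N) sequentially sequentially"
    by (rule filterlim_at_top_mono[OF filterlim_ident]) (use N in \<open>simp add: eventually_sequentially\<close>)
  from filterlim_compose[OF Dirichlet_L_partial_sums[OF dcharacter_cnj[OF rho] k nt'] this]
  show ?thesis using dcharacter_at_0[OF psi] True by (simp add: phi_def const_C_def)
next
  case False
  thus ?thesis using dcharacter_at_0[OF psi] by (simp add: phi_def const_C_def)
qed

lemma al_phi:
  assumes T: "T \<ge> 1" and N: "N = T * R"
  shows "al N (phi T \<alpha> \<beta>) = of_nat T * (\<Sum>j\<in>{0..<int R}. of_int j * \<alpha> j) * (\<Sum>n\<in>{0..<int N}. \<beta> n)"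
proof -
  have "al N (phi T \<alpha> \<beta>) = (\<Sum>m\<in>{0..<int N}. of_int m * (if int T dvd m then \<alpha> (m div int T) else 0)) * (\<Sum>n\<in>{0..<int N}. \<beta> n)"
    unfolding al_def pbox_def sum_product sum.cartesian_product by (intro sum.cong refl) (auto simp: phi_def)
  also have "(\<Sum>m\<in>{0..<int N}. of_int m * (if int T dvd m then \<alpha> (m div int T) else 0)) =
      (\<Sum>m\<in>{0..<int (T * R)}. if int T dvd m then of_nat T * (of_int (m div int T) * \<alpha> (m div int T)) else 0)"
    unfolding N
  proof (intro sum.cong refl)
    fix m
    show "of_int m * (if int T dvd m then \<alpha> (m div int T) else 0) = (if int T dvd m then of_nat T * (of_int (m div int T) * \<alpha> (m div int T)) else (0 :: complex))"
    proof (cases "int T dvd m")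
      case True
      then obtain b where "m = int T * b" by auto
      thus ?thesis using T by simp
    qed simp
  qed
  also have "\<dots> = (\<Sum>j\<in>{0..<int R}. of_nat T * (of_int j * \<alpha> j))"
    by (rule sum_multiples[OF T])
  finally show ?thesis by (simp add: sum_distrib_left)
qed

text \<open>By \<open>al_phi\<close> the moment factors into the first moment of \<psi> and a sum of
  cnj \<rho> over full periods. The latter vanishes unless \<rho> is trivial; then \<psi> is odd,
  its first moment is -L times L(0, \<psi>), and the sum over one period is the totient of
  M.\<close>

lemma constant_D:
  assumes psi: "dcharacter L \<psi>" and rho: "dcharacter M \<rho>" and t: "t \<ge> 1"
    and par: "\<psi> (- 1) * \<rho> (- 1) = - 1"
  shows "of_real pi * \<i> * al (t * L * M) (phi (t * M) \<psi> (\<lambda>n. cnj (\<rho> n))) / of_nat (t * L * M) ^ 2 = const_D M \<psi> \<rho>"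
proof -
  have M1: "M \<ge> 1" and L1: "L \<ge> 1" by (rule dcharacterD(1)[OF rho], rule dcharacterD(1)[OF psi])
  have N: "t * L * M = (t * M) * L" by simp
  have T: "t * M \<ge> 1" using t M1 by simp
  have s: "(\<Sum>n\<in>{0..<int (t * L * M)}. cnj (\<rho> n)) = of_nat (t * L) * (\<Sum>n\<in>{0..<int M}. cnj (\<rho> n))"
    by (rule sum_periods[where f = "\<lambda>n. cnj (\<rho> n)"]) (rule dcharacterD(3)[OF dcharacter_cnj[OF rho]])
  show ?thesis
  proof (cases "\<rho> = trivial_char M")
    case False
    have "(\<Sum>n\<in>{0..<int M}. cnj (\<rho> n)) = 0"
      using sum_nontrivial_dcharacter[OF rho False] by (simp flip: cnj_sum)
    thus ?thesis using False unfolding al_phi[OF T N] s by (simp add: const_D_def)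
  next
    case True
    have "\<rho> (- 1) = 1" by (simp add: True trivial_char_def)
    hence p1: "\<psi> (- 1) = - 1" using par by simp
    have nt: "\<psi> \<noteq> trivial_char L" "\<psi> \<noteq> trivial_char 1" using p1 by (auto simp: trivial_char_def)
    hence psi0: "\<psi> 0 = 0" using dcharacter_at_0[OF psi] by simp
    have psiL: "\<psi> (int L) = 0" using dcharacterD(3)[OF psi, of 0] psi0 by simp
    have "(\<Sum>i<L. \<psi> (int (Suc i))) = (\<Sum>a\<in>{0..<int L}. \<psi> a)"
      by (rule sum_interval_shift) (simp add: psi0 psiL)
    hence z: "(\<Sum>i<L. \<psi> (int (Suc i))) = 0" using sum_nontrivial_dcharacter[OF psi nt(1)] by simp
    have "(\<Sum>i<L. of_int (int (Suc i)) * \<psi> (int (Suc i))) = (\<Sum>j\<in>{0..<int L}. of_int j * \<psi> j)"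
      by (rule sum_interval_shift[where f = "\<lambda>j. of_int j * \<psi> j"]) (simp add: psiL)
    hence "Dirichlet_L 0 \<psi> = - (\<Sum>j\<in>{0..<int L}. of_int j * \<psi> j) / of_nat L"
      using Dirichlet_L_mean_zero(2)[where \<eta> = \<psi>, OF L1 dcharacterD(3)[OF psi] z] by simp
    hence B: "(\<Sum>j\<in>{0..<int L}. of_int j * \<psi> j) = - of_nat L * Dirichlet_L 0 \<psi>" using L1 by simp
    have "(\<Sum>n\<in>{0..<int M}. cnj (\<rho> n)) = (\<Sum>n\<in>{0..<int M}. trivial_char M n)"
      by (intro sum.cong refl) (simp add: True trivial_char_def)
    hence C: "(\<Sum>n\<in>{0..<int M}. cnj (\<rho> n)) = of_nat M * (\<Prod>p\<in>prime_factors M. 1 - 1 / of_nat p)"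
      using sum_trivial_char[OF M1] by simp
    show ?thesis unfolding al_phi[OF T N] s B C
      using True t L1 M1 by (simp add: const_D_def field_simps power2_eq_square)
  qed
qed

text \<open>Reconciles the trivial case of weight 2 in \<open>eis_hol\<close>, which is written
  without a Gauss sum, with the general \<open>eis_q_part\<close>.\<close>

lemma gauss_sum_trivial:
  assumes "M \<ge> 1"
  shows "gauss_sum (conductor M (trivial_char M)) (\<lambda>n. cnj (primitive_char M (trivial_char M) n)) = 1"
proof -
  have d: "dcharacter M (trivial_char M)" "dcharacter 1 (trivial_char 1)"
    using assms by (auto intro: dcharacter_trivial)
  have ind: "induces 1 (trivial_char 1) M (trivial_char M)"
    using d by (auto simp: induces_def trivial_char_def)
  have ip: "induces (conductor M (trivial_char M)) (primitive_char M (trivial_char M)) M (trivial_char M)"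
    by (rule primitive_char_induces[OF d(1)])
  hence "conductor M (trivial_char M) \<ge> 1" unfolding induces_def using dcharacterD(1) by blast
  moreover have "conductor M (trivial_char M) \<le> 1" by (rule conductor_le[OF ind])
  ultimately have c: "conductor M (trivial_char M) = 1" by simp
  have "primitive_char M (trivial_char M) = trivial_char 1"
    by (rule induces_unique[OF ip[unfolded c] ind])
  thus ?thesis unfolding c by (simp add: gauss_sum_def trivial_char_def)
qed

lemma dcharacter_minus_1_real:
  assumes "dcharacter L \<psi>"
  shows "cnj (\<psi> (- 1)) = \<psi> (- 1)"
proof -
  have "\<psi> (- 1) * \<psi> (- 1) = 1"
    using dcharacterD(2)[OF assms, of "- 1" "- 1"] dcharacter_1[OF assms] by simp
  hence "\<psi> (- 1) = 1 \<or> \<psi> (- 1) = - 1" by (simp add: square_eq_1_iff)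
  thus ?thesis by auto
qed

lemma phi_parity:
  assumes psi: "dcharacter L \<psi>" and rho: "dcharacter M \<rho>" and par: "\<psi> (- 1) * \<rho> (- 1) = (- 1) ^ k"
  shows "phi T (\<lambda>m. cnj (\<psi> m)) \<rho> (- m, - n) = (- 1) ^ k * phi T (\<lambda>m. cnj (\<psi> m)) \<rho> (m, n)"
proof -
  have "phi T (\<lambda>m. cnj (\<psi> m)) \<rho> (- m, - n) = (cnj (\<psi> (- 1)) * \<rho> (- 1)) * phi T (\<lambda>m. cnj (\<psi> m)) \<rho> (m, n)"
    by (rule phi_minus[where \<alpha> = "\<lambda>m. cnj (\<psi> m)"]) (rule dcharacter_uminus[OF dcharacter_cnj[OF psi]], rule dcharacter_uminus[OF rho])
  thus ?thesis by (simp only: dcharacter_minus_1_real[OF psi] par)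
qed

lemma cnj_phi: "cnj (phi T (\<lambda>m. cnj (\<psi> m)) \<rho> x) = phi T \<psi> (\<lambda>n. cnj (\<rho> n)) x"
  by (simp add: phi_def)

lemma periodic_phi_char:
  assumes "dcharacter L \<alpha>" "dcharacter M \<beta>" "T * L dvd N" "M dvd N" "T \<ge> 1"
  shows "periodic N (phi T \<alpha> \<beta>)"
  by (rule periodic_phi[where \<alpha> = \<alpha> and \<beta> = \<beta> and L = L and M = M,
        OF dcharacterD(3)[OF assms(1)] dcharacterD(3)[OF assms(2)] assms(3-5)])

text \<open>The sum over the box factors into two character sums, one of which vanishes unless both
  characters are trivial.\<close>

lemma admissible_phi:
  assumes psi: "dcharacter L \<psi>" and rho: "dcharacter M \<rho>" and t: "t \<ge> 1" and k: "k \<ge> 1"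
    and nt: "k \<le> 2 \<Longrightarrow> \<psi> \<noteq> trivial_char L \<or> \<rho> \<noteq> trivial_char M"
  shows "admissible k (t * L * M) (phi (t * M) (\<lambda>m. cnj (\<psi> m)) \<rho>)"
proof -
  have LM: "L \<ge> 1" "M \<ge> 1" by (rule dcharacterD(1)[OF psi], rule dcharacterD(1)[OF rho])
  have N: "t * L * M = t * M * L" by simp
  have T: "t * M \<ge> 1" using t LM by simp
  have "periodic (t * L * M) (phi (t * M) (\<lambda>m. cnj (\<psi> m)) \<rho>)"
    by (rule periodic_phi_char[OF dcharacter_cnj[OF psi] rho _ _ T]) (simp_all add: N)
  moreover have "(\<Sum>b\<in>pbox (t * L * M). phi (t * M) (\<lambda>m. cnj (\<psi> m)) \<rho> b) = 0" if k: "k \<le> 2"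
  proof -
    have "(\<Sum>n\<in>{0..<int (t * M * L)}. \<rho> n) = (\<Sum>n\<in>{0..<int (t * L * M)}. \<rho> n)" unfolding N ..
    also have "\<dots> = of_nat (t * L) * (\<Sum>n\<in>{0..<int M}. \<rho> n)"
      by (rule sum_periods[where f = \<rho>, OF dcharacterD(3)[OF rho]])
    finally have r: "(\<Sum>n\<in>{0..<int (t * M * L)}. \<rho> n) = of_nat (t * L) * (\<Sum>n\<in>{0..<int M}. \<rho> n)" .
    have s: "(\<Sum>m\<in>{0..<int L}. cnj (\<psi> m)) = cnj (\<Sum>m\<in>{0..<int L}. \<psi> m)" by simp
    show ?thesis
      unfolding N sum_box_phi[OF T] r s
      using nt[OF k] sum_nontrivial_dcharacter[OF psi] sum_nontrivial_dcharacter[OF rho] by (auto simp del: cnj_sum)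
  qed
  ultimately show ?thesis using k t LM by (cases "k \<le> 2") (auto simp: admissible_def)
qed

lemma fterm_linear:
  "fterm k N (\<lambda>x. a x + c * b x) z x = fterm k N a z x + c * fterm k N b z x"
proof -
  have "fhat N (\<lambda>x. a x + c * b x) m n = fhat N a m n + c * fhat N b m n" for m n
    unfolding fhat_def sum_distrib_left sum.distrib[symmetric] by (intro sum.cong refl) (simp add: algebra_simps)
  thus ?thesis by (cases x) (simp only: fterm_def prod.case fcoef_def distrib_left distrib_right mult_ac)
qed

lemma infsum_fterm_linear:
  assumes N: "N \<ge> 1" and z: "Im z > 0" and per: "periodic N a" "periodic N b"
  shows "infsum (fterm k N (\<lambda>x. a x + c * b x) z) UNIV = infsum (fterm k N a z) UNIV + c * infsum (fterm k N b z) UNIV"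
proof -
  have "(fterm k N a z has_sum infsum (fterm k N a z) UNIV) UNIV" "(fterm k N b z has_sum infsum (fterm k N b z) UNIV) UNIV"
    by (rule has_sum_infsum, rule Infinite_Sum.abs_summable_summable, rule fterm_abs_summable[OF N _ z], rule per)+
  hence "((\<lambda>x. fterm k N a z x + c * fterm k N b z x) has_sum infsum (fterm k N a z) UNIV + c * infsum (fterm k N b z) UNIV) UNIV"
    by (intro has_sum_add has_sum_cmult_right)
  thus ?thesis unfolding fterm_linear[symmetric] by (rule infsumI)
qed

lemma nontrivial_pair_of_odd:
  assumes "\<psi> (- 1) * \<rho> (- 1) = (- 1 :: complex)"
  shows "\<psi> \<noteq> trivial_char L \<or> \<rho> \<noteq> trivial_char M"
  using assms by (auto simp: trivial_char_def)

lemma eis_harmonic_eq_Fphi: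
  assumes psi: "dcharacter L \<psi>" and rho: "dcharacter M \<rho>" and t: "t \<ge> 1" and k: "k \<ge> 1"
    and nt: "k \<le> 2 \<Longrightarrow> \<psi> \<noteq> trivial_char L \<or> \<rho> \<noteq> trivial_char M" and z: "Im z > 0"
  shows "eis_harmonic k L M t \<psi> \<rho> z = Fphi k (t * L * M) (phi (t * M) (\<lambda>m. cnj (\<psi> m)) \<rho>) z"
proof -
  define N where "N = t * L * M"
  define \<phi> where "\<phi> = phi (t * M) (\<lambda>m. cnj (\<psi> m)) \<rho>"
  have adm: "admissible k N \<phi>" unfolding N_def \<phi>_def by (rule admissible_phi[OF psi rho t k nt])
  have T: "t * M \<ge> 1" using t dcharacterD(1)[OF rho] by simp
  have E: "eis_nonhol (2 - int k) (of_nat (t * M) * z) s (\<lambda>m. cnj (\<psi> m)) \<rho> = 1 / 2 * Sphi k N \<phi> 1 (k - 1) z (s - of_nat (k - 1))"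
    if "Re s > real (k - 1) - 1 / 4" for s
    unfolding \<phi>_def by (rule eis_nonhol_eq_Sphi[OF adm[unfolded \<phi>_def] T z that])
  have E0: "eis_nonhol (2 - int k) (of_nat (t * M) * z) (of_nat (k - 1)) (\<lambda>m. cnj (\<psi> m)) \<rho> = 1 / 2 * Sphi k N \<phi> 1 (k - 1) z 0"
    using E[of "of_nat (k - 1)"] by simp
  consider "k > 2" | "k = 2" | "k = 1" using k by linarith
  thus ?thesis
  proof cases
    case 1
    hence "eis_harmonic k L M t \<psi> \<rho> z = of_real (Im z) ^ (k - 1) / of_nat (k - 1) *
        eis_nonhol (2 - int k) (of_nat (t * M) * z) (of_nat (k - 1)) (\<lambda>m. cnj (\<psi> m)) \<rho>"
      unfolding eis_harmonic_def Let_def by (simp only: if_True)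
    also have "\<dots> = Fphi k N \<phi> z"
      unfolding E0 by (rule Fphi_eq_Sphi[OF adm, symmetric]) (use 1 in simp)
    finally show ?thesis unfolding N_def \<phi>_def .
  next
    case 2
    have n: "\<not> (\<psi> = trivial_char L \<and> \<rho> = trivial_char M)" using nt 2 by simp
    have "eis_harmonic k L M t \<psi> \<rho> z = of_real (Im z) * eis_nonhol 0 (of_nat (t * M) * z) 1 (\<lambda>m. cnj (\<psi> m)) \<rho>"
      unfolding eis_harmonic_def Let_def 2 if_not_P[OF n] by simp
    also have "eis_nonhol 0 (of_nat (t * M) * z) 1 (\<lambda>m. cnj (\<psi> m)) \<rho> = 1 / 2 * Sphi k N \<phi> 1 (k - 1) z 0"
      using E0 by (simp add: 2)
    also have "of_real (Im z) * (1 / 2 * Sphi k N \<phi> 1 (k - 1) z 0) = Fphi k N \<phi> z"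
      using Fphi_eq_Sphi[OF adm, of z] by (simp add: 2)
    finally show ?thesis unfolding N_def \<phi>_def .
  next
    case 3
    have "eis_harmonic k L M t \<psi> \<rho> z = deriv (\<lambda>s. of_real (Im z) powr s * eis_nonhol 1 (of_nat (t * M) * z) s (\<lambda>m. cnj (\<psi> m)) \<rho>) 0"
      unfolding eis_harmonic_def Let_def 3 by simp
    also have "\<dots> = deriv (\<lambda>s. of_real (Im z) powr s * (1 / 2 * Sphi 1 N \<phi> 1 0 z s)) 0"
    proof (rule deriv_cong_ev[OF _ refl])
      have "open {s. Re s > (- 1 / 4 :: real)}" by (rule open_halfspace_Re_gt)
      hence "eventually (\<lambda>s. s \<in> {s. Re s > (- 1 / 4 :: real)}) (nhds (0 :: complex))"
        by (rule eventually_nhds_in_open) simp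
      thus "eventually (\<lambda>s. of_real (Im z) powr s * eis_nonhol 1 (of_nat (t * M) * z) s (\<lambda>m. cnj (\<psi> m)) \<rho> =
          of_real (Im z) powr s * (1 / 2 * Sphi 1 N \<phi> 1 0 z s)) (nhds 0)"
      proof eventually_elim
        case (elim s)
        thus ?case using E[of s] by (simp add: 3)
      qed
    qed
    also have "\<dots> = Fphi 1 N \<phi> z"
      by (rule DERIV_imp_deriv[OF Fphi_deriv[OF _ z]]) (use adm 3 in simp)
    finally show ?thesis using 3 unfolding N_def \<phi>_def by simp
  qed
qed

text \<open>\<open>eis_harmonic\<close> and \<open>Fphi\<close> agree on the upper half-plane only,
  hence the congruence rules. The three parts of the expansion, row 0, the moment term and the
  exponential series, are matched with \<open>const_C\<close>, \<open>const_D\<close> and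
  \<open>eis_q_part\<close>.\<close>

lemma eis_harmonic_nontrivial:
  assumes psi: "dcharacter L \<psi>" and rho: "dcharacter M \<rho>" and t: "t \<ge> 1" and k: "k \<ge> 1"
    and par: "\<psi> (- 1) * \<rho> (- 1) = (- 1) ^ k"
    and nt: "k = 2 \<Longrightarrow> \<psi> \<noteq> trivial_char L \<or> \<rho> \<noteq> trivial_char M"
  shows "eis_harmonic k L M t \<psi> \<rho> \<in> harmonic_maass_space (2 - int k) (t * L * M) (\<lambda>d. cnj (\<psi> d * \<rho> d))"
    and "Im z > 0 \<Longrightarrow> xi_op (2 - int k) (eis_harmonic k L M t \<psi> \<rho>) z = eis_hol_t k L M t \<psi> \<rho> z"
proof -
  define N where "N = t * L * M"
  define \<phi> where "\<phi> = phi (t * M) (\<lambda>m. cnj (\<psi> m)) \<rho>"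
  define \<theta> where "\<theta> = phi (t * M) \<psi> (\<lambda>n. cnj (\<rho> n))"
  have LM: "L \<ge> 1" "M \<ge> 1" by (rule dcharacterD(1)[OF psi], rule dcharacterD(1)[OF rho])
  have T: "t * M \<ge> 1" and N1: "N \<ge> 1" using t LM by (simp_all add: N_def)
  have nt': "\<psi> \<noteq> trivial_char L \<or> \<rho> \<noteq> trivial_char M" if k2: "k \<le> 2"
  proof (cases "k = 1")
    case True
    thus ?thesis using nontrivial_pair_of_odd[of \<psi> \<rho>] par by simp
  next
    case False
    thus ?thesis using nt k2 k by simp
  qed
  have adm: "admissible k N \<phi>" unfolding N_def \<phi>_def by (rule admissible_phi[OF psi rho t k nt'])
  have parity: "\<phi> (- m, - n) = (- 1) ^ k * \<phi> (m, n)" for m n unfolding \<phi>_def by (rule phi_parity[OF psi rho par])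
  have eq: "Fphi k N \<phi> z = eis_harmonic k L M t \<psi> \<rho> z" if "z \<in> upper_half_plane" for z
    using eis_harmonic_eq_Fphi[OF psi rho t k nt'] that by (simp add: N_def \<phi>_def upper_half_plane_def)
  have "Fphi k N \<phi> \<in> harmonic_maass_space (2 - int k) N (\<lambda>d. cnj (\<psi> d * \<rho> d))"
  proof (rule Fphi_in_harmonic_maass_space[OF adm parity])
    fix a b c d mn assume g: "(a, b, c, d) \<in> Gamma0 N"
    show "pull \<phi> (a, b, c, d) mn = cnj (\<psi> d * \<rho> d) * \<phi> mn"
      unfolding \<phi>_def complex_cnj_mult
      by (rule pull_phi[OF dcharacter_cnj[OF psi] rho _ T _ _ g]) (simp_all add: N_def)
  qed
  from harmonic_maass_space_cong[OF eq this]
  show "eis_harmonic k L M t \<psi> \<rho> \<in> harmonic_maass_space (2 - int k) (t * L * M) (\<lambda>d. cnj (\<psi> d * \<rho> d))"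
    unfolding N_def .
  assume z: "Im z > 0"
  hence zH: "z \<in> upper_half_plane" by (simp add: upper_half_plane_def)
  have th: "cnj (\<phi> x) = \<theta> x" for x by (simp add: \<phi>_def \<theta>_def cnj_phi)
  obtain V where V: "(\<lambda>n. \<Sum>x<n * N. \<theta> (0, int (Suc x)) * inverse (of_nat (Suc x)) ^ k) \<longlonglongrightarrow> V"
    and xi_all: "\<And>z. Im z > 0 \<Longrightarrow> xi_op (2 - int k) (Fphi k N \<phi>) z =
      V + (if k = 1 then of_real pi * \<i> * al N \<theta> / of_nat N ^ 2 else 0) + infsum (fterm k N \<theta> z) UNIV"
    by (rule xi_Fphi_expansion[OF adm parity, unfolded th]) blast
  note xi = xi_all[OF z]
  have nt1: "\<psi> \<noteq> trivial_char 1 \<or> \<rho> \<noteq> trivial_char M" if "k = 1"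
    using nontrivial_pair_of_odd[of \<psi> \<rho>] par that by simp
  have VC: "V = const_C k \<psi> \<rho>"
    by (rule LIMSEQ_unique[OF V]) (unfold \<theta>_def, rule constant_row_limit[OF psi rho k N1 nt1])
  have Q: "infsum (fterm k N \<theta> z) UNIV = eis_q_part k M \<psi> \<rho> (of_nat t * z)"
    unfolding N_def \<theta>_def
    by (rule fterm_phi_eq_eis_q_part[OF psi rho z t _ _ k]) (use t LM in simp_all)
  have D: "of_real pi * \<i> * al N \<theta> / of_nat N ^ 2 = const_D M \<psi> \<rho>" if "k = 1"
    unfolding N_def \<theta>_def by (rule constant_D[OF psi rho t]) (use par that in simp)
  have "xi_op (2 - int k) (eis_harmonic k L M t \<psi> \<rho>) z = xi_op (2 - int k) (Fphi k N \<phi>) z"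
    by (rule xi_op_cong[OF _ zH]) (rule eq[symmetric])
  also have "\<dots> = const_C k \<psi> \<rho> + (if k = 1 then const_D M \<psi> \<rho> else 0) + eis_q_part k M \<psi> \<rho> (of_nat t * z)"
    unfolding xi VC Q using D by (cases "k = 1") simp_all
  also have "\<dots> = eis_hol_t k L M t \<psi> \<rho> z"
  proof -
    have n: "\<not> (k = 2 \<and> \<psi> = trivial_char L \<and> \<rho> = trivial_char M)" using nt by blast
    show ?thesis unfolding eis_hol_t_def eis_hol_def if_not_P[OF n] by (cases "k = 1") simp_all
  qed
  finally show "xi_op (2 - int k) (eis_harmonic k L M t \<psi> \<rho>) z = eis_hol_t k L M t \<psi> \<rho> z" .
qed

lemma eis_hol_2_trivial:
  assumes "M \<ge> 1"
  shows "eis_hol 2 L M (trivial_char L) (trivial_char M) z =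
    const_C 2 (trivial_char L) (trivial_char M)
    - of_real pi / (2 * of_nat M * of_real (Im z)) * (\<Prod>p\<in>prime_factors M. 1 - 1 / of_nat p) * (\<Prod>p\<in>prime_factors L. 1 - 1 / of_nat p)
    + eis_q_part 2 M (trivial_char L) (trivial_char M) z"
proof -
  have "(- 2 * of_real pi * \<i> / of_nat M) ^ 2 = - 4 * of_real pi ^ 2 / complex_of_nat M ^ 2"
    by (simp add: power_divide power_mult_distrib)
  thus ?thesis by (simp add: eis_hol_def eis_q_part_def gauss_sum_trivial[OF assms])
qed

text \<open>Neither \<phi>1 nor \<phi>2 has mean zero, but over a box the first sums to t times the
  second, so \<phi>1 - t \<phi>2 is admissible. On the holomorphic side the terms with 1/y cancel
  because Im (tz) = t Im z.\<close>

lemma eis_harmonic_trivial: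
  assumes LM: "L \<ge> 1" "M \<ge> 1" and t: "t \<ge> 1"
  defines "\<psi> \<equiv> trivial_char L" and "\<rho> \<equiv> trivial_char M"
  shows "eis_harmonic 2 L M t \<psi> \<rho> \<in> harmonic_maass_space 0 (t * L * M) (\<lambda>d. cnj (\<psi> d * \<rho> d))"
    and "Im z > 0 \<Longrightarrow> xi_op 0 (eis_harmonic 2 L M t \<psi> \<rho>) z = eis_hol_t 2 L M t \<psi> \<rho> z"
proof -
  define N where "N = t * L * M"
  define \<phi>1 where "\<phi>1 = phi M \<psi> \<rho>"
  define \<phi>2 where "\<phi>2 = phi (t * M) \<psi> \<rho>"
  define \<phi> where "\<phi> = (\<lambda>mn. \<phi>1 mn + (- of_nat t) * \<phi>2 mn)"
  have psi: "dcharacter L \<psi>" and rho: "dcharacter M \<rho>"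
    unfolding \<psi>_def \<rho>_def using LM by (auto intro: dcharacter_trivial)
  have cn: "(\<lambda>m. cnj (\<psi> m)) = \<psi>" "(\<lambda>m. cnj (\<rho> m)) = \<rho>" by (simp_all add: fun_eq_iff \<psi>_def \<rho>_def trivial_char_def)
  have T: "t * M \<ge> 1" and N1: "N \<ge> 1" using t LM by (simp_all add: N_def)
  have p1: "periodic N \<phi>1" unfolding \<phi>1_def
    by (rule periodic_phi_char[OF psi rho]) (use LM in \<open>simp_all add: N_def\<close>)
  have p2: "periodic N \<phi>2" unfolding \<phi>2_def
    by (rule periodic_phi_char[OF psi rho]) (use T in \<open>simp_all add: N_def\<close>)
  have "(\<Sum>b\<in>pbox N. \<phi> b) = 0"
  proof -
    have s: "(\<Sum>b\<in>pbox N. \<phi> b) = (\<Sum>b\<in>pbox N. \<phi>1 b) - of_nat t * (\<Sum>b\<in>pbox N. \<phi>2 b)"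
      by (simp add: \<phi>_def sum_subtractf sum_distrib_left)
    have e: "N = M * (t * L)" "N = t * M * L" by (simp_all add: N_def)
    have "(\<Sum>b\<in>pbox N. \<phi>1 b) = (\<Sum>m\<in>{0..<int (t * L)}. \<psi> m) * (\<Sum>n\<in>{0..<int N}. \<rho> n)"
      unfolding \<phi>1_def unfolding e(1) by (rule sum_box_phi[OF LM(2)])
    also have "(\<Sum>m\<in>{0..<int (t * L)}. \<psi> m) = of_nat t * (\<Sum>m\<in>{0..<int L}. \<psi> m)"
      by (rule sum_periods[where f = \<psi>, OF dcharacterD(3)[OF psi]])
    finally have b1: "(\<Sum>b\<in>pbox N. \<phi>1 b) = of_nat t * (\<Sum>m\<in>{0..<int L}. \<psi> m) * (\<Sum>n\<in>{0..<int N}. \<rho> n)" .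
    have b2: "(\<Sum>b\<in>pbox N. \<phi>2 b) = (\<Sum>m\<in>{0..<int L}. \<psi> m) * (\<Sum>n\<in>{0..<int N}. \<rho> n)"
      unfolding \<phi>2_def unfolding e(2) by (rule sum_box_phi[OF T])
    show ?thesis unfolding s b1 b2 by simp
  qed
  hence adm: "admissible 2 N \<phi>"
    using periodic_linear[OF p1 p2, of "- of_nat t"] N1 by (simp add: admissible_def \<phi>_def)
  have par: "\<psi> (- 1) * \<rho> (- 1) = (- 1) ^ 2" by (simp add: \<psi>_def \<rho>_def trivial_char_def)
  have parity: "\<phi> (- m, - n) = (- 1) ^ 2 * \<phi> (m, n)" for m n
    using phi_parity[OF psi rho par, of M m n, unfolded cn] phi_parity[OF psi rho par, of "t * M" m n, unfolded cn]
    by (simp add: \<phi>_def \<phi>1_def \<phi>2_def)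
  have eq: "Fphi 2 N \<phi> z = eis_harmonic 2 L M t \<psi> \<rho> z" if "z \<in> upper_half_plane" for z
  proof -
    have z: "Im z > 0" using that by (simp add: upper_half_plane_def)
    have "((\<lambda>s. of_real (Im z) powr s * eis_nonhol 0 (of_nat M * z) s \<psi> \<rho> -
        of_nat t * of_real (Im z) powr s * eis_nonhol 0 (of_nat (t * M) * z) s \<psi> \<rho>) \<longlongrightarrow> Fphi 2 N \<phi> z) (at 1)"
      unfolding \<phi>_def \<phi>1_def \<phi>2_def
      by (rule Fphi_trivial_limit[OF LM(2) T z N1 p1[unfolded \<phi>1_def] p2[unfolded \<phi>2_def] adm[unfolded \<phi>_def \<phi>1_def \<phi>2_def]])
    hence "Lim (at 1) (\<lambda>s. of_real (Im z) powr s * eis_nonhol 0 (of_nat M * z) s \<psi> \<rho> -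
        of_nat t * of_real (Im z) powr s * eis_nonhol 0 (of_nat (t * M) * z) s \<psi> \<rho>) = Fphi 2 N \<phi> z"
      by (intro tendsto_Lim) simp_all
    thus ?thesis unfolding eis_harmonic_def Let_def \<psi>_def \<rho>_def by simp
  qed
  have "Fphi 2 N \<phi> \<in> harmonic_maass_space (2 - int 2) N (\<lambda>d. cnj (\<psi> d * \<rho> d))"
  proof (rule Fphi_in_harmonic_maass_space[OF adm parity])
    fix a b c d mn assume g: "(a, b, c, d) \<in> Gamma0 N"
    have "pull \<phi>1 (a, b, c, d) mn = \<psi> d * cnj (\<rho> d) * \<phi>1 mn"
      unfolding \<phi>1_def by (rule pull_phi[OF psi rho _ _ _ _ g]) (use LM in \<open>simp_all add: N_def\<close>)
    moreover have "pull \<phi>2 (a, b, c, d) mn = \<psi> d * cnj (\<rho> d) * \<phi>2 mn"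
      unfolding \<phi>2_def by (rule pull_phi[OF psi rho _ T _ _ g]) (simp_all add: N_def)
    moreover have "pull \<phi> (a, b, c, d) mn = pull \<phi>1 (a, b, c, d) mn + (- of_nat t) * pull \<phi>2 (a, b, c, d) mn"
      by (simp add: pull_def \<phi>_def)
    ultimately show "pull \<phi> (a, b, c, d) mn = cnj (\<psi> d * \<rho> d) * \<phi> mn"
      using fun_cong[OF cn(1), of d] by (simp add: \<phi>_def algebra_simps)
  qed
  from harmonic_maass_space_cong[OF eq this]
  show "eis_harmonic 2 L M t \<psi> \<rho> \<in> harmonic_maass_space 0 (t * L * M) (\<lambda>d. cnj (\<psi> d * \<rho> d))"
    unfolding N_def by simp
  assume z: "Im z > 0"
  hence zH: "z \<in> upper_half_plane" by (simp add: upper_half_plane_def)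
  have th: "cnj (\<phi> x) = \<phi> x" for x
    using cnj_phi[of M \<psi> \<rho>] cnj_phi[of "t * M" \<psi> \<rho>] by (simp add: \<phi>_def \<phi>1_def \<phi>2_def cn)
  obtain V where V: "(\<lambda>n. \<Sum>x<n * N. \<phi> (0, int (Suc x)) * inverse (of_nat (Suc x)) ^ 2) \<longlonglongrightarrow> V"
    and xi_all: "\<And>z. Im z > 0 \<Longrightarrow> xi_op (2 - int 2) (Fphi 2 N \<phi>) z = V + (if (2::nat) = 1 then of_real pi * \<i> * al N \<phi> / of_nat N ^ 2 else 0) + infsum (fterm 2 N \<phi> z) UNIV"
    by (rule xi_Fphi_expansion[OF adm parity, unfolded th]) blast
  note xi = xi_all[OF z]
  define C where "C = const_C 2 \<psi> \<rho>"
  have r: "(\<lambda>n. \<Sum>x<n * N. \<phi>1 (0, int (Suc x)) * inverse (of_nat (Suc x)) ^ 2) \<longlonglongrightarrow> C"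
    "(\<lambda>n. \<Sum>x<n * N. \<phi>2 (0, int (Suc x)) * inverse (of_nat (Suc x)) ^ 2) \<longlonglongrightarrow> C"
    using constant_row_limit[OF psi rho _ N1, where k = 2 and T = M, unfolded cn]
      constant_row_limit[OF psi rho _ N1, where k = 2 and T = "t * M", unfolded cn]
    by (simp_all add: \<phi>1_def \<phi>2_def C_def)
  have "(\<lambda>n. (\<Sum>x<n * N. \<phi>1 (0, int (Suc x)) * inverse (of_nat (Suc x)) ^ 2) +
      (- of_nat t) * (\<Sum>x<n * N. \<phi>2 (0, int (Suc x)) * inverse (of_nat (Suc x)) ^ 2)) \<longlonglongrightarrow> C + (- of_nat t) * C"
    by (intro tendsto_add tendsto_mult_left r)
  moreover have "(\<Sum>x<K. \<phi>1 (0, int (Suc x)) * inverse (of_nat (Suc x)) ^ 2) +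
      (- of_nat t) * (\<Sum>x<K. \<phi>2 (0, int (Suc x)) * inverse (of_nat (Suc x)) ^ 2) = (\<Sum>x<K. \<phi> (0, int (Suc x)) * inverse (of_nat (Suc x)) ^ 2)" for K
    unfolding \<phi>_def sum_distrib_left sum.distrib[symmetric] by (intro sum.cong refl) (simp only: distrib_right mult.assoc)
  ultimately have "(\<lambda>n. \<Sum>x<n * N. \<phi> (0, int (Suc x)) * inverse (of_nat (Suc x)) ^ 2) \<longlonglongrightarrow> C + (- of_nat t) * C" by simp
  hence VC: "V = C - of_nat t * C" using LIMSEQ_unique[OF V] by simp
  have q1: "infsum (fterm 2 N \<phi>1 z) UNIV = eis_q_part 2 M \<psi> \<rho> (of_nat 1 * z)"
    using fterm_phi_eq_eis_q_part[OF psi rho z, of 1 "t * L" 2, unfolded cn] t LM by (simp add: N_def \<phi>1_def)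
  have q2: "infsum (fterm 2 N \<phi>2 z) UNIV = eis_q_part 2 M \<psi> \<rho> (of_nat t * z)"
    using fterm_phi_eq_eis_q_part[OF psi rho z, of t "t * L" 2, unfolded cn] t LM by (simp add: N_def \<phi>2_def)
  have Q: "infsum (fterm 2 N \<phi> z) UNIV = eis_q_part 2 M \<psi> \<rho> z - of_nat t * eis_q_part 2 M \<psi> \<rho> (of_nat t * z)"
    unfolding \<phi>_def infsum_fterm_linear[OF N1 z p1 p2] q1 q2 by simp
  define X where "X = of_real pi * (\<Prod>p\<in>prime_factors M. 1 - 1 / of_nat p) * (\<Prod>p\<in>prime_factors L. 1 - 1 / complex_of_nat p)"
  have eh: "eis_hol 2 L M \<psi> \<rho> w = C - X / (2 * of_nat M * of_real (Im w)) + eis_q_part 2 M \<psi> \<rho> w" for w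
    unfolding \<psi>_def \<rho>_def eis_hol_2_trivial[OF LM(2)] C_def X_def by simp
  have "xi_op 0 (eis_harmonic 2 L M t \<psi> \<rho>) z = xi_op 0 (Fphi 2 N \<phi>) z"
    by (rule xi_op_cong[OF _ zH]) (rule eq[symmetric])
  also have "\<dots> = C - of_nat t * C + (eis_q_part 2 M \<psi> \<rho> z - of_nat t * eis_q_part 2 M \<psi> \<rho> (of_nat t * z))"
    using xi unfolding VC Q by simp
  also have "\<dots> = eis_hol 2 L M \<psi> \<rho> z - of_nat t * eis_hol 2 L M \<psi> \<rho> (of_nat t * z)"
  proof -
    have "of_nat t * (X / (2 * of_nat M * of_real (Im (of_nat t * z)))) = X / (2 * of_nat M * of_real (Im z))"
      using t by (simp add: field_simps)
    thus ?thesis unfolding eh by (simp add: ring_distribs)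
  qed
  also have "\<dots> = eis_hol_t 2 L M t \<psi> \<rho> z" by (simp add: eis_hol_t_def \<psi>_def \<rho>_def)
  finally show "xi_op 0 (eis_harmonic 2 L M t \<psi> \<rho>) z = eis_hol_t 2 L M t \<psi> \<rho> z" .
qed

theorem theorem4p1:
  fixes k L M t :: nat
    and \<psi> \<rho> :: "int \<Rightarrow> complex"
  assumes "k \<ge> 1" and "L \<ge> 1" and "M \<ge> 1" and "t \<ge> 1"
    and "dcharacter L \<psi>" and "dcharacter M \<rho>"
    and "\<psi> (- 1) * \<rho> (- 1) = (- 1) ^ k"
  shows "eis_harmonic k L M t \<psi> \<rho>
           \<in> harmonic_maass_space (2 - int k) (t * L * M) (\<lambda>d. cnj (\<psi> d * \<rho> d)) \<and>
         (\<forall>z\<in>upper_half_plane.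
            xi_op (2 - int k) (eis_harmonic k L M t \<psi> \<rho>) z = eis_hol_t k L M t \<psi> \<rho> z)"
proof (cases "k = 2 \<and> \<psi> = trivial_char L \<and> \<rho> = trivial_char M")
  case True
  thus ?thesis using eis_harmonic_trivial[OF assms(2-4)] by (simp add: upper_half_plane_def)
next
  case False
  hence "k = 2 \<Longrightarrow> \<psi> \<noteq> trivial_char L \<or> \<rho> \<noteq> trivial_char M" by blast
  from eis_harmonic_nontrivial[OF assms(5,6,4,1,7) this]
  show ?thesis by (simp add: upper_half_plane_def)
qed

end
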